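(* Let $\Gamma$ be a central extension of $\mathbb{Z}^n$ by $\mathbb{Z}$ with k-invariant $\omega=c_1e_1^*\wedge e_{t+1}^*+\dots+c_te_t^*\wedge e_{2t}^*$, where $2t\le n$ and $c_1,\dots,c_t$ are positive integers such that $c_i$ divides $c_{i+1}$. Let $p(z)=\prod_{j=1}^s(z-\lambda_j)^{m_j}$, where $\lambda_1,\dots,\lambda_s\in\mathbb{C}$ are distinct, $\lambda_j$ is a primitive $k_j$-th root of unity, $m_j\ge 1$ and $m=\sum_j m_j$. If $\mathrm{Hom}(\Gamma,U(m))_{p(z)}$ is non-empty, then there is a $U(m)$-equivariant homeomorphism $$\mathrm{Hom}(\Gamma,U(m))_{p(z)}\cong U(m)\times_{\prod_{j=1}^sU(m_j)}\prod_{j=1}^sB_n(U(m_j))_{D_n(-c_1q_j,\dots,-c_tq_j)},$$ where $q_j=\frac{1}{2\pi\sqrt{-1}}\log\lambda_j\in\mathbb{Q}/\mathbb{Z}$. Moreover, the orbit space of $\mathrm{Hom}(\Gamma,U(m))_{p(z)}$ under the action of $U(m)$ is homeomorphic to the product of symmetric products of tori $\prod_{j=1}^s(\mathbb{T}^n)^{l_j}/\Sigma_{l_j}$, where $l_j=m_j\big/\prod_{i=1}^t\frac{k_j}{\gcd(k_j,c_i)}$ for $j=1,\dots,s$.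
   Context: $U(m)$ is the unitary group, $\mathbb{T}^n=(\mathbb{S}^1)^n$, $[A,B]=ABA^{-1}B^{-1}$. $\Gamma$ has generators $a_1,\dots,a_n,x$ and relations: $x$ is central, $[a_i,a_{t+i}]=x^{c_i}$ for $1\le i\le t$, all other pairs $a_i,a_{i'}$ commute. $\mathrm{Hom}(\Gamma,U(m))\subset U(m)^{n+1}$ via $f\mapsto (f(x),f(a_1),\dots,f(a_n))$, with $U(m)$ acting by conjugation; $\mathrm{Hom}(\Gamma,U(m))_{p(z)}$ is the subspace of $f$ for which $f(x)$ has characteristic polynomial $p(z)$. For $d_1,\dots,d_t\in\mathbb{Q}/\mathbb{Z}$ (zero allowed), $D_n(d_1,\dots,d_t)=(d_{ij})$ is the $n\times n$ matrix over $\mathbb{Q}/\mathbb{Z}$ with $d_{k+t,k}=d_k$, $d_{k,k+t}=-d_k$ for $1\le k\le t$, and all other entries $0$. For an $n\times n$ matrix $D=(d_{ij})$ over $\mathbb{Q}/\mathbb{Z}$, $B_n(U(m))_D$ is the space of $n$-tuples $(A_1,\dots,A_n)\in U(m)^n$ with $[A_i,A_j]=e^{2\pi\sqrt{-1}\,d_{ij}}I_m$ for all $i,j$; $U(m)$ acts on it by simultaneous conjugation. $\prod_jU(m_j)\subset U(m)$ is the block diagonal subgroup, and on the right-hand side $U(m)$ acts by left multiplication on the first factor. The function $w\mapsto\frac{1}{2\pi\sqrt{-1}}\log w$ denotes the isomorphism from roots of unity to $\mathbb{Q}/\mathbb{Z}$ inverse to $q\mapsto e^{2\pi\sqrt{-1}q}$.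 $\Sigma_l$ acts on $(\mathbb{T}^n)^l$ by permuting factors. *)

theory Defs
  imports
    "HOL-Algebra.Group_Action"
    "HOL-Algebra.Product_Groups"
    "HOL-Algebra.Sym_Groups"
    "HOL-Analysis.Function_Topology"
    "HOL-Analysis.Product_Topology"
    "HOL-Analysis.Complex_Transcendental"
    "Jordan_Normal_Form.Char_Poly"
    "Jordan_Normal_Form.Schur_Decomposition"
begin

section \<open>The group of rationals modulo the integers\<close>

quotient_type ratmod = rat / "\<lambda>a b. a - b \<in> \<int>"
proof (rule equivpI)
  show "reflp (\<lambda>a b :: rat. a - b \<in> \<int>)" by (simp add: reflp_def)
  show "symp (\<lambda>a b :: rat. a - b \<in> \<int>)"
    by (rule sympI, drule Ints_minus) simp
  show "transp (\<lambda>a b :: rat. a - b \<in> \<int>)"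
    by (rule transpI, drule (1) Ints_add) simp
qed

instantiation ratmod :: ab_group_add
begin

lift_definition zero_ratmod :: ratmod is "0" .

lift_definition plus_ratmod :: "ratmod \<Rightarrow> ratmod \<Rightarrow> ratmod" is "(+)"
  by (drule (1) Ints_add) (simp add: algebra_simps)

lift_definition uminus_ratmod :: "ratmod \<Rightarrow> ratmod" is "uminus"
  by (drule Ints_minus) (simp add: algebra_simps)

lift_definition minus_ratmod :: "ratmod \<Rightarrow> ratmod \<Rightarrow> ratmod" is "(-)"
  by (drule (1) Ints_diff) (simp add: algebra_simps)

instance
  by standard (transfer; simp add: algebra_simps)+

end

lift_definition int_scale :: "int \<Rightarrow> ratmod \<Rightarrow> ratmod" is "\<lambda>k q. of_int k * q"
  by (simp add: Ints_mult flip: right_diff_distrib)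

lift_definition exp_ratmod :: "ratmod \<Rightarrow> complex" is "\<lambda>q. exp (2 * pi * \<i> * of_rat q)"
proof -
  fix a b :: rat
  assume "a - b \<in> \<int>"
  then obtain z where "a - b = of_int z" by (elim Ints_cases)
  then have "a = b + of_int z" by (simp add: algebra_simps)
  then have "(of_rat a :: complex) = of_rat b + of_int z" by (simp add: of_rat_add)
  then show "exp (2 * pi * \<i> * of_rat a) = exp (2 * pi * \<i> * of_rat b)"
    by (auto simp: exp_eq algebra_simps)
qed

lemma inj_exp_ratmod: "inj exp_ratmod"
proof (rule injI, transfer)
  fix a b :: rat
  assume "exp (2 * pi * \<i> * of_rat a) = exp (2 * pi * \<i> * of_rat b)"
  then obtain z :: int where z: "2 * pi * \<i> * of_rat a = 2 * pi * \<i> * of_rat b + (of_int (2 * z) * pi) * \<i>"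
    by (auto simp: exp_eq)
  have "2 * pi * \<i> * (of_rat a - of_rat b - of_int z) = 0"
    using z by (simp add: algebra_simps)
  then have "of_rat a - of_rat b - of_int z = (0 :: complex)" by simp
  then have "of_rat (a - b - of_int z) = (of_rat 0 :: complex)" by (simp add: of_rat_diff)
  then have "a - b - of_int z = 0" by (simp only: of_rat_eq_iff)
  then show "a - b \<in> \<int>" by (metis Ints_of_int eq_iff_diff_eq_0)
qed

text \<open>The map \<open>w \<mapsto> (1 / (2 \<pi> \<i>)) log w\<close>, meaningful only for roots of unity \<open>w\<close>.\<close>

definition log_ratmod :: "complex \<Rightarrow> ratmod" where
  "log_ratmod = the_inv exp_ratmod"

definition primitive_root_of_unity :: "nat \<Rightarrow> complex \<Rightarrow> bool" where
  "primitive_root_of_unity k w \<longleftrightarrow> k > 0 \<and> w ^ k = 1 \<and> (\<forall>l. 0 < l \<and> l < k \<longrightarrow> w ^ l \<noteq> 1)"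

lemma log_ratmod_exp [simp]: "log_ratmod (exp_ratmod q) = q"
  unfolding log_ratmod_def by (rule the_inv_f_f[OF inj_exp_ratmod])

lemma exp_log_ratmod:
  assumes "w ^ k = 1" "k > 0"
  shows "exp_ratmod (log_ratmod w) = w"
proof -
  obtain j where "w = exp (2 * of_real pi * \<i> * of_nat j / of_nat k)"
    using assms complex_roots_unity[of k] by auto
  also have "\<dots> = exp (2 * pi * \<i> * of_rat (of_nat j / of_nat k))"
    by (simp add: of_rat_divide)
  also have "\<dots> = exp_ratmod (abs_ratmod (of_nat j / of_nat k))"
    by (simp add: exp_ratmod.abs_eq)
  finally show ?thesis by simp
qed


section \<open>Orbit spaces and balanced products\<close>

definition orbit_space :: "('g, 'm) monoid_scheme \<Rightarrow> ('g \<Rightarrow> 'x \<Rightarrow> 'x) \<Rightarrow> 'x topology \<Rightarrow> 'x set topology" where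
  "orbit_space G \<phi> X = topology (\<lambda>\<U>. \<U> \<subseteq> orbits G (topspace X) \<phi> \<and>
     openin X {x \<in> topspace X. orbit G \<phi> x \<in> \<U>})"

lemma openin_orbit_space:
  "openin (orbit_space G \<phi> X) \<U> \<longleftrightarrow>
     \<U> \<subseteq> orbits G (topspace X) \<phi> \<and> openin X {x \<in> topspace X. orbit G \<phi> x \<in> \<U>}"
proof -
  have "istopology (\<lambda>\<U>. \<U> \<subseteq> orbits G (topspace X) \<phi> \<and>
     openin X {x \<in> topspace X. orbit G \<phi> x \<in> \<U>})" (is "istopology ?P")
    unfolding istopology_def
  proof (intro conjI allI impI)
    fix S T assume "?P S" "?P T"
    moreover have "{x \<in> topspace X. orbit G \<phi> x \<in> S \<inter> T} =
        {x \<in> topspace X. orbit G \<phi> x \<in> S} \<inter> {x \<in> topspace X. orbit G \<phi> x \<in> T}" by auto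
    ultimately show "S \<inter> T \<subseteq> orbits G (topspace X) \<phi>"
      "openin X {x \<in> topspace X. orbit G \<phi> x \<in> S \<inter> T}" by auto
  next
    fix \<K> assume *: "\<forall>K\<in>\<K>. ?P K"
    then show "\<Union>\<K> \<subseteq> orbits G (topspace X) \<phi>" by auto
    have "{x \<in> topspace X. orbit G \<phi> x \<in> \<Union>\<K>} = (\<Union>K\<in>\<K>. {x \<in> topspace X. orbit G \<phi> x \<in> K})"
      by auto
    then show "openin X {x \<in> topspace X. orbit G \<phi> x \<in> \<Union>\<K>}" using * by auto
  qed
  then show ?thesis by (simp add: orbit_space_def topology_inverse')
qed

lemma topspace_orbit_space [simp]: "topspace (orbit_space G \<phi> X) = orbits G (topspace X) \<phi>"
proof (rule antisym)
  show "topspace (orbit_space G \<phi> X) \<subseteq> orbits G (topspace X) \<phi>"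
    using openin_orbit_space openin_topspace by blast
  have "{x \<in> topspace X. orbit G \<phi> x \<in> orbits G (topspace X) \<phi>} = topspace X"
    by (auto simp: orbits_def)
  then have "openin (orbit_space G \<phi> X) (orbits G (topspace X) \<phi>)"
    by (simp add: openin_orbit_space)
  then show "orbits G (topspace X) \<phi> \<subseteq> topspace (orbit_space G \<phi> X)"
    by (rule openin_subset)
qed

lemma quotient_map_orbit: "quotient_map X (orbit_space G \<phi> X) (orbit G \<phi>)"
  unfolding quotient_map_def
  by (auto simp: openin_orbit_space) (auto simp: orbits_def)

text \<open>\<open>X \<times>\<^bsub>H\<^esub> Y\<close> for a right action \<open>\<rho>\<close> of \<open>H\<close> on \<open>X\<close> and a left action \<open>\<phi>\<close> on \<open>Y\<close>.\<close>

definition balanced_product ::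
  "('h, 'm) monoid_scheme \<Rightarrow> ('x \<Rightarrow> 'h \<Rightarrow> 'x) \<Rightarrow> ('h \<Rightarrow> 'y \<Rightarrow> 'y) \<Rightarrow>
   'x topology \<Rightarrow> 'y topology \<Rightarrow> ('x \<times> 'y) set topology" where
  "balanced_product H \<rho> \<phi> X Y =
     orbit_space H (\<lambda>h (x, y). (\<rho> x (inv\<^bsub>H\<^esub> h), \<phi> h y)) (prod_topology X Y)"


section \<open>Unitary groups\<close>

definition unitary_group :: "nat \<Rightarrow> complex mat monoid" where
  "unitary_group m = \<lparr>carrier = {A \<in> carrier_mat m m. A * mat_adjoint A = 1\<^sub>m m \<and> mat_adjoint A * A = 1\<^sub>m m},
     monoid.mult = (*), one = 1\<^sub>m m\<rparr>"

text \<open>The topology of entrywise convergence.\<close>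

definition unitary_topology :: "nat \<Rightarrow> complex mat topology" where
  "unitary_topology m = pullback_topology (carrier (unitary_group m))
     (\<lambda>A. \<lambda>ij \<in> {..<m} \<times> {..<m}. A $$ ij)
     (product_topology (\<lambda>_. euclidean) ({..<m} \<times> {..<m}))"

lemma mat_adjoint_index:
  "i < dim_col A \<Longrightarrow> j < dim_row A \<Longrightarrow> mat_adjoint A $$ (i, j) = conjugate (A $$ (j, i))"
  by (simp add: mat_adjoint_def mat_of_rows_def)

lemma mat_adjoint_dim [simp]:
  "dim_row (mat_adjoint A) = dim_col A" "dim_col (mat_adjoint A) = dim_row A"
  by (auto simp: mat_adjoint_def)

lemma mat_adjoint_adjoint: "mat_adjoint (mat_adjoint A) = A"
  by (rule eq_matI) (auto simp: mat_adjoint_index)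

lemma mat_adjoint_mult:
  fixes A B :: "complex mat"
  assumes "A \<in> carrier_mat m m" "B \<in> carrier_mat m m"
  shows "mat_adjoint (A * B) = mat_adjoint B * mat_adjoint A"
proof (rule eq_matI)
  fix i j assume "i < dim_row (mat_adjoint B * mat_adjoint A)" "j < dim_col (mat_adjoint B * mat_adjoint A)"
  then have ij: "i < m" "j < m" using assms by auto
  have "mat_adjoint (A * B) $$ (i, j) = cnj (\<Sum>k = 0..<m. A $$ (j, k) * B $$ (k, i))"
    using assms ij by (simp add: mat_adjoint_index scalar_prod_def)
  also have "\<dots> = (\<Sum>k = 0..<m. cnj (B $$ (k, i)) * cnj (A $$ (j, k)))"
    by (simp add: mult.commute)
  also have "\<dots> = (mat_adjoint B * mat_adjoint A) $$ (i, j)"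
    using assms ij by (simp add: mat_adjoint_index scalar_prod_def)
  finally show "mat_adjoint (A * B) $$ (i, j) = (mat_adjoint B * mat_adjoint A) $$ (i, j)" .
qed (use assms in auto)

lemma mat_adjoint_one: "mat_adjoint (1\<^sub>m m :: complex mat) = 1\<^sub>m m"
  by (rule eq_matI) (auto simp: mat_adjoint_index)

lemma group_unitary_group: "group (unitary_group m)"
proof (rule groupI)
  fix A B assume A: "A \<in> carrier (unitary_group m)" and B: "B \<in> carrier (unitary_group m)"
  define A' where "A' = mat_adjoint A"
  define B' where "B' = mat_adjoint B"
  have c: "A \<in> carrier_mat m m" "B \<in> carrier_mat m m" "A' \<in> carrier_mat m m" "B' \<in> carrier_mat m m"
    using A B by (auto simp: unitary_group_def A'_def B'_def)
  have u: "A * A' = 1\<^sub>m m" "A' * A = 1\<^sub>m m" "B * B' = 1\<^sub>m m" "B' * B = 1\<^sub>m m"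
    using A B by (auto simp: unitary_group_def A'_def B'_def)
  have "A * B * (B' * A') = A * (B * B') * A'" "B' * A' * (A * B) = B' * (A' * A) * B"
    using c by (auto simp: assoc_mult_mat[of _ m m _ m _ m])
  then show "A \<otimes>\<^bsub>unitary_group m\<^esub> B \<in> carrier (unitary_group m)"
    using c u by (simp add: unitary_group_def mat_adjoint_mult[of A m B] flip: A'_def B'_def)
next
  fix A assume A: "A \<in> carrier (unitary_group m)"
  then show "\<exists>B \<in> carrier (unitary_group m). B \<otimes>\<^bsub>unitary_group m\<^esub> A = \<one>\<^bsub>unitary_group m\<^esub>"
    by (intro bexI[of _ "mat_adjoint A"]) (auto simp: unitary_group_def mat_adjoint_adjoint)
qed (auto simp: unitary_group_def mat_adjoint_one)

lemma topspace_unitary_topology [simp]: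
  "topspace (unitary_topology m) = carrier (unitary_group m)"
  by (auto simp: unitary_topology_def topspace_pullback_topology)

definition conj_action :: "nat \<Rightarrow> 'i set \<Rightarrow> complex mat \<Rightarrow> ('i \<Rightarrow> complex mat) \<Rightarrow> 'i \<Rightarrow> complex mat" where
  "conj_action m I g A =
     (\<lambda>i \<in> I. g \<otimes>\<^bsub>unitary_group m\<^esub> A i \<otimes>\<^bsub>unitary_group m\<^esub> inv\<^bsub>unitary_group m\<^esub> g)"

text \<open>The product of the groups \<open>U(\<mu> j)\<close> for \<open>1 \<le> j \<le> s\<close>, and its block diagonal embedding.\<close>

definition block_unitary_group :: "nat \<Rightarrow> (nat \<Rightarrow> nat) \<Rightarrow> (nat \<Rightarrow> complex mat) monoid" where
  "block_unitary_group s \<mu> = product_group {1..s} (\<lambda>j. unitary_group (\<mu> j))"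

definition block_diag :: "nat \<Rightarrow> (nat \<Rightarrow> complex mat) \<Rightarrow> complex mat" where
  "block_diag s h = diag_block_mat (map h [1..<Suc s])"


section \<open>Almost commuting tuples\<close>

definition commutator :: "('a, 'b) monoid_scheme \<Rightarrow> 'a \<Rightarrow> 'a \<Rightarrow> 'a" where
  "commutator G a b = a \<otimes>\<^bsub>G\<^esub> b \<otimes>\<^bsub>G\<^esub> inv\<^bsub>G\<^esub> a \<otimes>\<^bsub>G\<^esub> inv\<^bsub>G\<^esub> b"

text \<open>Rows and columns are numbered from 1; an \<open>n \<times> n\<close> matrix is given by its values on
  \<open>{1..n} \<times> {1..n}\<close>.\<close>

definition D_matrix :: "nat \<Rightarrow> (nat \<Rightarrow> ratmod) \<Rightarrow> nat \<Rightarrow> nat \<Rightarrow> ratmod" where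
  "D_matrix t d i j =
     (if j \<in> {1..t} \<and> i = j + t then d j
      else if i \<in> {1..t} \<and> j = i + t then - d i
      else 0)"

definition almost_commuting :: "nat \<Rightarrow> nat \<Rightarrow> (nat \<Rightarrow> nat \<Rightarrow> ratmod) \<Rightarrow> (nat \<Rightarrow> complex mat) topology" where
  "almost_commuting n m D =
     subtopology (product_topology (\<lambda>_. unitary_topology m) {1..n})
       {A. \<forall>i \<in> {1..n}. \<forall>j \<in> {1..n}.
          commutator (unitary_group m) (A i) (A j) = exp_ratmod (D i j) \<cdot>\<^sub>m 1\<^sub>m m}"


section \<open>Central extensions by the integers\<close>

definition central_extension ::
  "('e, 'a) monoid_scheme \<Rightarrow> ('q, 'b) monoid_scheme \<Rightarrow> (int \<Rightarrow> 'e) \<Rightarrow> ('e \<Rightarrow> 'q) \<Rightarrow> bool" where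
  "central_extension E Q \<iota> \<pi> \<longleftrightarrow>
     group E \<and> group Q \<and>
     \<iota> \<in> hom integer_group E \<and> inj \<iota> \<and>
     \<pi> \<in> hom E Q \<and> \<pi> ` carrier E = carrier Q \<and>
     kernel E Q \<pi> = range \<iota> \<and>
     (\<forall>z. \<forall>g \<in> carrier E. \<iota> z \<otimes>\<^bsub>E\<^esub> g = g \<otimes>\<^bsub>E\<^esub> \<iota> z)"

text \<open>The k-invariant is the class in \<open>H\<^sup>2(Q; \<int>)\<close> of the cocycle of any set-theoretic section
  \<open>\<sigma>\<close>. Here \<open>\<beta>\<close> is a representing 2-cocycle; the cocycle of \<open>\<sigma>\<close> may differ from it by the
  coboundary of \<open>h\<close>.\<close>

definition has_k_invariant ::
  "('e, 'a) monoid_scheme \<Rightarrow> ('q, 'b) monoid_scheme \<Rightarrow> (int \<Rightarrow> 'e) \<Rightarrow> ('e \<Rightarrow> 'q) \<Rightarrow>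
   ('q \<Rightarrow> 'q \<Rightarrow> int) \<Rightarrow> bool" where
  "has_k_invariant E Q \<iota> \<pi> \<beta> \<longleftrightarrow>
     (\<exists>\<sigma> h. (\<forall>v \<in> carrier Q. \<sigma> v \<in> carrier E \<and> \<pi> (\<sigma> v) = v) \<and>
       (\<forall>v \<in> carrier Q. \<forall>w \<in> carrier Q.
          \<sigma> v \<otimes>\<^bsub>E\<^esub> \<sigma> w = \<iota> (\<beta> v w + (h v + h w - h (v \<otimes>\<^bsub>Q\<^esub> w))) \<otimes>\<^bsub>E\<^esub> \<sigma> (v \<otimes>\<^bsub>Q\<^esub> w)))"

definition Zn :: "nat \<Rightarrow> (nat \<Rightarrow> int) monoid" where
  "Zn n = product_group {1..n} (\<lambda>_. integer_group)"

definition Zn_basis :: "nat \<Rightarrow> nat \<Rightarrow> nat \<Rightarrow> int" where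
  "Zn_basis n i = (\<lambda>j \<in> {1..n}. if j = i then 1 else 0)"

text \<open>\<open>e\<^sub>i\<^sup>* \<and> e\<^sub>j\<^sup>*\<close> is the cup product of two classes of degree 1, hence represented by
  the cocycle \<open>(v, w) \<mapsto> v\<^sub>i w\<^sub>j\<close>.\<close>

definition omega :: "nat \<Rightarrow> (nat \<Rightarrow> nat) \<Rightarrow> (nat \<Rightarrow> int) \<Rightarrow> (nat \<Rightarrow> int) \<Rightarrow> int" where
  "omega t c v w = (\<Sum>i = 1..t. int (c i) * (v i * w (t + i)))"

lemma commutator_lifts:
  assumes E: "central_extension E Q \<iota> \<pi>" and Q: "comm_group Q"
    and k: "has_k_invariant E Q \<iota> \<pi> \<beta>"
    and ab: "a \<in> carrier E" "b \<in> carrier E"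
  shows "commutator E a b = \<iota> (\<beta> (\<pi> a) (\<pi> b) - \<beta> (\<pi> b) (\<pi> a))"
proof -
  interpret E: group E using E by (simp add: central_extension_def)
  interpret Q: comm_group Q by (rule Q)
  have pi: "\<pi> \<in> hom E Q" and ker: "kernel E Q \<pi> = range \<iota>"
    and iota: "\<iota> \<in> hom integer_group E"
    and cen: "\<And>z g. g \<in> carrier E \<Longrightarrow> \<iota> z \<otimes>\<^bsub>E\<^esub> g = g \<otimes>\<^bsub>E\<^esub> \<iota> z"
    using E by (auto simp: central_extension_def)
  have ic: "\<iota> z \<in> carrier E" for z using iota by (auto simp: hom_def)
  have ia: "\<iota> y \<otimes>\<^bsub>E\<^esub> \<iota> z = \<iota> (y + z)" for y z using iota by (auto simp: hom_def)
  obtain \<sigma> h where s: "\<And>v. v \<in> carrier Q \<Longrightarrow> \<sigma> v \<in> carrier E \<and> \<pi> (\<sigma> v) = v"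
    and m: "\<And>v w. v \<in> carrier Q \<Longrightarrow> w \<in> carrier Q \<Longrightarrow>
       \<sigma> v \<otimes>\<^bsub>E\<^esub> \<sigma> w = \<iota> (\<beta> v w + (h v + h w - h (v \<otimes>\<^bsub>Q\<^esub> w))) \<otimes>\<^bsub>E\<^esub> \<sigma> (v \<otimes>\<^bsub>Q\<^esub> w)"
    using k unfolding has_k_invariant_def by blast
  have pc: "\<pi> g \<in> carrier Q" if "g \<in> carrier E" for g using pi that by (auto simp: hom_def)
  have lift: "\<exists>z. g = \<iota> z \<otimes>\<^bsub>E\<^esub> \<sigma> (\<pi> g)" if g: "g \<in> carrier E" for g
  proof -
    interpret hom: group_hom E Q \<pi>
      using pi by unfold_locales
    have sg: "\<sigma> (\<pi> g) \<in> carrier E" "\<pi> (\<sigma> (\<pi> g)) = \<pi> g" using s pc[OF g] by auto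
    have "g \<otimes>\<^bsub>E\<^esub> inv\<^bsub>E\<^esub> \<sigma> (\<pi> g) \<in> kernel E Q \<pi>"
      using g sg by (simp add: kernel_def)
    then obtain z where "g \<otimes>\<^bsub>E\<^esub> inv\<^bsub>E\<^esub> \<sigma> (\<pi> g) = \<iota> z" using ker by auto
    then have "g = \<iota> z \<otimes>\<^bsub>E\<^esub> \<sigma> (\<pi> g)" using g sg ic by (metis E.inv_solve_right)
    then show ?thesis by blast
  qed
  define v w where "v = \<pi> a" and "w = \<pi> b"
  have vw: "v \<in> carrier Q" "w \<in> carrier Q" using pc ab by (auto simp: v_def w_def)
  obtain y where y: "a = \<iota> y \<otimes>\<^bsub>E\<^esub> \<sigma> v" using lift[OF ab(1)] v_def by auto
  obtain z where z: "b = \<iota> z \<otimes>\<^bsub>E\<^esub> \<sigma> w" using lift[OF ab(2)] w_def by auto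
  have sc: "\<sigma> v \<in> carrier E" "\<sigma> w \<in> carrier E" "\<sigma> (v \<otimes>\<^bsub>Q\<^esub> w) \<in> carrier E" using s vw by auto
  have prod: "(\<iota> i \<otimes>\<^bsub>E\<^esub> p) \<otimes>\<^bsub>E\<^esub> (\<iota> j \<otimes>\<^bsub>E\<^esub> q) = \<iota> (i + j) \<otimes>\<^bsub>E\<^esub> (p \<otimes>\<^bsub>E\<^esub> q)"
    if "p \<in> carrier E" "q \<in> carrier E" for i j p q
    using that ic cen[of p j] by (metis E.m_assoc E.m_closed ia)
  have sw: "w \<otimes>\<^bsub>Q\<^esub> v = v \<otimes>\<^bsub>Q\<^esub> w" using vw by (simp add: Q.m_comm)
  let ?d = "\<beta> v w - \<beta> w v"
  have 1: "a \<otimes>\<^bsub>E\<^esub> b = \<iota> (y + z + (\<beta> v w + (h v + h w - h (v \<otimes>\<^bsub>Q\<^esub> w)))) \<otimes>\<^bsub>E\<^esub> \<sigma> (v \<otimes>\<^bsub>Q\<^esub> w)"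
    unfolding y z prod[OF sc(1,2)] m[OF vw] using sc ic by (simp add: ia flip: E.m_assoc)
  have 2: "b \<otimes>\<^bsub>E\<^esub> a = \<iota> (z + y + (\<beta> w v + (h w + h v - h (v \<otimes>\<^bsub>Q\<^esub> w)))) \<otimes>\<^bsub>E\<^esub> \<sigma> (v \<otimes>\<^bsub>Q\<^esub> w)"
    unfolding y z prod[OF sc(2,1)] m[OF vw(2,1)] sw using sc ic by (simp add: ia flip: E.m_assoc)
  have "a \<otimes>\<^bsub>E\<^esub> b = \<iota> ?d \<otimes>\<^bsub>E\<^esub> (b \<otimes>\<^bsub>E\<^esub> a)"
    unfolding 1 2 using sc ic by (simp add: ia algebra_simps flip: E.m_assoc)
  then show ?thesis
    using ab ic[of ?d] unfolding commutator_def v_def w_def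
    by (simp add: E.m_assoc E.inv_mult_group[symmetric])
qed


lemma omega_basis:
  assumes "2 * t \<le> n" "i \<in> {1..n}" "j \<in> {1..n}"
  shows "omega t c (Zn_basis n i) (Zn_basis n j) = (if i \<in> {1..t} \<and> j = t + i then int (c i) else 0)"
proof -
  have "omega t c (Zn_basis n i) (Zn_basis n j) =
      (\<Sum>r = 1..t. if r = i then (if j = t + i then int (c i) else 0) else 0)"
    unfolding omega_def using assms by (intro sum.cong) (auto simp: Zn_basis_def)
  then show ?thesis by simp
qed

text \<open>With these conventions arbitrary lifts \<open>a\<^sub>i\<close> of the standard basis, together with
  \<open>x = \<iota> 1\<close>, satisfy the defining relations of the group.\<close>

lemma extension_relations:
  assumes E: "central_extension E (Zn n) \<iota> \<pi>" and k: "has_k_invariant E (Zn n) \<iota> \<pi> (omega t c)"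
    and t: "2 * t \<le> n"
    and a: "\<And>i. i \<in> {1..n} \<Longrightarrow> a i \<in> carrier E \<and> \<pi> (a i) = Zn_basis n i"
  shows "i \<in> {1..t} \<Longrightarrow> commutator E (a i) (a (t + i)) = \<iota> 1 [^]\<^bsub>E\<^esub> c i"
    and "i \<in> {1..n} \<Longrightarrow> j \<in> {1..n} \<Longrightarrow> \<not> (i \<in> {1..t} \<and> j = t + i) \<Longrightarrow>
      \<not> (j \<in> {1..t} \<and> i = t + j) \<Longrightarrow> commutator E (a i) (a j) = \<one>\<^bsub>E\<^esub>"
proof -
  interpret E: group E using E by (simp add: central_extension_def)
  have iota: "\<iota> \<in> hom integer_group E" using E by (simp add: central_extension_def)
  have zero: "\<iota> 0 = \<one>\<^bsub>E\<^esub>"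
    using hom_one[OF iota] by simp
  have pow: "\<iota> 1 [^]\<^bsub>E\<^esub> r = \<iota> (int r)" for r :: nat
  proof (induction r)
    case (Suc r)
    have "\<iota> (int r + 1) = \<iota> (int r) \<otimes>\<^bsub>E\<^esub> \<iota> 1"
      using hom_mult[OF iota, of "int r" 1] by simp
    then show ?case using Suc by (simp add: add.commute)
  qed (simp add: zero)
  have Z: "comm_group (Zn n)"
  proof -
    have "group (Zn n)" using E by (simp add: central_extension_def)
    then show ?thesis
      by (rule group.group_comm_groupI) (auto simp: Zn_def product_group_def integer_group_def add.commute)
  qed
  have comm: "commutator E (a i) (a j) =
      \<iota> (omega t c (Zn_basis n i) (Zn_basis n j) - omega t c (Zn_basis n j) (Zn_basis n i))"
    if "i \<in> {1..n}" "j \<in> {1..n}" for i j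
    using commutator_lifts[OF E Z k, of "a i" "a j"] a[OF that(1)] a[OF that(2)] by simp
  show "commutator E (a i) (a (t + i)) = \<iota> 1 [^]\<^bsub>E\<^esub> c i" if "i \<in> {1..t}"
    using that t by (subst comm) (auto simp: omega_basis pow)
  show "commutator E (a i) (a j) = \<one>\<^bsub>E\<^esub>"
    if "i \<in> {1..n}" "j \<in> {1..n}" "\<not> (i \<in> {1..t} \<and> j = t + i)" "\<not> (j \<in> {1..t} \<and> i = t + j)"
    using that t by (subst comm) (auto simp: omega_basis zero)
qed


section \<open>Spaces of unitary representations\<close>

text \<open>Homomorphisms are made extensional, so that they are determined by their values on the
  group; the topology is induced from \<open>U(m)\<^bsup>n+1\<^esup>\<close> by \<open>f \<mapsto> (f x, f a\<^sub>1, \<dots>, f a\<^sub>n)\<close>.\<close>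

definition hom_space ::
  "('g, 'r) monoid_scheme \<Rightarrow> nat \<Rightarrow> 'g \<Rightarrow> (nat \<Rightarrow> 'g) \<Rightarrow> nat \<Rightarrow> ('g \<Rightarrow> complex mat) topology" where
  "hom_space G n x a m =
     pullback_topology (hom G (unitary_group m) \<inter> extensional (carrier G))
       (\<lambda>f. (f x, \<lambda>i \<in> {1..n}. f (a i)))
       (prod_topology (unitary_topology m) (product_topology (\<lambda>_. unitary_topology m) {1..n}))"

definition hom_space_char_poly ::
  "('g, 'r) monoid_scheme \<Rightarrow> nat \<Rightarrow> 'g \<Rightarrow> (nat \<Rightarrow> 'g) \<Rightarrow> nat \<Rightarrow> complex poly \<Rightarrow>
   ('g \<Rightarrow> complex mat) topology" where
  "hom_space_char_poly G n x a m p = subtopology (hom_space G n x a m) {f. char_poly (f x) = p}"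

text \<open>\<open>U(m) \<times>\<^bsub>\<Prod> U(\<mu> j)\<^esub> \<Prod> B\<^sub>n(U(\<mu> j))\<^bsub>D j\<^esub>\<close>, and left multiplication by \<open>g\<close> on its
  first factor. A point is an orbit, so \<open>g\<close> acts by taking images.\<close>

definition induced_space ::
  "nat \<Rightarrow> nat \<Rightarrow> nat \<Rightarrow> (nat \<Rightarrow> nat) \<Rightarrow> (nat \<Rightarrow> nat \<Rightarrow> nat \<Rightarrow> ratmod) \<Rightarrow>
   (complex mat \<times> (nat \<Rightarrow> nat \<Rightarrow> complex mat)) set topology" where
  "induced_space n m s \<mu> D =
     balanced_product (block_unitary_group s \<mu>)
       (\<lambda>u h. u \<otimes>\<^bsub>unitary_group m\<^esub> block_diag s h)
       (\<lambda>h B. \<lambda>j \<in> {1..s}. conj_action (\<mu> j) {1..n} (h j) (B j))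
       (unitary_topology m)
       (product_topology (\<lambda>j. almost_commuting n (\<mu> j) (D j)) {1..s})"

definition left_mult_action :: "nat \<Rightarrow> complex mat \<Rightarrow> (complex mat \<times> 'y) set \<Rightarrow> (complex mat \<times> 'y) set" where
  "left_mult_action m g Z = (\<lambda>(u, y). (g \<otimes>\<^bsub>unitary_group m\<^esub> u, y)) ` Z"


section \<open>Symmetric products of tori\<close>

definition torus :: "nat \<Rightarrow> (nat \<Rightarrow> complex) topology" where
  "torus n = product_topology (\<lambda>_. top_of_set (sphere 0 1)) {1..n}"

definition permute_factors :: "nat \<Rightarrow> (nat \<Rightarrow> nat) \<Rightarrow> (nat \<Rightarrow> 'x) \<Rightarrow> nat \<Rightarrow> 'x" where
  "permute_factors l p z = (\<lambda>i \<in> {1..l}. z (inv' p i))"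

definition symmetric_product :: "nat \<Rightarrow> 'x topology \<Rightarrow> (nat \<Rightarrow> 'x) set topology" where
  "symmetric_product l X =
     orbit_space (sym_group l) (permute_factors l) (product_topology (\<lambda>_. X) {1..l})"

end

theory Submission
  imports Defs "HOL-Analysis.Abstract_Topological_Spaces"
begin

text \<open>
  A homomorphism is determined by the images \<open>X, A\<^sub>1, \<dots>, A\<^sub>n\<close> of \<open>x, a\<^sub>1, \<dots>, a\<^sub>n\<close>, and any unitary matrices
  satisfying the defining relations occur. On an eigenspace of the central matrix \<open>X\<close> with eigenvalue
  \<open>\<lambda>\<^sub>j\<close> the commutator relations become \<open>A\<^sub>i A\<^sub>t\<^sub>+\<^sub>i = \<lambda>\<^sub>j^c\<^sub>i A\<^sub>t\<^sub>+\<^sub>i A\<^sub>i\<close>. Starting from a joint eigenvector of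
  \<open>A\<^sub>1, \<dots>, A\<^sub>t\<close> and of the commuting powers of the other \<open>A\<^sub>i\<close>, the operators \<open>A\<^sub>t\<^sub>+\<^sub>i\<close> move it through
  orthogonal joint eigenspaces and span an invariant block of dimension \<open>\<Prod>\<^sub>i k\<^sub>j / gcd(k\<^sub>j, c\<^sub>i)\<close>. By passing to
  orthogonal complements, every representation is unitarily equivalent to an explicit monomial model
  with parameters in a torus, and two models are equivalent iff, up to permuting blocks with the same
  \<open>\<lambda>\<^sub>j\<close>, the parameters have the same powers. These powers are the scalars by which central elements
  of the group algebra act, so they are conjugation invariants.

  Both homeomorphisms are obtained by comparing two quotient maps with the same fibres out of a compact
  space. For the first one the compact space is \<open>U(m) \<times> \<Prod>\<^sub>j B\<^sub>n(U(\<mu> j))\<close> with the map \<open>(u, B) \<mapsto> u B u\<^sup>*\<close>, where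
  a unitary matrix commuting with the block scalar matrix of the \<open>\<lambda>\<^sub>j\<close> is block diagonal. For the second
  one it is the torus of model parameters.
\<close>

text \<open>Eigenvectors and diagonalizations cannot be chosen continuously over the space of
  representations, so no inverse map is written down: once the spaces are compact, a normal form
  that exists pointwise is enough. The product of symmetric products is reached through open orbit
  maps, because products preserve open quotient maps but not all quotient maps.

  The parameters of a block and its invariants differ. A block determines only the powers z_i^N_i,
  where N_i is the order of \<lambda>_j^c for the two generators of a pair with constant c, and 1
  for the other generators. The coordinatewise power map sends the parameter torus onto a torus of
  the same dimension, which is why T^n appears in the answer.

  That equivalent models have equal invariants is shown without characters: an intertwiner is
  invertible, so some term of the Leibniz expansion of its determinant is nonzero, and this term
  matches basis vectors with equal invariants. Non-emptiness supplies the integrality of l_j, since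
  one decomposed representation shows that the block dimension divides m_j.\<close>

section \<open>Quotient maps\<close>

text \<open>Each map is constant on the fibres of the other, so each factors continuously through
  the other, and surjectivity makes the two factorizations mutually inverse. The values of
  \<open>F\<close> on representatives are kept because equivariance is later computed from
  them.\<close>

lemma quotient_maps_same_fibres:
  assumes q1: "quotient_map X Y q1" and q2: "quotient_map X Z q2"
    and eq: "\<And>x x'. x \<in> topspace X \<Longrightarrow> x' \<in> topspace X \<Longrightarrow> q1 x = q1 x' \<longleftrightarrow> q2 x = q2 x'"
  obtains F where "homeomorphic_map Y Z F" "\<And>x. x \<in> topspace X \<Longrightarrow> F (q1 x) = q2 x"
proof -
  obtain F where F: "continuous_map Y Z F" "F ` topspace Y = q2 ` topspace X"
    "\<And>x. x \<in> topspace X \<Longrightarrow> F (q1 x) = q2 x"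
    using quotient_map_lift_exists[OF q1 quotient_imp_continuous_map[OF q2]] eq by metis
  obtain G where G: "continuous_map Z Y G" "G ` topspace Z = q1 ` topspace X"
    "\<And>x. x \<in> topspace X \<Longrightarrow> G (q2 x) = q1 x"
    using quotient_map_lift_exists[OF q2 quotient_imp_continuous_map[OF q1]] eq by metis
  have s1: "q1 ` topspace X = topspace Y" and s2: "q2 ` topspace X = topspace Z"
    using q1 q2 by (auto simp: quotient_map_def)
  have "homeomorphic_maps Y Z F G"
    unfolding homeomorphic_maps_def using F G s1 s2 by (metis (no_types, lifting) imageE)
  then show ?thesis
    using that F(3) homeomorphic_maps_map by blast
qed

text \<open>Products of quotient maps need not be quotient maps, while open surjections survive
  products: a basic open box is sent to a box, and surjectivity keeps all but finitely many of its
  sides full.\<close>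

lemma open_map_product:
  assumes op: "\<And>i. i \<in> I \<Longrightarrow> open_map (X i) (Y i) (q i)"
    and sur: "\<And>i. i \<in> I \<Longrightarrow> q i ` topspace (X i) = topspace (Y i)"
  shows "open_map (product_topology X I) (product_topology Y I) (\<lambda>x. \<lambda>i\<in>I. q i (x i))"
  unfolding open_map_def
proof (intro allI impI)
  fix S assume S: "openin (product_topology X I) S"
  show "openin (product_topology Y I) ((\<lambda>x. \<lambda>i\<in>I. q i (x i)) ` S)"
    unfolding openin_product_topology_alt
  proof (intro ballI)
    fix y assume "y \<in> (\<lambda>x. \<lambda>i\<in>I. q i (x i)) ` S"
    then obtain x where x: "x \<in> S" "y = (\<lambda>i\<in>I. q i (x i))" by auto
    obtain U where U': "finite {i \<in> I. U i \<noteq> topspace (X i)} \<and> (\<forall>i\<in>I. openin (X i) (U i)) \<and>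
      x \<in> Pi\<^sub>E I U \<and> Pi\<^sub>E I U \<subseteq> S"
      by (rule exE[OF bspec[OF S[unfolded openin_product_topology_alt] x(1)]])
    then have U: "finite {i \<in> I. U i \<noteq> topspace (X i)}" "\<And>i. i \<in> I \<Longrightarrow> openin (X i) (U i)"
      "x \<in> Pi\<^sub>E I U" "Pi\<^sub>E I U \<subseteq> S"
      by simp_all
    show "\<exists>V. finite {i \<in> I. V i \<noteq> topspace (Y i)} \<and> (\<forall>i\<in>I. openin (Y i) (V i)) \<and>
        y \<in> Pi\<^sub>E I V \<and> Pi\<^sub>E I V \<subseteq> (\<lambda>x. \<lambda>i\<in>I. q i (x i)) ` S"
    proof (intro exI conjI)
      show "finite {i \<in> I. q i ` U i \<noteq> topspace (Y i)}"
        by (rule finite_subset[OF _ U(1)]) (use sur in auto)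
      show "\<forall>i\<in>I. openin (Y i) (q i ` U i)"
        using op U(2) by (auto simp: open_map_def)
      show "y \<in> (\<Pi>\<^sub>E i\<in>I. q i ` U i)"
        using U(3) x(2) by auto
      show "(\<Pi>\<^sub>E i\<in>I. q i ` U i) \<subseteq> (\<lambda>x. \<lambda>i\<in>I. q i (x i)) ` S"
      proof
        fix w assume w: "w \<in> (\<Pi>\<^sub>E i\<in>I. q i ` U i)"
        then have "\<forall>i\<in>I. \<exists>v. v \<in> U i \<and> q i v = w i" by (fastforce simp: PiE_iff)
        then obtain v where v: "\<And>i. i \<in> I \<Longrightarrow> v i \<in> U i \<and> q i (v i) = w i" by metis
        have "restrict v I \<in> S" using v U(4) by auto
        moreover have "w = (\<lambda>i\<in>I. q i (restrict v I i))"
          using v w by (intro ext) (auto simp: PiE_iff extensional_def)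
        ultimately show "w \<in> (\<lambda>x. \<lambda>i\<in>I. q i (x i)) ` S" by blast
      qed
    qed
  qed
qed

lemma quotient_map_open_product:
  assumes "\<And>i. i \<in> I \<Longrightarrow> quotient_map (X i) (Y i) (q i)"
    and "\<And>i. i \<in> I \<Longrightarrow> open_map (X i) (Y i) (q i)"
  shows "quotient_map (product_topology X I) (product_topology Y I) (\<lambda>x. \<lambda>i\<in>I. q i (x i))"
proof (rule continuous_open_imp_quotient_map)
  have s: "q i ` topspace (X i) = topspace (Y i)" if "i \<in> I" for i
    using assms(1)[OF that] by (auto simp: quotient_map_def)
  show "open_map (product_topology X I) (product_topology Y I) (\<lambda>x. \<lambda>i\<in>I. q i (x i))"
    by (rule open_map_product) (use assms s in auto)
  have "continuous_map (product_topology X I) (Y i) (\<lambda>x. q i (x i))" if "i \<in> I" for i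
    using continuous_map_compose[OF continuous_map_product_projection[OF that, of X]
        quotient_imp_continuous_map[OF assms(1)[OF that]]] by (simp add: o_def)
  then show "continuous_map (product_topology X I) (product_topology Y I) (\<lambda>x. \<lambda>i\<in>I. q i (x i))"
    by (auto simp: continuous_map_componentwise)
  show "(\<lambda>x. \<lambda>i\<in>I. q i (x i)) ` topspace (product_topology X I) = topspace (product_topology Y I)"
  proof (intro equalityI subsetI)
    fix w assume w: "w \<in> topspace (product_topology Y I)"
    then have "w i \<in> q i ` topspace (X i)" if "i \<in> I" for i using s that by (auto simp: PiE_iff)
    then have "\<forall>i\<in>I. \<exists>v. v \<in> topspace (X i) \<and> q i v = w i" by fastforce
    then obtain v where v: "\<And>i. i \<in> I \<Longrightarrow> v i \<in> topspace (X i) \<and> q i (v i) = w i" by metis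
    have "restrict v I \<in> topspace (product_topology X I)" using v by auto
    moreover have "w = (\<lambda>i\<in>I. q i (restrict v I i))"
      using v w by (intro ext) (auto simp: PiE_iff extensional_def)
    ultimately show "w \<in> (\<lambda>x. \<lambda>i\<in>I. q i (x i)) ` topspace (product_topology X I)" by blast
  next
    have "q i v \<in> topspace (Y i)" if "i \<in> I" "v \<in> topspace (X i)" for i v
      using s that by blast
    then show "w \<in> topspace (product_topology Y I)"
      if "w \<in> (\<lambda>x. \<lambda>i\<in>I. q i (x i)) ` topspace (product_topology X I)" for w
      using that by (auto simp: PiE_iff)
  qed
qed

section \<open>The permutation action on factors and its orbits\<close>

lemma permute_factors_in:
  assumes "p permutes {1..l}" "z \<in> {1..l} \<rightarrow>\<^sub>E A"
  shows "permute_factors l p z \<in> {1..l} \<rightarrow>\<^sub>E A"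
  using assms(2)
  by (simp add: permute_factors_def PiE_iff permutes_in_image[OF permutes_inv[OF assms(1)]]
      del: atLeastAtMost_iff One_nat_def)

lemma permute_factors_compose:
  assumes "p permutes {1..l}" "p' permutes {1..l}"
  shows "permute_factors l p (permute_factors l p' z) = permute_factors l (p \<circ> p') z"
  using assms
  by (simp add: permute_factors_def fun_eq_iff o_inv_distrib permutes_bij
      permutes_in_image[OF permutes_inv[OF assms(1)]] del: atLeastAtMost_iff One_nat_def)

text \<open>The comparison of block invariants produces equality of orbits in this pointwise form;
  the inverse in \<open>permute_factors\<close> disappears because p ranges over a group.\<close>

lemma orbit_permute_factors_eq_iff:
  assumes "z \<in> {1..l} \<rightarrow>\<^sub>E A" "z' \<in> {1..l} \<rightarrow>\<^sub>E A"
  shows "orbit (sym_group l) (permute_factors l) z = orbit (sym_group l) (permute_factors l) z' \<longleftrightarrow>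
    (\<exists>p. p permutes {1..l} \<and> (\<forall>b \<in> {1..l}. z' b = z (p b)))" (is "?L \<longleftrightarrow> ?R")
proof
  have id: "permute_factors l id z' = z'"
    using assms(2) by (simp add: permute_factors_def PiE_iff extensional_restrict inv_id)
  have "permute_factors l id z' \<in> orbit (sym_group l) (permute_factors l) z'"
    unfolding orbit_def mem_Collect_eq sym_group_carrier by (rule exI[of _ id]) (simp add: permutes_id)
  moreover assume ?L
  ultimately have "z' \<in> orbit (sym_group l) (permute_factors l) z"
    by (simp add: id)
  then obtain p where p: "p permutes {1..l}" "z' = permute_factors l p z"
    by (auto simp: orbit_def sym_group_carrier)
  have "z' b = z (inv' p b)" if "b \<in> {1..l}" for b
    using that by (simp add: p(2) permute_factors_def)
  with permutes_inv[OF p(1)] show ?R by (intro exI[of _ "inv' p"] conjI ballI)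
next
  assume ?R
  then obtain p where p: "p permutes {1..l}" "\<And>b. b \<in> {1..l} \<Longrightarrow> z' b = z (p b)" by auto
  have z': "z' = permute_factors l (inv' p) z"
    unfolding permute_factors_def inv_inv_eq[OF permutes_bij[OF p(1)]]
    by (rule extensionalityI[of _ "{1..l}"]) (use assms(2) p(2) in \<open>auto simp: PiE_iff\<close>)
  have z: "z = permute_factors l p z'"
    unfolding z' permute_factors_compose[OF p(1) permutes_inv[OF p(1)]] permutes_inv_o(1)[OF p(1)]
    using assms(1) by (simp add: permute_factors_def PiE_iff extensional_restrict inv_id)
  \<comment> \<open>Translating the base point never enlarges an orbit; applied to p and to its
    inverse this gives both inclusions.\<close>
  have "orbit (sym_group l) (permute_factors l) (permute_factors l q u) \<subseteq> orbit (sym_group l) (permute_factors l) u"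
    if "q permutes {1..l}" for q and u :: "nat \<Rightarrow> 'a"
  proof
    fix w assume "w \<in> orbit (sym_group l) (permute_factors l) (permute_factors l q u)"
    then obtain r where r: "r permutes {1..l}" "w = permute_factors l r (permute_factors l q u)"
      by (auto simp: orbit_def sym_group_carrier)
    then have "w = permute_factors l (r \<circ> q) u" using that by (simp add: permute_factors_compose)
    with permutes_compose[OF that r(1)] show "w \<in> orbit (sym_group l) (permute_factors l) u"
      unfolding orbit_def mem_Collect_eq sym_group_carrier by (intro exI conjI)
  qed
  from this[OF p(1), of z', folded z] this[OF permutes_inv[OF p(1)], of z, folded z']
  show ?L by (rule equalityI)
qed

text \<open>The saturation of an open set is the union of its preimages under the permutations, each
  of which acts continuously.\<close>

lemma open_map_symmetric_product:
  "open_map (product_topology (\<lambda>_. X) {1..l}) (symmetric_product l X) (orbit (sym_group l) (permute_factors l))"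
  unfolding open_map_def
proof (intro allI impI)
  let ?P = "product_topology (\<lambda>_. X) {1..l}" and ?o = "orbit (sym_group l) (permute_factors l)"
  fix U assume U: "openin ?P U"
  have cont: "continuous_map ?P ?P (permute_factors l p)" if "p permutes {1..l}" for p
    unfolding permute_factors_def continuous_map_componentwise
    by (auto intro!: continuous_map_product_projection
        simp: permutes_in_image[OF permutes_inv[OF that]] simp del: atLeastAtMost_iff One_nat_def)
  have eq: "{x \<in> topspace ?P. ?o x \<in> ?o ` U} =
      (\<Union>p\<in>{p. p permutes {1..l}}. {x \<in> topspace ?P. permute_factors l p x \<in> U})" (is "?A = ?B")
  proof (intro equalityI subsetI)
    fix x assume x: "x \<in> ?A"
    then obtain u where u: "u \<in> U" "?o x = ?o u" by auto
    have ut: "u \<in> topspace ?P" using U u openin_subset by blast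
    obtain p where p: "p permutes {1..l}" "\<And>b. b \<in> {1..l} \<Longrightarrow> u b = x (p b)"
      using orbit_permute_factors_eq_iff[of x l "topspace X" u] u(2) x ut by auto
    have "permute_factors l (inv' p) x = u"
      unfolding permute_factors_def inv_inv_eq[OF permutes_bij[OF p(1)]]
      by (rule extensionalityI[of _ "{1..l}"]) (use ut p(2) in \<open>auto simp: PiE_iff\<close>)
    then show "x \<in> ?B" using x u(1) permutes_inv[OF p(1)] by auto
  next
    fix x assume "x \<in> ?B"
    then obtain p where p: "p permutes {1..l}" "x \<in> topspace ?P" "permute_factors l p x \<in> U" by auto
    have "?o x = ?o (permute_factors l p x)"
    proof (subst orbit_permute_factors_eq_iff[of _ _ "topspace X"])
      show "x \<in> {1..l} \<rightarrow>\<^sub>E topspace X" using p(2) by simp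
      then show "permute_factors l p x \<in> {1..l} \<rightarrow>\<^sub>E topspace X"
        by (rule permute_factors_in[OF p(1)])
      have "permute_factors l p x b = x (inv' p b)" if "b \<in> {1..l}" for b
        using that by (simp add: permute_factors_def)
      with permutes_inv[OF p(1)]
      show "\<exists>q. q permutes {1..l} \<and> (\<forall>b\<in>{1..l}. permute_factors l p x b = x (q b))"
        by (intro exI[of _ "inv' p"] conjI ballI)
    qed
    then show "x \<in> ?A" using p by auto
  qed
  have "openin ?P ?A"
    unfolding eq using openin_continuous_map_preimage[OF cont U] by (intro openin_Union) blast
  moreover have "?o ` U \<subseteq> orbits (sym_group l) (topspace ?P) (permute_factors l)"
    using openin_subset[OF U] by (auto simp: orbits_def)
  ultimately show "openin (symmetric_product l X) (?o ` U)"
    by (simp add: symmetric_product_def openin_orbit_space)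
qed

text \<open>The logarithms \<open>q j\<close> are prescribed for j in {1..s} only, so the families
  of factors to be identified in the end agree just on the index set.\<close>

lemma product_topology_cong:
  assumes "\<And>i. i \<in> I \<Longrightarrow> X i = Y i"
  shows "product_topology X I = product_topology Y I"
proof -
  have F: "{i \<in> I. U i \<noteq> topspace (X i)} = {i \<in> I. U i \<noteq> topspace (Y i)}" for U
    by (rule Collect_cong) (simp only: assms cong: conj_cong)
  have O: "(\<forall>i\<in>I. openin (X i) (U i)) \<longleftrightarrow> (\<forall>i\<in>I. openin (Y i) (U i))" for U
    by (simp only: assms cong: ball_cong)
  show ?thesis unfolding topology_eq openin_product_topology_alt F O by simp
qed

section \<open>The topology of the unitary group\<close>

abbreviation unitary :: "nat \<Rightarrow> complex mat set" where
  "unitary m \<equiv> carrier (unitary_group m)"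

text \<open>A left inverse of a square matrix is two-sided, so orthonormality of the columns is
  enough.\<close>

lemma unitaryI:
  assumes "A \<in> carrier_mat m m" "mat_adjoint A * A = 1\<^sub>m m"
  shows "A \<in> unitary m"
proof -
  have "mat_adjoint A \<in> carrier_mat m m" using assms(1) by auto
  from mat_mult_left_right_inverse[OF this assms] show ?thesis
    using assms by (simp add: unitary_group_def)
qed

lemma unitaryD:
  assumes "A \<in> unitary m"
  shows "A \<in> carrier_mat m m" "A * mat_adjoint A = 1\<^sub>m m" "mat_adjoint A * A = 1\<^sub>m m"
    "mat_adjoint A \<in> unitary m" "mat_adjoint A \<in> carrier_mat m m"
  using assms by (auto simp: unitary_group_def mat_adjoint_adjoint)

lemma unitary_group_simps [simp]:
  "monoid.mult (unitary_group m) = (*)" "one (unitary_group m) = 1\<^sub>m m"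
  by (auto simp: unitary_group_def)

lemma inv_unitary_group [simp]: "A \<in> unitary m \<Longrightarrow> inv\<^bsub>unitary_group m\<^esub> A = mat_adjoint A"
  by (rule group.inv_equality[OF group_unitary_group]) (auto dest: unitaryD)

lemma unitary_mult [intro]: "A \<in> unitary m \<Longrightarrow> B \<in> unitary m \<Longrightarrow> A * B \<in> unitary m"
  using group.is_monoid[OF group_unitary_group, THEN monoid.m_closed] by simp

lemma continuous_map_into_unitary:
  "continuous_map X (unitary_topology m) f \<longleftrightarrow>
     f \<in> topspace X \<rightarrow> unitary m \<and>
     (\<forall>i<m. \<forall>j<m. continuous_map X euclidean (\<lambda>x. f x $$ (i, j)))" (is "?L \<longleftrightarrow> ?R")
proof
  assume f: ?L
  have "continuous_map (unitary_topology m) (product_topology (\<lambda>_. euclidean) ({..<m} \<times> {..<m}))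
      (id \<circ> (\<lambda>A. \<lambda>ij \<in> {..<m} \<times> {..<m}. A $$ ij) :: complex mat \<Rightarrow> _)"
    unfolding unitary_topology_def by (rule continuous_map_pullback) simp
  from continuous_map_compose[OF f this]
  have "\<forall>i<m. \<forall>j<m. continuous_map X euclidean (\<lambda>x. f x $$ (i, j))"
    by (auto simp add: continuous_map_componentwise o_def)
  then show ?R using continuous_map_funspace[OF f] by auto
next
  assume ?R
  then show ?L unfolding unitary_topology_def
    by (intro continuous_map_pullback') (auto simp: continuous_map_componentwise o_def)
qed

lemma continuous_map_unitary_entry:
  "continuous_map X (unitary_topology m) f \<Longrightarrow> i < m \<Longrightarrow> j < m \<Longrightarrow>
    continuous_map X euclidean (\<lambda>x. f x $$ (i, j))"
  by (simp add: continuous_map_into_unitary)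

lemma continuous_map_complex_mult:
  fixes f g :: "'a \<Rightarrow> complex"
  assumes "continuous_map X euclidean f" "continuous_map X euclidean g"
  shows "continuous_map X euclidean (\<lambda>x. f x * g x)"
  using assms by (simp add: continuous_map_atin tendsto_mult)

lemma continuous_map_cnj:
  assumes "continuous_map X euclidean f"
  shows "continuous_map X euclidean (\<lambda>x. cnj (f x))"
  using continuous_map_compose[OF assms, of euclidean cnj]
  by (simp add: o_def continuous_on_cnj continuous_on_id)

lemma continuous_map_unitary_mult:
  assumes "continuous_map X (unitary_topology m) f" "continuous_map X (unitary_topology m) g"
  shows "continuous_map X (unitary_topology m) (\<lambda>x. f x * g x)"
  unfolding continuous_map_into_unitary
proof (intro conjI allI impI)
  have fg: "f x \<in> unitary m" "g x \<in> unitary m" if "x \<in> topspace X" for x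
    using that assms by (auto simp: continuous_map_into_unitary)
  then show "(\<lambda>x. f x * g x) \<in> topspace X \<rightarrow> unitary m" by auto
  fix i j assume ij: "i < m" "j < m"
  have "continuous_map X euclidean (\<lambda>x. \<Sum>k = 0..<m. f x $$ (i, k) * g x $$ (k, j))"
    using ij by (intro continuous_map_sum continuous_map_complex_mult continuous_map_unitary_entry[OF assms(1)]
        continuous_map_unitary_entry[OF assms(2)]) auto
  then show "continuous_map X euclidean (\<lambda>x. (f x * g x) $$ (i, j))"
  proof (rule continuous_map_eq)
    fix x assume "x \<in> topspace X"
    then have "f x \<in> carrier_mat m m" "g x \<in> carrier_mat m m" using fg unitaryD(1) by blast+
    then show "(\<Sum>k = 0..<m. f x $$ (i, k) * g x $$ (k, j)) = (f x * g x) $$ (i, j)"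
      using ij by (simp add: scalar_prod_def)
  qed
qed

lemma continuous_map_unitary_adjoint:
  assumes "continuous_map X (unitary_topology m) f"
  shows "continuous_map X (unitary_topology m) (\<lambda>x. mat_adjoint (f x))"
  unfolding continuous_map_into_unitary
proof (intro conjI allI impI)
  have fx: "f x \<in> unitary m" if "x \<in> topspace X" for x
    using that assms by (auto simp: continuous_map_into_unitary)
  then show "(\<lambda>x. mat_adjoint (f x)) \<in> topspace X \<rightarrow> unitary m" by (auto dest: unitaryD)
  fix i j assume ij: "i < m" "j < m"
  show "continuous_map X euclidean (\<lambda>x. mat_adjoint (f x) $$ (i, j))"
  proof (rule continuous_map_eq[OF continuous_map_cnj[OF continuous_map_unitary_entry[OF assms ij(2,1)]]])
    fix x assume "x \<in> topspace X"
    then have "f x \<in> carrier_mat m m" using fx unitaryD(1) by blast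
    then show "cnj (f x $$ (j, i)) = mat_adjoint (f x) $$ (i, j)"
      using ij by (simp add: mat_adjoint_index)
  qed
qed

lemma unitary_entry_eqI:
  assumes "A \<in> unitary m" "B \<in> unitary m" "\<And>i j. i < m \<Longrightarrow> j < m \<Longrightarrow> A $$ (i, j) = B $$ (i, j)"
  shows "A = B"
  using assms by (intro eq_matI) (auto dest!: unitaryD(1))

section \<open>Hausdorffness and compactness of the unitary group\<close>

lemma Hausdorff_space_pullback_topology:
  assumes "Hausdorff_space Y" "inj_on f A"
  shows "Hausdorff_space (pullback_topology A f Y)"
  unfolding Hausdorff_space_def
proof (intro allI impI, elim conjE)
  fix x y assume xy: "x \<in> topspace (pullback_topology A f Y)" "y \<in> topspace (pullback_topology A f Y)" "x \<noteq> y"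
  then have "f x \<noteq> f y" "f x \<in> topspace Y" "f y \<in> topspace Y" "x \<in> A" "y \<in> A"
    using assms(2) by (auto simp: topspace_pullback_topology inj_on_def)
  then obtain U V where UV: "openin Y U" "openin Y V" "f x \<in> U" "f y \<in> V" "disjnt U V"
    using assms(1) unfolding Hausdorff_space_def by metis
  show "\<exists>U V. openin (pullback_topology A f Y) U \<and> openin (pullback_topology A f Y) V \<and> x \<in> U \<and> y \<in> V \<and> disjnt U V"
    by (intro exI[of _ "f -` U \<inter> A"] exI[of _ "f -` V \<inter> A"])
      (use UV \<open>x \<in> A\<close> \<open>y \<in> A\<close> in \<open>auto simp: openin_pullback_topology disjnt_def\<close>)
qed

lemma Hausdorff_space_unitary_topology: "Hausdorff_space (unitary_topology m)"
  unfolding unitary_topology_def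
proof (rule Hausdorff_space_pullback_topology)
  show "inj_on (\<lambda>A. \<lambda>ij\<in>{..<m} \<times> {..<m}. A $$ ij) (unitary m)"
  proof (rule inj_onI)
    fix A B :: "complex mat"
    assume AB: "A \<in> unitary m" "B \<in> unitary m"
      "(\<lambda>ij\<in>{..<m} \<times> {..<m}. A $$ ij) = (\<lambda>ij\<in>{..<m} \<times> {..<m}. B $$ ij)"
    then show "A = B"
      by (intro unitary_entry_eqI[of A m B]) (auto dest!: fun_cong simp: restrict_def split: if_splits)
  qed
qed (simp add: Hausdorff_space_product_topology)

text \<open>The diagonal entries of \<open>A * mat_adjoint A\<close> say that the rows are unit
  vectors.\<close>

lemma norm_unitary_entry_le_1:
  assumes "A \<in> unitary m" "i < m" "j < m"
  shows "norm (A $$ (i, j)) \<le> 1"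
proof -
  have "(A * mat_adjoint A) $$ (i, i) = 1" using assms unitaryD(2) by simp
  then have "(\<Sum>k = 0..<m. A $$ (i, k) * cnj (A $$ (i, k))) = 1"
    using assms unitaryD(1)[OF assms(1)] by (simp add: scalar_prod_def mat_adjoint_index)
  then have "complex_of_real (\<Sum>k = 0..<m. (norm (A $$ (i, k)))\<^sup>2) = 1"
    by (simp only: of_real_sum complex_norm_square)
  then have "(\<Sum>k = 0..<m. (norm (A $$ (i, k)))\<^sup>2) = 1" by (simp only: of_real_eq_1_iff)
  moreover have "(norm (A $$ (i, j)))\<^sup>2 \<le> (\<Sum>k = 0..<m. (norm (A $$ (i, k)))\<^sup>2)"
    by (rule member_le_sum) (use assms in auto)
  ultimately show ?thesis by (simp add: abs_square_le_1)
qed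

text \<open>The entries lie in the closed unit disc, so the group is the continuous image of a
  closed subset of a product of discs, cut out by the orthonormality of the columns.\<close>

lemma compact_space_unitary_topology: "compact_space (unitary_topology m)"
proof -
  define I where "I = {..<m} \<times> {..<m}"
  define P where "P = product_topology (\<lambda>_ :: nat \<times> nat. top_of_set (cball (0::complex) 1)) I"
  define u where "u E i j = (\<Sum>k = 0..<m. cnj (E (k, i)) * E (k, j))" for E :: "nat \<times> nat \<Rightarrow> complex" and i j
  define K where "K = {E \<in> topspace P. \<forall>i<m. \<forall>j<m. u E i j = (if i = j then 1 else 0)}"
  have P: "compact_space P"
    unfolding P_def by (intro compact_space_product_topology[THEN iffD2] disjI2) (simp add: compact_space_subtopology)
  have cont: "continuous_map P euclidean (\<lambda>E. E ij)" if "ij \<in> I" for ij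
    using continuous_map_product_projection[OF that, of "\<lambda>_. top_of_set (cball (0::complex) 1)"]
    unfolding P_def by (rule continuous_map_into_fulltopology)
  have "closedin P {E \<in> topspace P. u E i j = (if i = j then 1 else 0)}" if "i < m" "j < m" for i j
    unfolding u_def using that
    by (intro closedin_continuous_maps_eq[of euclidean] continuous_map_sum continuous_map_complex_mult cont continuous_map_cnj)
      (auto simp: I_def)
  \<comment> \<open>The whole space is inserted so that the intersection also makes sense for m = 0,
    when there are no equations.\<close>
  then have "closedin P (\<Inter>(insert (topspace P) ((\<lambda>(i, j). {E \<in> topspace P. u E i j = (if i = j then 1 else 0)}) ` I)))"
    by (intro closedin_Inter) (auto simp: I_def)
  also have "\<Inter>(insert (topspace P) ((\<lambda>(i, j). {E \<in> topspace P. u E i j = (if i = j then 1 else 0)}) ` I)) = K"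
    by (auto simp: K_def I_def)
  finally have K: "compactin P K"
    by (rule closedin_compact_space[OF P])
  have KP: "compactin (subtopology P K) K"
    using K by (simp add: compactin_subtopology)
  define M where "M E = mat m m E" for E :: "nat \<times> nat \<Rightarrow> complex"
  have M: "mat_adjoint (M E) * M E = mat m m (\<lambda>(i, j). u E i j)" for E
    by (rule eq_matI) (auto simp: M_def u_def scalar_prod_def mat_adjoint_index)
  have MU: "M E \<in> unitary m" if "E \<in> K" for E
    using that by (intro unitaryI) (auto simp: M K_def intro!: eq_matI, auto simp: M_def)
  have "continuous_map (subtopology P K) (unitary_topology m) M"
    unfolding continuous_map_into_unitary
  proof (intro conjI allI impI)
    show "M \<in> topspace (subtopology P K) \<rightarrow> unitary m" using MU by auto
    fix i j assume "i < m" "j < m"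
    then show "continuous_map (subtopology P K) euclidean (\<lambda>x. M x $$ (i, j))"
      using continuous_map_from_subtopology[OF cont, of "(i, j)" K] by (simp add: M_def I_def)
  qed
  from image_compactin[OF KP this] have "compactin (unitary_topology m) (M ` K)" .
  moreover have "M ` K = unitary m"
  proof (intro equalityI subsetI)
    fix A assume A: "A \<in> unitary m"
    define E where "E = (\<lambda>ij \<in> I. A $$ ij)"
    have ME: "M E = A"
      using unitaryD(1)[OF A] by (intro eq_matI) (auto simp: M_def E_def I_def)
    have "mat m m (\<lambda>(i, j). u E i j) = 1\<^sub>m m"
      using unitaryD(3)[OF A] M[of E] ME by simp
    then have "u E i j = (if i = j then 1 else 0)" if "i < m" "j < m" for i j
      using that by (metis (no_types, lifting) index_mat(1) index_one_mat(1) case_prod_conv)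
    moreover have "E \<in> topspace P"
      using norm_unitary_entry_le_1[OF A] by (auto simp: P_def E_def I_def)
    ultimately show "A \<in> M ` K" using ME by (force simp: K_def)
  qed (use MU in auto)
  ultimately show ?thesis by (simp add: compact_space_def)
qed

section \<open>Heisenberg-type relations and homomorphisms\<close>

lemma (in group) commute_inv:
  assumes "x \<in> carrier G" "y \<in> carrier G" "x \<otimes> y = y \<otimes> x"
  shows "inv x \<otimes> y = y \<otimes> inv x"
proof -
  have "inv x \<otimes> y = inv x \<otimes> (y \<otimes> x) \<otimes> inv x" using assms(1,2) by (simp add: m_assoc)
  also have "\<dots> = y \<otimes> inv x" unfolding assms(3)[symmetric] using assms(1,2) by (simp add: m_assoc[symmetric])
  finally show ?thesis .
qed

lemma (in group) nat_pow_commute: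
  assumes "x \<in> carrier G" "y \<in> carrier G" "x \<otimes> y = y \<otimes> x"
  shows "x [^] (k::nat) \<otimes> y = y \<otimes> x [^] k"
proof (induction k)
  case (Suc k)
  have "x [^] Suc k \<otimes> y = x [^] k \<otimes> (x \<otimes> y)" using assms(1,2) by (simp add: m_assoc)
  also have "\<dots> = (x [^] k \<otimes> y) \<otimes> x" unfolding assms(3) using assms(1,2) by (simp add: m_assoc)
  also have "\<dots> = y \<otimes> x [^] Suc k" unfolding Suc using assms(1,2) by (simp add: m_assoc)
  finally show ?case .
qed (use assms in simp)

lemma (in group) int_pow_commute:
  assumes "x \<in> carrier G" "y \<in> carrier G" "x \<otimes> y = y \<otimes> x"
  shows "x [^] (i::int) \<otimes> y = y \<otimes> x [^] i"
proof (cases i rule: int_cases2)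
  case (nonneg k)
  then show ?thesis by (simp only: int_pow_int nat_pow_commute[OF assms])
next
  case (nonpos k)
  then show ?thesis
    using commute_inv[OF nat_pow_closed[OF assms(1)] assms(2) nat_pow_commute[OF assms]] assms(1)
    by (simp only: int_pow_neg_int)
qed

text \<open>Passing one b costs one factor z, which commutes with everything involved. A negative
  power is handled by solving the relation for the natural power for
  \<open>a \<otimes> inv B\<close>.\<close>

lemma (in group) twisted_commute_pow_right:
  assumes c: "a \<in> carrier G" "b \<in> carrier G" "z \<in> carrier G"
    and ab: "a \<otimes> b = z \<otimes> (b \<otimes> a)" and z: "z \<otimes> a = a \<otimes> z" "z \<otimes> b = b \<otimes> z"
  shows "a \<otimes> b [^] (j::int) = z [^] j \<otimes> (b [^] j \<otimes> a)"
proof -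
  have n: "a \<otimes> b [^] (k::nat) = z [^] k \<otimes> (b [^] k \<otimes> a)" for k
  proof (induction k)
    case (Suc k)
    have "a \<otimes> b [^] Suc k = (a \<otimes> b [^] k) \<otimes> b" using c by (simp add: m_assoc)
    also have "\<dots> = z [^] k \<otimes> (b [^] k \<otimes> (a \<otimes> b))" unfolding Suc using c by (simp add: m_assoc)
    also have "\<dots> = z [^] k \<otimes> ((b [^] k \<otimes> z) \<otimes> (b \<otimes> a))" unfolding ab using c by (simp add: m_assoc)
    also have "b [^] k \<otimes> z = z \<otimes> b [^] k"
      by (rule nat_pow_commute[OF c(2,3) z(2)[symmetric]])
    finally show ?case using c by (simp add: m_assoc)
  qed (use c in simp)
  show ?thesis
  proof (cases j rule: int_cases2)
    case (nonneg k)
    show ?thesis unfolding nonneg int_pow_int by (rule n)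
  next
    case (nonpos k)
    define B Z where "B = b [^] k" and "Z = z [^] k"
    have BZ: "B \<in> carrier G" "Z \<in> carrier G" using c by (auto simp: B_def Z_def)
    have e: "a \<otimes> B = Z \<otimes> (B \<otimes> a)" using n[of k] by (simp add: B_def Z_def)
    have "B \<otimes> z = z \<otimes> B" unfolding B_def by (rule nat_pow_commute[OF c(2,3) z(2)[symmetric]])
    from nat_pow_commute[OF c(3) BZ(1) this[symmetric]]
    have ZB: "Z \<otimes> B = B \<otimes> Z" unfolding Z_def .
    have "a = (a \<otimes> B) \<otimes> inv B" using BZ c by (simp add: m_assoc)
    also have "\<dots> = Z \<otimes> (B \<otimes> (a \<otimes> inv B))" unfolding e using BZ c by (simp add: m_assoc)
    finally have "inv B \<otimes> (inv Z \<otimes> a) = inv B \<otimes> (inv Z \<otimes> (Z \<otimes> (B \<otimes> (a \<otimes> inv B))))" by simp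
    then have "a \<otimes> inv B = inv B \<otimes> (inv Z \<otimes> a)"
      using BZ c by (simp add: m_assoc[symmetric])
    also have "\<dots> = inv (Z \<otimes> B) \<otimes> a" using BZ c by (simp add: inv_mult_group m_assoc)
    also have "\<dots> = inv Z \<otimes> (inv B \<otimes> a)" unfolding ZB using BZ c by (simp add: inv_mult_group m_assoc)
    finally show ?thesis
      unfolding nonpos int_pow_neg_int[OF c(2)] int_pow_neg_int[OF c(3)] B_def Z_def .
  qed
qed

text \<open>The exponent of a is treated by reading the previous relation backwards:
  \<open>B \<otimes> a = inv Z \<otimes> (a \<otimes> B)\<close> has the same shape with the roles
  exchanged.\<close>

lemma (in group) twisted_commute_pow:
  assumes c: "a \<in> carrier G" "b \<in> carrier G" "z \<in> carrier G"
    and ab: "a \<otimes> b = z \<otimes> (b \<otimes> a)" and z: "z \<otimes> a = a \<otimes> z" "z \<otimes> b = b \<otimes> z"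
  shows "a [^] (i::int) \<otimes> b [^] (j::int) = z [^] (i * j) \<otimes> (b [^] j \<otimes> a [^] i)"
proof -
  define B Z where "B = b [^] j" and "Z = z [^] j"
  have BZ: "B \<in> carrier G" "Z \<in> carrier G" using c by (auto simp: B_def Z_def)
  have aB: "a \<otimes> B = Z \<otimes> (B \<otimes> a)"
    unfolding B_def Z_def by (rule twisted_commute_pow_right[OF assms])
  have Za: "Z \<otimes> a = a \<otimes> Z" unfolding Z_def by (rule int_pow_commute[OF c(3,1) z(1)])
  have "z \<otimes> B = B \<otimes> z" unfolding B_def using int_pow_commute[OF c(2,3) z(2)[symmetric]] by simp
  then have ZB: "Z \<otimes> B = B \<otimes> Z" unfolding Z_def using int_pow_commute[OF c(3) BZ(1)] by simp
  have iZ: "inv Z \<otimes> y = y \<otimes> inv Z" if "Z \<otimes> y = y \<otimes> Z" "y \<in> carrier G" for y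
    using commute_inv[OF BZ(2) that(2,1)] .
  have "B \<otimes> a = inv Z \<otimes> (a \<otimes> B)"
    unfolding aB using BZ c by (simp add: m_assoc[symmetric])
  then have "B \<otimes> a [^] i = inv Z [^] i \<otimes> (a [^] i \<otimes> B)"
    by (intro twisted_commute_pow_right iZ Za ZB) (use BZ c in auto)
  moreover have "inv Z [^] i = inv (z [^] (i * j))"
    unfolding Z_def using c by (simp add: int_pow_pow int_pow_inv mult.commute)
  ultimately have "z [^] (i * j) \<otimes> (B \<otimes> a [^] i) = a [^] i \<otimes> B"
    using c BZ by (simp add: m_assoc[symmetric])
  then show ?thesis by (simp add: B_def)
qed

text \<open>\<open>x\<close> and \<open>a\<close> stand for the images of the generators in some group \<open>G\<close>.\<close>

definition heisenberg_rels ::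
  "('a, 'b) monoid_scheme \<Rightarrow> nat \<Rightarrow> nat \<Rightarrow> (nat \<Rightarrow> nat) \<Rightarrow> 'a \<Rightarrow> (nat \<Rightarrow> 'a) \<Rightarrow> bool" where
  "heisenberg_rels G n t c x a \<longleftrightarrow>
     x \<in> carrier G \<and> (\<forall>i\<in>{1..n}. a i \<in> carrier G) \<and>
     (\<forall>i\<in>{1..n}. x \<otimes>\<^bsub>G\<^esub> a i = a i \<otimes>\<^bsub>G\<^esub> x) \<and>
     (\<forall>i\<in>{1..t}. a i \<otimes>\<^bsub>G\<^esub> a (t + i) = x [^]\<^bsub>G\<^esub> c i \<otimes>\<^bsub>G\<^esub> (a (t + i) \<otimes>\<^bsub>G\<^esub> a i)) \<and>
     (\<forall>i\<in>{1..n}. \<forall>j\<in>{1..n}. \<not> (i \<in> {1..t} \<and> j = t + i) \<longrightarrow> \<not> (j \<in> {1..t} \<and> i = t + j) \<longrightarrow>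
        a i \<otimes>\<^bsub>G\<^esub> a j = a j \<otimes>\<^bsub>G\<^esub> a i)"

text \<open>The decreasing order of the factors makes the cocycle of this section equal to \<open>omega\<close>.\<close>

primrec normal_word :: "('a, 'b) monoid_scheme \<Rightarrow> (nat \<Rightarrow> 'a) \<Rightarrow> (nat \<Rightarrow> int) \<Rightarrow> nat \<Rightarrow> 'a" where
  "normal_word G a v 0 = \<one>\<^bsub>G\<^esub>"
| "normal_word G a v (Suc r) = a (Suc r) [^]\<^bsub>G\<^esub> v (Suc r) \<otimes>\<^bsub>G\<^esub> normal_word G a v r"

lemma (in group) normal_word_closed:
  "(\<And>i. i \<in> {1..r} \<Longrightarrow> a i \<in> carrier G) \<Longrightarrow> normal_word G a v r \<in> carrier G"
  by (induction r) auto

lemma (in group) x_pow_commutes_normal_word: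
  assumes "heisenberg_rels G n t c x a" "r \<le> n"
  shows "x [^] (i::int) \<otimes> normal_word G a v r = normal_word G a v r \<otimes> x [^] i"
  using assms(2)
proof (induction r)
  case (Suc r)
  have c: "x \<in> carrier G" "\<And>i. i \<in> {1..n} \<Longrightarrow> a i \<in> carrier G" "x \<otimes> a (Suc r) = a (Suc r) \<otimes> x"
    using assms(1) Suc.prems by (auto simp: heisenberg_rels_def)
  have W: "normal_word G a v r \<in> carrier G" "a (Suc r) \<in> carrier G"
    using Suc.prems c by (auto intro: normal_word_closed)
  have "a (Suc r) [^] v (Suc r) \<otimes> x = x \<otimes> a (Suc r) [^] v (Suc r)"
    by (rule int_pow_commute) (use c W in auto)
  then have "x [^] i \<otimes> a (Suc r) [^] v (Suc r) = a (Suc r) [^] v (Suc r) \<otimes> x [^] i"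
    by (intro int_pow_commute) (use c W in auto)
  then have "x [^] i \<otimes> normal_word G a v (Suc r) =
      a (Suc r) [^] v (Suc r) \<otimes> (x [^] i \<otimes> normal_word G a v r)"
    using c W by (simp add: m_assoc[symmetric])
  also have "\<dots> = normal_word G a v (Suc r) \<otimes> x [^] i"
    using Suc W c by (simp add: m_assoc)
  finally show ?case .
qed (use assms in \<open>auto simp: heisenberg_rels_def\<close>)

text \<open>Among the letters of index at most r only \<open>a i\<close> with q = t + i fails to
  commute with \<open>a q\<close>, so the sum has at most one nonzero term. It is kept as a sum
  because these terms add up to \<open>omega\<close> in the product of two words.\<close>

lemma (in group) normal_word_commute_generator:
  assumes R: "heisenberg_rels G n t c x a" and t: "2 * t \<le> n" and rq: "r < q" "q \<le> n"
  shows "normal_word G a v r \<otimes> a q [^] (u::int) =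
    x [^] (\<Sum>i = 1..t. if i \<le> r \<and> q = t + i then int (c i) * (v i * u) else 0) \<otimes> (a q [^] u \<otimes> normal_word G a v r)"
  using rq
proof (induction r)
  case 0
  then show ?case using R by (simp add: heisenberg_rels_def)
next
  case (Suc r)
  have xc: "x \<in> carrier G" and ac: "\<And>i. i \<in> {1..n} \<Longrightarrow> a i \<in> carrier G"
    and xa: "\<And>i. i \<in> {1..n} \<Longrightarrow> x \<otimes> a i = a i \<otimes> x"
    and pair: "\<And>i. i \<in> {1..t} \<Longrightarrow> a i \<otimes> a (t + i) = x [^] c i \<otimes> (a (t + i) \<otimes> a i)"
    and comm: "\<And>i j. i \<in> {1..n} \<Longrightarrow> j \<in> {1..n} \<Longrightarrow> \<not> (i \<in> {1..t} \<and> j = t + i) \<Longrightarrow> \<not> (j \<in> {1..t} \<and> i = t + j) \<Longrightarrow>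
        a i \<otimes> a j = a j \<otimes> a i"
    using R by (auto simp: heisenberg_rels_def)
  define S where "S r = (\<Sum>i = 1..t. if i \<le> r \<and> q = t + i then int (c i) * (v i * u) else 0)" for r
  \<comment> \<open>The exponent contributed by the single letter \<open>a (Suc r)\<close>; zero
    unless that letter is paired with \<open>a q\<close>.\<close>
  define e where "e = (if Suc r \<in> {1..t} \<and> q = t + Suc r then int (c (Suc r)) else 0)"
  let ?W = "normal_word G a v r" and ?b = "a (Suc r)" and ?w = "v (Suc r)"
  have W: "?W \<in> carrier G" "?b \<in> carrier G" "a q \<in> carrier G"
    using Suc.prems ac by (auto intro: normal_word_closed)
  have xp: "x [^] (i::int) \<otimes> y [^] (j::int) = y [^] j \<otimes> x [^] i" if "y \<in> {?b, a q}" for i j y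
  proof -
    have y: "y \<in> carrier G" "x \<otimes> y = y \<otimes> x" using that W xa Suc.prems by auto
    have "y [^] j \<otimes> x = x \<otimes> y [^] j" by (rule int_pow_commute) (use y xc in auto)
    then show ?thesis by (intro int_pow_commute) (use y xc in auto)
  qed
  have "?b \<otimes> a q = x [^] e \<otimes> (a q \<otimes> ?b)"
  proof (cases "Suc r \<in> {1..t} \<and> q = t + Suc r")
    case True
    then show ?thesis using pair[of "Suc r"] by (simp add: e_def int_pow_int)
  next
    case False
    then show ?thesis using comm[of "Suc r" q] Suc.prems W xc by (auto simp: e_def)
  qed
  then have "?b [^] ?w \<otimes> a q [^] u = (x [^] e) [^] (?w * u) \<otimes> (a q [^] u \<otimes> ?b [^] ?w)"
    by (intro twisted_commute_pow) (use W xc xp[of ?b e 1] xp[of "a q" e 1] in \<open>auto simp: int_pow_1\<close>)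
  then have ba: "?b [^] ?w \<otimes> a q [^] u = x [^] (e * (?w * u)) \<otimes> (a q [^] u \<otimes> ?b [^] ?w)"
    using xc by (simp add: int_pow_pow mult.commute)
  have IH: "?W \<otimes> a q [^] u = x [^] S r \<otimes> (a q [^] u \<otimes> ?W)"
    unfolding S_def using Suc by simp
  have S: "S (Suc r) = S r + e * (?w * u)"
  proof -
    have "S (Suc r) = (\<Sum>i = 1..t. (if i \<le> r \<and> q = t + i then int (c i) * (v i * u) else 0) +
        (if i = Suc r then e * (?w * u) else 0))"
      unfolding S_def by (intro sum.cong) (auto simp: e_def le_Suc_eq)
    also have "\<dots> = S r + (\<Sum>i = 1..t. if i = Suc r then e * (?w * u) else 0)"
      by (simp add: S_def sum.distrib)
    also have "(\<Sum>i = 1..t. if i = Suc r then e * (?w * u) else 0) = e * (?w * u)"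
      by (auto simp: e_def)
    finally show ?thesis .
  qed
  have "normal_word G a v (Suc r) \<otimes> a q [^] u = ?b [^] ?w \<otimes> (?W \<otimes> a q [^] u)"
    using W by (simp add: m_assoc)
  also have "\<dots> = (?b [^] ?w \<otimes> x [^] S r) \<otimes> (a q [^] u \<otimes> ?W)"
    unfolding IH using W xc by (simp add: m_assoc)
  also have "\<dots> = x [^] S r \<otimes> ((?b [^] ?w \<otimes> a q [^] u) \<otimes> ?W)"
    using W xc xp[of ?b "S r" ?w] by (simp add: m_assoc[symmetric])
  also have "\<dots> = x [^] S (Suc r) \<otimes> (a q [^] u \<otimes> normal_word G a v (Suc r))"
    unfolding ba S using W xc by (simp add: int_pow_mult m_assoc)
  finally show ?case unfolding S_def .
qed

text \<open>The first letter of the second word is pulled to the left through the tail of the first;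
  whenever a power of \<open>a (t + i)\<close> passes the power of \<open>a i\<close>, the factor
  x^(c_i v_i w_(t+i)) appears. For r = n the exponent is \<open>omega\<close>, the cocycle of the
  extension.\<close>

lemma (in group) normal_word_mult:
  assumes R: "heisenberg_rels G n t c x a" and t: "2 * t \<le> n" and r: "r \<le> n"
  shows "normal_word G a v r \<otimes> normal_word G a w r =
    x [^] (\<Sum>i = 1..t. if t + i \<le> r then int (c i) * (v i * w (t + i)) else 0) \<otimes> normal_word G a (\<lambda>i. v i + w i) r"
  using r
proof (induction r)
  case 0
  then show ?case using R by (simp add: heisenberg_rels_def)
next
  case (Suc r)
  have xc: "x \<in> carrier G" and ac: "\<And>i. i \<in> {1..n} \<Longrightarrow> a i \<in> carrier G"
    and xa: "\<And>i. i \<in> {1..n} \<Longrightarrow> x \<otimes> a i = a i \<otimes> x"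
    using R by (auto simp: heisenberg_rels_def)
  let ?V = "normal_word G a v r" and ?W = "normal_word G a w r" and ?b = "a (Suc r)"
  define S where "S r = (\<Sum>i = 1..t. if t + i \<le> r then int (c i) * (v i * w (t + i)) else 0)" for r
  define e where "e = (\<Sum>i = 1..t. if i \<le> r \<and> Suc r = t + i then int (c i) * (v i * w (Suc r)) else 0)"
  have W: "?V \<in> carrier G" "?W \<in> carrier G" "?b \<in> carrier G" "normal_word G a (\<lambda>i. v i + w i) r \<in> carrier G"
    using Suc.prems ac by (auto intro: normal_word_closed)
  have xb: "x [^] (i::int) \<otimes> ?b [^] (j::int) = ?b [^] j \<otimes> x [^] i" for i j
  proof -
    have "?b [^] j \<otimes> x = x \<otimes> ?b [^] j" by (rule int_pow_commute) (use W xc xa Suc.prems in auto)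
    then show ?thesis by (intro int_pow_commute) (use W xc in auto)
  qed
  have xbl: "?b [^] (j::int) \<otimes> (x [^] (i::int) \<otimes> y) = x [^] i \<otimes> (?b [^] j \<otimes> y)" if "y \<in> carrier G" for i j y
    using W xc that xb[of i j] by (simp add: m_assoc[symmetric])
  have S: "S (Suc r) = e + S r"
    unfolding S_def e_def sum.distrib[symmetric] by (intro sum.cong) (auto simp: le_Suc_eq)
  have "normal_word G a v (Suc r) \<otimes> normal_word G a w (Suc r) =
      ?b [^] v (Suc r) \<otimes> ((?V \<otimes> ?b [^] w (Suc r)) \<otimes> ?W)"
    using W by (simp add: m_assoc)
  also have "?V \<otimes> ?b [^] w (Suc r) = x [^] e \<otimes> (?b [^] w (Suc r) \<otimes> ?V)"
    unfolding e_def by (rule normal_word_commute_generator[OF R t]) (use Suc in auto)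
  also have "?b [^] v (Suc r) \<otimes> (x [^] e \<otimes> (?b [^] w (Suc r) \<otimes> ?V) \<otimes> ?W) =
      (?b [^] v (Suc r) \<otimes> x [^] e) \<otimes> (?b [^] w (Suc r) \<otimes> (?V \<otimes> ?W))"
    using W xc by (simp add: m_assoc)
  also have "?V \<otimes> ?W = x [^] S r \<otimes> normal_word G a (\<lambda>i. v i + w i) r"
    unfolding S_def using Suc by simp
  also have "(?b [^] v (Suc r) \<otimes> x [^] e) \<otimes> (?b [^] w (Suc r) \<otimes> (x [^] S r \<otimes> normal_word G a (\<lambda>i. v i + w i) r)) =
      x [^] e \<otimes> (x [^] S r \<otimes> (?b [^] v (Suc r) \<otimes> (?b [^] w (Suc r) \<otimes> normal_word G a (\<lambda>i. v i + w i) r)))"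
    using W xc by (simp add: m_assoc xbl)
  also have "\<dots> = x [^] S (Suc r) \<otimes> normal_word G a (\<lambda>i. v i + w i) (Suc r)"
    unfolding S using W xc by (simp add: int_pow_mult m_assoc)
  finally show ?case unfolding S_def .
qed

section \<open>Normal words in Z^n and under homomorphisms\<close>

lemma Zn_simps [simp]:
  "carrier (Zn n) = extensional {1..n}"
  "v \<otimes>\<^bsub>Zn n\<^esub> w = (\<lambda>i\<in>{1..n}. v i + w i)"
  "\<one>\<^bsub>Zn n\<^esub> = (\<lambda>i\<in>{1..n}. 0)"
  by (simp_all add: Zn_def PiE_def)

lemma normal_word_cong: "(\<And>i. i \<in> {1..r} \<Longrightarrow> v i = w i) \<Longrightarrow> normal_word G a v r = normal_word G a w r"
  by (induction r) auto

lemma normal_word_hom: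
  assumes "group_hom G H f" "\<And>i. i \<in> {1..r} \<Longrightarrow> a i \<in> carrier G"
  shows "f (normal_word G a v r) = normal_word H (\<lambda>i. f (a i)) v r"
proof -
  interpret group_hom G H f by fact
  show ?thesis using assms(2)
  proof (induction r)
    case (Suc r)
    then have "normal_word G a v r \<in> carrier G" "a (Suc r) \<in> carrier G"
      by (auto intro: G.normal_word_closed)
    then show ?case using Suc by (simp add: hom_int_pow)
  qed simp
qed

lemma (in group) normal_word_zero: "normal_word G a (\<lambda>i. 0) r = \<one>"
  by (induction r) auto

lemma (in group) normal_word_basis:
  assumes "\<And>i. i \<in> {1..r} \<Longrightarrow> a i \<in> carrier G"
  shows "normal_word G a (\<lambda>i. if i = j then 1 else 0) r = (if j \<in> {1..r} then a j else \<one>)"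
  using assms by (induction r) (auto simp: le_Suc_eq)

text \<open>At r = n the word returns its exponent vector, so the normal words of the extension are
  lifts of the elements of Z^n.\<close>

lemma normal_word_Zn:
  assumes "r \<le> n"
  shows "normal_word (Zn n) (Zn_basis n) v r = (\<lambda>i\<in>{1..n}. if i \<le> r then v i else 0)"
proof -
  interpret Z: group "Zn n" unfolding Zn_def by (rule product_group) auto
  have pow: "Zn_basis n j [^]\<^bsub>Zn n\<^esub> (z::int) = (\<lambda>i\<in>{1..n}. if i = j then z else 0)" if "j \<in> {1..n}" for j z
  proof -
    have b: "Zn_basis n j \<in> carrier (Zn n)" by (simp add: Zn_basis_def)
    have n: "Zn_basis n j [^]\<^bsub>Zn n\<^esub> (k::nat) = (\<lambda>i\<in>{1..n}. if i = j then int k else 0)" for k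
      by (induction k) (auto simp: Zn_basis_def fun_eq_iff)
    show ?thesis
    proof (cases z rule: int_cases2)
      case (nonneg k)
      show ?thesis unfolding nonneg int_pow_int n ..
    next
      case (nonpos k)
      have "inv\<^bsub>Zn n\<^esub> (\<lambda>i\<in>{1..n}. if i = j then int k else 0) = (\<lambda>i\<in>{1..n}. if i = j then - int k else 0)"
        by (rule Z.inv_equality) (auto simp: fun_eq_iff)
      then show ?thesis unfolding nonpos Z.int_pow_neg_int[OF b] n by (simp add: fun_eq_iff)
    qed
  qed
  show ?thesis using assms
  proof (induction r)
    case (Suc r)
    then have r: "Suc r \<in> {1..n}" by simp
    show ?case unfolding normal_word.simps Zn_simps pow[OF r] using Suc by (auto simp: fun_eq_iff le_Suc_eq)
  qed (simp add: fun_eq_iff)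
qed

section \<open>The extension as the group presented by the relations\<close>

locale heisenberg_extension =
  fixes \<Gamma> :: "('g, 'r) monoid_scheme" and \<iota> :: "int \<Rightarrow> 'g" and \<pi> :: "'g \<Rightarrow> nat \<Rightarrow> int"
    and x :: 'g and a :: "nat \<Rightarrow> 'g" and n t :: nat and c :: "nat \<Rightarrow> nat"
  assumes t2n: "2 * t \<le> n"
    and ext: "central_extension \<Gamma> (Zn n) \<iota> \<pi>"
    and kinv: "has_k_invariant \<Gamma> (Zn n) \<iota> \<pi> (omega t c)"
    and x_eq: "x = \<iota> 1"
    and lifts: "\<And>i. i \<in> {1..n} \<Longrightarrow> a i \<in> carrier \<Gamma> \<and> \<pi> (a i) = Zn_basis n i"
begin

sublocale E: group \<Gamma> using ext by (simp add: central_extension_def)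
sublocale Z: group "Zn n" using ext by (simp add: central_extension_def)
sublocale pi: group_hom \<Gamma> "Zn n" \<pi>
  using ext by unfold_locales (simp add: central_extension_def)

lemma iota: "\<iota> z \<in> carrier \<Gamma>" "\<iota> y \<otimes>\<^bsub>\<Gamma>\<^esub> \<iota> z = \<iota> (y + z)" "inj \<iota>" "kernel \<Gamma> (Zn n) \<pi> = range \<iota>"
  "g \<in> carrier \<Gamma> \<Longrightarrow> \<iota> z \<otimes>\<^bsub>\<Gamma>\<^esub> g = g \<otimes>\<^bsub>\<Gamma>\<^esub> \<iota> z"
  using ext by (auto simp: central_extension_def hom_def)

lemma iota_pow: "x [^]\<^bsub>\<Gamma>\<^esub> (z::int) = \<iota> z"
proof -
  have h: "group_hom integer_group \<Gamma> \<iota>"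
    using ext E.group_axioms by (simp add: central_extension_def group_hom_def group_hom_axioms_def)
  have "\<iota> (1 [^]\<^bsub>integer_group\<^esub> z) = \<iota> 1 [^]\<^bsub>\<Gamma>\<^esub> z"
    by (rule group_hom.hom_int_pow[OF h]) simp
  moreover have "(1::int) [^]\<^bsub>integer_group\<^esub> z = z"
  proof -
    have n: "(1::int) [^]\<^bsub>integer_group\<^esub> (k::nat) = int k" for k by (induction k) auto
    show ?thesis by (cases z rule: int_cases2)
        (simp_all only: int_pow_int group.int_pow_neg_int[OF group_integer_group] n carrier_integer_group UNIV_I inv_integer_group)
  qed
  ultimately show ?thesis by (simp add: x_eq)
qed

lemma x_closed: "x \<in> carrier \<Gamma>" using iota(1) x_eq by simp

text \<open>Exchange relations mention no inverses, which suits operators applied to vectors; the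
  commutator form is how the extension delivers them.\<close>

lemma rels_of_commutators:
  assumes "group G" "x' \<in> carrier G" "\<And>i. i \<in> {1..n} \<Longrightarrow> a' i \<in> carrier G"
    and "\<And>i. i \<in> {1..n} \<Longrightarrow> x' \<otimes>\<^bsub>G\<^esub> a' i = a' i \<otimes>\<^bsub>G\<^esub> x'"
    and "\<And>i. i \<in> {1..t} \<Longrightarrow> commutator G (a' i) (a' (t + i)) = x' [^]\<^bsub>G\<^esub> c i"
    and "\<And>i j. i \<in> {1..n} \<Longrightarrow> j \<in> {1..n} \<Longrightarrow> \<not> (i \<in> {1..t} \<and> j = t + i) \<Longrightarrow>
      \<not> (j \<in> {1..t} \<and> i = t + j) \<Longrightarrow> commutator G (a' i) (a' j) = \<one>\<^bsub>G\<^esub>"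
  shows "heisenberg_rels G n t c x' a'"
proof -
  interpret group G by fact
  have com: "u \<otimes>\<^bsub>G\<^esub> v = commutator G u v \<otimes>\<^bsub>G\<^esub> (v \<otimes>\<^bsub>G\<^esub> u)" if "u \<in> carrier G" "v \<in> carrier G" for u v
  proof -
    have "commutator G u v \<otimes>\<^bsub>G\<^esub> (v \<otimes>\<^bsub>G\<^esub> u) =
        u \<otimes>\<^bsub>G\<^esub> (v \<otimes>\<^bsub>G\<^esub> (inv\<^bsub>G\<^esub> u \<otimes>\<^bsub>G\<^esub> ((inv\<^bsub>G\<^esub> v \<otimes>\<^bsub>G\<^esub> v) \<otimes>\<^bsub>G\<^esub> u)))"
      using that unfolding commutator_def by (simp only: m_assoc m_closed inv_closed)
    then show ?thesis using that by simp
  qed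
  have 1: "a' i \<otimes>\<^bsub>G\<^esub> a' (t + i) = x' [^]\<^bsub>G\<^esub> c i \<otimes>\<^bsub>G\<^esub> (a' (t + i) \<otimes>\<^bsub>G\<^esub> a' i)" if "i \<in> {1..t}" for i
    using com[of "a' i" "a' (t + i)"] assms(3)[of i] assms(3)[of "t + i"] assms(5)[OF that] that t2n by simp
  have 2: "a' i \<otimes>\<^bsub>G\<^esub> a' j = a' j \<otimes>\<^bsub>G\<^esub> a' i"
    if "i \<in> {1..n}" "j \<in> {1..n}" "\<not> (i \<in> {1..t} \<and> j = t + i)" "\<not> (j \<in> {1..t} \<and> i = t + j)" for i j
    using com[of "a' i" "a' j"] assms(3)[OF that(1)] assms(3)[OF that(2)] assms(6)[OF that] by simp
  show ?thesis
    unfolding heisenberg_rels_def using 1 2 assms(2-4) by blast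
qed

lemma Gamma_rels: "heisenberg_rels \<Gamma> n t c x a"
proof (rule rels_of_commutators)
  note e = extension_relations[OF ext kinv t2n lifts]
  show "commutator \<Gamma> (a i) (a (t + i)) = x [^]\<^bsub>\<Gamma>\<^esub> c i" if "i \<in> {1..t}" for i
    using e(1)[OF _ that] x_eq by simp
  show "commutator \<Gamma> (a i) (a j) = \<one>\<^bsub>\<Gamma>\<^esub>"
    if "i \<in> {1..n}" "j \<in> {1..n}" "\<not> (i \<in> {1..t} \<and> j = t + i)" "\<not> (j \<in> {1..t} \<and> i = t + j)" for i j
    using e(2)[OF _ that] by simp
qed (use lifts x_closed x_eq iota(5) E.group_axioms in auto)

lemma rels_hom:
  assumes "group H" "f \<in> hom \<Gamma> H"
  shows "heisenberg_rels H n t c (f x) (\<lambda>i. f (a i))"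
proof -
  interpret group_hom \<Gamma> H f
    using assms E.group_axioms by (simp add: group_hom_def group_hom_axioms_def)
  note R = Gamma_rels[unfolded heisenberg_rels_def]
  have ac: "a i \<in> carrier \<Gamma>" if "i \<in> {1..n}" for i using lifts that by auto
  show ?thesis unfolding heisenberg_rels_def
  proof (intro conjI ballI impI)
    show "f x \<in> carrier H" using x_closed by simp
    show "f (a i) \<in> carrier H" if "i \<in> {1..n}" for i using ac[OF that] by simp
    show "f x \<otimes>\<^bsub>H\<^esub> f (a i) = f (a i) \<otimes>\<^bsub>H\<^esub> f x" if "i \<in> {1..n}" for i
    proof -
      have "x \<otimes>\<^bsub>\<Gamma>\<^esub> a i = a i \<otimes>\<^bsub>\<Gamma>\<^esub> x" using R that by blast
      then show ?thesis using ac[OF that] x_closed by (metis hom_mult)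
    qed
    show "f (a i) \<otimes>\<^bsub>H\<^esub> f (a (t + i)) = f x [^]\<^bsub>H\<^esub> c i \<otimes>\<^bsub>H\<^esub> (f (a (t + i)) \<otimes>\<^bsub>H\<^esub> f (a i))" if i: "i \<in> {1..t}" for i
    proof -
      have "a i \<in> carrier \<Gamma>" "a (t + i) \<in> carrier \<Gamma>" using i t2n by (auto intro!: ac)
      moreover have "a i \<otimes>\<^bsub>\<Gamma>\<^esub> a (t + i) = x [^]\<^bsub>\<Gamma>\<^esub> c i \<otimes>\<^bsub>\<Gamma>\<^esub> (a (t + i) \<otimes>\<^bsub>\<Gamma>\<^esub> a i)" using R i by blast
      ultimately show ?thesis using x_closed
        by (metis hom_mult hom_nat_pow E.m_closed E.nat_pow_closed)
    qed
    show "f (a i) \<otimes>\<^bsub>H\<^esub> f (a j) = f (a j) \<otimes>\<^bsub>H\<^esub> f (a i)"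
      if "i \<in> {1..n}" "j \<in> {1..n}" "\<not> (i \<in> {1..t} \<and> j = t + i)" "\<not> (j \<in> {1..t} \<and> i = t + j)" for i j
    proof -
      have "a i \<otimes>\<^bsub>\<Gamma>\<^esub> a j = a j \<otimes>\<^bsub>\<Gamma>\<^esub> a i" using R that by blast
      then show ?thesis using ac[OF that(1)] ac[OF that(2)] by (metis hom_mult)
    qed
  qed
qed

text \<open>The element and the word with exponents \<open>\<pi> g\<close> have the same projection,
  so they differ by an element of the kernel, which is the image of the injective
  \<open>\<iota>\<close>.\<close>

lemma normal_form:
  assumes g: "g \<in> carrier \<Gamma>"
  shows "\<exists>!z. g = \<iota> z \<otimes>\<^bsub>\<Gamma>\<^esub> normal_word \<Gamma> a (\<pi> g) n"
proof -
  let ?w = "normal_word \<Gamma> a (\<pi> g) n"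
  have ac: "a i \<in> carrier \<Gamma>" if "i \<in> {1..n}" for i using lifts that by auto
  have w: "?w \<in> carrier \<Gamma>" using ac by (rule E.normal_word_closed)
  have pg: "\<pi> g \<in> carrier (Zn n)" using g by (rule pi.hom_closed)
  have "\<pi> ?w = normal_word (Zn n) (\<lambda>i. \<pi> (a i)) (\<pi> g) n"
    by (rule normal_word_hom[OF pi.group_hom_axioms ac])
  also have "\<dots> = normal_word (Zn n) (Zn_basis n) (\<pi> g) n"
  proof -
    have "normal_word (Zn n) (\<lambda>i. \<pi> (a i)) v r = normal_word (Zn n) (Zn_basis n) v r" if "r \<le> n" for v r
      using that lifts by (induction r) auto
    then show ?thesis by simp
  qed
  also have "\<dots> = \<pi> g"
    using pg by (subst normal_word_Zn) (auto simp: fun_eq_iff extensional_def)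
  finally have "g \<otimes>\<^bsub>\<Gamma>\<^esub> inv\<^bsub>\<Gamma>\<^esub> ?w \<in> kernel \<Gamma> (Zn n) \<pi>"
    using g w pg by (simp add: kernel_def del: Zn_simps)
  then obtain z where "g \<otimes>\<^bsub>\<Gamma>\<^esub> inv\<^bsub>\<Gamma>\<^esub> ?w = \<iota> z" using iota(4) by auto
  then have "g = \<iota> z \<otimes>\<^bsub>\<Gamma>\<^esub> ?w" using g w iota(1) by (metis E.inv_solve_right)
  moreover have "z' = z''" if "g = \<iota> z' \<otimes>\<^bsub>\<Gamma>\<^esub> ?w" "g = \<iota> z'' \<otimes>\<^bsub>\<Gamma>\<^esub> ?w" for z' z''
  proof -
    have "\<iota> z' \<otimes>\<^bsub>\<Gamma>\<^esub> ?w = \<iota> z'' \<otimes>\<^bsub>\<Gamma>\<^esub> ?w" using that by simp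
    then have "\<iota> z' = \<iota> z''" using w iota(1) by simp
    then show ?thesis using iota(3) by (simp add: inj_eq)
  qed
  ultimately show ?thesis by blast
qed

definition center_part :: "'g \<Rightarrow> int" where
  "center_part g = (THE z. g = \<iota> z \<otimes>\<^bsub>\<Gamma>\<^esub> normal_word \<Gamma> a (\<pi> g) n)"

lemma center_part: "g \<in> carrier \<Gamma> \<Longrightarrow> g = \<iota> (center_part g) \<otimes>\<^bsub>\<Gamma>\<^esub> normal_word \<Gamma> a (\<pi> g) n"
  unfolding center_part_def by (rule theI'[OF normal_form])

lemma center_part_eqI:
  "g \<in> carrier \<Gamma> \<Longrightarrow> g = \<iota> z \<otimes>\<^bsub>\<Gamma>\<^esub> normal_word \<Gamma> a (\<pi> g) n \<Longrightarrow> center_part g = z"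
  using normal_form center_part by blast

text \<open>The homomorphism promised by the presentation, written on normal forms.\<close>

definition induced_hom :: "('h, 'k) monoid_scheme \<Rightarrow> 'h \<Rightarrow> (nat \<Rightarrow> 'h) \<Rightarrow> 'g \<Rightarrow> 'h" where
  "induced_hom H X A = (\<lambda>g\<in>carrier \<Gamma>. X [^]\<^bsub>H\<^esub> center_part g \<otimes>\<^bsub>H\<^esub> normal_word H A (\<pi> g) n)"

lemma normal_word_omega:
  assumes "group H" "heisenberg_rels H n t c X A"
  shows "normal_word H A v n \<otimes>\<^bsub>H\<^esub> normal_word H A w n =
    X [^]\<^bsub>H\<^esub> omega t c v w \<otimes>\<^bsub>H\<^esub> normal_word H A (\<lambda>i. v i + w i) n"
proof -
  interpret group H by fact
  have "(\<Sum>i = 1..t. if t + i \<le> n then int (c i) * (v i * w (t + i)) else 0) = omega t c v w"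
    unfolding omega_def using t2n by (intro sum.cong) auto
  then show ?thesis using normal_word_mult[OF assms(2) t2n, of n v w] by simp
qed

text \<open>The failure of additivity is the cocycle of the normal words: the central factors of g
  and h move to the front, and multiplying the two words adds \<open>omega\<close>.\<close>

lemma center_part_mult:
  assumes "g \<in> carrier \<Gamma>" "h \<in> carrier \<Gamma>"
  shows "center_part (g \<otimes>\<^bsub>\<Gamma>\<^esub> h) = center_part g + center_part h + omega t c (\<pi> g) (\<pi> h)"
proof (rule center_part_eqI)
  have ac: "a i \<in> carrier \<Gamma>" if "i \<in> {1..n}" for i using lifts that by auto
  let ?V = "normal_word \<Gamma> a (\<pi> g) n" and ?W = "normal_word \<Gamma> a (\<pi> h) n"
  have w: "normal_word \<Gamma> a v n \<in> carrier \<Gamma>" for v using ac by (rule E.normal_word_closed)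
  have "g \<otimes>\<^bsub>\<Gamma>\<^esub> h = (\<iota> (center_part g) \<otimes>\<^bsub>\<Gamma>\<^esub> ?V) \<otimes>\<^bsub>\<Gamma>\<^esub> (\<iota> (center_part h) \<otimes>\<^bsub>\<Gamma>\<^esub> ?W)"
    using assms center_part by simp
  also have "\<dots> = \<iota> (center_part g) \<otimes>\<^bsub>\<Gamma>\<^esub> ((?V \<otimes>\<^bsub>\<Gamma>\<^esub> \<iota> (center_part h)) \<otimes>\<^bsub>\<Gamma>\<^esub> ?W)"
    using w iota(1) by (simp add: E.m_assoc)
  also have "?V \<otimes>\<^bsub>\<Gamma>\<^esub> \<iota> (center_part h) = \<iota> (center_part h) \<otimes>\<^bsub>\<Gamma>\<^esub> ?V"
    using iota(5)[OF w] by simp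
  also have "\<iota> (center_part g) \<otimes>\<^bsub>\<Gamma>\<^esub> (\<iota> (center_part h) \<otimes>\<^bsub>\<Gamma>\<^esub> ?V \<otimes>\<^bsub>\<Gamma>\<^esub> ?W) =
      (\<iota> (center_part g) \<otimes>\<^bsub>\<Gamma>\<^esub> \<iota> (center_part h)) \<otimes>\<^bsub>\<Gamma>\<^esub> (?V \<otimes>\<^bsub>\<Gamma>\<^esub> ?W)"
    using w iota(1) by (simp add: E.m_assoc)
  also have "?V \<otimes>\<^bsub>\<Gamma>\<^esub> ?W = \<iota> (omega t c (\<pi> g) (\<pi> h)) \<otimes>\<^bsub>\<Gamma>\<^esub> normal_word \<Gamma> a (\<lambda>i. \<pi> g i + \<pi> h i) n"
    using normal_word_omega[OF E.group_axioms Gamma_rels] by (simp add: iota_pow)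
  also have "normal_word \<Gamma> a (\<lambda>i. \<pi> g i + \<pi> h i) n = normal_word \<Gamma> a (\<pi> (g \<otimes>\<^bsub>\<Gamma>\<^esub> h)) n"
    using assms by (intro normal_word_cong) (simp add: pi.hom_mult)
  finally show "g \<otimes>\<^bsub>\<Gamma>\<^esub> h = \<iota> (center_part g + center_part h + omega t c (\<pi> g) (\<pi> h)) \<otimes>\<^bsub>\<Gamma>\<^esub>
      normal_word \<Gamma> a (\<pi> (g \<otimes>\<^bsub>\<Gamma>\<^esub> h)) n"
    using w iota(1) by (simp add: iota(2) E.m_assoc[symmetric])
qed (use assms in simp)

text \<open>Words in \<Gamma> and words in H multiply with the same exponent \<open>omega\<close>,
  so the correction term of \<open>center_part_mult\<close> is exactly the power of X that
  multiplying two words in H produces.\<close>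

lemma induced_hom:
  assumes H: "group H" and R: "heisenberg_rels H n t c X A"
  shows "induced_hom H X A \<in> hom \<Gamma> H \<inter> extensional (carrier \<Gamma>)"
    and "induced_hom H X A x = X" and "\<And>i. i \<in> {1..n} \<Longrightarrow> induced_hom H X A (a i) = A i"
proof -
  interpret H: group H by fact
  have X: "X \<in> carrier H" and A: "\<And>i. i \<in> {1..n} \<Longrightarrow> A i \<in> carrier H"
    using R by (auto simp: heisenberg_rels_def)
  have w: "normal_word H A v n \<in> carrier H" for v using A by (rule H.normal_word_closed)
  have xw: "X [^]\<^bsub>H\<^esub> (z::int) \<otimes>\<^bsub>H\<^esub> normal_word H A v n = normal_word H A v n \<otimes>\<^bsub>H\<^esub> X [^]\<^bsub>H\<^esub> z" for z v
    by (rule H.x_pow_commutes_normal_word[OF R]) simp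
  have "induced_hom H X A \<in> hom \<Gamma> H"
  proof (rule homI)
    fix g h assume gh: "g \<in> carrier \<Gamma>" "h \<in> carrier \<Gamma>"
    let ?V = "normal_word H A (\<pi> g) n" and ?W = "normal_word H A (\<pi> h) n"
    let ?p = "\<lambda>z::int. X [^]\<^bsub>H\<^esub> z"
    have VW: "?V \<otimes>\<^bsub>H\<^esub> ?W = ?p (omega t c (\<pi> g) (\<pi> h)) \<otimes>\<^bsub>H\<^esub> normal_word H A (\<pi> (g \<otimes>\<^bsub>\<Gamma>\<^esub> h)) n"
      unfolding normal_word_omega[OF H R] using gh
      by (intro arg_cong2[where f = "monoid.mult H"] refl normal_word_cong) (simp add: pi.hom_mult)
    have "induced_hom H X A g \<otimes>\<^bsub>H\<^esub> induced_hom H X A h =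
        ?p (center_part g) \<otimes>\<^bsub>H\<^esub> ((?V \<otimes>\<^bsub>H\<^esub> ?p (center_part h)) \<otimes>\<^bsub>H\<^esub> ?W)"
      using gh w X by (simp add: induced_hom_def H.m_assoc)
    also have "\<dots> = (?p (center_part g) \<otimes>\<^bsub>H\<^esub> ?p (center_part h)) \<otimes>\<^bsub>H\<^esub> (?V \<otimes>\<^bsub>H\<^esub> ?W)"
      unfolding xw[symmetric] using w X by (simp add: H.m_assoc)
    also have "\<dots> = induced_hom H X A (g \<otimes>\<^bsub>\<Gamma>\<^esub> h)"
      unfolding VW using gh w X
      by (simp add: induced_hom_def center_part_mult H.int_pow_mult H.m_assoc)
    finally show "induced_hom H X A (g \<otimes>\<^bsub>\<Gamma>\<^esub> h) = induced_hom H X A g \<otimes>\<^bsub>H\<^esub> induced_hom H X A h" by simp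
  qed (use w X in \<open>simp add: induced_hom_def\<close>)
  then show "induced_hom H X A \<in> hom \<Gamma> H \<inter> extensional (carrier \<Gamma>)"
    by (simp add: induced_hom_def)
  have ac: "a i \<in> carrier \<Gamma>" if "i \<in> {1..n}" for i using lifts that by auto
  have "x \<in> kernel \<Gamma> (Zn n) \<pi>" using iota(4) x_eq by simp
  then have px: "\<pi> x = (\<lambda>i\<in>{1..n}. 0)" by (simp add: kernel_def)
  have z: "normal_word G b (\<lambda>i\<in>{1..n}. 0) n = \<one>\<^bsub>G\<^esub>" if "group G" for G :: "('c, 'd) monoid_scheme" and b
    using normal_word_cong[of n "\<lambda>i\<in>{1..n}. 0" "\<lambda>i. 0" G b] group.normal_word_zero[OF that, of b n] by simp
  have "center_part x = 1"
    using x_closed px z[OF E.group_axioms, of a] by (intro center_part_eqI) (auto simp: x_eq)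
  then show "induced_hom H X A x = X"
    using x_closed px z[OF H, of A] X by (simp add: induced_hom_def)
  fix i assume i: "i \<in> {1..n}"
  have b: "normal_word G b (Zn_basis n i) n = b i" if "group G" "\<And>i. i \<in> {1..n} \<Longrightarrow> b i \<in> carrier G"
    for G :: "('c, 'd) monoid_scheme" and b
    using normal_word_cong[of n "Zn_basis n i" "\<lambda>k. if k = i then 1 else 0" G b]
      group.normal_word_basis[OF that(1), of n b i] that(2) i by (simp add: Zn_basis_def)
  have "\<iota> 0 = \<one>\<^bsub>\<Gamma>\<^esub>" using iota_pow[of 0] by simp
  then have "center_part (a i) = 0"
    using i lifts[OF i] b[OF E.group_axioms ac] by (intro center_part_eqI) auto
  then show "induced_hom H X A (a i) = A i"
    using i lifts[OF i] b[OF H A] A[OF i] by (simp add: induced_hom_def)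
qed

text \<open>By the normal form every element is a product of powers of x and the a_i, so the values
  there determine a homomorphism on the group; extensionality settles the arguments outside.\<close>

lemma hom_eqI:
  assumes H: "group H"
    and f: "f \<in> hom \<Gamma> H \<inter> extensional (carrier \<Gamma>)" and f': "f' \<in> hom \<Gamma> H \<inter> extensional (carrier \<Gamma>)"
    and eq: "f x = f' x" "\<And>i. i \<in> {1..n} \<Longrightarrow> f (a i) = f' (a i)"
  shows "f = f'"
proof (rule extensionalityI[of _ "carrier \<Gamma>"])
  have ac: "a i \<in> carrier \<Gamma>" if "i \<in> {1..n}" for i using lifts that by auto
  have w: "normal_word \<Gamma> a v n \<in> carrier \<Gamma>" for v using ac by (rule E.normal_word_closed)
  fix g assume g: "g \<in> carrier \<Gamma>"
  have val: "F g = F x [^]\<^bsub>H\<^esub> center_part g \<otimes>\<^bsub>H\<^esub> normal_word H (\<lambda>i. F (a i)) (\<pi> g) n" if "F \<in> hom \<Gamma> H" for F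
  proof -
    interpret F: group_hom \<Gamma> H F
      using that H E.group_axioms by (simp add: group_hom_def group_hom_axioms_def)
    have "F g = F (\<iota> (center_part g) \<otimes>\<^bsub>\<Gamma>\<^esub> normal_word \<Gamma> a (\<pi> g) n)"
      using center_part[OF g] by simp
    also have "\<dots> = F (x [^]\<^bsub>\<Gamma>\<^esub> center_part g) \<otimes>\<^bsub>H\<^esub> F (normal_word \<Gamma> a (\<pi> g) n)"
      using w iota(1) by (simp add: iota_pow)
    also have "\<dots> = F x [^]\<^bsub>H\<^esub> center_part g \<otimes>\<^bsub>H\<^esub> normal_word H (\<lambda>i. F (a i)) (\<pi> g) n"
      using normal_word_hom[OF F.group_hom_axioms ac] by (simp add: F.hom_int_pow x_closed)
    finally show ?thesis .
  qed
  have "normal_word H (\<lambda>i. f (a i)) v r = normal_word H (\<lambda>i. f' (a i)) v r" if "r \<le> n" for v r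
    using that eq(2) by (induction r) auto
  then show "f g = f' g" using val[of f] val[of f'] f f' eq(1) by simp
qed (use f f' in auto)

end

section \<open>Unitary operators and orthonormal families\<close>

lemma cscalar_prod_sum:
  fixes v w :: "complex vec"
  assumes "v \<in> carrier_vec m" "w \<in> carrier_vec m"
  shows "v \<bullet>c w = (\<Sum>i<m. v $ i * cnj (w $ i))"
  using assms by (simp add: scalar_prod_def lessThan_atLeast0)

lemma mult_mat_vec_sum:
  assumes "A \<in> carrier_mat m m" "v \<in> carrier_vec m" "i < m"
  shows "(A *\<^sub>v v) $ i = (\<Sum>k<m. A $$ (i, k) * v $ k)"
  using assms by (simp add: scalar_prod_def lessThan_atLeast0)

lemma cscalar_prod_adjoint:
  fixes A :: "complex mat"
  assumes "A \<in> carrier_mat m m" "v \<in> carrier_vec m" "w \<in> carrier_vec m"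
  shows "(A *\<^sub>v v) \<bullet>c w = v \<bullet>c (mat_adjoint A *\<^sub>v w)"
proof -
  have a: "mat_adjoint A \<in> carrier_mat m m" using assms(1) by auto
  have "(A *\<^sub>v v) \<bullet>c w = (\<Sum>i<m. (\<Sum>k<m. A $$ (i, k) * v $ k) * cnj (w $ i))"
    using assms by (subst cscalar_prod_sum[of _ m]) (auto simp: mult_mat_vec_sum simp del: index_mult_mat_vec)
  also have "\<dots> = (\<Sum>k<m. \<Sum>i<m. A $$ (i, k) * v $ k * cnj (w $ i))"
    unfolding sum_distrib_right by (rule sum.swap)
  also have "\<dots> = (\<Sum>k<m. v $ k * cnj (\<Sum>i<m. mat_adjoint A $$ (k, i) * w $ i))"
    using assms(1) by (intro sum.cong refl) (simp add: sum_distrib_left mat_adjoint_index mult_ac)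
  also have "\<dots> = v \<bullet>c (mat_adjoint A *\<^sub>v w)"
    using assms a by (subst cscalar_prod_sum[of _ m]) (auto simp: mult_mat_vec_sum simp del: index_mult_mat_vec)
  finally show ?thesis .
qed

lemma unitary_cscalar_prod:
  assumes A: "A \<in> unitary m" and vw: "v \<in> carrier_vec m" "w \<in> carrier_vec m"
  shows "(A *\<^sub>v v) \<bullet>c (A *\<^sub>v w) = v \<bullet>c w"
proof -
  have "mat_adjoint A *\<^sub>v (A *\<^sub>v w) = w"
    using unitaryD[OF A] vw by (simp flip: assoc_mult_mat_vec)
  then show ?thesis
    using cscalar_prod_adjoint[OF unitaryD(1)[OF A] vw(1), of "A *\<^sub>v w"] unitaryD(1)[OF A] vw by simp
qed

lemma cscalar_prod_smult:
  fixes v w :: "complex vec"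
  assumes "v \<in> carrier_vec m" "w \<in> carrier_vec m"
  shows "(a \<cdot>\<^sub>v v) \<bullet>c w = a * (v \<bullet>c w)" "v \<bullet>c (a \<cdot>\<^sub>v w) = cnj a * (v \<bullet>c w)"
  using assms by (simp_all add: cscalar_prod_sum[of _ m] sum_distrib_left mult_ac)

lemma cscalar_prod_add_left:
  fixes u v w :: "complex vec"
  assumes "u \<in> carrier_vec m" "v \<in> carrier_vec m" "w \<in> carrier_vec m"
  shows "(u + v) \<bullet>c w = u \<bullet>c w + v \<bullet>c w"
  using assms by (simp add: cscalar_prod_sum[of _ m] sum.distrib algebra_simps)

lemma cscalar_prod_eq_0_commute:
  fixes v w :: "complex vec"
  assumes "v \<in> carrier_vec m" "w \<in> carrier_vec m"
  shows "v \<bullet>c w = 0 \<longleftrightarrow> w \<bullet>c v = 0"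
proof -
  have "v \<bullet>c w = cnj (w \<bullet>c v)" using assms by (simp add: cscalar_prod_sum[of _ m] mult_ac)
  then show ?thesis by simp
qed

lemma unitary_eigenvalue_norm:
  assumes "A \<in> unitary m" "v \<in> carrier_vec m" "v \<noteq> 0\<^sub>v m" "A *\<^sub>v v = c \<cdot>\<^sub>v v"
  shows "norm c = 1"
proof -
  have "c * cnj c * (v \<bullet>c v) = v \<bullet>c v"
    using unitary_cscalar_prod[OF assms(1,2,2)] assms(2) unfolding assms(4)
    by (simp add: cscalar_prod_smult[of _ m] mult_ac)
  moreover have "v \<bullet>c v \<noteq> 0" using conjugate_square_eq_0_vec[OF assms(2)] assms(3) by simp
  ultimately have "c * cnj c = 1" by simp
  then have "complex_of_real ((norm c)\<^sup>2) = 1" by (simp only: complex_norm_square)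
  then have "(norm c)\<^sup>2 = 1" by (simp only: of_real_eq_1_iff)
  then show ?thesis using norm_ge_zero[of c] by (auto simp: power2_eq_1_iff)
qed

text \<open>Unitarity multiplies the scalar product by c times the conjugate of d. As d has modulus
  one, its conjugate is its inverse, so this factor is 1 only for c = d.\<close>

lemma unitary_eigenvectors_orthogonal:
  assumes A: "A \<in> unitary m" and vw: "v \<in> carrier_vec m" "w \<in> carrier_vec m"
    and eig: "A *\<^sub>v v = c \<cdot>\<^sub>v v" "A *\<^sub>v w = d \<cdot>\<^sub>v w" and cd: "c \<noteq> d" "norm d = 1"
  shows "v \<bullet>c w = 0"
proof -
  have "c * cnj d * (v \<bullet>c w) = v \<bullet>c w"
    using unitary_cscalar_prod[OF A vw] vw unfolding eig by (simp add: cscalar_prod_smult[of _ m] mult_ac)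
  moreover have "c * cnj d \<noteq> 1"
  proof
    assume "c * cnj d = 1"
    moreover have "d * cnj d = 1" using complex_norm_square[of d] cd(2) by simp
    ultimately show False using cd(1) by (metis mult_cancel_right mult_zero_right zero_neq_one)
  qed
  ultimately show ?thesis by simp
qed

section \<open>Subspaces, annihilating polynomials and eigenvectors\<close>

definition lin_subspace :: "nat \<Rightarrow> complex vec set \<Rightarrow> bool" where
  "lin_subspace m W \<longleftrightarrow> W \<subseteq> carrier_vec m \<and> 0\<^sub>v m \<in> W \<and>
     (\<forall>v\<in>W. \<forall>w\<in>W. v + w \<in> W) \<and> (\<forall>a. \<forall>v\<in>W. a \<cdot>\<^sub>v v \<in> W)"

lemma lin_subspaceD:
  assumes "lin_subspace m W"
  shows "v \<in> W \<Longrightarrow> v \<in> carrier_vec m" "0\<^sub>v m \<in> W"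
    "v \<in> W \<Longrightarrow> w \<in> W \<Longrightarrow> v + w \<in> W" "v \<in> W \<Longrightarrow> a \<cdot>\<^sub>v v \<in> W"
  using assms by (auto simp: lin_subspace_def)

text \<open>Non-square systems are padded with a zero row to square ones; the vanishing determinant
  then yields the nonzero kernel vector, or the contradiction, in the lemmas below.\<close>

lemma det_zero_row:
  fixes M :: "complex mat"
  assumes "M \<in> carrier_mat r r" "k < r" "\<And>j. j < r \<Longrightarrow> M $$ (k, j) = 0"
  shows "det M = 0"
proof -
  have "transpose_mat M *\<^sub>v unit_vec r k = 0\<^sub>v r"
    using assms by (intro eq_vecI) (auto simp: scalar_prod_def unit_vec_def if_distrib cong: if_cong)
  then have "det (transpose_mat M) = 0"
    using assms by (subst det_0_iff_vec_prod_zero[of _ r]) (auto intro!: exI[of _ "unit_vec r k"])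
  then show ?thesis using det_transpose[OF assms(1)] by simp
qed

context
  fixes m :: nat and T :: "complex mat" and w :: "complex vec"
  assumes T: "T \<in> carrier_mat m m" and w: "w \<in> carrier_vec m"
begin

text \<open>This is q(T) w by Horner's rule. Only vectors are formed, so the value stays in every
  T-invariant subspace containing w.\<close>

definition poly_op :: "complex poly \<Rightarrow> complex vec" where
  "poly_op q = fold_coeffs (\<lambda>a u. a \<cdot>\<^sub>v w + T *\<^sub>v u) q (0\<^sub>v m)"

lemma poly_op_0: "poly_op 0 = 0\<^sub>v m"
  by (simp add: poly_op_def)

lemma poly_op_pCons: "poly_op (pCons a q) = a \<cdot>\<^sub>v w + T *\<^sub>v poly_op q"
proof (cases "a = 0 \<and> q = 0")
  case True
  then show ?thesis using T w by (auto simp: poly_op_def intro!: eq_vecI)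
qed (auto simp: poly_op_def)

lemma poly_op_closed: "poly_op q \<in> carrier_vec m"
  by (induction q) (use T w in \<open>auto simp: poly_op_0 poly_op_pCons\<close>)

lemma poly_op_in_subspace:
  assumes "lin_subspace m W" "w \<in> W" "\<And>v. v \<in> W \<Longrightarrow> T *\<^sub>v v \<in> W"
  shows "poly_op q \<in> W"
  by (induction q) (use assms lin_subspaceD[OF assms(1)] in \<open>auto simp: poly_op_0 poly_op_pCons\<close>)

lemma poly_op_root_factor: "poly_op ([:- a, 1:] * q) = T *\<^sub>v poly_op q + (- a) \<cdot>\<^sub>v poly_op q"
proof -
  have add: "poly_op (p + q) = poly_op p + poly_op q" for p q
  proof (induction p q rule: poly_induct2)
    case (pCons a p b q)
    then show ?case using T w poly_op_closed[of p] poly_op_closed[of q]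
      by (intro eq_vecI) (auto simp: poly_op_pCons mult_add_distrib_mat_vec[of _ m m] algebra_simps simp del: index_mult_mat_vec)
  qed (simp add: poly_op_0)
  have smult: "poly_op (smult c p) = c \<cdot>\<^sub>v poly_op p" for c p
  proof (induction p)
    case (pCons a p)
    then show ?case using T w poly_op_closed[of p]
      by (intro eq_vecI) (auto simp: poly_op_pCons mult_mat_vec[of _ m m] algebra_simps simp del: index_mult_mat_vec)
  qed (auto simp: poly_op_0 intro!: eq_vecI)
  have "[:- a, 1:] * q = pCons 0 q + smult (- a) q" by simp
  then show ?thesis
    using T w poly_op_closed[of q] by (simp only: add smult poly_op_pCons) (auto intro!: eq_vecI simp del: index_mult_mat_vec)
qed

lemma poly_op_Poly:
  assumes "i < m"
  shows "poly_op (Poly us) $ i = (\<Sum>j<length us. us ! j * (((*\<^sub>v) T ^^ j) w) $ i)"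
  using assms
proof (induction us arbitrary: i)
  case (Cons u us)
  have c: "((*\<^sub>v) T ^^ j) w \<in> carrier_vec m" for j by (induction j) (use T w in auto)
  have "(T *\<^sub>v poly_op (Poly us)) $ i = (\<Sum>k<m. T $$ (i, k) * (\<Sum>j<length us. us ! j * (((*\<^sub>v) T ^^ j) w) $ k))"
    using T poly_op_closed Cons by (subst mult_mat_vec_sum[of _ m]) (auto intro!: sum.cong)
  also have "\<dots> = (\<Sum>j<length us. us ! j * (\<Sum>k<m. T $$ (i, k) * (((*\<^sub>v) T ^^ j) w) $ k))"
    unfolding sum_distrib_left by (subst sum.swap) (simp add: mult_ac)
  also have "\<dots> = (\<Sum>j<length us. us ! j * (((*\<^sub>v) T ^^ Suc j) w) $ i)"
    using T c Cons.prems by (simp add: mult_mat_vec_sum[of _ m] del: index_mult_mat_vec)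
  finally have "(T *\<^sub>v poly_op (Poly us)) $ i = (\<Sum>j<length us. us ! j * (((*\<^sub>v) T ^^ Suc j) w) $ i)" .
  then show ?case
    using Cons.prems T w poly_op_closed[of "Poly us"]
    by (simp add: poly_op_pCons sum.lessThan_Suc_shift del: funpow.simps sum.lessThan_Suc index_mult_mat_vec)
qed (simp add: poly_op_0)

text \<open>The m + 1 vectors w, T w, ..., T^m w are linearly dependent in dimension m, and a
  dependence is a polynomial killing w.\<close>

lemma poly_op_annihilator: "\<exists>q. q \<noteq> 0 \<and> poly_op q = 0\<^sub>v m"
proof -
  \<comment> \<open>The columns are the vectors T^j w; row m is the zero row that makes the matrix
    square.\<close>
  define M where "M = mat (Suc m) (Suc m) (\<lambda>(i, j). if i < m then (((*\<^sub>v) T ^^ j) w) $ i else 0)"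
  have M: "M \<in> carrier_mat (Suc m) (Suc m)" by (simp add: M_def)
  have "det M = 0" by (rule det_zero_row[OF M, of m]) (auto simp: M_def)
  then obtain u where u: "u \<in> carrier_vec (Suc m)" "u \<noteq> 0\<^sub>v (Suc m)" "M *\<^sub>v u = 0\<^sub>v (Suc m)"
    using det_0_iff_vec_prod_zero[OF M] by auto
  define q where "q = Poly (list_of_vec u)"
  have "poly_op q = 0\<^sub>v m"
  proof (rule eq_vecI)
    fix i assume i: "i < dim_vec (0\<^sub>v m :: complex vec)"
    have "poly_op q $ i = (\<Sum>j<Suc m. M $$ (i, j) * u $ j)"
      using i u(1) by (simp add: q_def poly_op_Poly M_def list_of_vec_index mult.commute carrier_vecD del: sum.lessThan_Suc)
    also have "\<dots> = (M *\<^sub>v u) $ i" using i M u(1) by (subst mult_mat_vec_sum[OF M]) auto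
    finally show "poly_op q $ i = 0\<^sub>v m $ i" using u(3) i by simp
  qed (use poly_op_closed in auto)
  moreover have "q \<noteq> 0"
  proof
    assume "q = 0"
    then have "u $ i = 0" if "i < Suc m" for i
      using that u(1) unfolding q_def
      by (metis coeff_0 coeff_Poly_eq nth_default_nth length_list_of_vec list_of_vec_index carrier_vecD)
    then show False using u by (auto intro!: eq_vecI)
  qed
  ultimately show ?thesis by blast
qed

end

text \<open>Split a root off an annihilating polynomial, q = (X - a) r. Either r(T) w = 0 and the
  degree drops, or r(T) w is an eigenvector for a, which lies in W because W is invariant. The
  argument chooses no basis of W.\<close>

lemma eigenvector_in_subspace:
  assumes T: "T \<in> carrier_mat m m" and W: "lin_subspace m W" and inv: "\<And>v. v \<in> W \<Longrightarrow> T *\<^sub>v v \<in> W"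
    and w: "w \<in> W" "w \<noteq> 0\<^sub>v m"
  shows "\<exists>v\<in>W. v \<noteq> 0\<^sub>v m \<and> (\<exists>c. T *\<^sub>v v = c \<cdot>\<^sub>v v)"
proof -
  note wc = lin_subspaceD(1)[OF W w(1)]
  obtain q where "q \<noteq> 0" "poly_op m T w q = 0\<^sub>v m"
    using poly_op_annihilator[OF T wc] by blast
  then show ?thesis
  proof (induction "degree q" arbitrary: q rule: less_induct)
    case less
    show ?case
    proof (cases "degree q = 0")
      case True
      then obtain c where q: "q = [:c:]" by (metis degree_eq_zeroE)
      then have "c \<cdot>\<^sub>v w = 0\<^sub>v m" "c \<noteq> 0"
      proof -
        have "T *\<^sub>v 0\<^sub>v m = 0\<^sub>v m" using T by (intro eq_vecI) auto
        then show "c \<cdot>\<^sub>v w = 0\<^sub>v m" "c \<noteq> 0"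
          using less.prems wc by (auto simp: q poly_op_pCons[OF T wc] poly_op_0[OF T wc])
      qed
      then have "(c \<cdot>\<^sub>v w) $ i = 0" if "i < m" for i using that by simp
      then have "w = 0\<^sub>v m" using wc \<open>c \<noteq> 0\<close> by (intro eq_vecI) auto
      then show ?thesis using w by simp
    next
      case False
      then obtain a where "poly q a = 0"
        using alg_closed_imp_poly_has_root[of q] by auto
      then obtain r where r: "q = [:- a, 1:] * r" by (metis poly_eq_0_iff_dvd dvdE)
      have r0: "r \<noteq> 0" using less.prems(1) r by auto
      then have deg: "degree r < degree q" unfolding r by (subst degree_mult_eq) auto
      show ?thesis
      proof (cases "poly_op m T w r = 0\<^sub>v m")
        case True
        then show ?thesis using less.hyps[OF deg r0] by blast
      next
        case False
        let ?v = "poly_op m T w r"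
        have v: "?v \<in> W" by (rule poly_op_in_subspace[OF T wc W w(1) inv])
        have vc: "?v \<in> carrier_vec m" "T *\<^sub>v ?v \<in> carrier_vec m" using lin_subspaceD(1)[OF W] v inv by auto
        have "T *\<^sub>v ?v + (- a) \<cdot>\<^sub>v ?v = 0\<^sub>v m"
          using less.prems(2) unfolding r poly_op_root_factor[OF T wc] .
        then have "(T *\<^sub>v ?v + (- a) \<cdot>\<^sub>v ?v) $ i = 0" if "i < m" for i
          using that by (metis index_zero_vec(1))
        then have "T *\<^sub>v ?v = a \<cdot>\<^sub>v ?v"
          using vc T by (intro eq_vecI) (auto simp del: index_mult_mat_vec)
        then show ?thesis using v False by blast
      qed
    qed
  qed
qed

text \<open>An eigenspace of one operator inside W is invariant under the operators commuting with
  it, so W is cut down one operator at a time. Commutation is asked on W only: in the application it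
  holds on one eigenspace of X.\<close>

lemma joint_eigenvector:
  assumes "finite I" "lin_subspace m W" "w \<in> W" "w \<noteq> 0\<^sub>v m"
    and "\<And>i. i \<in> I \<Longrightarrow> T i \<in> carrier_mat m m"
    and "\<And>i v. i \<in> I \<Longrightarrow> v \<in> W \<Longrightarrow> T i *\<^sub>v v \<in> W"
    and "\<And>i j v. i \<in> I \<Longrightarrow> j \<in> I \<Longrightarrow> v \<in> W \<Longrightarrow> T i *\<^sub>v (T j *\<^sub>v v) = T j *\<^sub>v (T i *\<^sub>v v)"
  shows "\<exists>v\<in>W. v \<noteq> 0\<^sub>v m \<and> (\<forall>i\<in>I. \<exists>c. T i *\<^sub>v v = c \<cdot>\<^sub>v v)"
  using assms
proof (induction I arbitrary: W w rule: finite_induct)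
  case (insert k I)
  note W = lin_subspaceD[OF insert.prems(1)]
  have "\<exists>v\<in>W. v \<noteq> 0\<^sub>v m \<and> (\<exists>c. T k *\<^sub>v v = c \<cdot>\<^sub>v v)"
    using insert.prems by (intro eigenvector_in_subspace[of _ m W w]) auto
  then obtain v where v': "v \<in> W" "v \<noteq> 0\<^sub>v m" "\<exists>c. T k *\<^sub>v v = c \<cdot>\<^sub>v v" by (elim bexE conjE)
  from v'(3) obtain c where "T k *\<^sub>v v = c \<cdot>\<^sub>v v" by (elim exE)
  note v = v'(1,2) this
  define W' where "W' = {u \<in> W. T k *\<^sub>v u = c \<cdot>\<^sub>v u}"
  have Tk: "T k \<in> carrier_mat m m" using insert.prems by auto
  have "lin_subspace m W'"
    unfolding lin_subspace_def W'_def using W Tk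
    by (auto simp: mult_add_distrib_mat_vec[of _ m m] mult_mat_vec[of _ m m] smult_add_distrib_vec[of _ m]
        smult_smult_assoc mult.commute intro!: eq_vecI[of "T k *\<^sub>v 0\<^sub>v m"])
  moreover have "T i *\<^sub>v u \<in> W'" if "i \<in> I" "u \<in> W'" for i u
  proof -
    have u: "u \<in> W" "T k *\<^sub>v u = c \<cdot>\<^sub>v u" using that by (auto simp: W'_def)
    have "T k *\<^sub>v (T i *\<^sub>v u) = T i *\<^sub>v (T k *\<^sub>v u)" using insert.prems(6) that(1) u(1) by auto
    also have "\<dots> = c \<cdot>\<^sub>v (T i *\<^sub>v u)" unfolding u(2)
      using insert.prems(4)[of i] that(1) W(1)[OF u(1)] by (simp add: mult_mat_vec[of _ m m])
    finally show ?thesis using insert.prems(5)[of i u] that(1) u(1) by (simp add: W'_def)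
  qed
  moreover have "v \<in> W'" using v by (simp add: W'_def)
  ultimately obtain v' where "v' \<in> W'" "v' \<noteq> 0\<^sub>v m" "\<forall>i\<in>I. \<exists>c. T i *\<^sub>v v' = c \<cdot>\<^sub>v v'"
    using insert.IH[of W' v] v(2) insert.prems(4,6) by (auto simp: W'_def)
  then show ?case by (auto simp: W'_def)
qed auto

section \<open>Orthonormal families and the matrices built from them\<close>

definition orthonormal :: "nat \<Rightarrow> 'i set \<Rightarrow> ('i \<Rightarrow> complex vec) \<Rightarrow> bool" where
  "orthonormal m I V \<longleftrightarrow> (\<forall>i\<in>I. V i \<in> carrier_vec m) \<and> (\<forall>i\<in>I. \<forall>j\<in>I. V i \<bullet>c V j = (if i = j then 1 else 0))"

text \<open>The vectors are the columns of M, padded with zeros below the first m rows. The padding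
  admits r > m, the case that the cardinality bound refutes.\<close>

lemma gram_matrix:
  assumes V: "\<And>p. p < r \<Longrightarrow> V p \<in> carrier_vec m" and m: "m \<le> r"
    and M: "M = mat r r (\<lambda>(i, p). if i < m then V p $ i else (0::complex))"
  shows "mat_adjoint M * M = mat r r (\<lambda>(p, q). V q \<bullet>c V p)"
proof (rule eq_matI)
  fix p q assume "p < dim_row (mat r r (\<lambda>(p, q). V q \<bullet>c V p))" "q < dim_col (mat r r (\<lambda>(p, q). V q \<bullet>c V p))"
  then have pq: "p < r" "q < r" by auto
  have "(mat_adjoint M * M) $$ (p, q) = (\<Sum>i<r. cnj (M $$ (i, p)) * M $$ (i, q))"
    using pq by (simp add: M scalar_prod_def mat_adjoint_index lessThan_atLeast0)
  also have "\<dots> = (\<Sum>i<m. V q $ i * cnj (V p $ i))"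
    using pq m by (intro sum.mono_neutral_cong_right) (auto simp: M)
  finally show "(mat_adjoint M * M) $$ (p, q) = mat r r (\<lambda>(p, q). V q \<bullet>c V p) $$ (p, q)"
    using pq V by (simp add: cscalar_prod_sum[of _ m])
qed (auto simp: M)

text \<open>More than m orthonormal vectors would give an invertible square matrix with a zero
  row.\<close>

lemma orthonormal_card_le:
  assumes "orthonormal m I V" "finite I"
  shows "card I \<le> m"
proof (rule ccontr)
  assume "\<not> card I \<le> m"
  then have m: "m < card I" by simp
  obtain f where f: "bij_betw f {0..<card I} I" using ex_bij_betw_nat_finite[OF assms(2)] by blast
  let ?r = "card I"
  define M where "M = mat ?r ?r (\<lambda>(i, p). if i < m then V (f p) $ i else 0)"
  have fI: "f p \<in> I" if "p < ?r" for p using f that by (auto simp: bij_betw_def)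
  have "mat_adjoint M * M = mat ?r ?r (\<lambda>(p, q). V (f q) \<bullet>c V (f p))"
    by (rule gram_matrix[OF _ _ M_def]) (use assms(1) fI m in \<open>auto simp: orthonormal_def\<close>)
  also have "\<dots> = 1\<^sub>m ?r"
    using assms(1) fI f by (intro eq_matI) (auto simp: orthonormal_def bij_betw_def inj_on_def)
  finally have e: "mat_adjoint M * M = 1\<^sub>m ?r" .
  have M: "M \<in> carrier_mat ?r ?r" "mat_adjoint M \<in> carrier_mat ?r ?r" by (auto simp: M_def)
  have "det M = 0" by (rule det_zero_row[OF M(1) m]) (use m in \<open>auto simp: M_def\<close>)
  moreover have "det (mat_adjoint M) * det M = 1"
    using det_mult[OF M(2,1)] e by simp
  ultimately show False by simp
qed

text \<open>Orthogonality to fewer than m vectors is a homogeneous system in m unknowns with a zero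
  row to spare.\<close>

lemma orthonormal_extend:
  assumes "orthonormal m I V" "finite I" "card I < m"
  obtains w where "w \<in> carrier_vec m" "w \<noteq> 0\<^sub>v m" "\<And>i. i \<in> I \<Longrightarrow> w \<bullet>c V i = 0"
proof -
  obtain f where f: "bij_betw f {0..<card I} I" using ex_bij_betw_nat_finite[OF assms(2)] by blast
  define M where "M = mat m m (\<lambda>(p, i). if p < card I then cnj (V (f p) $ i) else 0)"
  have M: "M \<in> carrier_mat m m" by (simp add: M_def)
  have "det M = 0" by (rule det_zero_row[OF M assms(3)]) (use assms(3) in \<open>auto simp: M_def\<close>)
  then obtain u where u: "u \<in> carrier_vec m" "u \<noteq> 0\<^sub>v m" "M *\<^sub>v u = 0\<^sub>v m"
    using det_0_iff_vec_prod_zero[OF M] by auto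
  have "u \<bullet>c V i = 0" if "i \<in> I" for i
  proof -
    have "i \<in> f ` {0..<card I}" using f that by (simp add: bij_betw_imp_surj_on)
    then obtain p where p: "p < card I" "f p = i" by auto
    then have "(M *\<^sub>v u) $ p = u \<bullet>c V i"
      using assms u(1) that M
      by (subst mult_mat_vec_sum[OF M]) (auto simp: cscalar_prod_sum[of _ m] orthonormal_def M_def mult.commute)
    then show ?thesis using u(3) p(1) assms(3) by simp
  qed
  then show ?thesis using that u by blast
qed

definition frame_mat :: "nat \<Rightarrow> (nat \<Rightarrow> 'i) \<Rightarrow> ('i \<Rightarrow> complex vec) \<Rightarrow> complex mat" where
  "frame_mat m ix V = mat m m (\<lambda>(r, p). V (ix p) $ r)"

lemma frame_mat_unitary:
  assumes "orthonormal m I V" "bij_betw ix {..<m} I"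
  shows "frame_mat m ix V \<in> unitary m"
proof (rule unitaryI)
  have ix: "ix p \<in> I" if "p < m" for p using assms(2) that by (auto simp: bij_betw_def)
  have "mat_adjoint (frame_mat m ix V) * frame_mat m ix V = mat m m (\<lambda>(p, q). V (ix q) \<bullet>c V (ix p))"
    using ix assms(1) by (intro gram_matrix[of _ _ m]) (auto simp: frame_mat_def orthonormal_def)
  also have "\<dots> = 1\<^sub>m m"
    using assms ix by (intro eq_matI) (auto simp: orthonormal_def bij_betw_def inj_on_def)
  finally show "mat_adjoint (frame_mat m ix V) * frame_mat m ix V = 1\<^sub>m m" .
qed (simp add: frame_mat_def)

text \<open>In the basis numbered by \<open>ix\<close>, the operator taking vector i to \<kappa> i
  times vector \<sigma> i; all model matrices have this form.\<close>

definition monomial_mat :: "nat \<Rightarrow> (nat \<Rightarrow> 'i) \<Rightarrow> ('i \<Rightarrow> 'i) \<Rightarrow> ('i \<Rightarrow> complex) \<Rightarrow> complex mat" where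
  "monomial_mat m ix \<sigma> \<kappa> = mat m m (\<lambda>(p, q). if ix p = \<sigma> (ix q) then \<kappa> (ix q) else 0)"

text \<open>The columns of the frame are the vectors V i, so the action of T on them, read column by
  column, is a matrix identity.\<close>

lemma frame_mat_intertwines:
  assumes V: "\<And>i. i \<in> I \<Longrightarrow> V i \<in> carrier_vec m" and ix: "bij_betw ix {..<m} I" and T: "T \<in> carrier_mat m m"
    and eq: "\<And>i. i \<in> I \<Longrightarrow> \<sigma> i \<in> I \<and> T *\<^sub>v V i = \<kappa> i \<cdot>\<^sub>v V (\<sigma> i)"
  shows "T * frame_mat m ix V = frame_mat m ix V * monomial_mat m ix \<sigma> \<kappa>"
proof (rule eq_matI)
  let ?g = "frame_mat m ix V" and ?M = "monomial_mat m ix \<sigma> \<kappa>"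
  fix r q assume "r < dim_row (?g * ?M)" "q < dim_col (?g * ?M)"
  then have rq: "r < m" "q < m" by (auto simp: frame_mat_def monomial_mat_def)
  have q: "ix q \<in> I" using ix rq by (auto simp: bij_betw_def)
  obtain p where p: "p < m" "ix p = \<sigma> (ix q)"
  proof -
    have "\<sigma> (ix q) \<in> ix ` {..<m}" using eq[OF q] ix by (simp add: bij_betw_imp_surj_on)
    then show ?thesis using that by auto
  qed
  have uniq: "ix p' = \<sigma> (ix q) \<longleftrightarrow> p' = p" if "p' < m" for p'
    using ix p that by (auto simp: bij_betw_def inj_on_def)
  have "(T * ?g) $$ (r, q) = (T *\<^sub>v V (ix q)) $ r"
    using T rq V[OF q] by (simp add: frame_mat_def scalar_prod_def)
  also have "\<dots> = \<kappa> (ix q) * V (\<sigma> (ix q)) $ r"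
    using eq[OF q] V[of "\<sigma> (ix q)"] rq by simp
  also have "\<dots> = (\<Sum>p'<m. if p' = p then V (ix p') $ r * \<kappa> (ix q) else 0)"
    using p by simp
  also have "\<dots> = (\<Sum>p'<m. ?g $$ (r, p') * ?M $$ (p', q))"
    using rq uniq by (intro sum.cong) (auto simp: frame_mat_def monomial_mat_def)
  also have "\<dots> = (?g * ?M) $$ (r, q)"
    using rq by (simp add: frame_mat_def monomial_mat_def scalar_prod_def lessThan_atLeast0)
  finally show "(T * ?g) $$ (r, q) = (?g * ?M) $$ (r, q)" .
qed (use T in \<open>auto simp: frame_mat_def monomial_mat_def\<close>)

section \<open>Cyclic systems of vectors\<close>

text \<open>The vector B_r^e_r ... B_1^e_1 v; adding one operator at a time lets its properties be
  proved by induction on r.\<close>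

primrec cyclic_vec :: "(nat \<Rightarrow> 'v \<Rightarrow> 'v) \<Rightarrow> (nat \<Rightarrow> nat) \<Rightarrow> 'v \<Rightarrow> nat \<Rightarrow> 'v" where
  "cyclic_vec B e v 0 = v"
| "cyclic_vec B e v (Suc r) = (B (Suc r) ^^ e (Suc r)) (cyclic_vec B e v r)"

lemma funpow_closed: "(\<And>w. w \<in> V \<Longrightarrow> f w \<in> V) \<Longrightarrow> w \<in> V \<Longrightarrow> (f ^^ k) w \<in> V"
  by (induction k) auto

lemma funpow_commute_on:
  assumes "\<And>w. w \<in> V \<Longrightarrow> f w \<in> V" "\<And>w. w \<in> V \<Longrightarrow> g w \<in> V" "\<And>w. w \<in> V \<Longrightarrow> f (g w) = g (f w)" "w \<in> V"
  shows "(f ^^ a) ((g ^^ b) w) = (g ^^ b) ((f ^^ a) w)"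
proof -
  have 1: "f ((g ^^ b) w) = (g ^^ b) (f w)" if "w \<in> V" for w
    using that assms(1-3) by (induction b) (simp_all add: funpow_closed)
  show ?thesis
    using assms(4) by (induction a) (simp_all add: 1 funpow_closed assms(1,2))
qed

lemma funpow_twist:
  fixes f g :: "complex vec \<Rightarrow> complex vec"
  assumes f: "\<And>w. w \<in> V \<Longrightarrow> f w \<in> V" and g: "\<And>w. w \<in> V \<Longrightarrow> g w \<in> V"
    and lin: "\<And>a w. w \<in> V \<Longrightarrow> g (a \<cdot>\<^sub>v w) = a \<cdot>\<^sub>v g w"
    and tw: "\<And>w. w \<in> V \<Longrightarrow> f (g w) = \<theta> \<cdot>\<^sub>v g (f w)" and w: "w \<in> V"
  shows "f ((g ^^ k) w) = \<theta> ^ k \<cdot>\<^sub>v (g ^^ k) (f w)"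
proof (induction k)
  case (Suc k)
  have "f ((g ^^ Suc k) w) = \<theta> \<cdot>\<^sub>v g (\<theta> ^ k \<cdot>\<^sub>v (g ^^ k) (f w))"
    using tw[OF funpow_closed[of V g w k, OF g w]] Suc by simp
  then show ?case using lin[OF funpow_closed[of V g "f w" k, OF g f[OF w]]]
    by (simp add: smult_smult_assoc)
qed simp

context
  fixes V :: "complex vec set" and B :: "nat \<Rightarrow> complex vec \<Rightarrow> complex vec" and t :: nat and v :: "complex vec"
  assumes B: "\<And>i w. i \<in> {1..t} \<Longrightarrow> w \<in> V \<Longrightarrow> B i w \<in> V"
    and comm: "\<And>i j w. i \<in> {1..t} \<Longrightarrow> j \<in> {1..t} \<Longrightarrow> w \<in> V \<Longrightarrow> B i (B j w) = B j (B i w)"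
    and v: "v \<in> V"
begin

lemma cyclic_vec_closed: "r \<le> t \<Longrightarrow> cyclic_vec B e v r \<in> V"
proof (induction r)
  case (Suc r)
  then show ?case using B[of "Suc r"] by (simp add: funpow_closed)
qed (simp add: v)

lemma cyclic_vec_upd_above: "r < i \<Longrightarrow> cyclic_vec B (e(i := x)) v r = cyclic_vec B e v r"
  by (induction r) auto

text \<open>Powers of \<open>B i\<close> commute past the later factors and are absorbed in the i-th
  exponent.\<close>

lemma cyclic_vec_step:
  assumes "i \<in> {1..r}" "r \<le> t"
  shows "(B i ^^ a) (cyclic_vec B e v r) = cyclic_vec B (e(i := e i + a)) v r"
  using assms
proof (induction r)
  case (Suc r)
  show ?case
  proof (cases "i = Suc r")
    case True
    have "(B i ^^ (e i + a)) w = (B i ^^ a) ((B i ^^ e i) w)" for w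
      unfolding add.commute[of "e i" a] funpow_add by simp
    from this[of "cyclic_vec B e v r"] show ?thesis
      unfolding True cyclic_vec.simps cyclic_vec_upd_above[OF lessI] by simp
  next
    case False
    then have i: "i \<in> {1..r}" "i \<in> {1..t}" "Suc r \<in> {1..t}" using Suc.prems by auto
    have "(B i ^^ a) (cyclic_vec B e v (Suc r)) = (B (Suc r) ^^ e (Suc r)) ((B i ^^ a) (cyclic_vec B e v r))"
      using i Suc.prems
      by (simp add: funpow_commute_on[of V "B i" "B (Suc r)"] B comm cyclic_vec_closed)
    then show ?thesis using Suc i(1) False by simp
  qed
qed simp

text \<open>A period of \<open>B i\<close> on v is a period on every vector reached from v, because
  the operators commute.\<close>

lemma cyclic_vec_periodic:
  assumes i: "i \<in> {1..t}" and per: "(B i ^^ N) v = v"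
  shows "cyclic_vec B (e(i := e i + N)) v t = cyclic_vec B e v t"
proof -
  have "(B i ^^ N) (cyclic_vec B e v r) = cyclic_vec B e v r" if "r \<le> t" for r
    using that
  proof (induction r)
    case (Suc r)
    then show ?case using i
      by (simp add: funpow_commute_on[of V "B i" "B (Suc r)"] B comm cyclic_vec_closed)
  qed (simp add: per)
  from this[of t] show ?thesis using cyclic_vec_step[of i t N e] i by simp
qed

lemma cyclic_vec_shift:
  assumes i: "i \<in> {1..t}" and per: "(B i ^^ N) v = v" and e: "e i < N"
  shows "B i (cyclic_vec B e v t) = cyclic_vec B (e(i := Suc (e i) mod N)) v t"
proof -
  have 1: "B i (cyclic_vec B e v t) = cyclic_vec B (e(i := Suc (e i))) v t"
    using cyclic_vec_step[of i t 1 e] i by simp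
  show ?thesis
  proof (cases "Suc (e i) = N")
    case True
    have "cyclic_vec B (e(i := N)) v t = cyclic_vec B (e(i := 0)) v t"
      using cyclic_vec_periodic[OF i per, of "e(i := 0)"] by simp
    then show ?thesis using 1 True by simp
  next
    case False
    then show ?thesis using 1 e by simp
  qed
qed

text \<open>S commutes with each operator up to a scalar, so each of the e_i applications of
  \<open>B i\<close> contributes one factor \<kappa> i to the eigenvalue.\<close>

lemma cyclic_vec_eigen:
  assumes S: "\<And>w. w \<in> V \<Longrightarrow> S w \<in> V" and Slin: "\<And>a w. w \<in> V \<Longrightarrow> S (a \<cdot>\<^sub>v w) = a \<cdot>\<^sub>v S w"
    and Blin: "\<And>i a w. i \<in> {1..t} \<Longrightarrow> w \<in> V \<Longrightarrow> B i (a \<cdot>\<^sub>v w) = a \<cdot>\<^sub>v B i w"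
    and tw: "\<And>i w. i \<in> {1..t} \<Longrightarrow> w \<in> V \<Longrightarrow> S (B i w) = \<kappa> i \<cdot>\<^sub>v B i (S w)" and Sv: "S v = \<sigma> \<cdot>\<^sub>v v"
    and r: "r \<le> t"
  shows "S (cyclic_vec B e v r) = (\<sigma> * (\<Prod>i = 1..r. \<kappa> i ^ e i)) \<cdot>\<^sub>v cyclic_vec B e v r"
  using r
proof (induction r)
  case (Suc r)
  let ?u = "cyclic_vec B e v r" and ?p = "\<sigma> * (\<Prod>i = 1..r. \<kappa> i ^ e i)"
  have i: "Suc r \<in> {1..t}" using Suc by simp
  have u: "?u \<in> V" using Suc by (simp add: cyclic_vec_closed)
  have lin: "(B (Suc r) ^^ k) (a \<cdot>\<^sub>v ?u) = a \<cdot>\<^sub>v (B (Suc r) ^^ k) ?u" for a k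
    by (induction k) (auto simp: Blin[OF i funpow_closed[of V "B (Suc r)", OF B[OF i] u]])
  have "S (cyclic_vec B e v (Suc r)) = \<kappa> (Suc r) ^ e (Suc r) \<cdot>\<^sub>v (B (Suc r) ^^ e (Suc r)) (S ?u)"
    using funpow_twist[of V S "B (Suc r)" "\<kappa> (Suc r)" ?u, OF S B[OF i] Blin[OF i] tw[OF i] u] by simp
  also have "\<dots> = (?p * \<kappa> (Suc r) ^ e (Suc r)) \<cdot>\<^sub>v cyclic_vec B e v (Suc r)"
    using Suc by (simp add: lin smult_smult_assoc mult_ac)
  finally show ?case by (simp add: mult_ac)
qed (simp add: Sv)

text \<open>Applied with f the squared norm, which the rescaled unitary operators preserve.\<close>

lemma cyclic_vec_invariant:
  assumes "\<And>i w. i \<in> {1..t} \<Longrightarrow> w \<in> V \<Longrightarrow> f (B i w) = f w" "r \<le> t"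
  shows "f (cyclic_vec B e v r) = f v"
  using assms(2)
proof (induction r)
  case (Suc r)
  have i: "Suc r \<in> {1..t}" using Suc by simp
  have u: "cyclic_vec B e v r \<in> V" using Suc by (simp add: cyclic_vec_closed)
  have "f ((B (Suc r) ^^ k) (cyclic_vec B e v r)) = f (cyclic_vec B e v r)" for k
    by (induction k) (auto simp: assms(1)[OF i funpow_closed[of V "B (Suc r)", OF B[OF i] u]])
  then show ?case using Suc by simp
qed simp

end

lemma unitary_pow_mult_vec:
  assumes "A \<in> unitary m" "w \<in> carrier_vec m"
  shows "(A [^]\<^bsub>unitary_group m\<^esub> (k::nat)) *\<^sub>v w = ((*\<^sub>v) A ^^ k) w"
proof -
  interpret group "unitary_group m" by (rule group_unitary_group)
  have c: "A [^]\<^bsub>unitary_group m\<^esub> (k::nat) \<in> carrier_mat m m" for k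
    by (rule unitaryD(1)[OF nat_pow_closed[OF assms(1)]])
  show ?thesis using assms(2)
  proof (induction k arbitrary: w)
    case (Suc k)
    have "(A [^]\<^bsub>unitary_group m\<^esub> Suc k) *\<^sub>v w = (A [^]\<^bsub>unitary_group m\<^esub> k) *\<^sub>v (A *\<^sub>v w)"
      using c unitaryD(1)[OF assms(1)] Suc.prems by (simp add: assoc_mult_mat_vec[of _ m m _ m])
    then show ?case using Suc unitaryD(1)[OF assms(1)]
      by (simp add: funpow_swap1)
  qed simp
qed

text \<open>Every V i is up to a nonzero scalar the image of some V i', so the scalar product can be
  moved through T by unitarity. This makes the orthogonal complements of blocks invariant.\<close>

lemma unitary_preserves_orthogonal:
  assumes T: "T \<in> unitary m" and V: "\<And>i. i \<in> I \<Longrightarrow> V i \<in> carrier_vec m"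
    and eq: "\<And>i. i \<in> I \<Longrightarrow> \<exists>i'\<in>I. \<exists>a. a \<noteq> 0 \<and> T *\<^sub>v V i' = a \<cdot>\<^sub>v V i"
    and w: "w \<in> carrier_vec m" "\<And>i. i \<in> I \<Longrightarrow> w \<bullet>c V i = 0" and i: "i \<in> I"
  shows "(T *\<^sub>v w) \<bullet>c V i = 0"
proof -
  obtain i' a where a: "i' \<in> I" "a \<noteq> 0" "T *\<^sub>v V i' = a \<cdot>\<^sub>v V i" using eq[OF i] by (elim bexE exE conjE)
  have "cnj a * ((T *\<^sub>v w) \<bullet>c V i) = (T *\<^sub>v w) \<bullet>c (T *\<^sub>v V i')"
    unfolding a(3) using w V[OF i] unitaryD(1)[OF T] by (simp add: cscalar_prod_smult[of _ m])
  also have "\<dots> = 0" using unitary_cscalar_prod[OF T w(1) V[OF a(1)]] w(2)[OF a(1)] by simp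
  finally show ?thesis using a(2) by simp
qed

section \<open>Models of the irreducible representations\<close>

locale heisenberg_type =
  fixes n t s :: nat and c k :: "nat \<Rightarrow> nat" and lam :: "nat \<Rightarrow> complex"
  assumes t2n: "2 * t \<le> n"
    and c_pos: "\<And>i. i \<in> {1..t} \<Longrightarrow> c i > 0"
    and lam_inj: "inj_on lam {1..s}"
    and prim: "\<And>j. j \<in> {1..s} \<Longrightarrow> primitive_root_of_unity (k j) (lam j)"
begin

text \<open>\<open>N j i\<close> is the order of \<open>lam j ^ c i\<close> for \<open>1 \<le> i \<le> t\<close>. The power \<open>a\<^sub>i ^ N j i\<close> acts as a
  scalar on every irreducible representation with \<open>x \<mapsto> lam j\<close>.\<close>

definition N :: "nat \<Rightarrow> nat \<Rightarrow> nat" where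
  "N j i = (if i \<in> {1..t} then k j div gcd (k j) (c i)
            else if i \<in> {t+1..2*t} then k j div gcd (k j) (c (i - t)) else 1)"

text \<open>The basis of one block is indexed by a product of cyclic groups Z/N_i;
  \<open>shift\<close> translates by one in the coordinate paired with the generator.\<close>

definition Box :: "nat \<Rightarrow> (nat \<Rightarrow> nat) set" where
  "Box j = (\<Pi>\<^sub>E i\<in>{1..t}. {..<N j i})"

definition shift :: "nat \<Rightarrow> nat \<Rightarrow> (nat \<Rightarrow> nat) \<Rightarrow> nat \<Rightarrow> nat" where
  "shift j i e = (if i \<in> {t+1..2*t} then e(i - t := Suc (e (i - t)) mod N j (i - t)) else e)"

text \<open>The coordinate e_i counts the applications of a_(t+i), and each of them multiplies the
  eigenvalue of a_i by lam_j^c_i.\<close>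

definition coef :: "nat \<Rightarrow> (nat \<Rightarrow> complex) \<Rightarrow> nat \<Rightarrow> (nat \<Rightarrow> nat) \<Rightarrow> complex" where
  "coef j z i e = (if i \<in> {1..t} then z i * lam j ^ (c i * e i) else z i)"

lemma k_pos: "j \<in> {1..s} \<Longrightarrow> k j > 0"
  using prim[of j] by (simp add: primitive_root_of_unity_def)

lemma N_pos:
  assumes "j \<in> {1..s}"
  shows "N j i > 0"
proof -
  have "k j div gcd (k j) b > 0" for b
    using k_pos[OF assms] by (simp add: div_greater_zero_iff gcd_le1_nat)
  then show ?thesis by (simp add: N_def)
qed

lemma N_add: "i \<in> {1..t} \<Longrightarrow> N j (t + i) = N j i"
  by (auto simp: N_def)

lemma lam_pow_eq_1_iff: "j \<in> {1..s} \<Longrightarrow> lam j ^ l = 1 \<longleftrightarrow> k j dvd l"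
proof -
  assume j: "j \<in> {1..s}"
  have p: "k j > 0" "lam j ^ k j = 1" "\<And>l. 0 < l \<Longrightarrow> l < k j \<Longrightarrow> lam j ^ l \<noteq> 1"
    using prim[OF j] by (auto simp: primitive_root_of_unity_def)
  have "lam j ^ l = lam j ^ (k j * (l div k j) + l mod k j)" by simp
  also have "\<dots> = lam j ^ (l mod k j)" unfolding power_add power_mult p(2) by simp
  finally have "lam j ^ l = lam j ^ (l mod k j)" .
  then show ?thesis using p(3)[of "l mod k j"] p(1) by (auto simp: dvd_eq_mod_eq_0)
qed

lemma lam_pow_N:
  assumes "j \<in> {1..s}" "i \<in> {1..t}"
  shows "lam j ^ (c i * N j i) = 1"
proof -
  have "k j dvd c i * (k j div gcd (k j) (c i))"
    by (metis div_mult_swap dvd_triv_left gcd_dvd1 gcd_dvd2 mult.commute)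
  then show ?thesis using assms by (simp add: lam_pow_eq_1_iff N_def)
qed

lemma lam_nonzero: "j \<in> {1..s} \<Longrightarrow> lam j \<noteq> 0"
  using prim[of j] by (auto simp: primitive_root_of_unity_def power_0_left)

lemma norm_lam: "j \<in> {1..s} \<Longrightarrow> norm (lam j) = 1"
proof -
  assume j: "j \<in> {1..s}"
  then have "lam j ^ k j = 1" using prim by (simp add: primitive_root_of_unity_def)
  then have "norm (lam j ^ k j) = 1" by (simp only: norm_one)
  then have "norm (lam j) ^ k j = 1 ^ k j" by (simp only: norm_power power_one)
  then show "norm (lam j) = 1" by (rule power_eq_imp_eq_base) (use k_pos[OF j] in simp_all)
qed

text \<open>The order of lam_j^c_i is k_j / gcd(k_j, c_i): dividing the relation k_j | c_i (b - a)
  by the gcd leaves coprime factors, so the quotient divides b - a, which is too small to be a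
  positive multiple.\<close>

lemma lam_pow_inj:
  assumes j: "j \<in> {1..s}" and i: "i \<in> {1..t}" and e: "e < N j i" "e' < N j i"
    and eq: "lam j ^ (c i * e) = lam j ^ (c i * e')"
  shows "e = e'"
proof -
  have main: "a = b" if ab: "a \<le> b" "b < N j i" "lam j ^ (c i * a) = lam j ^ (c i * b)" for a b
  proof -
    let ?g = "gcd (k j) (c i)"
    have "lam j ^ (c i * a) * lam j ^ (c i * (b - a)) = lam j ^ (c i * b)"
      using ab(1) by (simp flip: power_add add: algebra_simps)
    then have "lam j ^ (c i * (b - a)) = 1"
      using lam_nonzero[OF j] by (simp add: ab(3)[symmetric])
    then have "k j dvd c i * (b - a)" by (simp only: lam_pow_eq_1_iff[OF j])
    have g: "?g \<noteq> 0" using k_pos[OF j] by simp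
    obtain k' c' where kc: "k j = k' * ?g" "c i = c' * ?g" "coprime k' c'"
      using gcd_coprime_exists[OF g] by (elim exE conjE)
    have "k' * ?g dvd (c' * (b - a)) * ?g"
      using \<open>k j dvd c i * (b - a)\<close> by (subst (asm) kc(1), subst (asm) kc(2)) (simp add: mult_ac)
    then have "?g * k' dvd ?g * (c' * (b - a))" by (simp only: mult.commute)
    then have "k' dvd c' * (b - a)" using g by (simp only: nat_mult_dvd_cancel_disj) blast
    then have "k' dvd b - a" using kc(3) by (simp add: coprime_dvd_mult_right_iff)
    moreover have "N j i = k'"
    proof -
      have "N j i = k j div ?g" using i by (simp add: N_def)
      also have "\<dots> = (k' * ?g) div ?g" using kc(1) by (rule arg_cong[where f = "\<lambda>q. q div ?g"])
      also have "\<dots> = k'" by (rule nonzero_mult_div_cancel_right[OF g])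
      finally show ?thesis .
    qed
    ultimately have "N j i dvd b - a" by simp
    moreover have "b - a < N j i" using ab(2) by linarith
    ultimately have "b - a = 0" using nat_dvd_not_less by blast
    then show ?thesis using ab(1) by simp
  qed
  show ?thesis using main[of e e'] main[of e' e] e eq by (cases "e \<le> e'") auto
qed

lemma finite_Box: "finite (Box j)"
  unfolding Box_def by (intro finite_PiE) auto

lemma card_Box: "card (Box j) = (\<Prod>i = 1..t. N j i)"
  unfolding Box_def by (subst card_PiE) auto

lemma shift_in_Box: "j \<in> {1..s} \<Longrightarrow> e \<in> Box j \<Longrightarrow> shift j i e \<in> Box j"
  using N_pos[of j "i - t"] by (auto simp: Box_def shift_def PiE_iff extensional_def)

lemma shift_inj: "j \<in> {1..s} \<Longrightarrow> inj_on (shift j i) (Box j)"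
proof (rule inj_onI)
  fix e e' assume j: "j \<in> {1..s}" and e: "e \<in> Box j" "e' \<in> Box j" "shift j i e = shift j i e'"
  show "e = e'"
  proof (cases "i \<in> {t+1..2*t}")
    case True
    define r where "r = i - t"
    have r: "r \<in> {1..t}" using True by (auto simp: r_def)
    have eq: "e(r := Suc (e r) mod N j r) = e'(r := Suc (e' r) mod N j r)"
      using e(3) True by (simp add: shift_def r_def)
    have "e r < N j r" "e' r < N j r" using e r by (auto simp: Box_def PiE_iff)
    moreover have "Suc (e r) mod N j r = Suc (e' r) mod N j r" using fun_cong[OF eq, of r] by simp
    ultimately have "e r = e' r" by (auto simp: mod_Suc split: if_splits)
    then show ?thesis using eq by (auto simp: fun_eq_iff split: if_splits)
  next
    case False
    then show ?thesis using e(3) by (simp only: shift_def if_False)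
  qed
qed

lemma shift_surj: "j \<in> {1..s} \<Longrightarrow> shift j i ` Box j = Box j"
  by (rule endo_inj_surj[OF finite_Box _ shift_inj]) (auto intro: shift_in_Box)

lemma norm_coef: "j \<in> {1..s} \<Longrightarrow> norm (z i) = 1 \<Longrightarrow> norm (coef j z i e) = 1"
  by (simp add: coef_def norm_mult norm_power norm_lam)

section \<open>Blocks inside an arbitrary representation\<close>

definition model_block ::
  "nat \<Rightarrow> complex mat \<Rightarrow> (nat \<Rightarrow> complex mat) \<Rightarrow> nat \<Rightarrow> (nat \<Rightarrow> complex) \<Rightarrow> ((nat \<Rightarrow> nat) \<Rightarrow> complex vec) \<Rightarrow> bool" where
  "model_block m X A j z u \<longleftrightarrow> (\<forall>e\<in>Box j. u e \<in> carrier_vec m \<and> X *\<^sub>v u e = lam j \<cdot>\<^sub>v u e \<and>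
     (\<forall>i\<in>{1..n}. A i *\<^sub>v u e = coef j z i e \<cdot>\<^sub>v u (shift j i e)))"

abbreviation unitary_rels :: "nat \<Rightarrow> complex mat \<Rightarrow> (nat \<Rightarrow> complex mat) \<Rightarrow> bool" where
  "unitary_rels m X A \<equiv> heisenberg_rels (unitary_group m) n t c X A"

lemma unitary_relsD:
  assumes "unitary_rels m X A"
  shows "X \<in> unitary m" "i \<in> {1..n} \<Longrightarrow> A i \<in> unitary m"
    "i \<in> {1..n} \<Longrightarrow> X * A i = A i * X"
    "i \<in> {1..t} \<Longrightarrow> A i * A (t + i) = X [^]\<^bsub>unitary_group m\<^esub> c i * (A (t + i) * A i)"
    "i \<in> {1..n} \<Longrightarrow> i' \<in> {1..n} \<Longrightarrow> \<not> (i \<in> {1..t} \<and> i' = t + i) \<Longrightarrow> \<not> (i' \<in> {1..t} \<and> i = t + i') \<Longrightarrow>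
      A i * A i' = A i' * A i"
  using assms by (auto simp: heisenberg_rels_def)

text \<open>The scalar that the commutator of a_i and a_i' becomes on the eigenspace of x for
  lam_j.\<close>

definition twist :: "nat \<Rightarrow> nat \<Rightarrow> nat \<Rightarrow> complex" where
  "twist j i i' = (if i \<in> {1..t} \<and> i' = t + i then lam j ^ c i
     else if i' \<in> {1..t} \<and> i = t + i' then inverse (lam j ^ c i') else 1)"

text \<open>The A_i commute with X and so preserve its eigenspace, and there X^c_i is a scalar,
  which turns the relations into scalar exchange rules.\<close>

lemma rels_on_eigenspace:
  assumes R: "unitary_rels m X A" and j: "j \<in> {1..s}" and i: "i \<in> {1..n}" "i' \<in> {1..n}"
    and w: "w \<in> carrier_vec m" "X *\<^sub>v w = lam j \<cdot>\<^sub>v w"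
  shows "A i *\<^sub>v w \<in> carrier_vec m" "X *\<^sub>v (A i *\<^sub>v w) = lam j \<cdot>\<^sub>v (A i *\<^sub>v w)"
    "A i *\<^sub>v (A i' *\<^sub>v w) = twist j i i' \<cdot>\<^sub>v (A i' *\<^sub>v (A i *\<^sub>v w))"
proof -
  note RD = unitary_relsD[OF R]
  have Xc: "X \<in> carrier_mat m m" by (rule unitaryD(1)[OF RD(1)])
  have Ac: "A i \<in> carrier_mat m m" if "i \<in> {1..n}" for i by (rule unitaryD(1)[OF RD(2)[OF that]])
  have cl: "A i *\<^sub>v w \<in> carrier_vec m" if "i \<in> {1..n}" "w \<in> carrier_vec m" for i w using Ac[OF that(1)] that(2) by simp
  show 1: "A i *\<^sub>v w \<in> carrier_vec m" by (rule cl[OF i(1) w(1)])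
  have X: "X *\<^sub>v (A i *\<^sub>v w) = lam j \<cdot>\<^sub>v (A i *\<^sub>v w)"
    if "i \<in> {1..n}" "w \<in> carrier_vec m" "X *\<^sub>v w = lam j \<cdot>\<^sub>v w" for i w
  proof -
    have "X *\<^sub>v (A i *\<^sub>v w) = (A i * X) *\<^sub>v w"
      using Xc Ac[OF that(1)] that(2) RD(3)[OF that(1)] by (metis assoc_mult_mat_vec)
    also have "\<dots> = A i *\<^sub>v (lam j \<cdot>\<^sub>v w)" using Xc Ac[OF that(1)] that(2,3) by simp
    finally show ?thesis using Ac[OF that(1)] that(2) by (simp add: mult_mat_vec[of _ m m])
  qed
  show "X *\<^sub>v (A i *\<^sub>v w) = lam j \<cdot>\<^sub>v (A i *\<^sub>v w)" by (rule X[OF i(1) w])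
  have Xp: "(X [^]\<^bsub>unitary_group m\<^esub> (q::nat)) *\<^sub>v w = lam j ^ q \<cdot>\<^sub>v w"
    if "w \<in> carrier_vec m" "X *\<^sub>v w = lam j \<cdot>\<^sub>v w" for q w
    unfolding unitary_pow_mult_vec[OF RD(1) that(1)]
    by (induction q) (use that Xc in \<open>simp_all add: mult_mat_vec[of _ m m] smult_smult_assoc mult.commute\<close>)
  have pair: "A r *\<^sub>v (A (t + r) *\<^sub>v w) = lam j ^ c r \<cdot>\<^sub>v (A (t + r) *\<^sub>v (A r *\<^sub>v w))" if r: "r \<in> {1..t}" for r
  proof -
    have rn: "r \<in> {1..n}" "t + r \<in> {1..n}" using r t2n by auto
    note c = Ac[OF rn(1)] Ac[OF rn(2)]
    interpret U: group "unitary_group m" by (rule group_unitary_group)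
    have Xpc: "X [^]\<^bsub>unitary_group m\<^esub> c r \<in> carrier_mat m m"
      by (rule unitaryD(1)[OF U.nat_pow_closed[OF RD(1)]])
    have "A r *\<^sub>v (A (t + r) *\<^sub>v w) = (A r * A (t + r)) *\<^sub>v w" using c w(1) by (simp add: assoc_mult_mat_vec[of _ m m _ m])
    also have "\<dots> = X [^]\<^bsub>unitary_group m\<^esub> c r *\<^sub>v (A (t + r) *\<^sub>v (A r *\<^sub>v w))"
      unfolding RD(4)[OF r] using c w(1) Xpc by (simp add: assoc_mult_mat_vec[of _ m m _ m])
    also have "\<dots> = lam j ^ c r \<cdot>\<^sub>v (A (t + r) *\<^sub>v (A r *\<^sub>v w))"
      by (intro Xp cl X rn w)
    finally show ?thesis .
  qed
  show "A i *\<^sub>v (A i' *\<^sub>v w) = twist j i i' \<cdot>\<^sub>v (A i' *\<^sub>v (A i *\<^sub>v w))"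
  proof (cases "(i \<in> {1..t} \<and> i' = t + i) \<or> (i' \<in> {1..t} \<and> i = t + i')")
    case True
    then consider "i \<in> {1..t}" "i' = t + i" | "i' \<in> {1..t}" "i = t + i'" by blast
    then show ?thesis
    proof cases
      case 1
      then show ?thesis using pair[of i] by (simp add: twist_def)
    next
      case 2
      then have tw: "twist j i i' = inverse (lam j ^ c i')" by (auto simp: twist_def)
      show ?thesis unfolding tw using 2 pair[of i'] lam_nonzero[OF j] by (simp add: smult_smult_assoc)
    qed
  next
    case False
    then have "A i * A i' = A i' * A i" using RD(5)[OF i] by blast
    then have "A i *\<^sub>v (A i' *\<^sub>v w) = A i' *\<^sub>v (A i *\<^sub>v w)"
      using Ac[OF i(1)] Ac[OF i(2)] w(1) by (metis assoc_mult_mat_vec)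
    then show ?thesis using False by (auto simp: twist_def)
  qed
qed

text \<open>In a pair of generators exactly one is a shift, and only that one is raised to the order
  N; this power removes the twist.\<close>

lemma twist_pow_N:
  assumes j: "j \<in> {1..s}" and i: "i \<in> {1..n}" "i' \<in> {1..n}"
  shows "(twist j i i' ^ (if i' \<in> {t+1..2*t} then N j i' else 1)) ^ (if i \<in> {t+1..2*t} then N j i else 1) = 1"
proof (cases "(i \<in> {1..t} \<and> i' = t + i) \<or> (i' \<in> {1..t} \<and> i = t + i')")
  case True
  then show ?thesis
    using lam_pow_N[OF j, of i] lam_pow_N[OF j, of i']
    by (auto simp: twist_def N_add power_inverse simp flip: power_mult)
qed (auto simp: twist_def)

text \<open>The block is the orbit of v under the rescaled shifts. Different indices are told apart
  by some diagonal generator, whose eigenvalues then differ, so the vectors are orthogonal;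
  unitarity keeps their length. For the shifts only the powers z_i^N_i are tied to v, which later
  lets one representation carry models with different parameters.\<close>

lemma cyclic_system:
  assumes R: "unitary_rels m X A" and W: "lin_subspace m W"
    and inv: "\<And>i w. i \<in> {1..n} \<Longrightarrow> w \<in> W \<Longrightarrow> A i *\<^sub>v w \<in> W"
    and j: "j \<in> {1..s}" and z: "\<And>i. i \<in> {1..n} \<Longrightarrow> norm (z i) = 1"
    and v: "v \<in> W" "v \<bullet>c v = 1" and Xv: "X *\<^sub>v v = lam j \<cdot>\<^sub>v v"
    and Av: "\<And>i. i \<in> {1..n} \<Longrightarrow> i \<notin> {t+1..2*t} \<Longrightarrow> A i *\<^sub>v v = z i \<cdot>\<^sub>v v"
    and Apow: "\<And>i. i \<in> {t+1..2*t} \<Longrightarrow> (A i [^]\<^bsub>unitary_group m\<^esub> N j i) *\<^sub>v v = z i ^ N j i \<cdot>\<^sub>v v"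
  obtains u where "model_block m X A j z u" "orthonormal m (Box j) u" "\<And>e. u e \<in> W"
proof -
  note RD = unitary_relsD[OF R]
  have Ac: "A i \<in> carrier_mat m m" if "i \<in> {1..n}" for i
    by (rule unitaryD(1)[OF RD(2)[OF that]])
  define V where "V = {w \<in> W. X *\<^sub>v w = lam j \<cdot>\<^sub>v w}"
  have Vc: "w \<in> carrier_vec m" if "w \<in> V" for w using that lin_subspaceD(1)[OF W] by (auto simp: V_def)
  have Xc: "X \<in> carrier_mat m m" by (rule unitaryD(1)[OF RD(1)])
  have AV: "A i *\<^sub>v w \<in> V" if "i \<in> {1..n}" "w \<in> V" for i w
    using inv[OF that(1)] rels_on_eigenspace(2)[OF R j that(1) that(1)] Vc[OF that(2)] that(2) by (simp add: V_def)
  have sV: "a \<cdot>\<^sub>v w \<in> V" if "w \<in> V" for a w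
    using that lin_subspaceD(4)[OF W] Vc[OF that] Xc
    by (simp add: V_def mult_mat_vec[of _ m m] smult_smult_assoc mult.commute)
  \<comment> \<open>Dividing by z makes the operator return v to itself after N steps, so that the
    wrap-around in \<open>shift\<close> carries no scalar.\<close>
  define B where "B r w = inverse (z (t + r)) \<cdot>\<^sub>v (A (t + r) *\<^sub>v w)" for r w
  have tr: "r \<in> {1..n}" "t + r \<in> {1..n}" if "r \<in> {1..t}" for r using that t2n by auto
  have z0: "z i \<noteq> 0" if "i \<in> {1..n}" for i using z[OF that] by auto
  have tw: "A i *\<^sub>v (A i' *\<^sub>v w) = twist j i i' \<cdot>\<^sub>v (A i' *\<^sub>v (A i *\<^sub>v w))"
    if "i \<in> {1..n}" "i' \<in> {1..n}" "w \<in> V" for i i' w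
    using rels_on_eigenspace(3)[OF R j that(1,2)] Vc[OF that(3)] that(3) by (simp add: V_def)
  have Alin: "A i *\<^sub>v (a \<cdot>\<^sub>v w) = a \<cdot>\<^sub>v (A i *\<^sub>v w)" if "i \<in> {1..n}" "w \<in> V" for i a w
    using Ac[OF that(1)] Vc[OF that(2)] by (rule mult_mat_vec)
  have BV: "B r w \<in> V" if "r \<in> {1..t}" "w \<in> V" for r w
    unfolding B_def using that tr AV sV by blast
  have Bcomm: "B r (B r' w) = B r' (B r w)" if r: "r \<in> {1..t}" "r' \<in> {1..t}" "w \<in> V" for r r' w
  proof -
    have "twist j (t + r) (t + r') = 1" using r by (auto simp: twist_def)
    then have "A (t + r) *\<^sub>v (A (t + r') *\<^sub>v w) = A (t + r') *\<^sub>v (A (t + r) *\<^sub>v w)"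
      using tw[of "t + r" "t + r'" w] tr r by simp
    then show ?thesis unfolding B_def using r tr by (simp add: Alin AV smult_smult_assoc mult.commute)
  qed
  have Blin: "B r (a \<cdot>\<^sub>v w) = a \<cdot>\<^sub>v B r w" if "r \<in> {1..t}" "w \<in> V" for r a w
    unfolding B_def using that tr by (simp add: Alin smult_smult_assoc mult.commute)
  have vV: "v \<in> V" using v Xv by (simp add: V_def)
  have Bpow: "(B r ^^ N j r) v = v" if r: "r \<in> {1..t}" for r
  proof -
    have e: "(B r ^^ q) v = inverse (z (t + r)) ^ q \<cdot>\<^sub>v ((*\<^sub>v) (A (t + r)) ^^ q) v" for q
    proof (induction q)
      case (Suc q)
      have "((*\<^sub>v) (A (t + r)) ^^ q) v \<in> V"
        by (rule funpow_closed[OF _ vV]) (rule AV[OF tr(2)[OF r]])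
      then show ?case using Suc tr[OF r] by (simp add: B_def Alin smult_smult_assoc)
    qed simp
    have "t + r \<in> {t+1..2*t}" using r by auto
    from Apow[OF this] have "((*\<^sub>v) (A (t + r)) ^^ N j r) v = z (t + r) ^ N j r \<cdot>\<^sub>v v"
      using unitary_pow_mult_vec[OF RD(2)[OF tr(2)[OF r]] Vc[OF vV]] N_add[OF r] by simp
    then show ?thesis
      using z0[OF tr(2)[OF r]] by (simp add: e smult_smult_assoc power_inverse)
  qed
  define u where "u e = cyclic_vec B e v t" for e
  have uV: "u e \<in> V" for e unfolding u_def by (rule cyclic_vec_closed[where B = B and V = V and t = t and v = v, OF BV Bcomm vV]) auto
  have eig: "A i *\<^sub>v u e = coef j z i e \<cdot>\<^sub>v u e" if i: "i \<in> {1..n}" "i \<notin> {t+1..2*t}" for i e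
  proof -
    have "A i *\<^sub>v u e = (z i * (\<Prod>r = 1..t. twist j i (t + r) ^ e r)) \<cdot>\<^sub>v u e"
      unfolding u_def
    proof (rule cyclic_vec_eigen[where B = B and V = V and t = t and v = v, OF BV Bcomm vV _ _ Blin])
      show "A i *\<^sub>v (B r w) = twist j i (t + r) \<cdot>\<^sub>v B r (A i *\<^sub>v w)" if "r \<in> {1..t}" "w \<in> V" for r w
        unfolding B_def using that tr tw[of i "t + r" w] i
        by (simp add: Alin AV smult_smult_assoc mult.commute)
    qed (use i AV Alin Av in auto)
    also have "(\<Prod>r = 1..t. twist j i (t + r) ^ e r) = (if i \<in> {1..t} then lam j ^ (c i * e i) else 1)"
    proof -
      \<comment> \<open>At most one of the shifts, the one paired with \<open>A i\<close>, fails to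
        commute with it.\<close>
      have "(\<Prod>r = 1..t. twist j i (t + r) ^ e r) = (\<Prod>r = 1..t. if r = i then lam j ^ (c i * e i) else 1)"
        using i by (intro prod.cong) (auto simp: twist_def power_mult)
      then show ?thesis by simp
    qed
    finally show ?thesis by (simp add: coef_def)
  qed
  have "A i *\<^sub>v u e = coef j z i e \<cdot>\<^sub>v u (shift j i e)" if i: "i \<in> {1..n}" and e: "e \<in> Box j" for i e
  proof (cases "i \<in> {t+1..2*t}")
    case True
    define r where "r = i - t"
    have r: "r \<in> {1..t}" "i = t + r" using True by (auto simp: r_def)
    have er: "e r < N j r" using e r by (auto simp: Box_def)
    have "B r (u e) = u (shift j i e)"
      unfolding u_def using cyclic_vec_shift[where B = B and V = V and t = t and v = v and e = e and i = r and N = "N j r", OF BV Bcomm vV r(1) Bpow[OF r(1)] er] True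
      by (simp add: shift_def r_def)
    moreover have "A i *\<^sub>v u e = z i \<cdot>\<^sub>v B r (u e)"
      using z0[OF i] r by (simp add: B_def smult_smult_assoc)
    moreover have "i \<notin> {1..t}" using True by auto
    ultimately show ?thesis by (auto simp add: coef_def)
  next
    case False
    then show ?thesis using eig[OF i] by (auto simp: shift_def)
  qed
  moreover have "X *\<^sub>v u e = lam j \<cdot>\<^sub>v u e" for e using uV[of e] by (simp add: V_def)
  ultimately have "model_block m X A j z u" using Vc[OF uV] by (simp add: model_block_def)
  moreover have "orthonormal m (Box j) u"
    unfolding orthonormal_def
  proof (intro conjI ballI)
    fix e e' assume e: "e \<in> Box j" "e' \<in> Box j"
    show "u e \<bullet>c u e' = (if e = e' then 1 else 0)"
    proof (cases "e = e'")
      case True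
      have "u e \<bullet>c u e = v \<bullet>c v"
        unfolding u_def
      proof (rule cyclic_vec_invariant[where B = B and V = V and t = t and v = v and r = t and f = "\<lambda>w. w \<bullet>c w", OF BV Bcomm vV])
        fix r w assume r: "r \<in> {1..t}" and w: "w \<in> V"
        have z1: "inverse (z (t + r)) * cnj (inverse (z (t + r))) = 1"
          using complex_norm_square[of "inverse (z (t + r))"] z[OF tr(2)[OF r]] by (simp add: norm_inverse)
        have "B r w \<bullet>c B r w = (inverse (z (t + r)) * cnj (inverse (z (t + r)))) * (w \<bullet>c w)"
          unfolding B_def using Vc[OF w] Vc[OF AV[OF tr(2)[OF r] w]] unitary_cscalar_prod[OF RD(2)[OF tr(2)[OF r]] Vc[OF w] Vc[OF w]]
          by (simp add: cscalar_prod_smult[of _ m] del: complex_cnj_inverse)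
        then show "B r w \<bullet>c B r w = w \<bullet>c w" using z1 by simp
      qed auto
      then show ?thesis using True v by simp
    next
      case False
      then obtain i where i: "i \<in> {1..t}" "e i \<noteq> e' i"
        using e unfolding Box_def by (metis PiE_ext)
      have "e i < N j i" "e' i < N j i" using e i by (auto simp: Box_def)
      then have ne: "lam j ^ (c i * e i) \<noteq> lam j ^ (c i * e' i)" using lam_pow_inj[OF j i(1)] i(2) by blast
      have i2: "i \<notin> {t+1..2*t}" using i by auto
      have "u e \<bullet>c u e' = 0"
      proof (rule unitary_eigenvectors_orthogonal[OF RD(2)[OF tr(1)[OF i(1)]] Vc[OF uV] Vc[OF uV]
            eig[OF tr(1)[OF i(1)] i2] eig[OF tr(1)[OF i(1)] i2]])
        show "coef j z i e \<noteq> coef j z i e'" using ne i z0[OF tr(1)[OF i(1)]] by (simp add: coef_def)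
        show "norm (coef j z i e') = 1" using norm_coef[of j z i e'] j z[OF tr(1)[OF i(1)]] by blast
      qed
      then show ?thesis using False by simp
    qed
  qed (use Vc[OF uV] in auto)
  ultimately show ?thesis using that uV by (auto simp: V_def)
qed

end

section \<open>Decomposition into irreducible blocks\<close>

lemma normalize_vec:
  fixes v :: "complex vec"
  assumes "v \<in> carrier_vec m" "v \<noteq> 0\<^sub>v m"
  obtains a where "(a \<cdot>\<^sub>v v) \<bullet>c (a \<cdot>\<^sub>v v) = 1"
proof -
  define r where "r = (\<Sum>i<m. (norm (v $ i))\<^sup>2)"
  have vv: "v \<bullet>c v = of_real r"
    unfolding r_def of_real_sum complex_norm_square by (rule cscalar_prod_sum[OF assms(1,1)])
  have "r \<ge> 0" unfolding r_def by (simp add: sum_nonneg)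
  moreover have "r \<noteq> 0" using vv conjugate_square_eq_0_vec[OF assms(1)] assms(2) by auto
  ultimately have r: "r > 0" by simp
  define a where "a = complex_of_real (inverse (sqrt r))"
  have "a * cnj a * of_real r = of_real (inverse (sqrt r) * inverse (sqrt r) * r)"
    by (simp add: a_def)
  also have "inverse (sqrt r) * inverse (sqrt r) * r = 1"
  proof -
    have "inverse (sqrt r) * inverse (sqrt r) = inverse r"
      using r by (simp flip: inverse_mult_distrib)
    then show ?thesis using r by simp
  qed
  finally have "(a \<cdot>\<^sub>v v) \<bullet>c (a \<cdot>\<^sub>v v) = 1"
    using assms(1) vv by (simp add: cscalar_prod_smult[of _ m] mult_ac)
  then show ?thesis by (rule that)
qed

lemma orthogonal_subspace:
  assumes "\<And>i. i \<in> I \<Longrightarrow> V i \<in> carrier_vec m"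
  shows "lin_subspace m {w \<in> carrier_vec m. \<forall>i\<in>I. w \<bullet>c V i = 0}"
proof -
  have z: "0\<^sub>v m \<bullet>c V i = 0" if "i \<in> I" for i
    by (subst cscalar_prod_sum[of _ m]) (use assms[OF that] in auto)
  show ?thesis
    unfolding lin_subspace_def
  proof (intro conjI ballI allI)
    show "{w \<in> carrier_vec m. \<forall>i\<in>I. w \<bullet>c V i = 0} \<subseteq> carrier_vec m" by (rule Collect_restrict)
    show "0\<^sub>v m \<in> {w \<in> carrier_vec m. \<forall>i\<in>I. w \<bullet>c V i = 0}" using z by simp
    fix v assume v: "v \<in> {w \<in> carrier_vec m. \<forall>i\<in>I. w \<bullet>c V i = 0}"
    show "a \<cdot>\<^sub>v v \<in> {w \<in> carrier_vec m. \<forall>i\<in>I. w \<bullet>c V i = 0}" for a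
    proof -
      have "(a \<cdot>\<^sub>v v) \<bullet>c V i = 0" if "i \<in> I" for i
        using v that assms[OF that] by (simp add: cscalar_prod_smult[of _ m])
      then show ?thesis using v by simp
    qed
    fix w assume w: "w \<in> {w \<in> carrier_vec m. \<forall>i\<in>I. w \<bullet>c V i = 0}"
    have "(v + w) \<bullet>c V i = 0" if "i \<in> I" for i
      using v w that assms[OF that] by (simp add: cscalar_prod_add_left[of _ m])
    then show "v + w \<in> {w \<in> carrier_vec m. \<forall>i\<in>I. w \<bullet>c V i = 0}" using v w by simp
  qed
qed

text \<open>Root multiplicities are read off a factorization into linear factors; two factorizations
  of one characteristic polynomial are compared this way.\<close>

lemma order_prod_linear:
  assumes "finite F"
  shows "order a (\<Prod>x\<in>F. [:- d x, 1::complex:]) = card {x \<in> F. d x = a}"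
proof -
  have nz: "(\<Prod>x\<in>F. [:- d x, 1::complex:]) \<noteq> 0" if "finite F" for F using that by (simp add: prod_zero_iff)
  have lin: "order a [:- b, 1:] = (if b = a then 1 else 0)" for b
    using order_power_n_n[of a 1] by (auto intro: order_0I)
  show ?thesis
    using assms
  proof (induction F rule: finite_induct)
    case (insert x F)
    have "order a (\<Prod>x\<in>insert x F. [:- d x, 1:]) = order a [:- d x, 1:] + order a (\<Prod>x\<in>F. [:- d x, 1:])"
    proof -
      have "[:- d x, 1:] * (\<Prod>x\<in>F. [:- d x, 1:]) \<noteq> 0"
        using nz[OF insert.hyps(1)] by (simp only: mult_eq_0_iff) simp
      from order_mult[OF this, of a] show ?thesis unfolding prod.insert[OF insert.hyps] .
    qed
    also have "\<dots> = (if d x = a then 1 else 0) + card {x \<in> F. d x = a}"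
      unfolding lin insert.IH ..
    also have "\<dots> = card {y \<in> insert x F. d y = a}"
    proof (cases "d x = a")
      case True
      then have "{y \<in> insert x F. d y = a} = insert x {x \<in> F. d x = a}" by auto
      then show ?thesis using True insert.hyps by simp
    next
      case False
      then have "{y \<in> insert x F. d y = a} = {x \<in> F. d x = a}" by auto
      then show ?thesis using False by simp
    qed
    finally show ?case .
  qed simp
qed

lemma char_poly_diagonalized:
  assumes g: "g \<in> unitary m" and X: "X \<in> carrier_mat m m"
    and ix: "bij_betw ix {..<m} I" and eq: "X * g = g * monomial_mat m ix id \<kappa>"
  shows "char_poly X = (\<Prod>i\<in>I. [:- \<kappa> i, 1:])"
proof -
  let ?D = "monomial_mat m ix id \<kappa>"
  have D: "?D \<in> carrier_mat m m" by (simp add: monomial_mat_def)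
  have inj: "inj_on ix {..<m}" using ix by (rule bij_betw_imp_inj_on)
  have off: "?D $$ (p, q) = (if p = q then \<kappa> (ix q) else 0)" if "p < m" "q < m" for p q
    using that inj by (simp add: monomial_mat_def inj_on_eq_iff)
  note gD = unitaryD[OF g]
  have "X = X * (g * mat_adjoint g)" using X gD by simp
  also have "\<dots> = (X * g) * mat_adjoint g" by (rule assoc_mult_mat[symmetric, OF X gD(1,5)])
  also have "\<dots> = g * ?D * mat_adjoint g" by (simp only: eq)
  finally have "similar_mat_wit X ?D g (mat_adjoint g)"
    using X D gD by (intro similar_mat_witI[of _ _ m]) auto
  then have "similar_mat X ?D" unfolding similar_mat_def by blast
  then have "char_poly X = char_poly ?D" by (rule char_poly_similar)
  also have "\<dots> = (\<Prod>a\<leftarrow>diag_mat ?D. [:- a, 1:])"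
    by (rule char_poly_upper_triangular[OF D]) (use D off in \<open>auto simp: upper_triangular_def\<close>)
  also have "diag_mat ?D = map (\<lambda>p. \<kappa> (ix p)) [0..<m]"
    using D off by (simp add: diag_mat_def)
  also have "(\<Prod>a\<leftarrow>map (\<lambda>p. \<kappa> (ix p)) [0..<m]. [:- a, 1:]) = (\<Prod>p<m. [:- \<kappa> (ix p), 1:])"
    by (induction m) (simp_all add: mult.commute)
  also have "\<dots> = (\<Prod>i\<in>I. [:- \<kappa> i, 1:])"
    by (rule prod.reindex_bij_betw[OF ix])
  finally show ?thesis .
qed

definition eigenvalues_in :: "nat \<Rightarrow> complex mat \<Rightarrow> complex set \<Rightarrow> bool" where
  "eigenvalues_in m X L \<longleftrightarrow>
     (\<forall>a v. v \<in> carrier_vec m \<longrightarrow> v \<noteq> 0\<^sub>v m \<longrightarrow> X *\<^sub>v v = a \<cdot>\<^sub>v v \<longrightarrow> a \<in> L)"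

context heisenberg_type
begin

section \<open>Splitting off blocks one at a time\<close>

text \<open>Inside W pass to an eigenspace of X. There the A_i commute only up to twists, but their
  powers with exponent N for the shifts and 1 otherwise do commute and have a joint eigenvector; the
  z_i are roots of its eigenvalues.\<close>

lemma joint_model_vector:
  assumes R: "unitary_rels m X A" and W: "lin_subspace m W"
    and invX: "\<forall>w\<in>W. X *\<^sub>v w \<in> W"
    and inv: "\<forall>i\<in>{1..n}. \<forall>w\<in>W. A i *\<^sub>v w \<in> W"
    and spec: "eigenvalues_in m X (lam ` {1..s})"
    and w: "w \<in> W" "w \<noteq> 0\<^sub>v m"
  obtains j z v where "j \<in> {1..s}" "\<And>i. i \<in> {1..n} \<Longrightarrow> norm (z i) = 1" "v \<in> W" "v \<bullet>c v = 1"
    "X *\<^sub>v v = lam j \<cdot>\<^sub>v v" "\<And>i. i \<in> {1..n} \<Longrightarrow> i \<notin> {t+1..2*t} \<Longrightarrow> A i *\<^sub>v v = z i \<cdot>\<^sub>v v"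
    "\<And>i. i \<in> {t+1..2*t} \<Longrightarrow> (A i [^]\<^bsub>unitary_group m\<^esub> N j i) *\<^sub>v v = z i ^ N j i \<cdot>\<^sub>v v"
proof -
  note RD = unitary_relsD[OF R] and Wd = lin_subspaceD[OF W]
  interpret U: group "unitary_group m" by (rule group_unitary_group)
  have Xc: "X \<in> carrier_mat m m" by (rule unitaryD(1)[OF RD(1)])
  have Ac: "A i \<in> carrier_mat m m" if "i \<in> {1..n}" for i by (rule unitaryD(1)[OF RD(2)[OF that]])
  obtain v0 where v0: "v0 \<in> W" "v0 \<noteq> 0\<^sub>v m" and ev0: "\<exists>a. X *\<^sub>v v0 = a \<cdot>\<^sub>v v0"
  proof -
    have "\<exists>v\<in>W. v \<noteq> 0\<^sub>v m \<and> (\<exists>a. X *\<^sub>v v = a \<cdot>\<^sub>v v)"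
      by (rule eigenvector_in_subspace[OF Xc W bspec[OF invX] w])
    then show ?thesis using that by (elim bexE conjE)
  qed
  obtain a0 where a0: "X *\<^sub>v v0 = a0 \<cdot>\<^sub>v v0" using ev0 by (elim exE)
  obtain j where j: "j \<in> {1..s}" "a0 = lam j" using spec Wd(1)[OF v0(1)] v0(2) a0 unfolding eigenvalues_in_def by blast
  define V where "V = {w \<in> W. X *\<^sub>v w = lam j \<cdot>\<^sub>v w}"
  have VW: "w \<in> W" and VX: "X *\<^sub>v w = lam j \<cdot>\<^sub>v w" if "w \<in> V" for w using that by (simp_all add: V_def)
  have Vc: "w \<in> carrier_vec m" if "w \<in> V" for w by (rule Wd(1)[OF VW[OF that]])
  have VI: "w \<in> V" if "w \<in> W" "X *\<^sub>v w = lam j \<cdot>\<^sub>v w" for w using that by (simp add: V_def)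
  have V: "lin_subspace m V"
    unfolding lin_subspace_def
  proof (intro conjI ballI allI subsetI)
    show "0\<^sub>v m \<in> V" using Wd(2) Xc by (intro VI) (auto intro!: eq_vecI)
    show "x + y \<in> V" if "x \<in> V" "y \<in> V" for x y
      using Vc[OF that(1)] Vc[OF that(2)] Wd(3)[OF VW[OF that(1)] VW[OF that(2)]] VX[OF that(1)] VX[OF that(2)] Xc
      by (intro VI) (simp_all add: mult_add_distrib_mat_vec[of _ m m] smult_add_distrib_vec[of _ m])
    show "b \<cdot>\<^sub>v x \<in> V" if "x \<in> V" for b x
      using Vc[OF that] Wd(4)[OF VW[OF that]] VX[OF that] Xc
      by (intro VI) (simp_all add: mult_mat_vec[of _ m m] smult_smult_assoc mult.commute)
  qed (rule Vc)
  have AV: "A i *\<^sub>v w \<in> V" if "i \<in> {1..n}" "w \<in> V" for i w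
    by (rule VI[OF bspec[OF bspec[OF inv that(1)] VW[OF that(2)]] rels_on_eigenspace(2)[OF R j(1) that(1) that(1) Vc[OF that(2)] VX[OF that(2)]]])
  have tw: "A i *\<^sub>v (A i' *\<^sub>v w) = twist j i i' \<cdot>\<^sub>v (A i' *\<^sub>v (A i *\<^sub>v w))"
    if "i \<in> {1..n}" "i' \<in> {1..n}" "w \<in> V" for i i' w
    by (rule rels_on_eigenspace(3)[OF R j(1) that(1,2) Vc[OF that(3)] VX[OF that(3)]])
  have Alin: "A i *\<^sub>v (a \<cdot>\<^sub>v w) = a \<cdot>\<^sub>v (A i *\<^sub>v w)" if "i \<in> {1..n}" "w \<in> V" for i a w
    using Ac[OF that(1)] Vc[OF that(2)] by (rule mult_mat_vec)
  have tw0: "twist j i i' \<noteq> 0" for i i' using lam_nonzero[OF j(1)] by (simp add: twist_def)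
  define d where "d i = (if i \<in> {t+1..2*t} then N j i else 1)" for i
  define T where "T i = A i [^]\<^bsub>unitary_group m\<^esub> d i" for i
  have TU: "T i \<in> unitary m" if "i \<in> {1..n}" for i
    unfolding T_def by (rule U.nat_pow_closed[OF RD(2)[OF that]])
  have Tv: "T i *\<^sub>v w = ((*\<^sub>v) (A i) ^^ d i) w" if "i \<in> {1..n}" "w \<in> V" for i w
    unfolding T_def by (rule unitary_pow_mult_vec[OF RD(2)[OF that(1)] Vc[OF that(2)]])
  have powV: "((*\<^sub>v) (A i) ^^ q) w \<in> V" if "i \<in> {1..n}" "w \<in> V" for i q w
    by (rule funpow_closed[OF _ that(2)]) (rule AV[OF that(1)])
  have powlin: "((*\<^sub>v) (A i) ^^ q) (a \<cdot>\<^sub>v w) = a \<cdot>\<^sub>v ((*\<^sub>v) (A i) ^^ q) w" if "i \<in> {1..n}" "w \<in> V" for i q a w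
    by (induction q) (simp_all add: Alin[OF that(1) powV[OF that]])
  have "\<exists>v\<in>V. v \<noteq> 0\<^sub>v m \<and> (\<forall>i\<in>{1..n}. \<exists>a. T i *\<^sub>v v = a \<cdot>\<^sub>v v)"
  proof (rule joint_eigenvector[OF _ V _ v0(2)])
    show "v0 \<in> V" using v0 a0 j by (intro VI) simp_all
    show "T i \<in> carrier_mat m m" if "i \<in> {1..n}" for i by (rule unitaryD(1)[OF TU[OF that]])
    show "T i *\<^sub>v w \<in> V" if "i \<in> {1..n}" "w \<in> V" for i w
      unfolding Tv[OF that] by (rule powV[OF that])
    show "T i *\<^sub>v (T i' *\<^sub>v w) = T i' *\<^sub>v (T i *\<^sub>v w)" if ii: "i \<in> {1..n}" "i' \<in> {1..n}" and w: "w \<in> V" for i i' w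
    proof -
      \<comment> \<open>Commutation in two rounds: A_i is moved past the whole power of A_i', then
        this is repeated for the power of A_i. The twist is raised to both exponents and becomes
        1.\<close>
      let ?P = "(*\<^sub>v) (A i)" and ?Q = "(*\<^sub>v) (A i') ^^ d i'" and ?\<theta> = "twist j i i' ^ d i'"
      have 1: "?P (?Q w) = ?\<theta> \<cdot>\<^sub>v ?Q (?P w)" if "w \<in> V" for w

        by (rule funpow_twist[where V = V and f = ?P and g = "(*\<^sub>v) (A i')" and \<theta> = "twist j i i'"])
          (fact that | erule AV[OF ii(1)] AV[OF ii(2)] Alin[OF ii(2)] tw[OF ii])+
      have th0: "?\<theta> \<noteq> 0" using tw0 by simp
      have 2: "?Q (?P w) = inverse ?\<theta> \<cdot>\<^sub>v ?P (?Q w)" if "w \<in> V" for w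
        unfolding 1[OF that] using th0 by (simp add: smult_smult_assoc)
      have "?Q ((?P ^^ d i) w) = inverse ?\<theta> ^ d i \<cdot>\<^sub>v (?P ^^ d i) (?Q w)"

        by (rule funpow_twist[where V = V and f = ?Q and g = ?P and \<theta> = "inverse ?\<theta>"])
          (fact w | erule powV[OF ii(2)] AV[OF ii(1)] Alin[OF ii(1)] 2)+
      also have "inverse ?\<theta> ^ d i = 1"
        using twist_pow_N[OF j(1) ii] unfolding d_def power_inverse by (simp only: inverse_1)
      finally show ?thesis
        using Tv[OF ii(1) w] Tv[OF ii(2) w] Tv[OF ii(1) powV[OF ii(2) w]] Tv[OF ii(2) powV[OF ii(1) w]] by simp
    qed
  qed simp
  then obtain v where v: "v \<in> V" "v \<noteq> 0\<^sub>v m" "\<forall>i\<in>{1..n}. \<exists>a. T i *\<^sub>v v = a \<cdot>\<^sub>v v" by (elim bexE conjE)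
  obtain a where a: "T i *\<^sub>v v = a i \<cdot>\<^sub>v v" if "i \<in> {1..n}" for i using bchoice[OF v(3)] by (elim exE) blast
  have na: "norm (a i) = 1" if "i \<in> {1..n}" for i
    by (rule unitary_eigenvalue_norm[OF TU[OF that] Vc[OF v(1)] v(2) a[OF that]])
  \<comment> \<open>A root of a number of modulus one has modulus one, so the parameters lie on the
    circle.\<close>
  have "\<exists>b. b ^ d i = a i \<and> norm b = 1" if "i \<in> {1..n}" for i
  proof -
    have d: "d i \<noteq> 0" using N_pos[OF j(1), of i] by (simp add: d_def)
    obtain b where b: "a i = b ^ d i" using exists_complex_root[OF d] by blast
    have "norm b ^ d i = 1 ^ d i" using na[OF that] by (simp only: b norm_power power_one)
    then have "norm b = 1" by (rule power_eq_imp_eq_base) (use d in simp_all)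
    then show ?thesis using b by (intro exI[of _ b]) simp
  qed
  then obtain z where z: "z i ^ d i = a i" "norm (z i) = 1" if "i \<in> {1..n}" for i
    using bchoice[of "{1..n}" "\<lambda>i b. b ^ d i = a i \<and> norm b = 1"] by blast
  obtain r where r: "(r \<cdot>\<^sub>v v) \<bullet>c (r \<cdot>\<^sub>v v) = 1" by (rule normalize_vec[OF Vc[OF v(1)] v(2)])
  have rV: "r \<cdot>\<^sub>v v \<in> V" by (rule lin_subspaceD(4)[OF V v(1)])
  have Tr: "T i *\<^sub>v (r \<cdot>\<^sub>v v) = z i ^ d i \<cdot>\<^sub>v (r \<cdot>\<^sub>v v)" if "i \<in> {1..n}" for i
    using unitaryD(1)[OF TU[OF that]] Vc[OF v(1)] a[OF that] z(1)[OF that]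
    by (simp add: mult_mat_vec[of _ m m] smult_smult_assoc mult.commute)
  show ?thesis
  proof (rule that[OF j(1) z(2) VW[OF rV] r VX[OF rV]])
    show "A i *\<^sub>v (r \<cdot>\<^sub>v v) = z i \<cdot>\<^sub>v (r \<cdot>\<^sub>v v)" if "i \<in> {1..n}" "i \<notin> {t+1..2*t}" for i
    proof -
      have "d i = 1" unfolding d_def using that(2) by (rule if_not_P)
      then show ?thesis using Tr[OF that(1)] Tv[OF that(1) rV] by simp
    qed
    show "(A i [^]\<^bsub>unitary_group m\<^esub> N j i) *\<^sub>v (r \<cdot>\<^sub>v v) = z i ^ N j i \<cdot>\<^sub>v (r \<cdot>\<^sub>v v)" if "i \<in> {t+1..2*t}" for i
      using Tr[of i] that t2n by (simp add: T_def d_def)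
  qed
qed

definition block_system ::
  "nat \<Rightarrow> complex mat \<Rightarrow> (nat \<Rightarrow> complex mat) \<Rightarrow> nat \<Rightarrow> (nat \<Rightarrow> nat) \<Rightarrow> (nat \<Rightarrow> nat \<Rightarrow> complex) \<Rightarrow>
    (nat \<Rightarrow> (nat \<Rightarrow> nat) \<Rightarrow> complex vec) \<Rightarrow> bool" where
  "block_system m X A r J Z u \<longleftrightarrow>
     (\<forall>b<r. J b \<in> {1..s} \<and> (\<forall>i\<in>{1..n}. norm (Z b i) = 1) \<and> model_block m X A (J b) (Z b) (u b)) \<and>
     orthonormal m (SIGMA b:{..<r}. Box (J b)) (\<lambda>(b, e). u b e)"

text \<open>Each operator permutes the lines spanned by the basis vectors of a block, so it
  preserves the orthogonal complement of the block.\<close>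

lemma block_system_orthogonal_invariant:
  assumes R: "unitary_rels m X A" and S: "block_system m X A r J Z u"
    and w: "w \<in> carrier_vec m" "\<And>b e. b < r \<Longrightarrow> e \<in> Box (J b) \<Longrightarrow> w \<bullet>c u b e = 0"
    and b: "b < r" "e \<in> Box (J b)"
  shows "(X *\<^sub>v w) \<bullet>c u b e = 0" and "i \<in> {1..n} \<Longrightarrow> (A i *\<^sub>v w) \<bullet>c u b e = 0"
proof -
  note RD = unitary_relsD[OF R]
  have mb: "J b \<in> {1..s}" "model_block m X A (J b) (Z b) (u b)" and Z: "\<And>i. i \<in> {1..n} \<Longrightarrow> norm (Z b i) = 1"
    using S b(1) by (simp_all add: block_system_def)
  have uc: "u b e \<in> carrier_vec m" if "e \<in> Box (J b)" for e
    using mb(2) that by (simp add: model_block_def)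
  show "(X *\<^sub>v w) \<bullet>c u b e = 0"
  proof (rule unitary_preserves_orthogonal[OF RD(1), of "Box (J b)" "u b"])
    fix e' assume e': "e' \<in> Box (J b)"
    then have "lam (J b) \<noteq> 0 \<and> X *\<^sub>v u b e' = lam (J b) \<cdot>\<^sub>v u b e'"
      using mb lam_nonzero[OF mb(1)] by (simp add: model_block_def)
    then show "\<exists>i'\<in>Box (J b). \<exists>a. a \<noteq> 0 \<and> X *\<^sub>v u b i' = a \<cdot>\<^sub>v u b e'"
      using e' by (intro bexI[of _ e'] exI[of _ "lam (J b)"])
  qed (use uc w b in auto)
  show "(A i *\<^sub>v w) \<bullet>c u b e = 0" if i: "i \<in> {1..n}"
  proof (rule unitary_preserves_orthogonal[OF RD(2)[OF i], of "Box (J b)" "u b"])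
    fix e' assume "e' \<in> Box (J b)"
    then have "e' \<in> shift (J b) i ` Box (J b)" using shift_surj[OF mb(1)] by simp
    then obtain e0 where e0: "e0 \<in> Box (J b)" "e' = shift (J b) i e0" by (elim imageE) simp
    have "norm (coef (J b) (Z b) i e0) = 1"
      using norm_coef[of "J b" "Z b" i e0] mb(1) Z[OF i] by simp
    then have "coef (J b) (Z b) i e0 \<noteq> 0 \<and> A i *\<^sub>v u b e0 = coef (J b) (Z b) i e0 \<cdot>\<^sub>v u b e'"
      using mb(2) e0 i by (auto simp: model_block_def)
    then show "\<exists>i'\<in>Box (J b). \<exists>a. a \<noteq> 0 \<and> A i *\<^sub>v u b i' = a \<cdot>\<^sub>v u b e'"
      using e0(1) by (intro bexI[of _ e0] exI[of _ "coef (J b) (Z b) i e0"])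
  qed (use uc w b in auto)
qed

lemma finite_blocks: "finite (SIGMA b:{..<r::nat}. Box (J b))"
  by (intro finite_SigmaI finite_Box finite_lessThan)

text \<open>If the blocks do not fill the space, their orthogonal complement is a nonzero invariant
  subspace; a cyclic system found inside it is automatically orthogonal to the old blocks.\<close>

lemma block_system_extend:
  assumes R: "unitary_rels m X A" and S: "block_system m X A r J Z u"
    and spec: "eigenvalues_in m X (lam ` {1..s})"
    and card: "card (SIGMA b:{..<r}. Box (J b)) < m"
  shows "\<exists>J Z u. block_system m X A (Suc r) J Z u"
proof -
  let ?I = "SIGMA b:{..<r}. Box (J b)"
  have on: "orthonormal m ?I (\<lambda>(b, e). u b e)" using S by (simp add: block_system_def)
  have uc: "u b e \<in> carrier_vec m" if "b < r" "e \<in> Box (J b)" for b e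
    using on that by (fastforce simp: orthonormal_def)
  obtain w where w: "w \<in> carrier_vec m" "w \<noteq> 0\<^sub>v m" and w2: "\<And>i. i \<in> ?I \<Longrightarrow> w \<bullet>c (\<lambda>(b, e). u b e) i = 0"
    using orthonormal_extend[OF on finite_blocks card] by metis
  define W where "W = {w \<in> carrier_vec m. \<forall>i\<in>?I. w \<bullet>c (\<lambda>(b, e). u b e) i = 0}"
  have W: "lin_subspace m W"
    unfolding W_def by (rule orthogonal_subspace) (use uc in auto)
  have WI: "w \<in> W" if "w \<in> carrier_vec m" "\<And>b e. b < r \<Longrightarrow> e \<in> Box (J b) \<Longrightarrow> w \<bullet>c u b e = 0" for w
    using that by (auto simp: W_def)
  have WD: "w \<bullet>c u b e = 0" if "w \<in> W" "b < r" "e \<in> Box (J b)" for w b e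
    using that by (auto simp: W_def)
  have wW: "w \<in> W" by (rule WI[OF w(1)]) (use w2[of "(_, _)"] in simp)
  note Wc = lin_subspaceD(1)[OF W] and RD = unitary_relsD[OF R]
  have invX': "X *\<^sub>v w \<in> W" if "w \<in> W" for w
    using unitaryD(1)[OF RD(1)] Wc[OF that]
    by (intro WI block_system_orthogonal_invariant(1)[OF R S] WD[OF that]) auto
  have inv': "A i *\<^sub>v w \<in> W" if "i \<in> {1..n}" "w \<in> W" for i w
    using unitaryD(1)[OF RD(2)[OF that(1)]] Wc[OF that(2)] that(1)
    by (intro WI block_system_orthogonal_invariant(2)[OF R S] WD[OF that(2)]) auto
  have invX: "\<forall>w\<in>W. X *\<^sub>v w \<in> W" using invX' by simp
  have inv: "\<forall>i\<in>{1..n}. \<forall>w\<in>W. A i *\<^sub>v w \<in> W" using inv' by simp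
  obtain j z v where v: "j \<in> {1..s}" "\<And>i. i \<in> {1..n} \<Longrightarrow> norm (z i) = 1" "v \<in> W" "v \<bullet>c v = 1"
    "X *\<^sub>v v = lam j \<cdot>\<^sub>v v" "\<And>i. i \<in> {1..n} \<Longrightarrow> i \<notin> {t+1..2*t} \<Longrightarrow> A i *\<^sub>v v = z i \<cdot>\<^sub>v v"
    "\<And>i. i \<in> {t+1..2*t} \<Longrightarrow> (A i [^]\<^bsub>unitary_group m\<^esub> N j i) *\<^sub>v v = z i ^ N j i \<cdot>\<^sub>v v"
    using joint_model_vector[OF R W invX inv spec wW w(2)] by metis
  obtain u' where u': "model_block m X A j z u'" "orthonormal m (Box j) u'" "\<And>e. u' e \<in> W"
    using cyclic_system[OF R W inv' v] by metis
  define J' Z' U' where "J' = J(r := j)" and "Z' = Z(r := z)" and "U' = u(r := u')"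
  have "block_system m X A (Suc r) J' Z' U'"
    unfolding block_system_def
  proof (intro conjI allI impI)
    fix b assume b: "b < Suc r"
    show "J' b \<in> {1..s}" "\<forall>i\<in>{1..n}. norm (Z' b i) = 1" "model_block m X A (J' b) (Z' b) (U' b)"
      using S v(1,2) u'(1) b by (auto simp: block_system_def J'_def Z'_def U'_def less_Suc_eq)
  next
    show "orthonormal m (SIGMA b:{..<Suc r}. Box (J' b)) (\<lambda>(b, e). U' b e)"
      unfolding orthonormal_def
    proof (intro conjI ballI, goal_cases)
      case (1 i)
      then show ?case using uc Wc[OF u'(3)] by (auto simp: J'_def U'_def less_Suc_eq)
    next
      case (2 i i')
      obtain b e b' e' where i: "i = (b, e)" "i' = (b', e')" by (metis surj_pair)
      have b: "b < Suc r" "b' < Suc r" "e \<in> Box (J' b)" "e' \<in> Box (J' b')" using 2 i by auto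
      consider "b = r" "b' = r" | "b = r" "b' < r" | "b < r" "b' = r" | "b < r" "b' < r" using b by linarith
      then show ?case
      proof cases
        case 1
        then show ?thesis using u'(2) b i by (simp add: orthonormal_def J'_def U'_def)
      next
        case 2
        then show ?thesis using WD[OF u'(3)] b i by (simp add: J'_def U'_def)
      next
        case 3
        have "u' e' \<bullet>c u b e = 0" using 3 WD[OF u'(3)] b by (simp add: J'_def)
        moreover have "u b e \<in> carrier_vec m" using 3 b by (intro uc) (simp_all add: J'_def)
        ultimately have "u b e \<bullet>c u' e' = 0" using cscalar_prod_eq_0_commute[OF Wc[OF u'(3)], of "u b e" e'] by simp
        then show ?thesis using 3 b i by (simp add: J'_def U'_def)
      next
        case 4
        have "(b, e) \<in> ?I" "(b', e') \<in> ?I" using 4 b by (auto simp: J'_def)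
        then show ?thesis using on 4 i unfolding orthonormal_def by (force simp: J'_def U'_def)
      qed
    qed
  qed
  then show ?thesis by (intro exI)
qed

text \<open>A system with the largest number of blocks fills the space, since otherwise it could be
  extended. A largest number exists because every block contributes at least one vector to an
  orthonormal family of size at most m.\<close>

lemma decomposition:
  assumes R: "unitary_rels m X A"
    and spec: "eigenvalues_in m X (lam ` {1..s})"
  obtains r J Z u where "block_system m X A r J Z u" "card (SIGMA b:{..<r}. Box (J b)) = m"
proof -
  let ?P = "\<lambda>r. \<exists>J Z u. block_system m X A r J Z u"
  have bound: "r \<le> card (SIGMA b:{..<r}. Box (J b)) \<and> card (SIGMA b:{..<r}. Box (J b)) \<le> m"
    if S: "block_system m X A r J Z u" for r J Z u
  proof
    have on: "orthonormal m (SIGMA b:{..<r}. Box (J b)) (\<lambda>(b, e). u b e)" using S by (simp add: block_system_def)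
    show "card (SIGMA b:{..<r}. Box (J b)) \<le> m" by (rule orthonormal_card_le[OF on finite_blocks])
    have pos: "card (Box (J b)) \<ge> 1" if "b < r" for b
    proof -
      have "J b \<in> {1..s}" using S that by (simp add: block_system_def)
      then have "(\<Prod>i = 1..t. N (J b) i) > 0" using N_pos by (intro prod_pos) auto
      then show ?thesis unfolding card_Box by linarith
    qed
    have "(\<Sum>b<r. 1) \<le> (\<Sum>b<r. card (Box (J b)))" by (rule sum_mono) (use pos in auto)
    then show "r \<le> card (SIGMA b:{..<r}. Box (J b))"
      using finite_Box by (subst card_SigmaI) auto
  qed
  have P0: "?P 0"
    by (intro exI[of _ "\<lambda>_. 0"] exI[of _ "\<lambda>_ _. 0"] exI[of _ "\<lambda>_ _. 0\<^sub>v m"]) (simp add: block_system_def orthonormal_def)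
  have Pb: "\<forall>r. ?P r \<longrightarrow> r \<le> m"
  proof (intro allI impI, elim exE)
    fix r J Z u assume "block_system m X A r J Z u"
    from bound[OF this] show "r \<le> m" by linarith
  qed
  define r where "r = (GREATEST r. ?P r)"
  have Pr: "?P r" unfolding r_def by (rule GreatestI_nat[of ?P 0 m]) (use P0 Pb in blast)+
  then obtain J Z u where S: "block_system m X A r J Z u" by (elim exE)
  have "\<not> card (SIGMA b:{..<r}. Box (J b)) < m"
  proof
    assume "card (SIGMA b:{..<r}. Box (J b)) < m"
    from block_system_extend[OF R S spec this] have "?P (Suc r)" .
    then have "Suc r \<le> r" unfolding r_def by (rule Greatest_le_nat[of ?P _ m]) (use Pb in blast)
    then show False by simp
  qed
  then have "card (SIGMA b:{..<r}. Box (J b)) = m" using bound[OF S] by linarith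
  then show ?thesis using that S by blast
qed

text \<open>The blocks diagonalize X with eigenvalue lam_j on every vector of a block of type j, so
  the multiplicity of lam_j in the characteristic polynomial counts the blocks of that type. This is
  the origin of the integers l_j.\<close>

lemma decomposition_count:
  assumes R: "unitary_rels m X A" and p: "char_poly X = (\<Prod>j = 1..s. [:- lam j, 1:] ^ \<mu> j)"
  obtains r J Z u where "block_system m X A r J Z u" "card (SIGMA b:{..<r}. Box (J b)) = m"
    "\<And>j. j \<in> {1..s} \<Longrightarrow> \<mu> j = card {b \<in> {..<r}. J b = j} * card (Box j)"
proof -
  note RD = unitary_relsD[OF R]
  have Xc: "X \<in> carrier_mat m m" by (rule unitaryD(1)[OF RD(1)])
  have "a \<in> lam ` {1..s}" if "v \<in> carrier_vec m" "v \<noteq> 0\<^sub>v m" "X *\<^sub>v v = a \<cdot>\<^sub>v v" for a v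
  proof -
    have "eigenvalue X a" using that Xc by (auto simp: eigenvalue_def eigenvector_def)
    then have "poly (char_poly X) a = 0" using eigenvalue_root_char_poly[OF Xc] by simp
    then show ?thesis unfolding p by (auto simp: poly_prod)
  qed
  then have spec: "eigenvalues_in m X (lam ` {1..s})" unfolding eigenvalues_in_def by blast
  obtain r J Z u where S: "block_system m X A r J Z u" and card: "card (SIGMA b:{..<r}. Box (J b)) = m"
    using decomposition[OF R spec] by blast
  let ?I = "SIGMA b:{..<r}. Box (J b)"
  have on: "orthonormal m ?I (\<lambda>(b, e). u b e)" using S by (simp add: block_system_def)
  obtain ix where "bij_betw ix {0..<card ?I} ?I" using ex_bij_betw_nat_finite[OF finite_blocks] by blast
  then have ix: "bij_betw ix {..<m} ?I" unfolding card by (simp only: lessThan_atLeast0)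
  let ?g = "frame_mat m ix (\<lambda>(b, e). u b e)"
  have "X * ?g = ?g * monomial_mat m ix id (\<lambda>(b, e). lam (J b))"
  proof (rule frame_mat_intertwines[OF _ ix Xc])
    fix i assume i: "i \<in> ?I"
    then obtain b e where be: "i = (b, e)" "b < r" "e \<in> Box (J b)" by auto
    then have mb: "model_block m X A (J b) (Z b) (u b)" using S by (simp add: block_system_def)
    then show "(\<lambda>(b, e). u b e) i \<in> carrier_vec m" using be by (simp add: model_block_def)
    show "id i \<in> ?I \<and> X *\<^sub>v (\<lambda>(b, e). u b e) i = (\<lambda>(b, e). lam (J b)) i \<cdot>\<^sub>v (\<lambda>(b, e). u b e) (id i)"
      using mb i be by (simp add: model_block_def)
  qed
  from char_poly_diagonalized[OF frame_mat_unitary[OF on ix] Xc ix this]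
  have cp: "char_poly X = (\<Prod>i\<in>?I. [:- (\<lambda>(b, e). lam (J b)) i, 1:])" .
  have "(\<Prod>j = 1..s. [:- lam j, 1:] ^ \<mu> j) = (\<Prod>j = 1..s. \<Prod>i<\<mu> j. [:- lam j, 1:])" by simp
  also have "\<dots> = (\<Prod>(j, i)\<in>(SIGMA j:{1..s}. {..<\<mu> j}). [:- lam j, 1:])"
    by (rule prod.Sigma) auto
  finally have cp': "char_poly X = (\<Prod>x\<in>(SIGMA j:{1..s}. {..<\<mu> j}). [:- lam (fst x), 1:])"
    unfolding p by (simp add: case_prod_beta)
  have "\<mu> j = card {b \<in> {..<r}. J b = j} * card (Box j)" if j: "j \<in> {1..s}" for j
  proof -
    have "order (lam j) (char_poly X) = card {x \<in> (SIGMA j:{1..s}. {..<\<mu> j}). lam (fst x) = lam j}"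
      unfolding cp' by (rule order_prod_linear) auto
    also have "{x \<in> (SIGMA j:{1..s}. {..<\<mu> j}). lam (fst x) = lam j} = {j} \<times> {..<\<mu> j}"
      using j lam_inj by (auto simp: inj_on_eq_iff)
    finally have 1: "order (lam j) (char_poly X) = \<mu> j" by simp
    have "order (lam j) (char_poly X) = card {x \<in> ?I. (\<lambda>(b, e). lam (J b)) x = lam j}"
      unfolding cp by (rule order_prod_linear[OF finite_blocks])
    also have "{x \<in> ?I. (\<lambda>(b, e). lam (J b)) x = lam j} = {b \<in> {..<r}. J b = j} \<times> Box j"
    proof -
      have "J b \<in> {1..s}" if "b < r" for b using S that by (simp add: block_system_def)
      then have "lam (J b) = lam j \<longleftrightarrow> J b = j" if "b < r" for b
        using that j lam_inj by (simp add: inj_on_eq_iff)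
      then show ?thesis by auto
    qed
    finally show ?thesis using 1 by (simp add: card_cartesian_product)
  qed
  then show ?thesis using that S card by blast
qed

end

section \<open>Block indices\<close>

definition block_offset :: "(nat \<Rightarrow> nat) \<Rightarrow> nat \<Rightarrow> nat" where
  "block_offset \<mu> j = (\<Sum>r = 1..<j. \<mu> r)"

definition block_pos :: "(nat \<Rightarrow> nat) \<Rightarrow> nat \<times> nat \<Rightarrow> nat" where
  "block_pos \<mu> = (\<lambda>(j, i). block_offset \<mu> j + i)"

definition block_index :: "nat \<Rightarrow> (nat \<Rightarrow> nat) \<Rightarrow> nat \<Rightarrow> nat \<times> nat" where
  "block_index s \<mu> = the_inv_into (SIGMA j:{1..s}. {..<\<mu> j}) (block_pos \<mu>)"

lemma bij_betw_block_pos: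
  "bij_betw (block_pos \<mu>) (SIGMA j:{1..s}. {..<\<mu> j}) {..<(\<Sum>j = 1..s. \<mu> j)}"
proof (induction s)
  case (Suc s)
  let ?M = "\<Sum>j = 1..s. \<mu> j"
  have o: "block_offset \<mu> (Suc s) = ?M"
    by (simp add: block_offset_def atLeastLessThanSuc_atLeastAtMost)
  have 1: "bij_betw (block_pos \<mu>) ({Suc s} \<times> {..<\<mu> (Suc s)}) {?M..<?M + \<mu> (Suc s)}"
    unfolding bij_betw_def
  proof
    show "inj_on (block_pos \<mu>) ({Suc s} \<times> {..<\<mu> (Suc s)})"
      by (auto simp: inj_on_def block_pos_def)
    show "block_pos \<mu> ` ({Suc s} \<times> {..<\<mu> (Suc s)}) = {?M..<?M + \<mu> (Suc s)}"
    proof (intro equalityI subsetI)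
      fix p assume p: "p \<in> {?M..<?M + \<mu> (Suc s)}"
      then have "p = block_pos \<mu> (Suc s, p - ?M)" by (simp add: block_pos_def o)
      moreover have "(Suc s, p - ?M) \<in> {Suc s} \<times> {..<\<mu> (Suc s)}" using p by auto
      ultimately show "p \<in> block_pos \<mu> ` ({Suc s} \<times> {..<\<mu> (Suc s)})" by (rule image_eqI)
    qed (auto simp: block_pos_def o)
  qed
  have 2: "(SIGMA j:{1..Suc s}. {..<\<mu> j}) = (SIGMA j:{1..s}. {..<\<mu> j}) \<union> {Suc s} \<times> {..<\<mu> (Suc s)}"
    by (auto simp: le_Suc_eq)
  have 3: "{..<(\<Sum>j = 1..Suc s. \<mu> j)} = {..<?M} \<union> {?M..<?M + \<mu> (Suc s)}" by auto
  show ?case unfolding 2 3 by (rule bij_betw_combine[OF Suc 1]) auto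
qed (simp add: bij_betw_def)

lemma bij_betw_block_index:
  "bij_betw (block_index s \<mu>) {..<(\<Sum>j = 1..s. \<mu> j)} (SIGMA j:{1..s}. {..<\<mu> j})"
  unfolding block_index_def by (rule bij_betw_the_inv_into[OF bij_betw_block_pos])

lemma block_index_pos: "j \<in> {1..s} \<Longrightarrow> i < \<mu> j \<Longrightarrow> block_index s \<mu> (block_pos \<mu> (j, i)) = (j, i)"
  unfolding block_index_def
  by (rule the_inv_into_f_f[OF bij_betw_imp_inj_on[OF bij_betw_block_pos]]) simp

lemma block_pos_index: "p < (\<Sum>j = 1..s. \<mu> j) \<Longrightarrow> block_pos \<mu> (block_index s \<mu> p) = p"
  unfolding block_index_def by (rule f_the_inv_into_f_bij_betw[OF bij_betw_block_pos]) simp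

section \<open>Direct sums of model representations\<close>

lemma (in heisenberg_type) card_Box_pos: "j \<in> {1..s} \<Longrightarrow> card (Box j) > 0"
  unfolding card_Box by (rule prod_pos) (simp add: N_pos)

locale heisenberg_model = heisenberg_type +
  fixes m :: nat and \<mu> l :: "nat \<Rightarrow> nat"
  assumes m_eq: "m = (\<Sum>j = 1..s. \<mu> j)"
    and mu_eq: "\<And>j. j \<in> {1..s} \<Longrightarrow> \<mu> j = l j * card (Box j)"
begin

text \<open>A label (j, b, e) names the eigenvalue, the copy of its block, and the basis vector
  within that copy.\<close>

definition Ix :: "(nat \<times> nat \<times> (nat \<Rightarrow> nat)) set" where
  "Ix = (SIGMA j:{1..s}. {1..l j} \<times> Box j)"

lemma IxI: "j \<in> {1..s} \<Longrightarrow> b \<in> {1..l j} \<Longrightarrow> e \<in> Box j \<Longrightarrow> (j, b, e) \<in> Ix"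
  by (simp add: Ix_def)

lemma IxE:
  assumes "x \<in> Ix"
  obtains j b e where "x = (j, b, e)" "j \<in> {1..s}" "b \<in> {1..l j}" "e \<in> Box j"
  using assms unfolding Ix_def by (elim SigmaE) blast

text \<open>The numbering is constrained: a position and its label share the eigenvalue index. This
  makes \<open>model_x\<close> the block scalar matrix with respect to the sizes \<mu> j.\<close>

lemma ex_ix: "\<exists>ix. bij_betw ix {..<m} Ix \<and> (\<forall>p<m. fst (ix p) = fst (block_index s \<mu> p))"
proof -
  have "\<exists>f. bij_betw f {..<\<mu> j} ({1..l j} \<times> Box j)" if "j \<in> {1..s}" for j
    by (rule finite_same_card_bij) (simp_all add: finite_Box card_cartesian_product mu_eq[OF that])
  then obtain f where f: "\<And>j. j \<in> {1..s} \<Longrightarrow> bij_betw (f j) {..<\<mu> j} ({1..l j} \<times> Box j)" by metis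
  have "bij_betw (\<lambda>(j, i). (j, f j i)) (SIGMA j:{1..s}. {..<\<mu> j}) Ix"
    unfolding bij_betw_def
  proof
    show "inj_on (\<lambda>(j, i). (j, f j i)) (SIGMA j:{1..s}. {..<\<mu> j})"
    proof (rule inj_onI)
      fix x y assume xy: "x \<in> (SIGMA j:{1..s}. {..<\<mu> j})" "y \<in> (SIGMA j:{1..s}. {..<\<mu> j})"
        "(\<lambda>(j, i). (j, f j i)) x = (\<lambda>(j, i). (j, f j i)) y"
      obtain j i where x: "x = (j, i)" "j \<in> {1..s}" "i < \<mu> j" using xy(1) by auto
      obtain i' where y: "y = (j, i')" "i' < \<mu> j" using xy(2,3) x(1) by auto
      show "x = y" using xy(3) x y inj_onD[OF bij_betw_imp_inj_on[OF f[OF x(2)]], of i i'] by simp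
    qed
    show "(\<lambda>(j, i). (j, f j i)) ` (SIGMA j:{1..s}. {..<\<mu> j}) = Ix"
    proof (intro equalityI subsetI)
      fix x assume "x \<in> (\<lambda>(j, i). (j, f j i)) ` (SIGMA j:{1..s}. {..<\<mu> j})"
      then obtain j i where x: "x = (j, f j i)" "j \<in> {1..s}" "i < \<mu> j" by auto
      then have "f j i \<in> {1..l j} \<times> Box j" using bij_betwE[OF f[OF x(2)]] by simp
      then show "x \<in> Ix" using x by (simp add: Ix_def)
    next
      fix x assume "x \<in> Ix"
      then obtain j y where x: "x = (j, y)" "j \<in> {1..s}" "y \<in> {1..l j} \<times> Box j" unfolding Ix_def by blast
      then have "y \<in> f j ` {..<\<mu> j}" using bij_betw_imp_surj_on[OF f[OF x(2)]] by simp
      then obtain i where "i < \<mu> j" "y = f j i" by auto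
      then show "x \<in> (\<lambda>(j, i). (j, f j i)) ` (SIGMA j:{1..s}. {..<\<mu> j})"
        using x by (intro image_eqI[of _ _ "(j, i)"]) auto
    qed
  qed
  from bij_betw_trans[OF bij_betw_block_index this]
  have "bij_betw ((\<lambda>(j, i). (j, f j i)) \<circ> block_index s \<mu>) {..<m} Ix" by (simp only: m_eq)
  then show ?thesis
    by (intro exI[of _ "(\<lambda>(j, i). (j, f j i)) \<circ> block_index s \<mu>"]) (simp add: case_prod_beta)
qed

definition ix :: "nat \<Rightarrow> nat \<times> nat \<times> (nat \<Rightarrow> nat)" where
  "ix = (SOME ix. bij_betw ix {..<m} Ix \<and> (\<forall>p<m. fst (ix p) = fst (block_index s \<mu> p)))"

lemma ix: "bij_betw ix {..<m} Ix" "p < m \<Longrightarrow> fst (ix p) = fst (block_index s \<mu> p)"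
  using someI_ex[OF ex_ix] unfolding ix_def by blast+

definition pos :: "nat \<times> nat \<times> (nat \<Rightarrow> nat) \<Rightarrow> nat" where
  "pos = the_inv_into {..<m} ix"

lemma ix_in: "p < m \<Longrightarrow> ix p \<in> Ix"
  using bij_betwE[OF ix(1)] by simp

lemma pos: "x \<in> Ix \<Longrightarrow> pos x < m" "x \<in> Ix \<Longrightarrow> ix (pos x) = x"
  unfolding pos_def using bij_betwE[OF bij_betw_the_inv_into[OF ix(1)]]
    f_the_inv_into_f_bij_betw[OF ix(1)] by simp_all

lemma pos_ix: "p < m \<Longrightarrow> pos (ix p) = p"
  unfolding pos_def by (rule the_inv_into_f_f[OF bij_betw_imp_inj_on[OF ix(1)]]) simp

lemma pos_eq_iff: "x \<in> Ix \<Longrightarrow> y \<in> Ix \<Longrightarrow> pos x = pos y \<longleftrightarrow> x = y"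
  using pos(2) by metis

definition dl :: "nat \<times> nat \<times> (nat \<Rightarrow> nat) \<Rightarrow> complex vec" where
  "dl x = unit_vec m (pos x)"

lemma dl_closed: "dl x \<in> carrier_vec m"
  by (simp add: dl_def)

lemma vec_dl:
  assumes "w \<in> carrier_vec m" "x \<in> Ix"
  shows "w \<bullet>c dl x = vec_index w (pos x)"
proof -
  have "w \<bullet>c dl x = (\<Sum>i<m. if i = pos x then vec_index w i else 0)"
    unfolding cscalar_prod_sum[OF assms(1) dl_closed] using pos(1)[OF assms(2)]
    by (intro sum.cong) (auto simp: dl_def)
  then show ?thesis using pos(1)[OF assms(2)] by simp
qed

lemma orthonormal_dl: "orthonormal m Ix dl"
  unfolding orthonormal_def
proof (intro conjI ballI)
  fix x y assume xy: "x \<in> Ix" "y \<in> Ix"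
  have "vec_index (dl x) (pos y) = (if x = y then 1 else 0)"
    using pos(1)[OF xy(1)] pos(1)[OF xy(2)] pos_eq_iff[OF xy] by (auto simp: dl_def)
  then show "dl x \<bullet>c dl y = (if x = y then 1 else 0)"
    by (simp only: vec_dl[OF dl_closed xy(2)])
qed (rule dl_closed)

lemma monomial_dl:
  assumes "x \<in> Ix" "\<sigma> x \<in> Ix"
  shows "monomial_mat m ix \<sigma> \<kappa> *\<^sub>v dl x = \<kappa> x \<cdot>\<^sub>v dl (\<sigma> x)"
proof (rule eq_vecI)
  note px = pos[OF assms(1)] and ps = pos[OF assms(2)]
  have M: "monomial_mat m ix \<sigma> \<kappa> \<in> carrier_mat m m" by (simp add: monomial_mat_def)
  fix p assume "p < dim_vec (\<kappa> x \<cdot>\<^sub>v dl (\<sigma> x))"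
  then have p: "p < m" by (simp add: dl_def)
  have "vec_index (monomial_mat m ix \<sigma> \<kappa> *\<^sub>v dl x) p =
      (\<Sum>q<m. if q = pos x then monomial_mat m ix \<sigma> \<kappa> $$ (p, q) else 0)"
    unfolding mult_mat_vec_sum[OF M dl_closed p] using px(1) by (intro sum.cong) (auto simp: dl_def)
  also have "\<dots> = (if ix p = \<sigma> x then \<kappa> x else 0)"
    using px p by (simp add: monomial_mat_def)
  also have "ix p = \<sigma> x \<longleftrightarrow> p = pos (\<sigma> x)" using ps(2) pos_ix[OF p] by metis
  finally show "vec_index (monomial_mat m ix \<sigma> \<kappa> *\<^sub>v dl x) p = vec_index (\<kappa> x \<cdot>\<^sub>v dl (\<sigma> x)) p"
    using p ps(1) by (simp add: dl_def)
qed (simp add: monomial_mat_def dl_def)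

lemma mat_eq_dlI:
  assumes A: "A \<in> carrier_mat m m" and B: "B \<in> carrier_mat m m"
    and eq: "\<And>x. x \<in> Ix \<Longrightarrow> A *\<^sub>v dl x = B *\<^sub>v dl x"
  shows "A = B"
proof (rule eq_matI)
  fix p q assume "p < dim_row B" "q < dim_col B"
  then have pq: "p < m" "q < m" using B by auto
  have "vec_index (C *\<^sub>v dl (ix q)) p = C $$ (p, q)" if C: "C \<in> carrier_mat m m" for C
  proof -
    have "vec_index (C *\<^sub>v dl (ix q)) p = (\<Sum>r<m. if r = q then C $$ (p, r) else 0)"
      unfolding mult_mat_vec_sum[OF C dl_closed pq(1)] using pq
      by (intro sum.cong) (auto simp: dl_def pos_ix)
    then show ?thesis using pq by simp
  qed
  from this[OF A] this[OF B] show "A $$ (p, q) = B $$ (p, q)" using eq[OF ix_in[OF pq(2)]] by simp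
qed (use A B in auto)

text \<open>The columns are unit multiples of distinct standard basis vectors, so the matrix is the
  frame of an orthonormal family.\<close>

lemma monomial_unitary:
  assumes "\<And>x. x \<in> Ix \<Longrightarrow> \<sigma> x \<in> Ix" "inj_on \<sigma> Ix" "\<And>x. x \<in> Ix \<Longrightarrow> norm (\<kappa> x) = 1"
  shows "monomial_mat m ix \<sigma> \<kappa> \<in> unitary m"
proof -
  let ?V = "\<lambda>x. \<kappa> x \<cdot>\<^sub>v dl (\<sigma> x)"
  have "orthonormal m Ix ?V"
    unfolding orthonormal_def
  proof (intro conjI ballI)
    fix x y assume xy: "x \<in> Ix" "y \<in> Ix"
    have "?V x \<bullet>c ?V y = \<kappa> x * cnj (\<kappa> y) * (dl (\<sigma> x) \<bullet>c dl (\<sigma> y))"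
      using dl_closed by (simp add: cscalar_prod_smult[of _ m])
    also have "\<dots> = (if x = y then \<kappa> x * cnj (\<kappa> x) else 0)"
      using orthonormal_dl assms(1)[OF xy(1)] assms(1)[OF xy(2)] inj_on_eq_iff[OF assms(2) xy]
      by (simp add: orthonormal_def)
    also have "\<kappa> x * cnj (\<kappa> x) = 1" using complex_norm_square[of "\<kappa> x"] assms(3)[OF xy(1)] by simp
    finally show "?V x \<bullet>c ?V y = (if x = y then 1 else 0)" .
  qed (simp add: dl_closed)
  then have "frame_mat m ix ?V \<in> unitary m" by (rule frame_mat_unitary[OF _ ix(1)])
  also have "frame_mat m ix ?V = monomial_mat m ix \<sigma> \<kappa>"
  proof (rule eq_matI)
    fix p q assume "p < dim_row (monomial_mat m ix \<sigma> \<kappa>)" "q < dim_col (monomial_mat m ix \<sigma> \<kappa>)"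
    then have pq: "p < m" "q < m" by (simp_all add: monomial_mat_def)
    have s: "\<sigma> (ix q) \<in> Ix" by (rule assms(1)[OF ix_in[OF pq(2)]])
    have "ix p = \<sigma> (ix q) \<longleftrightarrow> p = pos (\<sigma> (ix q))" using pos(2)[OF s] pos_ix[OF pq(1)] by metis
    then show "frame_mat m ix ?V $$ (p, q) = monomial_mat m ix \<sigma> \<kappa> $$ (p, q)"
      using pq pos(1)[OF s] by (simp add: frame_mat_def monomial_mat_def dl_def)
  qed (simp_all add: frame_mat_def monomial_mat_def)
  finally show ?thesis .
qed

section \<open>The model representations\<close>

definition sft :: "nat \<Rightarrow> nat \<times> nat \<times> (nat \<Rightarrow> nat) \<Rightarrow> nat \<times> nat \<times> (nat \<Rightarrow> nat)" where
  "sft i = (\<lambda>(j, b, e). (j, b, shift j i e))"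

definition cf :: "(nat \<Rightarrow> nat \<Rightarrow> nat \<Rightarrow> complex) \<Rightarrow> nat \<Rightarrow> nat \<times> nat \<times> (nat \<Rightarrow> nat) \<Rightarrow> complex" where
  "cf z i = (\<lambda>(j, b, e). coef j (z j b) i e)"

definition model_mat :: "(nat \<Rightarrow> nat \<Rightarrow> nat \<Rightarrow> complex) \<Rightarrow> nat \<Rightarrow> complex mat" where
  "model_mat z i = monomial_mat m ix (sft i) (cf z i)"

definition model_x :: "complex mat" where
  "model_x = monomial_mat m ix id (\<lambda>(j, b, e). lam j)"

definition Zset :: "(nat \<Rightarrow> nat \<Rightarrow> nat \<Rightarrow> complex) set" where
  "Zset = (\<Pi>\<^sub>E j\<in>{1..s}. \<Pi>\<^sub>E b\<in>{1..l j}. \<Pi>\<^sub>E i\<in>{1..n}. sphere 0 1)"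

lemma Zset_norm: "z \<in> Zset \<Longrightarrow> j \<in> {1..s} \<Longrightarrow> b \<in> {1..l j} \<Longrightarrow> i \<in> {1..n} \<Longrightarrow> norm (z j b i) = 1"
  by (simp add: Zset_def PiE_iff)

lemma sft_in: "x \<in> Ix \<Longrightarrow> sft i x \<in> Ix"
  by (elim IxE) (simp add: sft_def IxI shift_in_Box del: atLeastAtMost_iff)

lemma sft_inj: "inj_on (sft i) Ix"
proof (rule inj_onI)
  fix x y assume xy: "x \<in> Ix" "y \<in> Ix" "sft i x = sft i y"
  from xy(1) obtain j b e where x: "x = (j, b, e)" "j \<in> {1..s}" "e \<in> Box j" by (elim IxE)
  from xy(2) obtain j' b' e' where y: "y = (j', b', e')" "e' \<in> Box j'" by (elim IxE)
  have "j = j'" "b = b'" "shift j i e = shift j i e'" using xy(3) x(1) y(1) by (auto simp: sft_def)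
  then show "x = y" using x y inj_onD[OF shift_inj[OF x(2)], of i e e'] by simp
qed

lemma model_mat_unitary: "z \<in> Zset \<Longrightarrow> i \<in> {1..n} \<Longrightarrow> model_mat z i \<in> unitary m"
  unfolding model_mat_def
proof (rule monomial_unitary[OF sft_in sft_inj])
  fix x assume z: "z \<in> Zset" "i \<in> {1..n}" and "x \<in> Ix"
  then obtain j b e where x: "x = (j, b, e)" "j \<in> {1..s}" "b \<in> {1..l j}" "e \<in> Box j" by (elim IxE)
  show "norm (cf z i x) = 1"
    unfolding x(1) cf_def prod.case by (rule norm_coef[where z = "z j b", OF x(2) Zset_norm[OF z(1) x(2,3) z(2)]])
qed

lemma model_x_unitary: "model_x \<in> unitary m"
  unfolding model_x_def
proof (rule monomial_unitary)
  fix x assume "x \<in> Ix"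
  then obtain j b e where x: "x = (j, b, e)" "j \<in> {1..s}" by (elim IxE)
  then show "norm ((\<lambda>(j, b, e). lam j) x) = 1" by (simp add: norm_lam del: atLeastAtMost_iff)
qed simp_all

lemma model_mat_dl:
  assumes "j \<in> {1..s}" "b \<in> {1..l j}" "e \<in> Box j"
  shows "model_mat z i *\<^sub>v dl (j, b, e) = coef j (z j b) i e \<cdot>\<^sub>v dl (j, b, shift j i e)"
  unfolding model_mat_def using monomial_dl[where x = "(j, b, e)" and \<sigma> = "sft i" and \<kappa> = "cf z i", OF IxI[OF assms] sft_in[OF IxI[OF assms]]]
  by (simp add: sft_def cf_def)

lemma model_x_dl:
  assumes "j \<in> {1..s}" "b \<in> {1..l j}" "e \<in> Box j"
  shows "model_x *\<^sub>v dl (j, b, e) = lam j \<cdot>\<^sub>v dl (j, b, e)"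
  unfolding model_x_def using monomial_dl[OF IxI[OF assms], of id] IxI[OF assms] by simp

lemma coef_shift:
  assumes "\<not> (i \<in> {1..t} \<and> i' = t + i)"
  shows "coef j z i (shift j i' e) = coef j z i e"
  using assms by (auto simp: coef_def shift_def)

lemma shift_commute: "shift j i (shift j i' e) = shift j i' (shift j i e)"
proof (cases "i \<in> {t+1..2*t} \<and> i' \<in> {t+1..2*t} \<and> i \<noteq> i'")
  case True
  then have "i - t \<noteq> i' - t" by auto
  then show ?thesis using True by (intro ext) (simp add: shift_def)
next
  case False
  then consider "i \<notin> {t+1..2*t}" | "i' \<notin> {t+1..2*t}" | "i = i'" by blast
  then show ?thesis by cases (simp_all only: shift_def if_False)
qed

text \<open>All identities are checked on basis vectors. Applying a_(t+i) raises e_i by one, which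
  multiplies the eigenvalue of a_i by lam_j^c_i, and this is the action of x^c_i.\<close>

lemma model_rels:
  assumes z: "z \<in> Zset"
  shows "unitary_rels m model_x (model_mat z)"
proof -
  interpret U: group "unitary_group m" by (rule group_unitary_group)
  note Xc = unitaryD(1)[OF model_x_unitary]
  have Ac: "model_mat z i \<in> carrier_mat m m" for i by (simp add: model_mat_def monomial_mat_def)
  have 1: "model_x * model_mat z i = model_mat z i * model_x" for i
  proof (rule mat_eq_dlI)
    fix x assume "x \<in> Ix"
    then obtain j b e where x: "x = (j, b, e)" and m: "j \<in> {1..s}" "b \<in> {1..l j}" "e \<in> Box j" by (elim IxE)
    note m' = m(1,2) shift_in_Box[OF m(1,3)]
    show "(model_x * model_mat z i) *\<^sub>v dl x = (model_mat z i * model_x) *\<^sub>v dl x"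
      unfolding x assoc_mult_mat_vec[OF Xc Ac dl_closed] assoc_mult_mat_vec[OF Ac Xc dl_closed] model_mat_dl[OF m] model_x_dl[OF m]
        mult_mat_vec[OF Xc dl_closed] mult_mat_vec[OF Ac dl_closed] model_x_dl[OF m']
      by (simp add: smult_smult_assoc mult.commute)
  qed (rule mult_carrier_mat[OF Xc Ac] mult_carrier_mat[OF Ac Xc])+
  have 2: "model_mat z i * model_mat z i' = model_mat z i' * model_mat z i"
    if "\<not> (i \<in> {1..t} \<and> i' = t + i)" "\<not> (i' \<in> {1..t} \<and> i = t + i')" for i i'
  proof (rule mat_eq_dlI)
    fix x assume "x \<in> Ix"
    then obtain j b e where x: "x = (j, b, e)" and m: "j \<in> {1..s}" "b \<in> {1..l j}" "e \<in> Box j" by (elim IxE)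
    note m' = m(1,2) shift_in_Box[OF m(1,3)]
    show "(model_mat z i * model_mat z i') *\<^sub>v dl x = (model_mat z i' * model_mat z i) *\<^sub>v dl x"
      unfolding x assoc_mult_mat_vec[OF Ac Ac dl_closed] model_mat_dl[OF m] mult_mat_vec[OF Ac dl_closed] model_mat_dl[OF m']
        coef_shift[OF that(1)] coef_shift[OF that(2)] shift_commute[of j i i']
      by (simp add: smult_smult_assoc mult.commute)
  qed (rule mult_carrier_mat[OF Ac Ac])+
  have Xp: "(model_x [^]\<^bsub>unitary_group m\<^esub> (q::nat)) *\<^sub>v dl (j, b, e) = lam j ^ q \<cdot>\<^sub>v dl (j, b, e)"
    if "j \<in> {1..s}" "b \<in> {1..l j}" "e \<in> Box j" for q j b e
    unfolding unitary_pow_mult_vec[OF model_x_unitary dl_closed]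
    by (induction q)
      (simp_all add: mult_mat_vec[OF Xc dl_closed] model_x_dl[OF that] smult_smult_assoc mult.commute)
  have 3: "model_mat z i * model_mat z (t + i) = model_x [^]\<^bsub>unitary_group m\<^esub> c i * (model_mat z (t + i) * model_mat z i)"
    if i: "i \<in> {1..t}" for i
  proof (rule mat_eq_dlI)
    have Pc: "model_x [^]\<^bsub>unitary_group m\<^esub> c i \<in> carrier_mat m m"
      by (rule unitaryD(1)[OF U.nat_pow_closed[OF model_x_unitary]])
    then show "model_x [^]\<^bsub>unitary_group m\<^esub> c i * (model_mat z (t + i) * model_mat z i) \<in> carrier_mat m m"
      by (rule mult_carrier_mat[OF _ mult_carrier_mat[OF Ac Ac]])
    fix x assume "x \<in> Ix"
    then obtain j b e where x: "x = (j, b, e)" and m: "j \<in> {1..s}" "b \<in> {1..l j}" "e \<in> Box j" by (elim IxE)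
    note m' = m(1,2) shift_in_Box[OF m(1,3)]
    have sh: "shift j i e = e" for e using i by (auto simp: shift_def)
    have e: "e i < N j i" using m(3) i by (auto simp: Box_def PiE_iff)
    \<comment> \<open>At the wrap-around e_i drops from N - 1 to 0, and the identity survives
      because lam_j^(c_i N) = 1.\<close>
    have "lam j ^ (c i * (Suc (e i) mod N j i)) = lam j ^ c i * lam j ^ (c i * e i)"
    proof (cases "Suc (e i) = N j i")
      case True
      have "lam j ^ c i * lam j ^ (c i * e i) = lam j ^ (c i * N j i)"
        unfolding True[symmetric] by (simp add: power_add)
      then show ?thesis using lam_pow_N[OF m(1) i] True by simp
    next
      case False
      then show ?thesis using e by (simp add: power_add)
    qed
    then have cf: "coef j (z j b) i (shift j (t + i) e) = lam j ^ c i * coef j (z j b) i e"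
      using i by (auto simp: coef_def shift_def)
    show "(model_mat z i * model_mat z (t + i)) *\<^sub>v dl x = (model_x [^]\<^bsub>unitary_group m\<^esub> c i * (model_mat z (t + i) * model_mat z i)) *\<^sub>v dl x"
      unfolding x assoc_mult_mat_vec[OF Ac Ac dl_closed] assoc_mult_mat_vec[OF Pc mult_carrier_mat[OF Ac Ac] dl_closed]
        model_mat_dl[OF m] mult_mat_vec[OF Ac dl_closed] model_mat_dl[OF m'] sh mult_mat_vec[OF Pc smult_carrier_vec[THEN iffD2, OF dl_closed]]
        mult_mat_vec[OF Pc dl_closed] Xp[OF m'] cf
      by (simp add: smult_smult_assoc mult_ac)
  qed (rule mult_carrier_mat[OF Ac Ac])
  show ?thesis
    unfolding heisenberg_rels_def using model_x_unitary model_mat_unitary[OF z] 1 2 3 by (simp del: atLeastAtMost_iff)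
qed

text \<open>An orthonormal family labelled like the standard basis, on which the operators act as in
  the model, is a unitary change of basis to the model.\<close>

lemma realize:
  assumes X: "X \<in> carrier_mat m m" and A: "\<And>i. i \<in> {1..n} \<Longrightarrow> A i \<in> carrier_mat m m"
    and V: "orthonormal m Ix V"
    and blk: "\<And>j b. j \<in> {1..s} \<Longrightarrow> b \<in> {1..l j} \<Longrightarrow> model_block m X A j (z j b) (\<lambda>e. V (j, b, e))"
  shows "frame_mat m ix V \<in> unitary m" "X * frame_mat m ix V = frame_mat m ix V * model_x"
    "i \<in> {1..n} \<Longrightarrow> A i * frame_mat m ix V = frame_mat m ix V * model_mat z i"
proof -
  have Vc: "V x \<in> carrier_vec m" if "x \<in> Ix" for x using V that by (simp add: orthonormal_def)
  show "frame_mat m ix V \<in> unitary m" by (rule frame_mat_unitary[OF V ix(1)])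
  show "X * frame_mat m ix V = frame_mat m ix V * model_x"
    unfolding model_x_def
  proof (rule frame_mat_intertwines[OF Vc ix(1) X])
    fix x assume "x \<in> Ix"
    then obtain j b e where x: "x = (j, b, e)" "j \<in> {1..s}" "b \<in> {1..l j}" "e \<in> Box j" by (elim IxE)
    show "id x \<in> Ix \<and> X *\<^sub>v V x = (\<lambda>(j, b, e). lam j) x \<cdot>\<^sub>v V (id x)"
      using blk[OF x(2,3)] x(1,4) \<open>x \<in> Ix\<close> by (simp add: model_block_def)
  qed
  show "A i * frame_mat m ix V = frame_mat m ix V * model_mat z i" if i: "i \<in> {1..n}"
    unfolding model_mat_def
  proof (rule frame_mat_intertwines[OF Vc ix(1) A[OF i]])
    fix x assume xI: "x \<in> Ix"
    then obtain j b e where x: "x = (j, b, e)" "j \<in> {1..s}" "b \<in> {1..l j}" "e \<in> Box j" by (elim IxE)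
    show "sft i x \<in> Ix \<and> A i *\<^sub>v V x = cf z i x \<cdot>\<^sub>v V (sft i x)"
      using blk[OF x(2,3)] x(1,4) sft_in[OF xI] i by (simp add: model_block_def sft_def cf_def)
  qed
qed

theorem conjugate_to_model:
  assumes R: "unitary_rels m X A" and p: "char_poly X = (\<Prod>j = 1..s. [:- lam j, 1:] ^ \<mu> j)"
  obtains z g where "z \<in> Zset" "g \<in> unitary m" "X * g = g * model_x"
    "\<And>i. i \<in> {1..n} \<Longrightarrow> A i * g = g * model_mat z i"
proof -
  obtain r J Z u where S: "block_system m X A r J Z u"
    and cnt: "\<And>j. j \<in> {1..s} \<Longrightarrow> \<mu> j = card {b \<in> {..<r}. J b = j} * card (Box j)"
    using decomposition_count[OF R p] by metis
  \<comment> \<open>The blocks of type j found by the decomposition are renumbered by {1..l j};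
    cancelling \<open>card (Box j)\<close> in the two formulas for \<mu> j shows that there are l j
    of them.\<close>
  have "\<exists>f. bij_betw f {1..l j} {b \<in> {..<r}. J b = j}" if j: "j \<in> {1..s}" for j
  proof (rule finite_same_card_bij)
    show "card {1..l j} = card {b \<in> {..<r}. J b = j}"
      using cnt[OF j] mu_eq[OF j] card_Box_pos[OF j] by simp
  qed simp_all
  then obtain f where f: "\<And>j. j \<in> {1..s} \<Longrightarrow> bij_betw (f j) {1..l j} {b \<in> {..<r}. J b = j}" by metis
  have fb: "f j b < r" "J (f j b) = j" if "j \<in> {1..s}" "b \<in> {1..l j}" for j b
    using bij_betwE[OF f[OF that(1)]] that(2) by auto
  define V where "V = (\<lambda>(j, b, e). u (f j b) e)"
  define z where "z = (\<lambda>j\<in>{1..s}. \<lambda>b\<in>{1..l j}. \<lambda>i\<in>{1..n}. Z (f j b) i)"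
  let ?I = "SIGMA b:{..<r}. Box (J b)"
  have on: "orthonormal m ?I (\<lambda>(b, e). u b e)" using S by (simp add: block_system_def)
  have onI: "u b e \<in> carrier_vec m" "u b e \<bullet>c u b' e' = (if (b, e) = (b', e') then 1 else 0)"
    if "b < r" "e \<in> Box (J b)" "b' < r" "e' \<in> Box (J b')" for b e b' e'
  proof -
    have I: "(b, e) \<in> ?I" "(b', e') \<in> ?I" using that by auto
    show "u b e \<in> carrier_vec m" using on I(1) unfolding orthonormal_def by fastforce
    show "u b e \<bullet>c u b' e' = (if (b, e) = (b', e') then 1 else 0)"
      using bspec[OF bspec[OF on[unfolded orthonormal_def, THEN conjunct2] I(1)] I(2)] by simp
  qed
  have zS: "z \<in> Zset"
  proof -
    have "norm (Z (f j b) i) = 1" if "j \<in> {1..s}" "b \<in> {1..l j}" "i \<in> {1..n}" for j b i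
      using S fb[OF that(1,2)] that(3) by (simp add: block_system_def)
    then show ?thesis unfolding Zset_def z_def by (intro restrict_PiE_iff[THEN iffD2] ballI) simp
  qed
  have V: "orthonormal m Ix V"
    unfolding orthonormal_def
  proof (intro conjI ballI)
    fix x assume "x \<in> Ix"
    then obtain j b e where x: "x = (j, b, e)" "j \<in> {1..s}" "b \<in> {1..l j}" "e \<in> Box j" by (elim IxE)
    note fx = fb[OF x(2,3)]
    show "V x \<in> carrier_vec m" using onI(1)[of "f j b" e "f j b" e] fx x(1,4) by (simp add: V_def)
    fix y assume "y \<in> Ix"
    then obtain j' b' e' where y: "y = (j', b', e')" "j' \<in> {1..s}" "b' \<in> {1..l j'}" "e' \<in> Box j'" by (elim IxE)
    note fy = fb[OF y(2,3)]
    have eq: "f j b = f j' b' \<longleftrightarrow> j = j' \<and> b = b'"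
    proof
      assume e: "f j b = f j' b'"
      then have "j = j'" using fx fy by simp
      then show "j = j' \<and> b = b'" using e x y inj_onD[OF bij_betw_imp_inj_on[OF f[OF x(2)]]] by simp
    qed simp
    show "V x \<bullet>c V y = (if x = y then 1 else 0)"
      using onI(2)[of "f j b" e "f j' b'" e'] fx fy x(1,4) y(1,4) eq by (simp add: V_def)
  qed
  have blk: "model_block m X A j (z j b) (\<lambda>e. V (j, b, e))" if jb: "j \<in> {1..s}" "b \<in> {1..l j}" for j b
  proof -
    have "model_block m X A (J (f j b)) (Z (f j b)) (u (f j b))"
      using S fb(1)[OF jb] by (simp add: block_system_def)
    then have mb: "model_block m X A j (Z (f j b)) (u (f j b))" by (simp only: fb(2)[OF jb])
    have "z j b i = Z (f j b) i" if "i \<in> {1..n}" for i using jb that by (simp add: z_def)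
    then have "coef j (z j b) i e = coef j (Z (f j b)) i e" if "i \<in> {1..n}" for i e
      using that by (simp add: coef_def)
    then show ?thesis using mb by (simp add: model_block_def V_def)
  qed
  note RD = unitary_relsD[OF R]
  have Ac: "A i \<in> carrier_mat m m" if "i \<in> {1..n}" for i by (rule unitaryD(1)[OF RD(2)[OF that]])
  show ?thesis
    using that[OF zS] realize[OF unitaryD(1)[OF RD(1)] Ac V blk] by simp
qed

lemma model_x_char_poly: "char_poly model_x = (\<Prod>j = 1..s. [:- lam j, 1:] ^ \<mu> j)"
proof -
  have U1: "1\<^sub>m m \<in> unitary m" by (rule unitaryI) (auto simp: mat_adjoint_one)
  have "char_poly model_x = (\<Prod>x\<in>Ix. [:- (\<lambda>(j, b, e). lam j) x, 1:])"
    by (rule char_poly_diagonalized[OF U1 unitaryD(1)[OF model_x_unitary] ix(1)])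
      (use unitaryD(1)[OF model_x_unitary] in \<open>simp add: model_x_def\<close>)
  also have "\<dots> = (\<Prod>j\<in>{1..s}. \<Prod>y\<in>{1..l j} \<times> Box j. [:- lam j, 1:])"
    unfolding Ix_def by (subst prod.Sigma) (auto simp: finite_Box case_prod_beta)
  also have "\<dots> = (\<Prod>j = 1..s. [:- lam j, 1:] ^ \<mu> j)"
    by (intro prod.cong refl) (simp add: mu_eq card_cartesian_product del: atLeastAtMost_iff)
  finally show ?thesis .
qed

text \<open>The invariants of the block \<open>(j, b)\<close>: the scalars by which the central elements
  \<open>a\<^sub>i ^ N j i\<close> act on it.\<close>

definition pw :: "(nat \<Rightarrow> nat \<Rightarrow> nat \<Rightarrow> complex) \<Rightarrow> nat \<Rightarrow> nat \<Rightarrow> nat \<Rightarrow> complex" where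
  "pw z j b = (\<lambda>i\<in>{1..n}. z j b i ^ N j i)"

text \<open>For a shift, N steps lead once around the cycle and back to e; for a diagonal generator,
  the N-th power kills lam_j^(c_i e_i). Hence the scalar is the same on the whole block.\<close>

lemma model_mat_pow_dl:
  assumes z: "z \<in> Zset" and m: "j \<in> {1..s}" "b \<in> {1..l j}" "e \<in> Box j" and i: "i \<in> {1..n}"
  shows "(model_mat z i [^]\<^bsub>unitary_group m\<^esub> N j i) *\<^sub>v dl (j, b, e) = z j b i ^ N j i \<cdot>\<^sub>v dl (j, b, e)"
proof -
  note Ac = unitaryD(1)[OF model_mat_unitary[OF z i]]
  show ?thesis
  proof (cases "i \<in> {t+1..2*t}")
    case True
    define r where "r = i - t"
    have r: "r \<in> {1..t}" "i = t + r" using True by (auto simp: r_def)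
    have er: "e r < N j r" using m(3) r(1) by (auto simp: Box_def PiE_iff)
    have cf: "coef j (z j b) i e = z j b i" for e using True by (auto simp: coef_def)
    define ee where "ee q = e(r := (e r + q) mod N j r)" for q
    have ee0: "ee 0 = e" and eeN: "ee (N j r) = e" using er by (auto simp: ee_def)
    have sh: "shift j i (ee q) = ee (Suc q)" for q
      using True unfolding ee_def by (simp add: shift_def mod_Suc_eq flip: r_def)
    have "((*\<^sub>v) (model_mat z i) ^^ q) (dl (j, b, e)) = z j b i ^ q \<cdot>\<^sub>v dl (j, b, ee q) \<and> ee q \<in> Box j" for q
    proof (induction q)
      case 0
      then show ?case using m(3) by (simp add: ee0)
    next
      case (Suc q)
      have e': "ee q \<in> Box j" using Suc by blast
      have "((*\<^sub>v) (model_mat z i) ^^ Suc q) (dl (j, b, e)) = z j b i ^ q \<cdot>\<^sub>v (model_mat z i *\<^sub>v dl (j, b, ee q))"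
        using Suc mult_mat_vec[OF Ac dl_closed] by simp
      also have "\<dots> = z j b i ^ Suc q \<cdot>\<^sub>v dl (j, b, ee (Suc q))"
        unfolding model_mat_dl[OF m(1,2) e'] sh cf by (simp add: smult_smult_assoc mult.commute)
      finally show ?case using shift_in_Box[OF m(1) e', of i] unfolding sh by blast
    qed
    from this[of "N j r"] have "((*\<^sub>v) (model_mat z i) ^^ N j r) (dl (j, b, e)) = z j b i ^ N j r \<cdot>\<^sub>v dl (j, b, e)"
      by (simp only: eeN)
    moreover have "N j i = N j r" using N_add[OF r(1)] r(2) by simp
    ultimately show ?thesis
      unfolding unitary_pow_mult_vec[OF model_mat_unitary[OF z i] dl_closed] by simp
  next
    case False
    then have sh: "shift j i e = e" by (simp only: shift_def if_False)
    have "((*\<^sub>v) (model_mat z i) ^^ q) (dl (j, b, e)) = coef j (z j b) i e ^ q \<cdot>\<^sub>v dl (j, b, e)" for q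
      by (induction q)
        (simp_all add: mult_mat_vec[OF Ac dl_closed] model_mat_dl[OF m] sh smult_smult_assoc mult.commute)
    moreover have "coef j (z j b) i e ^ N j i = z j b i ^ N j i"
    proof (cases "i \<in> {1..t}")
      case True
      have "coef j (z j b) i e ^ N j i = z j b i ^ N j i * (lam j ^ (c i * N j i)) ^ e i"
        using True by (simp add: coef_def power_mult_distrib mult_ac flip: power_mult)
      then show ?thesis using lam_pow_N[OF m(1) True] by simp
    qed (simp only: coef_def if_False)
    ultimately show ?thesis
      unfolding unitary_pow_mult_vec[OF model_mat_unitary[OF z i] dl_closed] by simp
  qed
qed

section \<open>Intertwiners between models and their invariants\<close>

lemma intertwine_vec:
  assumes "A \<in> carrier_mat m m" "B \<in> carrier_mat m m" "g \<in> carrier_mat m m" "A * g = g * B" "w \<in> carrier_vec m"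
  shows "A *\<^sub>v (g *\<^sub>v w) = g *\<^sub>v (B *\<^sub>v w)"
  unfolding assoc_mult_mat_vec[OF assms(1,3,5), symmetric] assoc_mult_mat_vec[OF assms(3,2,5), symmetric] assms(4) ..

lemma intertwine_pow:
  assumes A: "A \<in> unitary m" and B: "B \<in> unitary m" and g: "g \<in> carrier_mat m m" and eq: "A * g = g * B"
    and w: "w \<in> carrier_vec m"
  shows "(A [^]\<^bsub>unitary_group m\<^esub> (q::nat)) *\<^sub>v (g *\<^sub>v w) = g *\<^sub>v ((B [^]\<^bsub>unitary_group m\<^esub> q) *\<^sub>v w)"
proof -
  note Ac = unitaryD(1)[OF A] and Bc = unitaryD(1)[OF B]
  have gw: "g *\<^sub>v w \<in> carrier_vec m" if "w \<in> carrier_vec m" for w by (rule mult_mat_vec_carrier[OF g that])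
  have Bw: "((*\<^sub>v) B ^^ q) w \<in> carrier_vec m" for q
    by (rule funpow_closed[OF _ w]) (rule mult_mat_vec_carrier[OF Bc])
  have "A *\<^sub>v (g *\<^sub>v w) = g *\<^sub>v (B *\<^sub>v w)" if "w \<in> carrier_vec m" for w
    by (rule intertwine_vec[OF Ac Bc g eq that])
  then have "((*\<^sub>v) A ^^ q) (g *\<^sub>v w) = g *\<^sub>v ((*\<^sub>v) B ^^ q) w"
    using Bw by (induction q) simp_all
  then show ?thesis unfolding unitary_pow_mult_vec[OF A gw[OF w]] unitary_pow_mult_vec[OF B w] .
qed

text \<open>The determinant is nonzero, so some product in its Leibniz expansion is. The permutation
  serves as a matching between the basis vectors of two equivalent models.\<close>

lemma permutation_of_unitary:
  assumes "g \<in> unitary m"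
  obtains \<pi> where "\<pi> permutes {0..<m}" "\<And>p. p < m \<Longrightarrow> g $$ (p, \<pi> p) \<noteq> 0"
proof -
  note gD = unitaryD[OF assms]
  have "det (mat_adjoint g) * det g = 1" using det_mult[OF gD(5,1)] gD(3) by simp
  then have "det g \<noteq> 0" by auto
  define F where "F \<pi> = signof \<pi> * (\<Prod>i = 0..<m. g $$ (i, \<pi> i))" for \<pi>
  have "\<exists>\<pi>\<in>{\<pi>. \<pi> permutes {0..<m}}. F \<pi> \<noteq> 0"
  proof (rule ccontr)
    assume "\<not> (\<exists>\<pi>\<in>{\<pi>. \<pi> permutes {0..<m}}. F \<pi> \<noteq> 0)"
    then have "(\<Sum>\<pi>\<in>{\<pi>. \<pi> permutes {0..<m}}. F \<pi>) = 0" by (intro sum.neutral) blast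
    then show False using \<open>det g \<noteq> 0\<close> unfolding det_def'[OF gD(1)] F_def by (rule notE[rotated])
  qed
  then obtain \<pi> where \<pi>: "\<pi> \<in> {\<pi>. \<pi> permutes {0..<m}}" "F \<pi> \<noteq> 0" by (elim bexE)
  have "g $$ (p, \<pi> p) \<noteq> 0" if "p < m" for p
  proof
    assume "g $$ (p, \<pi> p) = 0"
    then have "(\<Prod>i = 0..<m. g $$ (i, \<pi> i)) = 0"
      using that by (intro prod_zero bexI[of _ p]) simp_all
    then show False using \<pi>(2) by (simp add: F_def)
  qed
  with \<pi>(1) show ?thesis using that by blast
qed

text \<open>The image under g of the basis vector at q is an eigenvector of x and of the central
  powers, with the eigenvalues belonging to q. Since its component at p is nonzero, these are also
  the eigenvalues at p: eigenvectors of a unitary matrix for different eigenvalues are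
  orthogonal.\<close>

lemma invariants_of_intertwiner:
  assumes z: "z \<in> Zset" and z': "z' \<in> Zset" and g: "g \<in> unitary m"
    and gX: "model_x * g = g * model_x"
    and gA: "\<And>i. i \<in> {1..n} \<Longrightarrow> model_mat z i * g = g * model_mat z' i"
    and p: "p < m" "q < m" "g $$ (p, q) \<noteq> 0"
    and x: "ix p = (j, b, e)" and y: "ix q = (j', b', e')"
  shows "j = j' \<and> pw z j b = pw z' j' b'"
proof -
  interpret U: group "unitary_group m" by (rule group_unitary_group)
  note gc = unitaryD(1)[OF g]
  have xI: "(j, b, e) \<in> Ix" and yI: "(j', b', e') \<in> Ix" using ix_in[OF p(1)] ix_in[OF p(2)] x y by simp_all
  from xI have xm: "j \<in> {1..s}" "b \<in> {1..l j}" "e \<in> Box j" by (simp_all add: Ix_def)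
  from yI have ym: "j' \<in> {1..s}" "b' \<in> {1..l j'}" "e' \<in> Box j'" by (simp_all add: Ix_def)
  define w where "w = g *\<^sub>v dl (j', b', e')"
  have wc: "w \<in> carrier_vec m" unfolding w_def by (rule mult_mat_vec_carrier[OF gc dl_closed])
  have px: "pos (j, b, e) = p" "pos (j', b', e') = q" using pos_ix[OF p(1)] pos_ix[OF p(2)] x y by simp_all
  have "w \<bullet>c dl (j, b, e) = vec_index w p" using vec_dl[OF wc xI] px(1) by simp
  also have "\<dots> = (\<Sum>r<m. if r = q then g $$ (p, r) else 0)"
    unfolding w_def mult_mat_vec_sum[OF gc dl_closed p(1)] using p(2) by (intro sum.cong) (auto simp: dl_def px)
  finally have ne: "w \<bullet>c dl (j, b, e) \<noteq> 0" using p by simp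
  have main: "a = d" if T: "T \<in> unitary m" "T *\<^sub>v w = a \<cdot>\<^sub>v w" "T *\<^sub>v dl (j, b, e) = d \<cdot>\<^sub>v dl (j, b, e)" for T a d
  proof (rule ccontr)
    assume "a \<noteq> d"
    have "dl (j, b, e) \<noteq> 0\<^sub>v m" using p(1) by (simp add: dl_def px)
    then have "norm d = 1" by (rule unitary_eigenvalue_norm[OF T(1) dl_closed _ T(3)])
    from unitary_eigenvectors_orthogonal[OF T(1) wc dl_closed T(2,3) \<open>a \<noteq> d\<close> this] ne show False by simp
  qed
  have "model_x *\<^sub>v w = lam j' \<cdot>\<^sub>v w"
    unfolding w_def intertwine_vec[OF unitaryD(1)[OF model_x_unitary] unitaryD(1)[OF model_x_unitary] gc gX dl_closed]
      model_x_dl[OF ym] by (rule mult_mat_vec[OF gc dl_closed])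
  from main[OF model_x_unitary this model_x_dl[OF xm]] have jj: "j = j'"
    using lam_inj xm(1) ym(1) by (simp add: inj_on_eq_iff)
  have "z' j' b' i ^ N j' i = z j b i ^ N j i" if i: "i \<in> {1..n}" for i
  proof (rule main[OF U.nat_pow_closed[OF model_mat_unitary[OF z i]] _ model_mat_pow_dl[OF z xm i]])
    show "(model_mat z i [^]\<^bsub>unitary_group m\<^esub> N j i) *\<^sub>v w = z' j' b' i ^ N j' i \<cdot>\<^sub>v w"
      unfolding w_def jj intertwine_pow[OF model_mat_unitary[OF z i] model_mat_unitary[OF z' i] gc gA[OF i] dl_closed]
        model_mat_pow_dl[OF z' ym i] by (rule mult_mat_vec[OF gc dl_closed])
  qed
  then have "pw z j b = pw z' j' b'" unfolding pw_def by (intro restrict_ext) simp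
  then show ?thesis using jj by simp
qed

text \<open>The matching from the determinant preserves the eigenvalue index and the invariant of a
  position. Every block of type j occupies \<open>card (Box j)\<close> positions, so dividing the
  position counts by this number gives equal multiplicities of each invariant.\<close>

lemma equivalent_imp_same_invariants:
  assumes z: "z \<in> Zset" and z': "z' \<in> Zset" and g: "g \<in> unitary m"
    and gX: "model_x * g = g * model_x"
    and gA: "\<And>i. i \<in> {1..n} \<Longrightarrow> model_mat z i * g = g * model_mat z' i"
    and j: "j \<in> {1..s}"
  obtains \<tau> where "\<tau> permutes {1..l j}" "\<And>b. b \<in> {1..l j} \<Longrightarrow> pw z' j b = pw z j (\<tau> b)"
proof -
  obtain \<pi> where \<pi>: "\<pi> permutes {0..<m}" "\<And>p. p < m \<Longrightarrow> g $$ (p, \<pi> p) \<noteq> 0"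
    using permutation_of_unitary[OF g] by metis
  define ty where "ty z x = (fst x, pw z (fst x) (fst (snd x)))" for z and x :: "nat \<times> nat \<times> (nat \<Rightarrow> nat)"
  have \<pi>m: "\<pi> p < m" if "p < m" for p using permutes_in_image[OF \<pi>(1), of p] that by simp
  have ty: "ty z (ix p) = ty z' (ix (\<pi> p))" if "p < m" for p
  proof -
    obtain j1 b1 e1 where x: "ix p = (j1, b1, e1)" by (rule prod_cases3)
    obtain j2 b2 e2 where y: "ix (\<pi> p) = (j2, b2, e2)" by (rule prod_cases3)
    show ?thesis
      using invariants_of_intertwiner[OF z z' g gX gA that \<pi>m[OF that] \<pi>(2)[OF that] x y]
      by (auto simp add: ty_def x y)
  qed
  have cnt: "card {p \<in> {..<m}. ty z (ix p) = (j, \<theta>)} = card {b \<in> {1..l j}. pw z j b = \<theta>} * card (Box j)" for z \<theta>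
  proof -
    have "{x \<in> Ix. ty z x = (j, \<theta>)} = (\<lambda>(b, e). (j, b, e)) ` ({b \<in> {1..l j}. pw z j b = \<theta>} \<times> Box j)"
    proof (intro equalityI subsetI)
      fix x assume "x \<in> {x \<in> Ix. ty z x = (j, \<theta>)}"
      then have x: "x \<in> Ix" "ty z x = (j, \<theta>)" by simp_all
      obtain j' b e where x': "x = (j', b, e)" "j' \<in> {1..s}" "b \<in> {1..l j'}" "e \<in> Box j'" using x(1) by (elim IxE)
      have "j' = j \<and> pw z j' b = \<theta>"
        using x(2) unfolding x'(1) ty_def fst_conv snd_conv prod.inject .
      then have "j' = j" "pw z j' b = \<theta>" by (rule conjunct1, rule conjunct2)
      then show "x \<in> (\<lambda>(b, e). (j, b, e)) ` ({b \<in> {1..l j}. pw z j b = \<theta>} \<times> Box j)"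
        using x' by (intro image_eqI[of _ _ "(b, e)"]) simp_all
    next
      fix x assume "x \<in> (\<lambda>(b, e). (j, b, e)) ` ({b \<in> {1..l j}. pw z j b = \<theta>} \<times> Box j)"
      then obtain y where y: "x = (\<lambda>(b, e). (j, b, e)) y" "y \<in> {b \<in> {1..l j}. pw z j b = \<theta>} \<times> Box j"
        by (elim imageE)
      obtain b e where "y = (b, e)" by (rule prod.exhaust)
      with y have "x = (j, b, e)" "b \<in> {1..l j}" "pw z j b = \<theta>" "e \<in> Box j" by simp_all
      then show "x \<in> {x \<in> Ix. ty z x = (j, \<theta>)}" using IxI[OF j] by (simp add: ty_def)
    qed
    then have card_eq: "card {x \<in> Ix. ty z x = (j, \<theta>)} = card ({b \<in> {1..l j}. pw z j b = \<theta>} \<times> Box j)"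
      by (simp only:) (intro card_image, auto simp: inj_on_def)
    have "bij_betw ix {p \<in> {..<m}. ty z (ix p) = (j, \<theta>)} {x \<in> Ix. ty z x = (j, \<theta>)}"
      unfolding bij_betw_def
    proof
      show "inj_on ix {p \<in> {..<m}. ty z (ix p) = (j, \<theta>)}"
        using bij_betw_imp_inj_on[OF ix(1)] by (rule inj_on_subset) auto
      show "ix ` {p \<in> {..<m}. ty z (ix p) = (j, \<theta>)} = {x \<in> Ix. ty z x = (j, \<theta>)}"
      proof (intro equalityI subsetI)
        fix x assume x: "x \<in> {x \<in> Ix. ty z x = (j, \<theta>)}"
        then show "x \<in> ix ` {p \<in> {..<m}. ty z (ix p) = (j, \<theta>)}"
          by (intro rev_image_eqI[of "pos x"]) (simp_all add: pos)
      qed (use ix_in in blast)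
    qed
    from bij_betw_same_card[OF this] card_eq show ?thesis by (simp only: card_cartesian_product)
  qed
  have "card {b \<in> {1..l j}. pw z j b = \<theta>} = card {b \<in> {1..l j}. pw z' j b = \<theta>}" for \<theta>
  proof -
    have "bij_betw \<pi> {p \<in> {..<m}. ty z (ix p) = (j, \<theta>)} {p \<in> {..<m}. ty z' (ix p) = (j, \<theta>)}"
      unfolding bij_betw_def
    proof
      show "inj_on \<pi> {p \<in> {..<m}. ty z (ix p) = (j, \<theta>)}"
        using permutes_inj[OF \<pi>(1)] by (rule inj_on_subset) simp
      show "\<pi> ` {p \<in> {..<m}. ty z (ix p) = (j, \<theta>)} = {p \<in> {..<m}. ty z' (ix p) = (j, \<theta>)}"
      proof (intro equalityI subsetI)
        fix q assume q: "q \<in> {p \<in> {..<m}. ty z' (ix p) = (j, \<theta>)}"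
        then have "q \<in> \<pi> ` {0..<m}" using permutes_image[OF \<pi>(1)] by simp
        then obtain p where p: "p < m" "q = \<pi> p" by (elim imageE) simp
        show "q \<in> \<pi> ` {p \<in> {..<m}. ty z (ix p) = (j, \<theta>)}"
          using q ty[OF p(1)] p by (intro image_eqI[of _ _ p]) simp_all
      next
        fix q assume "q \<in> \<pi> ` {p \<in> {..<m}. ty z (ix p) = (j, \<theta>)}"
        then obtain p where p: "p \<in> {p \<in> {..<m}. ty z (ix p) = (j, \<theta>)}" "q = \<pi> p" by (elim imageE)
        then have "p < m" by simp
        then show "q \<in> {p \<in> {..<m}. ty z' (ix p) = (j, \<theta>)}" using ty[of p] \<pi>m[of p] p by simp
      qed
    qed
    then have "card {p \<in> {..<m}. ty z (ix p) = (j, \<theta>)} = card {p \<in> {..<m}. ty z' (ix p) = (j, \<theta>)}"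
      by (rule bij_betw_same_card)
    then show ?thesis using card_Box_pos[OF j] unfolding cnt by simp
  qed
  \<comment> \<open>Equal multiplicities of all values make the two families equal as multisets,
    that is, equal up to a permutation of the indices.\<close>
  then have "image_mset (pw z' j) (mset_set {1..l j}) = image_mset (pw z j) (mset_set {1..l j})"
  proof (intro multiset_eqI)
    fix \<theta>
    assume *: "\<And>\<theta>. card {b \<in> {1..l j}. pw z j b = \<theta>} = card {b \<in> {1..l j}. pw z' j b = \<theta>}"
    have "count (image_mset f (mset_set {1..l j})) \<theta> = card {b \<in> {1..l j}. f b = \<theta>}" for f :: "nat \<Rightarrow> nat \<Rightarrow> complex"
    proof -
      have "count (image_mset f (mset_set {1..l j})) \<theta> = (\<Sum>b\<in>f -` {\<theta>} \<inter> {1..l j}. 1)"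
        unfolding count_image_mset by (intro sum.cong) auto
      also have "f -` {\<theta>} \<inter> {1..l j} = {b \<in> {1..l j}. f b = \<theta>}" by auto
      finally show ?thesis by simp
    qed
    then show "count (image_mset (pw z' j) (mset_set {1..l j})) \<theta> = count (image_mset (pw z j) (mset_set {1..l j})) \<theta>"
      using *[of \<theta>] by simp
  qed
  from image_mset_eq_implies_permutes[OF finite_atLeastAtMost this]
  obtain \<tau> where "\<tau> permutes {1..l j}" "\<forall>b\<in>{1..l j}. pw z' j b = pw z j (\<tau> b)" by metis
  then show ?thesis using that by simp
qed

text \<open>The first N powers of lam_j^c_i are distinct N-th roots of unity, so by counting they
  are all of them.\<close>

lemma root_of_unity_ratio:
  assumes j: "j \<in> {1..s}" and i: "i \<in> {1..t}" and eq: "a ^ N j i = b ^ N j i" and b: "b \<noteq> 0"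
  obtains r where "r < N j i" "a = b * lam j ^ (c i * r)"
proof -
  let ?R = "{w::complex. w ^ N j i = 1}"
  have N: "N j i > 0" by (rule N_pos[OF j])
  have inj: "inj_on (\<lambda>r. lam j ^ (c i * r)) {..<N j i}"
  proof (rule inj_onI)
    fix e e' assume "e \<in> {..<N j i}" "e' \<in> {..<N j i}" "lam j ^ (c i * e) = lam j ^ (c i * e')"
    then show "e = e'" using lam_pow_inj[OF j i, of e e'] by simp
  qed
  have "(lam j ^ (c i * r)) ^ N j i = 1" for r
  proof -
    have "(lam j ^ (c i * r)) ^ N j i = (lam j ^ (c i * N j i)) ^ r" by (simp add: mult_ac flip: power_mult)
    then show ?thesis by (simp add: lam_pow_N[OF j i])
  qed
  then have sub: "(\<lambda>r. lam j ^ (c i * r)) ` {..<N j i} \<subseteq> ?R" by auto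
  have "card ?R = N j i" by (rule card_roots_unity_eq[OF N])
  moreover have "finite ?R" using N by (intro finite_roots_unity) simp
  ultimately have "(\<lambda>r. lam j ^ (c i * r)) ` {..<N j i} = ?R"
    using sub card_image[OF inj] by (intro card_subset_eq) simp_all
  moreover have "a / b \<in> ?R" using eq b by (simp add: power_divide)
  ultimately have "a / b \<in> (\<lambda>r. lam j ^ (c i * r)) ` {..<N j i}" by simp
  then obtain r where "r < N j i" "a / b = lam j ^ (c i * r)" by (elim imageE) simp
  then show ?thesis using that b by (simp add: field_simps)
qed

text \<open>The block (j, b) of z' is found inside the block (j, \<tau> j b) of z. For i \<le> t the
  ratio of the parameters is a power of lam_j^c_i, so starting from another basis vector of that
  block changes the eigenvalues from those of z to those of z'; for the shifts equality of the N-th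
  powers is what \<open>cyclic_system\<close> asks. The new bases together form the intertwining
  frame.\<close>

lemma same_invariants_imp_equivalent:
  assumes z: "z \<in> Zset" and z': "z' \<in> Zset"
    and \<tau>: "\<And>j. j \<in> {1..s} \<Longrightarrow> \<tau> j permutes {1..l j}"
    and eq: "\<And>j b. j \<in> {1..s} \<Longrightarrow> b \<in> {1..l j} \<Longrightarrow> pw z' j b = pw z j (\<tau> j b)"
  obtains g where "g \<in> unitary m" "model_x * g = g * model_x"
    "\<And>i. i \<in> {1..n} \<Longrightarrow> model_mat z i * g = g * model_mat z' i"
proof -
  note R = model_rels[OF z]
  note RD = unitary_relsD[OF R]
  \<comment> \<open>The span of the block (j, b), described as the orthogonal complement of the
    remaining basis vectors.\<close>
  define W where "W j b = {w \<in> carrier_vec m. \<forall>x\<in>{x \<in> Ix. fst x \<noteq> j \<or> fst (snd x) \<noteq> b}. w \<bullet>c dl x = 0}" for j b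
  have Wsub: "lin_subspace m (W j b)" for j b
    unfolding W_def by (rule orthogonal_subspace) (rule dl_closed)
  have W0: "vec_index w p = 0" if "w \<in> W j b" "p < m" "fst (ix p) \<noteq> j \<or> fst (snd (ix p)) \<noteq> b" for w j b p
  proof -
    have "ix p \<in> {x \<in> Ix. fst x \<noteq> j \<or> fst (snd x) \<noteq> b}" using ix_in[OF that(2)] that(3) by simp
    then have "w \<bullet>c dl (ix p) = 0" using that(1) unfolding W_def by blast
    moreover have "w \<in> carrier_vec m" using that(1) by (simp add: W_def)
    ultimately show ?thesis using vec_dl[OF _ ix_in[OF that(2)], of w] by (simp add: pos_ix[OF that(2)])
  qed
  have Winv: "model_mat z i *\<^sub>v w \<in> W j b" if i: "i \<in> {1..n}" and w: "w \<in> W j b" for i w j b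
  proof -
    have wc: "w \<in> carrier_vec m" using w by (simp add: W_def)
    have "(model_mat z i *\<^sub>v w) \<bullet>c dl x = 0" if x: "x \<in> {x \<in> Ix. fst x \<noteq> j \<or> fst (snd x) \<noteq> b}" for x
    proof (rule unitary_preserves_orthogonal[OF model_mat_unitary[OF z i], of "{x \<in> Ix. fst x \<noteq> j \<or> fst (snd x) \<noteq> b}" dl])
      fix y assume y: "y \<in> {x \<in> Ix. fst x \<noteq> j \<or> fst (snd x) \<noteq> b}"
      then have "y \<in> Ix" by simp
      then obtain j' b' e' where y': "y = (j', b', e')" "j' \<in> {1..s}" "b' \<in> {1..l j'}" "e' \<in> Box j'" by (elim IxE)
      have "e' \<in> shift j' i ` Box j'" using shift_surj[OF y'(2)] y'(4) by simp
      then obtain e0 where e0: "e0 \<in> Box j'" "e' = shift j' i e0" by (elim imageE) simp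
      have "norm (coef j' (z j' b') i e0) = 1"
        using norm_coef[of j' "z j' b'" i e0] y'(2) Zset_norm[OF z y'(2,3) i] by simp
      then have "coef j' (z j' b') i e0 \<noteq> 0" by auto
      moreover have "model_mat z i *\<^sub>v dl (j', b', e0) = coef j' (z j' b') i e0 \<cdot>\<^sub>v dl y"
        using model_mat_dl[OF y'(2,3) e0(1), of z i] y'(1) e0(2) by simp
      moreover have "(j', b', e0) \<in> {x \<in> Ix. fst x \<noteq> j \<or> fst (snd x) \<noteq> b}"
        using y y' IxI[OF y'(2,3) e0(1)] by simp
      ultimately show "\<exists>i'\<in>{x \<in> Ix. fst x \<noteq> j \<or> fst (snd x) \<noteq> b}. \<exists>a. a \<noteq> 0 \<and> model_mat z i *\<^sub>v dl i' = a \<cdot>\<^sub>v dl y"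
        by blast
    next
      fix y assume "y \<in> {x \<in> Ix. fst x \<noteq> j \<or> fst (snd x) \<noteq> b}"
      then show "w \<bullet>c dl y = 0" using w unfolding W_def by blast
    qed (rule dl_closed wc x)+
    then show ?thesis using mult_mat_vec_carrier[OF unitaryD(1)[OF model_mat_unitary[OF z i]] wc]
      by (simp add: W_def)
  qed
  have "\<exists>u. model_block m model_x (model_mat z) j (z' j b) u \<and> orthonormal m (Box j) u \<and> (\<forall>e. u e \<in> W j (\<tau> j b))"
    if j: "j \<in> {1..s}" and b: "b \<in> {1..l j}" for j b
  proof -
    define d where "d = \<tau> j b"
    have d: "d \<in> {1..l j}" unfolding d_def using permutes_in_image[OF \<tau>[OF j]] b by blast
    have pe: "z' j b i ^ N j i = z j d i ^ N j i" if "i \<in> {1..n}" for i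
      using fun_cong[OF eq[OF j b], of i] that by (simp add: pw_def d_def)
    have "\<exists>r. r < N j i \<and> z' j b i = z j d i * lam j ^ (c i * r)" if i: "i \<in> {1..t}" for i
    proof -
      have i': "i \<in> {1..n}" using i t2n by auto
      have "z j d i \<noteq> 0" using Zset_norm[OF z j d i'] by auto
      then show ?thesis using root_of_unity_ratio[OF j i pe[OF i']] by blast
    qed
    then obtain f where f: "\<And>i. i \<in> {1..t} \<Longrightarrow> f i < N j i \<and> z' j b i = z j d i * lam j ^ (c i * f i)" by metis
    \<comment> \<open>The index of the basis vector on which each a_i with i \<le> t has eigenvalue
      z' j b i.\<close>
    define e where "e = restrict f {1..t}"
    have e: "e \<in> Box j" using f by (simp add: e_def Box_def)
    note m = j d e
    have "\<exists>u. model_block m model_x (model_mat z) j (z' j b) u \<and> orthonormal m (Box j) u \<and> (\<forall>e. u e \<in> W j d)"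
    proof (rule cyclic_system[OF R Wsub[of j d] Winv j, of "z' j b" "dl (j, d, e)"])
      show "norm (z' j b i) = 1" if "i \<in> {1..n}" for i by (rule Zset_norm[OF z' j b that])
      have "dl (j, d, e) \<bullet>c dl x = 0" if "x \<in> Ix" "fst x \<noteq> j \<or> fst (snd x) \<noteq> d" for x
        using orthonormal_dl IxI[OF m] that by (auto simp: orthonormal_def)
      then show "dl (j, d, e) \<in> W j d" by (simp add: W_def dl_closed)
      show "dl (j, d, e) \<bullet>c dl (j, d, e) = 1" using orthonormal_dl IxI[OF m] by (simp add: orthonormal_def)
      show "model_x *\<^sub>v dl (j, d, e) = lam j \<cdot>\<^sub>v dl (j, d, e)" by (rule model_x_dl[OF m])
      show "model_mat z i *\<^sub>v dl (j, d, e) = z' j b i \<cdot>\<^sub>v dl (j, d, e)"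
        if i: "i \<in> {1..n}" "i \<notin> {t+1..2*t}" for i
      proof -
        have sh: "shift j i e = e" using i(2) by (simp only: shift_def if_False)
        have "coef j (z j d) i e = z' j b i"
        proof (cases "i \<in> {1..t}")
          case True
          then show ?thesis using f[OF True] by (simp add: coef_def e_def)
        next
          case False
          \<comment> \<open>Outside the pairs the exponent is 1, so equality of the powers is
            equality of the parameters.\<close>
          then have "N j i = 1" using i(2) by (simp only: N_def if_False)
          then show ?thesis using pe[OF i(1)] False by (simp only: coef_def if_False power_one_right)
        qed
        then show ?thesis using model_mat_dl[OF m, of z i] sh by simp
      qed
      show "(model_mat z i [^]\<^bsub>unitary_group m\<^esub> N j i) *\<^sub>v dl (j, d, e) = z' j b i ^ N j i \<cdot>\<^sub>v dl (j, d, e)"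
        if "i \<in> {t+1..2*t}" for i
      proof -
        have i: "i \<in> {1..n}" using that t2n by auto
        show ?thesis unfolding pe[OF i] by (rule model_mat_pow_dl[OF z m i])
      qed
    qed blast+
    then show ?thesis by (simp only: d_def)
  qed
  then obtain u where u: "\<And>j b. j \<in> {1..s} \<Longrightarrow> b \<in> {1..l j} \<Longrightarrow> model_block m model_x (model_mat z) j (z' j b) (u j b) \<and>
      orthonormal m (Box j) (u j b) \<and> (\<forall>e. u j b e \<in> W j (\<tau> j b))" by metis
  define V where "V = (\<lambda>(j, b, e). u j b e)"
  have V: "orthonormal m Ix V"
    unfolding orthonormal_def
  proof (intro conjI ballI)
    fix x assume "x \<in> Ix"
    then obtain j b e where x: "x = (j, b, e)" "j \<in> {1..s}" "b \<in> {1..l j}" "e \<in> Box j" by (elim IxE)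
    note ux = u[OF x(2,3)]
    have xc: "u j b e \<in> carrier_vec m" using lin_subspaceD(1)[OF Wsub] ux by blast
    then show "V x \<in> carrier_vec m" using x(1) by (simp add: V_def)
    fix y assume "y \<in> Ix"
    then obtain j' b' e' where y: "y = (j', b', e')" "j' \<in> {1..s}" "b' \<in> {1..l j'}" "e' \<in> Box j'" by (elim IxE)
    note uy = u[OF y(2,3)]
    have yc: "u j' b' e' \<in> carrier_vec m" using lin_subspaceD(1)[OF Wsub] uy by blast
    show "V x \<bullet>c V y = (if x = y then 1 else 0)"
    proof (cases "j = j' \<and> b = b'")
      case True
      then show ?thesis using ux x(1,4) y(1,4) by (simp add: V_def orthonormal_def)
    next
      case False
      \<comment> \<open>Different labels (j, b) are sent to different blocks, so the two vectors
        have disjoint supports.\<close>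
      have ne: "j \<noteq> j' \<or> \<tau> j b \<noteq> \<tau> j' b'"
        using False permutes_inj[OF \<tau>[OF x(2)]] by (auto simp: inj_eq)
      have uxW: "u j b e \<in> W j (\<tau> j b)" and uyW: "u j' b' e' \<in> W j' (\<tau> j' b')" using ux uy by blast+
      have "vec_index (u j b e) p * cnj (vec_index (u j' b' e') p) = 0" if "p < m" for p
      proof (cases "fst (ix p) \<noteq> j \<or> fst (snd (ix p)) \<noteq> \<tau> j b")
        case True
        then show ?thesis using W0[OF uxW that] by simp
      next
        case False
        then have "fst (ix p) \<noteq> j' \<or> fst (snd (ix p)) \<noteq> \<tau> j' b'" using ne by auto
        then show ?thesis using W0[OF uyW that] by simp
      qed
      then have "u j b e \<bullet>c u j' b' e' = 0"
        unfolding cscalar_prod_sum[OF xc yc] by (intro sum.neutral) simp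
      then show ?thesis using False x(1) y(1) by (auto simp: V_def)
    qed
  qed
  have blk: "model_block m model_x (model_mat z) j (z' j b) (\<lambda>e. V (j, b, e))" if "j \<in> {1..s}" "b \<in> {1..l j}" for j b
    using u[OF that] by (simp add: V_def)
  have Ac: "model_mat z i \<in> carrier_mat m m" for i by (simp add: model_mat_def monomial_mat_def)
  from realize[OF unitaryD(1)[OF model_x_unitary] Ac V blk] show ?thesis using that by blast
qed

end

section \<open>Block diagonal matrices\<close>

lemma block_pos_less: "j \<in> {1..s} \<Longrightarrow> i < \<mu> j \<Longrightarrow> block_pos \<mu> (j, i) < (\<Sum>j = 1..s. \<mu> j)"
  using bij_betwE[OF bij_betw_block_pos, of s \<mu>] by simp

lemma block_pos_eq_iff:
  assumes "j \<in> {1..s}" "i < \<mu> j" "j' \<in> {1..s}" "i' < \<mu> j'"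
  shows "block_pos \<mu> (j, i) = block_pos \<mu> (j', i') \<longleftrightarrow> j = j' \<and> i = i'"
proof
  assume "block_pos \<mu> (j, i) = block_pos \<mu> (j', i')"
  then have "block_index s \<mu> (block_pos \<mu> (j, i)) = block_index s \<mu> (block_pos \<mu> (j', i'))" by (rule arg_cong)
  then show "j = j' \<and> i = i'"
    by (simp only: block_index_pos[of j s i \<mu>, OF assms(1,2)] block_index_pos[of j' s i' \<mu>, OF assms(3,4)] prod.inject)
qed simp

lemma block_cases:
  assumes "p < (\<Sum>j = 1..s. \<mu> j)"
  obtains j i where "p = block_pos \<mu> (j, i)" "j \<in> {1..s}" "i < \<mu> j"
proof -
  have "block_index s \<mu> p \<in> (SIGMA j:{1..s}. {..<\<mu> j})"
    using bij_betwE[OF bij_betw_block_index] assms by simp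
  then obtain j i where "block_index s \<mu> p = (j, i)" "j \<in> {1..s}" "i < \<mu> j" by (elim SigmaE) simp
  note b = this
  show ?thesis
    by (rule that[OF _ b(2,3)]) (simp only: b(1)[symmetric] block_pos_index[OF assms])
qed

lemma sum_blocks: "(\<Sum>p<(\<Sum>j = 1..s. \<mu> j). F p) = (\<Sum>j = 1..s. \<Sum>i<\<mu> j. F (block_pos \<mu> (j, i)))"
  unfolding sum.reindex_bij_betw[OF bij_betw_block_pos, symmetric]
  by (subst sum.Sigma) (auto intro!: sum.cong)

lemma block_mat_eqI:
  fixes A B :: "complex mat"
  assumes "A \<in> carrier_mat m m" "B \<in> carrier_mat m m" "m = (\<Sum>j = 1..s. \<mu> j)"
    and eq: "\<And>j i j' i'. j \<in> {1..s} \<Longrightarrow> i < \<mu> j \<Longrightarrow> j' \<in> {1..s} \<Longrightarrow> i' < \<mu> j' \<Longrightarrow>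
      A $$ (block_pos \<mu> (j, i), block_pos \<mu> (j', i')) = B $$ (block_pos \<mu> (j, i), block_pos \<mu> (j', i'))"
  shows "A = B"
proof (rule eq_matI)
  fix p q assume "p < dim_row B" "q < dim_col B"
  then have pq: "p < (\<Sum>j = 1..s. \<mu> j)" "q < (\<Sum>j = 1..s. \<mu> j)" using assms(2,3) by auto
  obtain j i where p: "p = block_pos \<mu> (j, i)" "j \<in> {1..s}" "i < \<mu> j" by (rule block_cases[OF pq(1)])
  obtain j' i' where q: "q = block_pos \<mu> (j', i')" "j' \<in> {1..s}" "i' < \<mu> j'" by (rule block_cases[OF pq(2)])
  show "A $$ (p, q) = B $$ (p, q)" unfolding p(1) q(1) by (rule eq[OF p(2,3) q(2,3)])
qed (use assms in auto)

text \<open>Shape and entries go through one induction: when the last block is appended, the shape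
  of the others sizes the zero corners and decides in which corner an entry lies.\<close>

lemma block_diag_aux:
  assumes "\<And>j. j \<in> {1..s} \<Longrightarrow> h j \<in> carrier_mat (\<mu> j) (\<mu> j)"
  shows "block_diag s h \<in> carrier_mat (\<Sum>j = 1..s. \<mu> j) (\<Sum>j = 1..s. \<mu> j) \<and>
    (\<forall>j\<in>{1..s}. \<forall>i<\<mu> j. \<forall>j'\<in>{1..s}. \<forall>i'<\<mu> j'.
       block_diag s h $$ (block_pos \<mu> (j, i), block_pos \<mu> (j', i')) = (if j = j' then h j $$ (i, i') else 0))"
  using assms
proof (induction s)
  case 0
  then show ?case by (simp add: block_diag_def)
next
  case (Suc s)
  let ?M = "\<Sum>j = 1..s. \<mu> j"
  have IH: "block_diag s h \<in> carrier_mat ?M ?M"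
    "\<And>j i j' i'. j \<in> {1..s} \<Longrightarrow> i < \<mu> j \<Longrightarrow> j' \<in> {1..s} \<Longrightarrow> i' < \<mu> j' \<Longrightarrow>
       block_diag s h $$ (block_pos \<mu> (j, i), block_pos \<mu> (j', i')) = (if j = j' then h j $$ (i, i') else 0)"
    using Suc by simp_all
  have hS: "h (Suc s) \<in> carrier_mat (\<mu> (Suc s)) (\<mu> (Suc s))" using Suc.prems by simp
  have bd: "block_diag (Suc s) h = four_block_mat (block_diag s h) (0\<^sub>m ?M (\<mu> (Suc s))) (0\<^sub>m (\<mu> (Suc s)) ?M) (h (Suc s))"
  proof -
    have "block_diag (Suc s) h = diag_block_mat (map h [1..<Suc s] @ [h (Suc s)])"
      unfolding block_diag_def by (subst upt_Suc_append) simp_all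
    also have "\<dots> = four_block_mat (block_diag s h) (0\<^sub>m (dim_row (block_diag s h)) (dim_col (h (Suc s))))
        (0\<^sub>m (dim_row (h (Suc s))) (dim_col (block_diag s h))) (h (Suc s))"
      unfolding diag_block_mat_append Let_def diag_block_mat_singleton block_diag_def ..
    finally show ?thesis by (simp only: carrier_matD[OF IH(1)] carrier_matD[OF hS])
  qed
  have o: "block_offset \<mu> (Suc s) = ?M"
    by (simp add: block_offset_def atLeastLessThanSuc_atLeastAtMost)
  have 1: "block_diag (Suc s) h \<in> carrier_mat (?M + \<mu> (Suc s)) (?M + \<mu> (Suc s))"
    unfolding bd using IH(1) hS by (intro four_block_carrier_mat) auto
  have "block_diag (Suc s) h $$ (block_pos \<mu> (j, i), block_pos \<mu> (j', i')) = (if j = j' then h j $$ (i, i') else 0)"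
    if ji: "j \<in> {1..Suc s}" "i < \<mu> j" "j' \<in> {1..Suc s}" "i' < \<mu> j'" for j i j' i'
  proof -
    have lt: "block_pos \<mu> (j, i) < ?M \<longleftrightarrow> j \<in> {1..s}" if "j \<in> {1..Suc s}" "i < \<mu> j" for j i
    proof
      assume "block_pos \<mu> (j, i) < ?M"
      then have "j \<noteq> Suc s" by (auto simp: block_pos_def o)
      then show "j \<in> {1..s}" using that(1) by (simp add: le_Suc_eq)
    qed (use block_pos_less[of j s i \<mu>] that(2) in simp)
    have less: "block_pos \<mu> (j, i) < ?M + \<mu> (Suc s)" if "j \<in> {1..Suc s}" "i < \<mu> j" for j i
      using block_pos_less[of j "Suc s" i \<mu>] that by simp
    have Spos: "block_pos \<mu> (Suc s, i) - ?M = i" for i by (simp add: block_pos_def o)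
    have ent: "block_diag (Suc s) h $$ (p, q) =
        (if p < ?M then if q < ?M then block_diag s h $$ (p, q) else 0\<^sub>m ?M (\<mu> (Suc s)) $$ (p, q - ?M)
         else if q < ?M then 0\<^sub>m (\<mu> (Suc s)) ?M $$ (p - ?M, q) else h (Suc s) $$ (p - ?M, q - ?M))"
      if "p < ?M + \<mu> (Suc s)" "q < ?M + \<mu> (Suc s)" for p q
      unfolding bd using that IH(1) hS by (subst index_mat_four_block) auto
    consider "j \<in> {1..s}" "j' \<in> {1..s}" | "j \<in> {1..s}" "j' = Suc s" | "j = Suc s" "j' \<in> {1..s}" | "j = Suc s" "j' = Suc s"
      using ji by (auto simp: le_Suc_eq)
    then show ?thesis
    proof cases
      case 1
      then show ?thesis using ent[OF less[OF ji(1,2)] less[OF ji(3,4)]] lt[OF ji(1,2)] lt[OF ji(3,4)] IH(2) ji by simp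
    next
      case 2
      have "j' \<notin> {1..s}" "j \<noteq> j'" using 2 by auto
      then show ?thesis using ent[OF less[OF ji(1,2)] less[OF ji(3,4)]] lt[OF ji(1,2)] lt[OF ji(3,4)] 2 ji less[OF ji(3,4)]
        by simp
    next
      case 3
      have "j \<notin> {1..s}" "j \<noteq> j'" using 3 by auto
      then show ?thesis using ent[OF less[OF ji(1,2)] less[OF ji(3,4)]] lt[OF ji(1,2)] lt[OF ji(3,4)] 3 ji less[OF ji(1,2)]
        by simp
    next
      case 4
      have "j \<notin> {1..s}" "j' \<notin> {1..s}" using 4 by auto
      then show ?thesis using ent[OF less[OF ji(1,2)] less[OF ji(3,4)]] lt[OF ji(1,2)] lt[OF ji(3,4)] 4 Spos
        by simp
    qed
  qed
  then show ?case using 1 by simp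
qed

section \<open>The algebra of block diagonal matrices\<close>

locale blocks =
  fixes s :: nat and \<mu> :: "nat \<Rightarrow> nat" and m :: nat
  assumes m_sum: "m = (\<Sum>j = 1..s. \<mu> j)"
begin

definition block_family :: "(nat \<Rightarrow> complex mat) \<Rightarrow> bool" where
  "block_family h \<longleftrightarrow> (\<forall>j\<in>{1..s}. h j \<in> carrier_mat (\<mu> j) (\<mu> j))"

lemma block_familyI: "(\<And>j. j \<in> {1..s} \<Longrightarrow> h j \<in> carrier_mat (\<mu> j) (\<mu> j)) \<Longrightarrow> block_family h"
  by (simp add: block_family_def)

lemma block_familyD: "block_family h \<Longrightarrow> j \<in> {1..s} \<Longrightarrow> h j \<in> carrier_mat (\<mu> j) (\<mu> j)"
  unfolding block_family_def by blast

lemma pos_less: "j \<in> {1..s} \<Longrightarrow> i < \<mu> j \<Longrightarrow> block_pos \<mu> (j, i) < m"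
  unfolding m_sum using block_pos_less[of j s i \<mu>] by blast

lemma block_diag_carrier: "block_family h \<Longrightarrow> block_diag s h \<in> carrier_mat m m"
  unfolding m_sum using block_diag_aux[of s h \<mu>] block_familyD[of h] by blast

lemma block_diag_entry:
  assumes "block_family h" "j \<in> {1..s}" "i < \<mu> j" "j' \<in> {1..s}" "i' < \<mu> j'"
  shows "block_diag s h $$ (block_pos \<mu> (j, i), block_pos \<mu> (j', i')) = (if j = j' then h j $$ (i, i') else 0)"
  using block_diag_aux[of s h \<mu>, OF block_familyD[OF assms(1)]] assms(2-5) by blast

lemma block_diag_mult:
  assumes h: "block_family h" and h': "block_family h'"
  shows "block_diag s h * block_diag s h' = block_diag s (\<lambda>j. h j * h' j)"
proof (rule block_mat_eqI[OF _ _ m_sum])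
  note c = block_diag_carrier[OF h] block_diag_carrier[OF h']
  show "block_diag s h * block_diag s h' \<in> carrier_mat m m" by (rule mult_carrier_mat[OF c])
  have hh: "block_family (\<lambda>j. h j * h' j)"
    by (rule block_familyI) (rule mult_carrier_mat[OF block_familyD[OF h] block_familyD[OF h']])
  show "block_diag s (\<lambda>j. h j * h' j) \<in> carrier_mat m m" by (rule block_diag_carrier[OF hh])
  fix j i j' i' assume ji: "j \<in> {1..s}" "i < \<mu> j" "j' \<in> {1..s}" "i' < \<mu> j'"
  let ?p = "block_pos \<mu> (j, i)" and ?q = "block_pos \<mu> (j', i')"
  have "(block_diag s h * block_diag s h') $$ (?p, ?q) = (\<Sum>r<m. block_diag s h $$ (?p, r) * block_diag s h' $$ (r, ?q))"
    using c pos_less[OF ji(1,2)] pos_less[OF ji(3,4)] by (simp add: scalar_prod_def lessThan_atLeast0)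
  also have "\<dots> = (\<Sum>a = 1..s. \<Sum>b<\<mu> a. (if j = a then h j $$ (i, b) else 0) * (if a = j' then h' a $$ (b, i') else 0))"
    unfolding m_sum sum_blocks
    by (intro sum.cong refl) (simp add: block_diag_entry[OF h ji(1,2)] block_diag_entry[OF h' _ _ ji(3,4)])
  also have "\<dots> = (\<Sum>a = 1..s. if a = j then (\<Sum>b<\<mu> j. h j $$ (i, b) * (if j = j' then h' j $$ (b, i') else 0)) else 0)"
    by (intro sum.cong refl) auto
  also have "\<dots> = (if j = j' then (h j * h' j) $$ (i, i') else 0)"
  proof (cases "j = j'")
    case True
    have "(h j * h' j) $$ (i, i') = (\<Sum>b<\<mu> j. h j $$ (i, b) * h' j $$ (b, i'))"
      using carrier_matD[OF block_familyD[OF h ji(1)]] carrier_matD[OF block_familyD[OF h' ji(1)]] ji(2,4) True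
      by (simp add: scalar_prod_def lessThan_atLeast0)
    then show ?thesis using True ji(1) by simp
  qed simp
  finally show "(block_diag s h * block_diag s h') $$ (?p, ?q) = block_diag s (\<lambda>j. h j * h' j) $$ (?p, ?q)"
    by (simp add: block_diag_entry[OF hh ji])
qed

lemma adjoint_family:
  assumes "block_family h"
  shows "block_family (\<lambda>j. mat_adjoint (h j))"
proof (rule block_familyI)
  fix j assume "j \<in> {1..s}"
  from carrier_matD[OF block_familyD[OF assms this]] show "mat_adjoint (h j) \<in> carrier_mat (\<mu> j) (\<mu> j)"
    by (intro carrier_matI) simp_all
qed

lemma block_diag_adjoint:
  assumes h: "block_family h"
  shows "mat_adjoint (block_diag s h) = block_diag s (\<lambda>j. mat_adjoint (h j))"
proof (rule block_mat_eqI[OF _ _ m_sum])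
  note c = block_diag_carrier[OF h]
  show "mat_adjoint (block_diag s h) \<in> carrier_mat m m" using c by (intro carrier_matI) simp_all
  have hh: "block_family (\<lambda>j. mat_adjoint (h j))"
    by (rule adjoint_family[OF h])
  show "block_diag s (\<lambda>j. mat_adjoint (h j)) \<in> carrier_mat m m" by (rule block_diag_carrier[OF hh])
  fix j i j' i' assume ji: "j \<in> {1..s}" "i < \<mu> j" "j' \<in> {1..s}" "i' < \<mu> j'"
  let ?p = "block_pos \<mu> (j, i)" and ?q = "block_pos \<mu> (j', i')"
  have "mat_adjoint (block_diag s h) $$ (?p, ?q) = cnj (block_diag s h $$ (?q, ?p))"
    using c pos_less[OF ji(1,2)] pos_less[OF ji(3,4)] by (simp add: mat_adjoint_index)
  also have "\<dots> = (if j = j' then mat_adjoint (h j) $$ (i, i') else 0)"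
  proof (cases "j = j'")
    case True
    have "mat_adjoint (h j) $$ (i, i') = cnj (h j $$ (i', i))"
      using carrier_matD[OF block_familyD[OF h ji(1)]] ji(2,4) True by (simp add: mat_adjoint_index)
    then show ?thesis unfolding block_diag_entry[OF h ji(3,4,1,2)] using True by simp
  qed (simp add: block_diag_entry[OF h ji(3,4,1,2)])
  finally show "mat_adjoint (block_diag s h) $$ (?p, ?q) = block_diag s (\<lambda>j. mat_adjoint (h j)) $$ (?p, ?q)"
    by (simp add: block_diag_entry[OF hh ji])
qed

lemma block_diag_scalars:
  "block_family (\<lambda>j. f j \<cdot>\<^sub>m 1\<^sub>m (\<mu> j))"
  "j \<in> {1..s} \<Longrightarrow> i < \<mu> j \<Longrightarrow> j' \<in> {1..s} \<Longrightarrow> i' < \<mu> j' \<Longrightarrow>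
    block_diag s (\<lambda>j. f j \<cdot>\<^sub>m 1\<^sub>m (\<mu> j)) $$ (block_pos \<mu> (j, i), block_pos \<mu> (j', i')) =
    (if block_pos \<mu> (j, i) = block_pos \<mu> (j', i') then f j else 0)"
proof -
  show h: "block_family (\<lambda>j. f j \<cdot>\<^sub>m 1\<^sub>m (\<mu> j))" by (rule block_familyI) simp
  assume ji: "j \<in> {1..s}" "i < \<mu> j" "j' \<in> {1..s}" "i' < \<mu> j'"
  show "block_diag s (\<lambda>j. f j \<cdot>\<^sub>m 1\<^sub>m (\<mu> j)) $$ (block_pos \<mu> (j, i), block_pos \<mu> (j', i')) =
    (if block_pos \<mu> (j, i) = block_pos \<mu> (j', i') then f j else 0)"
    unfolding block_diag_entry[OF h ji] block_pos_eq_iff[OF ji] using ji by auto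
qed

lemma block_diag_one: "block_diag s (\<lambda>j. 1\<^sub>m (\<mu> j)) = 1\<^sub>m m"
proof (rule block_mat_eqI[OF _ _ m_sum])
  have h: "block_family (\<lambda>j. 1\<^sub>m (\<mu> j))" by (rule block_familyI) simp
  show "block_diag s (\<lambda>j. 1\<^sub>m (\<mu> j)) \<in> carrier_mat m m" by (rule block_diag_carrier[OF h])
  fix j i j' i' assume ji: "j \<in> {1..s}" "i < \<mu> j" "j' \<in> {1..s}" "i' < \<mu> j'"
  show "block_diag s (\<lambda>j. 1\<^sub>m (\<mu> j)) $$ (block_pos \<mu> (j, i), block_pos \<mu> (j', i')) = 1\<^sub>m m $$ (block_pos \<mu> (j, i), block_pos \<mu> (j', i'))"
    unfolding block_diag_entry[OF h ji] index_one_mat(1)[OF pos_less[OF ji(1,2)] pos_less[OF ji(3,4)]] block_pos_eq_iff[OF ji]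
    using ji by (cases "j = j'") simp_all
qed simp

lemma block_diag_inj:
  assumes h: "block_family h" and h': "block_family h'" and eq: "block_diag s h = block_diag s h'" and j: "j \<in> {1..s}"
  shows "h j = h' j"
proof (rule eq_matI)
  fix i i' assume "i < dim_row (h' j)" "i' < dim_col (h' j)"
  then have i: "i < \<mu> j" "i' < \<mu> j" using block_familyD[OF h' j] by auto
  show "h j $$ (i, i') = h' j $$ (i, i')"
    using block_diag_entry[OF h j i(1) j i(2)] block_diag_entry[OF h' j i(1) j i(2)] eq by simp
qed (use block_familyD[OF h j] block_familyD[OF h' j] in auto)

lemma block_diag_cong: "(\<And>j. j \<in> {1..s} \<Longrightarrow> h j = h' j) \<Longrightarrow> block_diag s h = block_diag s h'"
  unfolding block_diag_def by (intro arg_cong[of _ _ diag_block_mat] map_cong) auto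

lemma block_diag_unitary_iff:
  assumes h: "block_family h"
  shows "block_diag s h \<in> unitary m \<longleftrightarrow> (\<forall>j\<in>{1..s}. h j \<in> unitary (\<mu> j))"
proof -
  have ha: "block_family (\<lambda>j. mat_adjoint (h j))"
    by (rule adjoint_family[OF h])
  have hp: "block_family (\<lambda>j. mat_adjoint (h j) * h j)"
    by (rule block_familyI) (rule mult_carrier_mat[OF block_familyD[OF ha] block_familyD[OF h]])
  have o: "block_family (\<lambda>j. 1\<^sub>m (\<mu> j))" by (rule block_familyI) simp
  have e: "mat_adjoint (block_diag s h) * block_diag s h = block_diag s (\<lambda>j. mat_adjoint (h j) * h j)"
    unfolding block_diag_adjoint[OF h] by (rule block_diag_mult[OF ha h])
  show ?thesis
  proof
    assume "block_diag s h \<in> unitary m"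
    then have "block_diag s (\<lambda>j. mat_adjoint (h j) * h j) = block_diag s (\<lambda>j. 1\<^sub>m (\<mu> j))"
      using e unitaryD(3) by (simp add: block_diag_one)
    note eq = this
    show "\<forall>j\<in>{1..s}. h j \<in> unitary (\<mu> j)"
    proof
      fix j assume j: "j \<in> {1..s}"
      show "h j \<in> unitary (\<mu> j)"
        by (rule unitaryI[OF block_familyD[OF h j] block_diag_inj[OF hp o eq j]])
    qed
  next
    assume u: "\<forall>j\<in>{1..s}. h j \<in> unitary (\<mu> j)"
    have "block_diag s (\<lambda>j. mat_adjoint (h j) * h j) = block_diag s (\<lambda>j. 1\<^sub>m (\<mu> j))"
      by (rule block_diag_cong) (rule unitaryD(3)[OF bspec[OF u]])
    then show "block_diag s h \<in> unitary m"
      using e block_diag_carrier[OF h] by (intro unitaryI) (simp_all add: block_diag_one)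
  qed
qed

definition diag_part :: "complex mat \<Rightarrow> nat \<Rightarrow> complex mat" where
  "diag_part M j = mat (\<mu> j) (\<mu> j) (\<lambda>(i, i'). M $$ (block_pos \<mu> (j, i), block_pos \<mu> (j, i')))"

lemma diag_part_family: "block_family (diag_part M)"
  by (rule block_familyI) (simp add: diag_part_def)

text \<open>Comparing the entries at (p, q) gives M_pq f_j' = f_j M_pq, so entries linking blocks
  with different scalars vanish.\<close>

lemma commutes_with_scalars_imp_block_diag:
  assumes M: "M \<in> carrier_mat m m" and inj: "inj_on f {1..s}"
    and eq: "M * block_diag s (\<lambda>j. f j \<cdot>\<^sub>m 1\<^sub>m (\<mu> j)) = block_diag s (\<lambda>j. f j \<cdot>\<^sub>m 1\<^sub>m (\<mu> j)) * M"
  shows "M = block_diag s (diag_part M)"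
proof (rule block_mat_eqI[OF M block_diag_carrier[OF diag_part_family] m_sum])
  let ?L = "block_diag s (\<lambda>j. f j \<cdot>\<^sub>m 1\<^sub>m (\<mu> j))"
  have Lc: "?L \<in> carrier_mat m m" by (rule block_diag_carrier[OF block_diag_scalars(1)])
  fix j i j' i' assume ji: "j \<in> {1..s}" "i < \<mu> j" "j' \<in> {1..s}" "i' < \<mu> j'"
  let ?p = "block_pos \<mu> (j, i)" and ?q = "block_pos \<mu> (j', i')"
  note lt = pos_less[OF ji(1,2)] pos_less[OF ji(3,4)]
  have L: "?L $$ (r, ?q) = (if r = ?q then f j' else 0)" "?L $$ (?p, r) = (if r = ?p then f j else 0)" if "r < m" for r
  proof -
    have rs: "r < (\<Sum>j = 1..s. \<mu> j)" using that by (simp only: m_sum)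
    obtain a b where r: "r = block_pos \<mu> (a, b)" "a \<in> {1..s}" "b < \<mu> a" by (rule block_cases[OF rs])
    show "?L $$ (r, ?q) = (if r = ?q then f j' else 0)"
      unfolding r(1) block_diag_scalars(2)[OF r(2,3) ji(3,4)] block_pos_eq_iff[OF r(2,3) ji(3,4)] by simp
    show "?L $$ (?p, r) = (if r = ?p then f j else 0)"
      unfolding r(1) block_diag_scalars(2)[OF ji(1,2) r(2,3)] block_pos_eq_iff[OF ji(1,2) r(2,3)]
        block_pos_eq_iff[OF r(2,3) ji(1,2)] by auto
  qed
  have "(M * ?L) $$ (?p, ?q) = (\<Sum>r<m. M $$ (?p, r) * ?L $$ (r, ?q))"
    using M Lc lt by (simp add: scalar_prod_def lessThan_atLeast0)
  also have "\<dots> = (\<Sum>r<m. if r = ?q then M $$ (?p, ?q) * f j' else 0)"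
    by (intro sum.cong refl) (simp only: L(1) lessThan_iff, simp)
  finally have 1: "(M * ?L) $$ (?p, ?q) = M $$ (?p, ?q) * f j'" using lt by simp
  have "(?L * M) $$ (?p, ?q) = (\<Sum>r<m. ?L $$ (?p, r) * M $$ (r, ?q))"
    using M Lc lt by (simp add: scalar_prod_def lessThan_atLeast0)
  also have "\<dots> = (\<Sum>r<m. if r = ?p then f j * M $$ (?p, ?q) else 0)"
    by (intro sum.cong refl) (simp only: L(2) lessThan_iff, simp)
  finally have "(?L * M) $$ (?p, ?q) = f j * M $$ (?p, ?q)" using lt by simp
  then have "M $$ (?p, ?q) * f j' = f j * M $$ (?p, ?q)" using 1 by (simp only: eq)
  then have "j \<noteq> j' \<Longrightarrow> M $$ (?p, ?q) = 0"
    using inj ji(1,3) by (simp add: inj_on_eq_iff)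
  then show "M $$ (?p, ?q) = block_diag s (diag_part M) $$ (?p, ?q)"
    unfolding block_diag_entry[OF diag_part_family ji] using ji by (auto simp: diag_part_def)
qed

end

section \<open>Roots of unity and almost commuting tuples\<close>

lemma exp_ratmod_0: "exp_ratmod 0 = 1"
  by transfer simp

lemma exp_ratmod_uminus: "exp_ratmod (- r) = inverse (exp_ratmod r)"
  by transfer (simp add: of_rat_minus exp_minus)

lemma exp_ratmod_int_scale: "exp_ratmod (int_scale (int k) r) = exp_ratmod r ^ k"
  by transfer (simp add: of_rat_mult mult_ac flip: exp_of_nat_mult)

lemma int_scale_uminus: "int_scale (- k) r = - int_scale k r"
  by transfer simp

text \<open>The sign of the matrix is explained here: -c_i q_j stands at (t + i, i), hence c_i q_j
  at (i, t + i), whose exponential lam_j^c_i is the commutator of a_i and a_(t+i).\<close>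

lemma (in heisenberg_type) exp_D_matrix:
  assumes "j \<in> {1..s}"
  shows "exp_ratmod (D_matrix t (\<lambda>i. int_scale (- int (c i)) (log_ratmod (lam j))) i i') = twist j i i'"
proof -
  have "exp_ratmod (log_ratmod (lam j)) = lam j"
    using prim[OF assms] k_pos[OF assms] by (intro exp_log_ratmod[of _ "k j"]) (simp_all add: primitive_root_of_unity_def)
  then show ?thesis
    by (auto simp: D_matrix_def twist_def int_scale_uminus exp_ratmod_uminus exp_ratmod_int_scale exp_ratmod_0 add.commute)
qed

text \<open>The matrix C below is the inverse of B A and the commutator is A B C, so the two
  equations arise from each other by multiplying with C or with B A.\<close>

lemma commutator_unitary_eq_iff:
  assumes A: "A \<in> unitary d" and B: "B \<in> unitary d"
  shows "commutator (unitary_group d) A B = z \<cdot>\<^sub>m 1\<^sub>m d \<longleftrightarrow> A * B = z \<cdot>\<^sub>m (B * A)"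
proof -
  note a = unitaryD[OF A] and b = unitaryD[OF B]
  have BA: "B * A \<in> carrier_mat d d" and AB: "A * B \<in> carrier_mat d d" using a b by auto
  define C where "C = mat_adjoint A * mat_adjoint B"
  have C: "C \<in> carrier_mat d d" unfolding C_def using a b by auto
  have C1: "C * (B * A) = 1\<^sub>m d"
  proof -
    have "C * (B * A) = mat_adjoint A * (mat_adjoint B * (B * A))" unfolding C_def by (rule assoc_mult_mat[OF a(5) b(5) BA])
    also have "mat_adjoint B * (B * A) = mat_adjoint B * B * A" by (rule assoc_mult_mat[OF b(5,1) a(1), symmetric])
    finally show ?thesis using a b by simp
  qed
  have C2: "(B * A) * C = 1\<^sub>m d" by (rule mat_mult_left_right_inverse[OF C BA C1])
  have comm: "commutator (unitary_group d) A B = (A * B) * C"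
    using A B a b AB by (simp add: commutator_def C_def assoc_mult_mat[of _ d d _ d _ d])
  have one: "(z \<cdot>\<^sub>m 1\<^sub>m d) * M = z \<cdot>\<^sub>m M" if "M \<in> carrier_mat d d" for M
    using mult_smult_assoc_mat[OF one_carrier_mat that, of z] left_mult_one_mat[OF that] by (rule trans[OF _ arg_cong])
  show ?thesis
  proof (rule iffI)
    assume c: "commutator (unitary_group d) A B = z \<cdot>\<^sub>m 1\<^sub>m d"
    have "A * B = A * B * (C * (B * A))" by (simp only: C1 right_mult_one_mat[OF AB])
    also have "\<dots> = A * B * C * (B * A)" by (rule assoc_mult_mat[OF AB C BA, symmetric])
    also have "\<dots> = z \<cdot>\<^sub>m (B * A)" by (simp only: comm[symmetric] c one[OF BA])
    finally show "A * B = z \<cdot>\<^sub>m (B * A)" .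
  next
    assume c: "A * B = z \<cdot>\<^sub>m (B * A)"
    show "commutator (unitary_group d) A B = z \<cdot>\<^sub>m 1\<^sub>m d"
      by (simp only: comm c mult_smult_assoc_mat[OF BA C] C2)
  qed
qed

lemma topspace_almost_commuting:
  "topspace (almost_commuting n d D) = {A \<in> {1..n} \<rightarrow>\<^sub>E unitary d. \<forall>i\<in>{1..n}. \<forall>j\<in>{1..n}. A i * A j = exp_ratmod (D i j) \<cdot>\<^sub>m (A j * A i)}"
proof -
  have "A \<in> topspace (almost_commuting n d D) \<longleftrightarrow> A \<in> {1..n} \<rightarrow>\<^sub>E unitary d \<and>
      (\<forall>i\<in>{1..n}. \<forall>j\<in>{1..n}. A i * A j = exp_ratmod (D i j) \<cdot>\<^sub>m (A j * A i))" for A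
  proof (cases "A \<in> {1..n} \<rightarrow>\<^sub>E unitary d")
    case True
    have "commutator (unitary_group d) (A i) (A j) = exp_ratmod (D i j) \<cdot>\<^sub>m 1\<^sub>m d \<longleftrightarrow> A i * A j = exp_ratmod (D i j) \<cdot>\<^sub>m (A j * A i)"
      if "i \<in> {1..n}" "j \<in> {1..n}" for i j
      by (rule commutator_unitary_eq_iff[OF PiE_mem[OF True that(1)] PiE_mem[OF True that(2)]])
    with True show ?thesis
      by (simp only: almost_commuting_def topspace_subtopology topspace_product_topology topspace_unitary_topology
          Int_iff mem_Collect_eq simp_thms cong: ball_cong)
  next
    case False
    then show ?thesis
      by (simp only: almost_commuting_def topspace_subtopology topspace_product_topology topspace_unitary_topology
          Int_iff simp_thms)
  qed
  then show ?thesis by (simp only: set_eq_iff mem_Collect_eq simp_thms)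
qed

text \<open>This is a closed subset of a power of the compact unitary group, with one closed
  condition for each pair of indices.\<close>

lemma compact_space_almost_commuting: "compact_space (almost_commuting n d D)"
proof -
  let ?P = "product_topology (\<lambda>_. unitary_topology d) {1..n}"
  let ?S = "{A. \<forall>i\<in>{1..n}. \<forall>j\<in>{1..n}. commutator (unitary_group d) (A i) (A j) = exp_ratmod (D i j) \<cdot>\<^sub>m 1\<^sub>m d}"
  have P: "compact_space ?P"
    using compact_space_unitary_topology[of d] by (simp only: compact_space_product_topology simp_thms ball_triv)
  define C where "C i j A = commutator (unitary_group d) (A i) (A j)" for i j and A :: "nat \<Rightarrow> complex mat"
  define E where "E i j = {A \<in> topspace ?P. C i j A \<in> {exp_ratmod (D i j) \<cdot>\<^sub>m 1\<^sub>m d}}" for i j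
  have c: "continuous_map ?P (unitary_topology d) (\<lambda>A. A i)" if "i \<in> {1..n}" for i
    using that by (rule continuous_map_product_projection)
  have C: "continuous_map ?P (unitary_topology d) (C i j)" if "i \<in> {1..n}" "j \<in> {1..n}" for i j
  proof (rule continuous_map_eq)
    show "continuous_map ?P (unitary_topology d) (\<lambda>A. A i * A j * mat_adjoint (A i) * mat_adjoint (A j))"
      using that by (intro continuous_map_unitary_mult continuous_map_unitary_adjoint c)
    fix A assume "A \<in> topspace ?P"
    then have "A i \<in> unitary d" "A j \<in> unitary d" using that by (simp_all add: PiE_iff del: atLeastAtMost_iff)
    then show "A i * A j * mat_adjoint (A i) * mat_adjoint (A j) = C i j A"
      by (simp add: C_def commutator_def)
  qed
  have cl: "closedin ?P (E i j)" if "i \<in> {1..n}" "j \<in> {1..n}" for i j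
  proof (cases "exp_ratmod (D i j) \<cdot>\<^sub>m 1\<^sub>m d \<in> unitary d")
    case True
    have "closedin (unitary_topology d) {exp_ratmod (D i j) \<cdot>\<^sub>m 1\<^sub>m d}"
      by (rule closedin_Hausdorff_singleton[OF Hausdorff_space_unitary_topology]) (simp add: True)
    then show ?thesis unfolding E_def by (rule closedin_continuous_map_preimage[OF C[OF that]])
  next
    case False
    \<comment> \<open>Commutators of unitary matrices are unitary, so a right-hand side that is not
      unitary leaves no solutions.\<close>
    have "E i j = {}"
      using continuous_map_funspace[OF C[OF that]] False by (auto simp: E_def Pi_iff)
    then show ?thesis by simp
  qed
  have "closedin ?P (\<Inter>(insert (topspace ?P) ((\<lambda>(i, j). E i j) ` ({1..n} \<times> {1..n}))))"
    by (rule closedin_Inter) (use cl in \<open>auto simp del: topspace_product_topology\<close>)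
  moreover have "\<Inter>(insert (topspace ?P) ((\<lambda>(i, j). E i j) ` ({1..n} \<times> {1..n}))) = topspace ?P \<inter> ?S"
    by (auto simp add: E_def C_def simp del: topspace_product_topology)
  ultimately have "closedin ?P (topspace ?P \<inter> ?S)" by simp
  then have "compactin ?P (topspace ?P \<inter> ?S)" by (rule closedin_compact_space[OF P])
  then have "compact_space (subtopology ?P (topspace ?P \<inter> ?S))" by (rule compactin_subspace[THEN iffD1, THEN conjunct2])
  then show ?thesis by (simp only: almost_commuting_def subtopology_restrict)
qed

section \<open>The conjugation action on the space of representations\<close>

text \<open>The action laws are required on E only, because the actions below satisfy them on the
  underlying set of a topological space, not on all functions.\<close>

lemma orbit_eq_iff:
  assumes G: "group G"
    and closed: "\<And>g y. g \<in> carrier G \<Longrightarrow> y \<in> E \<Longrightarrow> \<phi> g y \<in> E"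
    and one: "\<And>y. y \<in> E \<Longrightarrow> \<phi> \<one>\<^bsub>G\<^esub> y = y"
    and mult: "\<And>g h y. g \<in> carrier G \<Longrightarrow> h \<in> carrier G \<Longrightarrow> y \<in> E \<Longrightarrow> \<phi> (g \<otimes>\<^bsub>G\<^esub> h) y = \<phi> g (\<phi> h y)"
    and y: "y \<in> E" and z: "z \<in> E"
  shows "orbit G \<phi> y = orbit G \<phi> z \<longleftrightarrow> (\<exists>g\<in>carrier G. z = \<phi> g y)"
proof -
  interpret G: group G by (rule G)
  show ?thesis
  proof (rule iffI)
    assume eq: "orbit G \<phi> y = orbit G \<phi> z"
    have "z = \<phi> \<one>\<^bsub>G\<^esub> z" by (rule one[OF z, symmetric])
    then have "z \<in> orbit G \<phi> z" unfolding orbit_def mem_Collect_eq by (intro exI conjI) (assumption, rule G.one_closed)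
    then have "z \<in> orbit G \<phi> y" unfolding eq .
    then show "\<exists>g\<in>carrier G. z = \<phi> g y" unfolding orbit_def mem_Collect_eq
      by (elim exE conjE) (rule bexI)
  next
    assume "\<exists>g\<in>carrier G. z = \<phi> g y"
    then obtain g where g: "g \<in> carrier G" "z = \<phi> g y" by (rule bexE)
    show "orbit G \<phi> y = orbit G \<phi> z"
    proof (rule equalityI; rule subsetI)
      fix w assume "w \<in> orbit G \<phi> y"
      then obtain h where h: "h \<in> carrier G" "w = \<phi> h y" unfolding orbit_def mem_Collect_eq by (elim exE conjE)
      have "w = \<phi> ((h \<otimes>\<^bsub>G\<^esub> inv\<^bsub>G\<^esub> g) \<otimes>\<^bsub>G\<^esub> g) y" using g(1) h by (simp add: G.m_assoc)
      also have "\<dots> = \<phi> (h \<otimes>\<^bsub>G\<^esub> inv\<^bsub>G\<^esub> g) z" unfolding g(2) by (rule mult) (use g(1) h(1) y in simp_all)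
      finally show "w \<in> orbit G \<phi> z" unfolding orbit_def mem_Collect_eq
        by (intro exI conjI) (assumption, use g(1) h(1) in simp)
    next
      fix w assume "w \<in> orbit G \<phi> z"
      then obtain h where h: "h \<in> carrier G" "w = \<phi> h z" unfolding orbit_def mem_Collect_eq by (elim exE conjE)
      have "w = \<phi> (h \<otimes>\<^bsub>G\<^esub> g) y" unfolding h(2) g(2) by (rule mult[symmetric]) (use g(1) h(1) y in simp_all)
      then show "w \<in> orbit G \<phi> y" unfolding orbit_def mem_Collect_eq
        by (intro exI conjI) (assumption, use g(1) h(1) in simp)
    qed
  qed
qed

lemma unitary_conj_eq_iff:
  assumes g: "g \<in> unitary m" and X: "X \<in> carrier_mat m m" and Y: "Y \<in> carrier_mat m m"
  shows "Y = g * X * mat_adjoint g \<longleftrightarrow> Y * g = g * X"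
proof -
  note u = unitaryD[OF g]
  have gX: "g * X \<in> carrier_mat m m" using u(1) X by simp
  show ?thesis
  proof (rule iffI)
    assume e: "Y = g * X * mat_adjoint g"
    have "Y * g = g * X * (mat_adjoint g * g)" unfolding e by (rule assoc_mult_mat[OF gX u(5) u(1)])
    then show "Y * g = g * X" by (simp only: u(3) right_mult_one_mat[OF gX])
  next
    assume e: "Y * g = g * X"
    have "g * X * mat_adjoint g = Y * (g * mat_adjoint g)" unfolding e[symmetric] by (rule assoc_mult_mat[OF Y u(1) u(5)])
    then show "Y = g * X * mat_adjoint g" by (simp only: u(2) right_mult_one_mat[OF Y])
  qed
qed

text \<open>The relations evaluate A at t + i with i \<le> t, which stays within {1..n} because 2 t
  \<le> n.\<close>

lemma heisenberg_rels_cong: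
  assumes "2 * t \<le> n" "\<And>i. i \<in> {1..n} \<Longrightarrow> A i = A' i"
  shows "heisenberg_rels G n t c X A \<longleftrightarrow> heisenberg_rels G n t c X A'"
proof -
  have "A i = A' i" "A (t + i) = A' (t + i)" if "i \<in> {1..t}" for i
    using that assms(1) by (auto intro!: assms(2))
  with assms(2) show ?thesis unfolding heisenberg_rels_def by (simp only: cong: ball_cong)
qed

lemma ex_unit_root:
  assumes "norm (w :: complex) = 1" "(d :: nat) > 0"
  shows "\<exists>r. norm r = 1 \<and> r ^ d = w"
proof -
  have w: "w = exp (\<i> * of_real (Arg w))" using Arg_eq[of w] assms(1) by force
  define r where "r = exp (\<i> * of_real (Arg w / real d))"
  have "norm r = 1" unfolding r_def by (simp only: norm_exp_i_times)
  moreover have "r ^ d = exp (of_nat d * (\<i> * of_real (Arg w / real d)))"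
    unfolding r_def by (rule exp_of_nat_mult[symmetric])
  moreover have "of_nat d * (\<i> * of_real (Arg w / real d)) = \<i> * of_real (Arg w)"
    using assms(2) by simp
  ultimately show ?thesis using w by (intro exI[of _ r]) simp
qed

lemma restrict_eq_iff: "restrict f I = restrict g I \<longleftrightarrow> (\<forall>i\<in>I. f i = g i)"
proof
  assume eq: "restrict f I = restrict g I"
  show "\<forall>i\<in>I. f i = g i"
  proof
    fix i assume i: "i \<in> I"
    show "f i = g i" using fun_cong[OF eq, of i] i by simp
  qed
qed (rule restrict_ext, simp)

lemma compact_torus: "compact_space (torus n)"
proof -
  have "compact_space (top_of_set (sphere (0::complex) 1))"
    by (simp add: compact_space_subtopology compactin_euclidean_iff)
  then show ?thesis unfolding torus_def compact_space_product_topology by (intro disjI2 ballI)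
qed

section \<open>Homomorphisms as tuples of unitary matrices\<close>

locale unitary_representations =
  ext: heisenberg_extension \<Gamma> \<iota> \<pi> x a n t c + heisenberg_model n t s c k lam m \<mu> l
  for \<Gamma> :: "('g, 'r) monoid_scheme" and \<iota> \<pi> x a n t s c k lam m \<mu> l
begin

sublocale blocks s \<mu> m
  by unfold_locales (rule m_eq)

definition HP :: "('g \<Rightarrow> complex mat) topology" where
  "HP = hom_space_char_poly \<Gamma> n x a m (\<Prod>j = 1..s. [:- lam j, 1:] ^ \<mu> j)"

definition rep :: "complex mat \<Rightarrow> (nat \<Rightarrow> complex mat) \<Rightarrow> 'g \<Rightarrow> complex mat" where
  "rep X A = ext.induced_hom (unitary_group m) X A"

abbreviation cj :: "complex mat \<Rightarrow> ('g \<Rightarrow> complex mat) \<Rightarrow> 'g \<Rightarrow> complex mat" where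
  "cj \<equiv> conj_action m (carrier \<Gamma>)"

lemma x_in: "x \<in> carrier \<Gamma>" by (rule ext.x_closed)

lemma a_in: "i \<in> {1..n} \<Longrightarrow> a i \<in> carrier \<Gamma>" by (rule conjunct1[OF ext.lifts])

lemma hom_unitary: "f \<in> hom \<Gamma> (unitary_group m) \<Longrightarrow> y \<in> carrier \<Gamma> \<Longrightarrow> f y \<in> unitary m"
  by (rule hom_in_carrier)

lemma topspace_HP:
  "topspace HP = {f \<in> hom \<Gamma> (unitary_group m) \<inter> extensional (carrier \<Gamma>).
     char_poly (f x) = (\<Prod>j = 1..s. [:- lam j, 1:] ^ \<mu> j)}"
proof -
  have "f x \<in> unitary m \<and> (\<lambda>i\<in>{1..n}. f (a i)) \<in> (\<Pi>\<^sub>E i\<in>{1..n}. unitary m)"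
    if "f \<in> hom \<Gamma> (unitary_group m)" for f
    by (intro conjI restrict_PiE_iff[THEN iffD2] ballI hom_unitary[OF that] x_in a_in)
  then show ?thesis
    unfolding HP_def hom_space_char_poly_def hom_space_def topspace_subtopology topspace_pullback_topology
    by (intro equalityI subsetI) (simp_all del: restrict_PiE_iff atLeastAtMost_iff)
qed

lemma HP_hom: "f \<in> topspace HP \<Longrightarrow> f \<in> hom \<Gamma> (unitary_group m) \<inter> extensional (carrier \<Gamma>)"
  and HP_char_poly: "f \<in> topspace HP \<Longrightarrow> char_poly (f x) = (\<Prod>j = 1..s. [:- lam j, 1:] ^ \<mu> j)"
  by (simp_all add: topspace_HP)

lemma HP_unitary: "f \<in> topspace HP \<Longrightarrow> y \<in> carrier \<Gamma> \<Longrightarrow> f y \<in> unitary m"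
  using HP_hom hom_unitary by blast

lemma HP_rels: "f \<in> topspace HP \<Longrightarrow> unitary_rels m (f x) (\<lambda>i. f (a i))"
  using HP_hom[of f] by (intro ext.rels_hom[OF group_unitary_group]) simp

lemma rep_values:
  assumes "unitary_rels m X A"
  shows "rep X A x = X" "i \<in> {1..n} \<Longrightarrow> rep X A (a i) = A i"
  unfolding rep_def by (rule ext.induced_hom[OF group_unitary_group assms], assumption?)+

lemma rep_in_HP:
  assumes "unitary_rels m X A" "char_poly X = (\<Prod>j = 1..s. [:- lam j, 1:] ^ \<mu> j)"
  shows "rep X A \<in> topspace HP"
  using ext.induced_hom(1)[OF group_unitary_group assms(1)] rep_values(1)[OF assms(1)] assms(2)
  by (simp add: topspace_HP rep_def)

lemma HP_eqI:
  assumes "f \<in> topspace HP" "f' \<in> topspace HP" "f x = f' x" "\<And>i. i \<in> {1..n} \<Longrightarrow> f (a i) = f' (a i)"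
  shows "f = f'"
  by (rule ext.hom_eqI[OF group_unitary_group HP_hom[OF assms(1)] HP_hom[OF assms(2)] assms(3,4)])

text \<open>The topology is pulled back along the values at the generators, and these values
  determine the homomorphism.\<close>

lemma Hausdorff_HP: "Hausdorff_space HP"
  unfolding HP_def hom_space_char_poly_def hom_space_def
proof (rule Hausdorff_space_subtopology[OF Hausdorff_space_pullback_topology])
  show "Hausdorff_space (prod_topology (unitary_topology m) (product_topology (\<lambda>_. unitary_topology m) {1..n}))"
    unfolding Hausdorff_space_prod_topology Hausdorff_space_product_topology
    by (intro disjI2 conjI ballI Hausdorff_space_unitary_topology)
  show "inj_on (\<lambda>f. (f x, \<lambda>i\<in>{1..n}. f (a i))) (hom \<Gamma> (unitary_group m) \<inter> extensional (carrier \<Gamma>))"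
  proof (rule inj_onI)
    fix f f' :: "'g \<Rightarrow> complex mat"
    assume f: "f \<in> hom \<Gamma> (unitary_group m) \<inter> extensional (carrier \<Gamma>)"
      "f' \<in> hom \<Gamma> (unitary_group m) \<inter> extensional (carrier \<Gamma>)"
      and eq: "(f x, \<lambda>i\<in>{1..n}. f (a i)) = (f' x, \<lambda>i\<in>{1..n}. f' (a i))"
    show "f = f'"
    proof (rule ext.hom_eqI[OF group_unitary_group f])
      show "f x = f' x" using eq by simp
      fix i assume i: "i \<in> {1..n}"
      have "(\<lambda>i\<in>{1..n}. f (a i)) i = (\<lambda>i\<in>{1..n}. f' (a i)) i"
        by (rule fun_cong[of _ _ i]) (rule conjunct2[OF eq[unfolded prod.inject]])
      then show "f (a i) = f' (a i)" by (simp only: restrict_apply' i)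
    qed
  qed
qed

lemma continuous_map_HP:
  assumes F: "F \<in> topspace X \<rightarrow> topspace HP"
    and x: "continuous_map X (unitary_topology m) (\<lambda>y. F y x)"
    and a: "\<And>i. i \<in> {1..n} \<Longrightarrow> continuous_map X (unitary_topology m) (\<lambda>y. F y (a i))"
  shows "continuous_map X HP F"
  unfolding HP_def hom_space_char_poly_def hom_space_def
proof (rule continuous_map_into_subtopology[OF continuous_map_pullback'])
  show "F \<in> topspace X \<rightarrow> {f. char_poly (f x) = (\<Prod>j = 1..s. [:- lam j, 1:] ^ \<mu> j)}"
    using F by (auto simp: topspace_HP)
  show "topspace X \<subseteq> F -` (hom \<Gamma> (unitary_group m) \<inter> extensional (carrier \<Gamma>))"
    using F by (auto simp: topspace_HP)
  have "continuous_map X (product_topology (\<lambda>_. unitary_topology m) {1..n}) (\<lambda>y. \<lambda>i\<in>{1..n}. F y (a i))"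
    unfolding continuous_map_componentwise
    using a by (simp add: image_subset_iff del: atLeastAtMost_iff)
  then show "continuous_map X (prod_topology (unitary_topology m) (product_topology (\<lambda>_. unitary_topology m) {1..n}))
      ((\<lambda>f. (f x, \<lambda>i\<in>{1..n}. f (a i))) \<circ> F)"
    using x by (simp add: o_def continuous_map_paired)
qed

lemma conj_value:
  assumes "g \<in> unitary m" "y \<in> carrier \<Gamma>"
  shows "cj g f y = g * f y * mat_adjoint g"
  using assms by (simp add: conj_action_def)

lemma conj_HP:
  assumes g: "g \<in> unitary m" and f: "f \<in> topspace HP"
  shows "cj g f \<in> topspace HP"
proof -
  note u = unitaryD[OF g]
  have fu: "f y \<in> unitary m" if "y \<in> carrier \<Gamma>" for y by (rule HP_unitary[OF f that])
  note fc = unitaryD(1)[OF fu]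
  have cu: "cj g f y \<in> unitary m" if "y \<in> carrier \<Gamma>" for y
    unfolding conj_value[OF g that] by (intro unitary_mult g fu[OF that] u(4))
  have "cj g f \<in> hom \<Gamma> (unitary_group m)"
  proof (rule homI)
    fix y z assume yz: "y \<in> carrier \<Gamma>" "z \<in> carrier \<Gamma>"
    have "f (y \<otimes>\<^bsub>\<Gamma>\<^esub> z) = f y * f z"
      using HP_hom[OF f] yz by (simp add: hom_def)
    moreover have "g * (f y * f z) * mat_adjoint g = (g * f y * mat_adjoint g) * (g * f z * mat_adjoint g)"
    proof -
      have "(g * f y * mat_adjoint g) * (g * f z * mat_adjoint g) = g * f y * (mat_adjoint g * g) * (f z * mat_adjoint g)"
        using u(1,5) fc[OF yz(1)] fc[OF yz(2)] by (simp add: assoc_mult_mat[of _ m m _ m _ m] del: u)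
      also have "\<dots> = g * (f y * f z) * mat_adjoint g"
        unfolding u(3) using u(1,5) fc[OF yz(1)] fc[OF yz(2)] by (simp add: assoc_mult_mat[of _ m m _ m _ m])
      finally show ?thesis by (rule sym)
    qed
    ultimately show "cj g f (y \<otimes>\<^bsub>\<Gamma>\<^esub> z) = cj g f y \<otimes>\<^bsub>unitary_group m\<^esub> cj g f z"
      using yz by (simp add: conj_value[OF g])
  qed (rule cu)
  moreover have "cj g f \<in> extensional (carrier \<Gamma>)" by (simp add: conj_action_def)
  moreover have "char_poly (cj g f x) = char_poly (f x)"
    unfolding conj_value[OF g x_in]
    by (rule char_poly_similar) (unfold similar_mat_def, intro exI,
        rule similar_mat_witI[OF u(2,3) refl _ fc[OF x_in] u(1,5)], use u fc[OF x_in] in simp)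
  ultimately show ?thesis using HP_char_poly[OF f] by (simp add: topspace_HP)
qed

lemma conj_one: "f \<in> topspace HP \<Longrightarrow> cj (1\<^sub>m m) f = f"
proof (rule HP_eqI)
  assume f: "f \<in> topspace HP"
  have o: "1\<^sub>m m \<in> unitary m" by (rule unitaryI) (simp_all add: mat_adjoint_one)
  show "cj (1\<^sub>m m) f \<in> topspace HP" by (rule conj_HP[OF o f])
  show "f \<in> topspace HP" by (rule f)
  show "cj (1\<^sub>m m) f x = f x"
    using unitaryD(1)[OF HP_unitary[OF f x_in]] by (simp add: conj_value[OF o x_in] mat_adjoint_one)
  show "cj (1\<^sub>m m) f (a i) = f (a i)" if "i \<in> {1..n}" for i
    using unitaryD(1)[OF HP_unitary[OF f a_in[OF that]]] by (simp add: conj_value[OF o a_in[OF that]] mat_adjoint_one)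
qed

lemma conj_mult:
  assumes g: "g \<in> unitary m" and h: "h \<in> unitary m" and f: "f \<in> topspace HP"
  shows "cj (g * h) f = cj g (cj h f)"
proof (rule HP_eqI)
  note gu = unitaryD[OF g] and hu = unitaryD[OF h]
  have gh: "g * h \<in> unitary m" by (rule unitary_mult[OF g h])
  show "cj (g * h) f \<in> topspace HP" by (rule conj_HP[OF gh f])
  show "cj g (cj h f) \<in> topspace HP" by (rule conj_HP[OF g conj_HP[OF h f]])
  have "cj (g * h) f y = cj g (cj h f) y" if y: "y \<in> carrier \<Gamma>" for y
    unfolding conj_value[OF gh y] conj_value[OF g y] conj_value[OF h y] mat_adjoint_mult[OF gu(1) hu(1)]
    using gu(1,5) hu(1,5) unitaryD(1)[OF HP_unitary[OF f y]] by (simp add: assoc_mult_mat[of _ m m _ m _ m])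
  then show "cj (g * h) f x = cj g (cj h f) x" "\<And>i. i \<in> {1..n} \<Longrightarrow> cj (g * h) f (a i) = cj g (cj h f) (a i)"
    using x_in a_in by simp_all
qed

lemma orbit_conj_eq_iff:
  assumes "f \<in> topspace HP" "f' \<in> topspace HP"
  shows "orbit (unitary_group m) cj f = orbit (unitary_group m) cj f' \<longleftrightarrow> (\<exists>g\<in>unitary m. f' = cj g f)"
  by (rule orbit_eq_iff[OF group_unitary_group, where E = "topspace HP"])
    (simp_all add: assms conj_HP conj_one conj_mult)

text \<open>Equality of homomorphisms is reduced to n + 1 intertwining relations at the generators,
  the form in which the models were compared.\<close>

lemma eq_conj_rep_iff:
  assumes f: "f \<in> topspace HP" and R: "unitary_rels m X A"
    and p: "char_poly X = (\<Prod>j = 1..s. [:- lam j, 1:] ^ \<mu> j)" and g: "g \<in> unitary m"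
  shows "f = cj g (rep X A) \<longleftrightarrow> f x * g = g * X \<and> (\<forall>i\<in>{1..n}. f (a i) * g = g * A i)"
proof -
  note r = rep_in_HP[OF R p]
  have "f y = cj g (rep X A) y \<longleftrightarrow> f y * g = g * rep X A y" if "y \<in> carrier \<Gamma>" for y
    unfolding conj_value[OF g that]
    by (rule unitary_conj_eq_iff[OF g unitaryD(1)[OF HP_unitary[OF r that]] unitaryD(1)[OF HP_unitary[OF f that]]])
  then have e: "f x = cj g (rep X A) x \<longleftrightarrow> f x * g = g * X"
    "\<And>i. i \<in> {1..n} \<Longrightarrow> f (a i) = cj g (rep X A) (a i) \<longleftrightarrow> f (a i) * g = g * A i"
    using x_in a_in by (simp_all only: rep_values[OF R])
  show ?thesis
  proof (rule iffI)
    assume eq: "f = cj g (rep X A)"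
    have "f x = cj g (rep X A) x" "\<And>i. f (a i) = cj g (rep X A) (a i)" by (rule fun_cong[OF eq])+
    then show "f x * g = g * X \<and> (\<forall>i\<in>{1..n}. f (a i) * g = g * A i)"
      by (intro conjI ballI e(1)[THEN iffD1] e(2)[THEN iffD1])
  next
    assume "f x * g = g * X \<and> (\<forall>i\<in>{1..n}. f (a i) * g = g * A i)"
    then show "f = cj g (rep X A)" using e by (intro HP_eqI[OF f conj_HP[OF g r]]) simp_all
  qed
qed

section \<open>The orbit space\<close>

definition mrep :: "(nat \<Rightarrow> nat \<Rightarrow> nat \<Rightarrow> complex) \<Rightarrow> 'g \<Rightarrow> complex mat" where
  "mrep z = rep model_x (model_mat z)"

definition TZ :: "(nat \<Rightarrow> nat \<Rightarrow> nat \<Rightarrow> complex) topology" where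
  "TZ = product_topology (\<lambda>j. product_topology (\<lambda>_. torus n) {1..l j}) {1..s}"

lemma topspace_TZ: "topspace TZ = Zset"
  by (simp add: TZ_def Zset_def torus_def)

lemma compact_TZ: "compact_space TZ"
  unfolding TZ_def compact_space_product_topology
  by (intro disjI2 ballI compact_torus[unfolded compact_space_product_topology]
      compact_space_product_topology[THEN iffD2])

lemma Hausdorff_TZ: "Hausdorff_space TZ"
  unfolding TZ_def torus_def Hausdorff_space_product_topology
  by (intro disjI2 ballI Hausdorff_space_subtopology Hausdorff_space_euclidean)

lemma continuous_map_TZ:
  assumes j: "j \<in> {1..s}" and b: "b \<in> {1..l j}" and i: "i \<in> {1..n}"
  shows "continuous_map TZ (top_of_set (sphere 0 1)) (\<lambda>z. z j b i)"
proof -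
  have "continuous_map TZ (product_topology (\<lambda>_. torus n) {1..l j}) (\<lambda>z. z j)"
    unfolding TZ_def by (rule continuous_map_product_projection[OF j])
  from continuous_map_compose[OF this continuous_map_product_projection[OF b]]
  have "continuous_map TZ (torus n) (\<lambda>z. z j b)" unfolding o_def .
  from continuous_map_compose[OF this[unfolded torus_def] continuous_map_product_projection[OF i]]
  show ?thesis unfolding o_def .
qed

lemma continuous_map_model_mat:
  assumes i: "i \<in> {1..n}"
  shows "continuous_map TZ (unitary_topology m) (\<lambda>z. model_mat z i)"
  unfolding continuous_map_into_unitary
proof (intro conjI allI impI)
  show "(\<lambda>z. model_mat z i) \<in> topspace TZ \<rightarrow> unitary m"
    unfolding topspace_TZ by (intro Pi_I model_mat_unitary i)
  fix p q assume pq: "p < m" "q < m"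
  obtain j b e where q: "ix q = (j, b, e)" "j \<in> {1..s}" "b \<in> {1..l j}" "e \<in> Box j" by (rule IxE[OF ix_in[OF pq(2)]])
  have c: "continuous_map TZ euclidean (\<lambda>z. z j b i)"
    by (rule continuous_map_into_fulltopology[OF continuous_map_TZ[OF q(2,3) i]])
  have "continuous_map TZ euclidean (\<lambda>z. if ix p = sft i (ix q) then (if i \<in> {1..t} then z j b i * lam j ^ (c i * e i) else z j b i) else 0)"
    using c continuous_map_complex_mult[OF c, of "\<lambda>z. lam j ^ (c i * e i)"] by simp
  then show "continuous_map TZ euclidean (\<lambda>z. model_mat z i $$ (p, q))"
    using pq by (simp add: model_mat_def monomial_mat_def cf_def coef_def q(1) cong: if_cong)
qed

lemma mrep_in_HP: "z \<in> Zset \<Longrightarrow> mrep z \<in> topspace HP"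
  unfolding mrep_def by (rule rep_in_HP[OF model_rels model_x_char_poly])

lemma continuous_map_conj_mrep:
  "continuous_map (prod_topology (unitary_topology m) TZ) HP (\<lambda>(g, z). cj g (mrep z))"
proof -
  let ?X = "prod_topology (unitary_topology m) TZ"
  have T: "fst y \<in> unitary m \<and> snd y \<in> Zset" if "y \<in> topspace ?X" for y
    using that by (auto simp: topspace_TZ)
  have 1: "continuous_map ?X (unitary_topology m) fst" by (rule continuous_map_fst)
  have v: "cj (fst y) (mrep (snd y)) x = fst y * model_x * mat_adjoint (fst y)"
    "i \<in> {1..n} \<Longrightarrow> cj (fst y) (mrep (snd y)) (a i) = fst y * model_mat (snd y) i * mat_adjoint (fst y)"
    if "y \<in> topspace ?X" for y i
    using T[OF that] rep_values[OF model_rels, of "snd y"] x_in a_in by (simp_all add: conj_value mrep_def del: atLeastAtMost_iff)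
  show ?thesis
  proof (rule continuous_map_HP)
    show "(\<lambda>(g, z). cj g (mrep z)) \<in> topspace ?X \<rightarrow> topspace HP"
      by (rule Pi_I) (simp add: T conj_HP mrep_in_HP split_beta)
    have "continuous_map ?X (unitary_topology m) (\<lambda>y. fst y * model_x * mat_adjoint (fst y))"
      by (intro continuous_map_unitary_mult continuous_map_unitary_adjoint 1)
        (simp add: model_x_unitary)
    then show "continuous_map ?X (unitary_topology m) (\<lambda>y. (case y of (g, z) \<Rightarrow> cj g (mrep z)) x)"
      by (rule continuous_map_eq) (simp only: split_beta v(1))
    fix i assume i: "i \<in> {1..n}"
    have 2: "continuous_map ?X (unitary_topology m) (\<lambda>y. model_mat (snd y) i)"
      using continuous_map_compose[OF continuous_map_snd continuous_map_model_mat[OF i]] by (simp only: o_def)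
    have "continuous_map ?X (unitary_topology m) (\<lambda>y. fst y * model_mat (snd y) i * mat_adjoint (fst y))"
      by (intro continuous_map_unitary_mult continuous_map_unitary_adjoint 1 2)
    then show "continuous_map ?X (unitary_topology m) (\<lambda>y. (case y of (g, z) \<Rightarrow> cj g (mrep z)) (a i))"
      by (rule continuous_map_eq) (simp only: split_beta v(2) i)
  qed
qed

lemma HP_conj_mrep:
  assumes f: "f \<in> topspace HP"
  obtains g z where "g \<in> unitary m" "z \<in> Zset" "f = cj g (mrep z)"
proof -
  show ?thesis
  proof (rule conjugate_to_model[OF HP_rels[OF f] HP_char_poly[OF f]])
    fix z g assume z: "z \<in> Zset" and g: "g \<in> unitary m" and X: "f x * g = g * model_x"
      and A: "\<And>i. i \<in> {1..n} \<Longrightarrow> f (a i) * g = g * model_mat z i"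
    have "f = cj g (mrep z)"
      unfolding mrep_def
      by (rule eq_conj_rep_iff[OF f model_rels[OF z] model_x_char_poly g, THEN iffD2]) (intro conjI ballI X A)
    with g z show ?thesis by (rule that)
  qed
qed

abbreviation cls :: "('g \<Rightarrow> complex mat) \<Rightarrow> ('g \<Rightarrow> complex mat) set" where
  "cls \<equiv> orbit (unitary_group m) cj"

lemma cls_conj: "g \<in> unitary m \<Longrightarrow> f \<in> topspace HP \<Longrightarrow> cls (cj g f) = cls f"
  using orbit_conj_eq_iff[of f "cj g f"] conj_HP by auto

text \<open>Closedness is tested upstairs: the representations whose class lies in the image of a
  closed C are the conjugates of the models over C. They form a continuous image of the compact set
  U(m) x C, hence a closed set in the Hausdorff space \<open>HP\<close>.\<close>

lemma quotient_map_mrep: "quotient_map TZ (orbit_space (unitary_group m) cj HP) (\<lambda>z. cls (mrep z))"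
proof (rule continuous_closed_imp_quotient_map)
  let ?O = "orbit_space (unitary_group m) cj HP"
  note q = quotient_map_orbit[of HP "unitary_group m" cj]
  have o: "1\<^sub>m m \<in> unitary m" by (rule unitaryI) (simp_all add: mat_adjoint_one)
  have "continuous_map TZ (prod_topology (unitary_topology m) TZ) (\<lambda>z. (1\<^sub>m m, z))"
    unfolding continuous_map_paired using o by simp
  from continuous_map_compose[OF this continuous_map_conj_mrep]
  have "continuous_map TZ HP (\<lambda>z. cj (1\<^sub>m m) (mrep z))" by (simp add: o_def)
  then have cont: "continuous_map TZ HP mrep"
    by (rule continuous_map_eq) (simp add: topspace_TZ conj_one mrep_in_HP)
  from continuous_map_compose[OF this quotient_imp_continuous_map[OF q]]
  show "continuous_map TZ ?O (\<lambda>z. cls (mrep z))" unfolding o_def .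
  show "(\<lambda>z. cls (mrep z)) ` topspace TZ = topspace ?O"
  proof (rule equalityI; rule subsetI)
    fix Y assume "Y \<in> (\<lambda>z. cls (mrep z)) ` topspace TZ"
    then show "Y \<in> topspace ?O" by (auto simp: orbits_def topspace_TZ intro: mrep_in_HP)
  next
    fix Y assume "Y \<in> topspace ?O"
    then obtain f where f: "f \<in> topspace HP" "Y = cls f" by (auto simp: orbits_def)
    obtain g z where "g \<in> unitary m" "z \<in> Zset" "f = cj g (mrep z)" by (rule HP_conj_mrep[OF f(1)])
    then show "Y \<in> (\<lambda>z. cls (mrep z)) ` topspace TZ"
      unfolding f(2) topspace_TZ by (intro image_eqI[of _ _ z]) (simp_all add: cls_conj mrep_in_HP)
  qed
  show "closed_map TZ ?O (\<lambda>z. cls (mrep z))"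
    unfolding closed_map_def
  proof (intro allI impI)
    fix C assume C: "closedin TZ C"
    have CZ: "C \<subseteq> Zset" using closedin_subset[OF C] by (simp add: topspace_TZ)
    have sub: "(\<lambda>z. cls (mrep z)) ` C \<subseteq> topspace ?O"
      using CZ mrep_in_HP by (auto simp: orbits_def)
    have eq: "{f. f \<in> topspace HP \<and> cls f \<in> (\<lambda>z. cls (mrep z)) ` C} = (\<lambda>(g, z). cj g (mrep z)) ` (unitary m \<times> C)"
    proof (rule equalityI; rule subsetI)
      fix f assume "f \<in> {f. f \<in> topspace HP \<and> cls f \<in> (\<lambda>z. cls (mrep z)) ` C}"
      then obtain z where f: "f \<in> topspace HP" and z: "z \<in> C" "cls (mrep z) = cls f" by auto
      have "mrep z \<in> topspace HP" using z(1) CZ by (intro mrep_in_HP) blast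
      from orbit_conj_eq_iff[OF this f, THEN iffD1, OF z(2)]
      obtain g where "g \<in> unitary m" "f = cj g (mrep z)" by (rule bexE)
      then show "f \<in> (\<lambda>(g, z). cj g (mrep z)) ` (unitary m \<times> C)"
        using z(1) by (intro image_eqI[of _ _ "(g, z)"]) simp_all
    next
      fix f assume "f \<in> (\<lambda>(g, z). cj g (mrep z)) ` (unitary m \<times> C)"
      then obtain y where "f = (\<lambda>(g, z). cj g (mrep z)) y" "y \<in> unitary m \<times> C" by (rule imageE)
      then have y: "f = cj (fst y) (mrep (snd y))" "fst y \<in> unitary m" "snd y \<in> C" by (simp_all add: split_beta mem_Times_iff)
      have "mrep (snd y) \<in> topspace HP" using y(3) CZ by (intro mrep_in_HP) blast
      then show "f \<in> {f. f \<in> topspace HP \<and> cls f \<in> (\<lambda>z. cls (mrep z)) ` C}"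
        using y by (simp add: conj_HP cls_conj)
    qed
    have "compactin (prod_topology (unitary_topology m) TZ) (unitary m \<times> C)"
      unfolding compactin_Times
      using closedin_compact_space[OF compact_TZ C] compact_space_unitary_topology[of m]
      by (simp add: compact_space_def)
    from image_compactin[OF this continuous_map_conj_mrep]
    have "closedin HP {f. f \<in> topspace HP \<and> cls f \<in> (\<lambda>z. cls (mrep z)) ` C}"
      unfolding eq by (rule compactin_imp_closedin[OF Hausdorff_HP])
    then show "closedin ?O ((\<lambda>z. cls (mrep z)) ` C)"
      using q sub unfolding quotient_map_closedin by blast
  qed
qed

section \<open>From parameters to invariants\<close>

definition pows :: "(nat \<Rightarrow> nat \<Rightarrow> nat \<Rightarrow> complex) \<Rightarrow> nat \<Rightarrow> nat \<Rightarrow> nat \<Rightarrow> complex" where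
  "pows z = (\<lambda>j\<in>{1..s}. \<lambda>b\<in>{1..l j}. pw z j b)"

lemma pw_in:
  assumes "z \<in> Zset" "j \<in> {1..s}" "b \<in> {1..l j}"
  shows "pw z j b \<in> (\<Pi>\<^sub>E i\<in>{1..n}. sphere 0 1)"
  unfolding pw_def using Zset_norm[OF assms] by (simp add: norm_power del: atLeastAtMost_iff)

lemma pows_in: "z \<in> Zset \<Longrightarrow> pows z \<in> Zset"
  unfolding pows_def Zset_def by (simp only: restrict_PiE_iff) (intro ballI pw_in, simp_all only: Zset_def)

text \<open>Numbers of modulus one have N-th roots of modulus one; they are chosen coordinatewise
  without any continuity.\<close>

lemma pows_surj: "pows ` Zset = Zset"
proof (rule equalityI; rule subsetI)
  fix w assume "w \<in> pows ` Zset"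
  then show "w \<in> Zset" by (elim imageE) (simp add: pows_in)
next
  fix w assume w: "w \<in> Zset"
  define r where "r j b i = (SOME r. norm r = 1 \<and> r ^ N j i = w j b i)" for j b i
  have r: "norm (r j b i) = 1 \<and> r j b i ^ N j i = w j b i" if "j \<in> {1..s}" "b \<in> {1..l j}" "i \<in> {1..n}" for j b i
    unfolding r_def by (rule someI_ex[OF ex_unit_root[OF Zset_norm[OF w that] N_pos[OF that(1)]]])
  define z where "z = (\<lambda>j\<in>{1..s}. \<lambda>b\<in>{1..l j}. \<lambda>i\<in>{1..n}. r j b i)"
  have "z \<in> Zset" unfolding z_def Zset_def restrict_PiE_iff using r by (simp del: atLeastAtMost_iff)
  moreover have "w = pows z"
  proof (rule PiE_ext[of _ "{1..s}" "\<lambda>j. \<Pi>\<^sub>E b\<in>{1..l j}. \<Pi>\<^sub>E i\<in>{1..n}. sphere 0 1"])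
    show "w \<in> (\<Pi>\<^sub>E j\<in>{1..s}. \<Pi>\<^sub>E b\<in>{1..l j}. \<Pi>\<^sub>E i\<in>{1..n}. sphere 0 1)" using w by (simp only: Zset_def)
    show "pows z \<in> (\<Pi>\<^sub>E j\<in>{1..s}. \<Pi>\<^sub>E b\<in>{1..l j}. \<Pi>\<^sub>E i\<in>{1..n}. sphere 0 1)"
      using pows_in[OF \<open>z \<in> Zset\<close>] by (simp only: Zset_def)
    fix j assume j: "j \<in> {1..s}"
    have wj: "w j \<in> (\<Pi>\<^sub>E b\<in>{1..l j}. \<Pi>\<^sub>E i\<in>{1..n}. sphere 0 1)" using w j unfolding Zset_def by (rule PiE_mem)
    show "w j = pows z j"
    proof (rule PiE_ext[OF wj])
      show "pows z j \<in> (\<Pi>\<^sub>E b\<in>{1..l j}. \<Pi>\<^sub>E i\<in>{1..n}. sphere 0 1)"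
        using pows_in[OF \<open>z \<in> Zset\<close>] j unfolding Zset_def by (rule PiE_mem)
      fix b assume b: "b \<in> {1..l j}"
      have wb: "w j b \<in> (\<Pi>\<^sub>E i\<in>{1..n}. sphere 0 1)" by (rule PiE_mem[OF wj b])
      have p: "pows z j b = pw z j b" unfolding pows_def using j b by (simp del: atLeastAtMost_iff)
      show "w j b = pows z j b"
        unfolding p by (rule PiE_ext[OF wb pw_in[OF \<open>z \<in> Zset\<close> j b]])
          (simp add: pw_def z_def j b r del: atLeastAtMost_iff One_nat_def)
    qed
  qed
  ultimately show "w \<in> pows ` Zset" by (intro image_eqI)
qed

text \<open>A continuous surjection from a compact space to a Hausdorff one is a quotient map.
  Passing to powers removes the ambiguity of the parameters by roots of unity and leaves a
  torus.\<close>

lemma quotient_map_pows: "quotient_map TZ TZ pows"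
proof (rule continuous_imp_quotient_map[OF _ compact_TZ Hausdorff_TZ])
  have c: "continuous_map TZ (top_of_set (sphere 0 1)) (\<lambda>z. z j b i ^ N j i)"
    if "j \<in> {1..s}" "b \<in> {1..l j}" "i \<in> {1..n}" for j b i
  proof (rule continuous_map_into_subtopology)
    have "continuous_map euclidean euclidean (\<lambda>w::complex. w ^ N j i)"
      by (simp add: continuous_on_power continuous_on_id)
    from continuous_map_compose[OF continuous_map_into_fulltopology[OF continuous_map_TZ[OF that]] this]
    show "continuous_map TZ euclidean (\<lambda>z. z j b i ^ N j i)" unfolding o_def .
    show "(\<lambda>z. z j b i ^ N j i) \<in> topspace TZ \<rightarrow> sphere 0 1"
      by (rule Pi_I) (simp add: topspace_TZ norm_power Zset_norm[OF _ that])
  qed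
  have "continuous_map TZ (torus n) (\<lambda>z. pw z j b)" if "j \<in> {1..s}" "b \<in> {1..l j}" for j b
    unfolding torus_def pw_def continuous_map_componentwise
    using c[OF that] by (simp add: image_subset_iff del: atLeastAtMost_iff)
  then have "continuous_map TZ (product_topology (\<lambda>_. torus n) {1..l j}) (\<lambda>z. \<lambda>b\<in>{1..l j}. pw z j b)" if "j \<in> {1..s}" for j
    unfolding continuous_map_componentwise
    using that by (simp add: image_subset_iff del: atLeastAtMost_iff)
  then show "continuous_map TZ TZ pows"
    unfolding pows_def by (subst (2) TZ_def, unfold continuous_map_componentwise) (simp add: image_subset_iff del: atLeastAtMost_iff)
  show "pows ` topspace TZ = topspace TZ" unfolding topspace_TZ by (rule pows_surj)
qed

definition invariant_classes :: "(nat \<Rightarrow> nat \<Rightarrow> nat \<Rightarrow> complex) \<Rightarrow> nat \<Rightarrow> (nat \<Rightarrow> nat \<Rightarrow> complex) set" where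
  "invariant_classes z = (\<lambda>j\<in>{1..s}. orbit (sym_group (l j)) (permute_factors (l j)) (\<lambda>b\<in>{1..l j}. pw z j b))"

text \<open>The target is a product of orbit spaces; the product of the orbit maps is again a
  quotient map because each of them is open.\<close>

lemma quotient_map_invariant_classes:
  "quotient_map TZ (product_topology (\<lambda>j. symmetric_product (l j) (torus n)) {1..s}) invariant_classes"
proof -
  have "quotient_map TZ (product_topology (\<lambda>j. symmetric_product (l j) (torus n)) {1..s})
      (\<lambda>z. \<lambda>j\<in>{1..s}. orbit (sym_group (l j)) (permute_factors (l j)) (z j))"
    unfolding TZ_def
    by (rule quotient_map_open_product[where q = "\<lambda>j. orbit (sym_group (l j)) (permute_factors (l j))"])
      (unfold symmetric_product_def, rule quotient_map_orbit, rule open_map_symmetric_product[unfolded symmetric_product_def])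
  from quotient_map_compose[OF quotient_map_pows this]
  show ?thesis by (simp add: o_def pows_def invariant_classes_def[abs_def] del: atLeastAtMost_iff cong: restrict_cong)
qed

text \<open>Both fibre relations are brought to concrete form: equality of classes in the symmetric
  products means a permutation of invariants for each j, equality of orbits means an intertwiner of
  the models, and the two comparison lemmas for models connect them.\<close>

lemma invariant_classes_eq_iff:
  assumes z: "z \<in> Zset" and z': "z' \<in> Zset"
  shows "invariant_classes z = invariant_classes z' \<longleftrightarrow> cls (mrep z) = cls (mrep z')"
proof -
  have o: "orbit (sym_group (l j)) (permute_factors (l j)) (\<lambda>b\<in>{1..l j}. pw z j b) =
      orbit (sym_group (l j)) (permute_factors (l j)) (\<lambda>b\<in>{1..l j}. pw z' j b) \<longleftrightarrow>
      (\<exists>\<tau>. \<tau> permutes {1..l j} \<and> (\<forall>b\<in>{1..l j}. pw z' j b = pw z j (\<tau> b)))" if j: "j \<in> {1..s}" for j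
  proof -
    have e: "(\<lambda>b\<in>{1..l j}. pw y j b) \<in> {1..l j} \<rightarrow>\<^sub>E (\<Pi>\<^sub>E i\<in>{1..n}. sphere 0 1)" if "y \<in> Zset" for y
      unfolding restrict_PiE_iff by (intro ballI pw_in[OF that j])
    have p: "(\<forall>b\<in>{1..l j}. (\<lambda>b\<in>{1..l j}. pw z' j b) b = (\<lambda>b\<in>{1..l j}. pw z j b) (\<tau> b)) \<longleftrightarrow>
        (\<forall>b\<in>{1..l j}. pw z' j b = pw z j (\<tau> b))" if "\<tau> permutes {1..l j}" for \<tau>
      by (rule ball_cong) (simp_all add: permutes_in_image[OF that] del: atLeastAtMost_iff One_nat_def)
    show ?thesis unfolding orbit_permute_factors_eq_iff[OF e[OF z] e[OF z']]
      using p by (simp only: cong: conj_cong)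
  qed
  have c: "cls (mrep z) = cls (mrep z') \<longleftrightarrow>
      (\<exists>g\<in>unitary m. model_x * g = g * model_x \<and> (\<forall>i\<in>{1..n}. model_mat z i * g = g * model_mat z' i))"
  proof -
    have "cls (mrep z) = cls (mrep z') \<longleftrightarrow> (\<exists>g\<in>unitary m. mrep z = cj g (mrep z'))"
      unfolding orbit_conj_eq_iff[OF mrep_in_HP[OF z'] mrep_in_HP[OF z], symmetric] by (rule eq_commute)
    also have "\<dots> \<longleftrightarrow> (\<exists>g\<in>unitary m. model_x * g = g * model_x \<and> (\<forall>i\<in>{1..n}. model_mat z i * g = g * model_mat z' i))"
    proof (rule bex_cong[OF refl])
      fix g assume g: "g \<in> unitary m"
      have v: "mrep z x = model_x" "i \<in> {1..n} \<Longrightarrow> mrep z (a i) = model_mat z i" for i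
        unfolding mrep_def by (rule rep_values[OF model_rels[OF z]], assumption?)+
      show "mrep z = cj g (mrep z') \<longleftrightarrow> model_x * g = g * model_x \<and> (\<forall>i\<in>{1..n}. model_mat z i * g = g * model_mat z' i)"
        using eq_conj_rep_iff[OF mrep_in_HP[OF z] model_rels[OF z'] model_x_char_poly g] v
        by (simp add: mrep_def[of z'] del: atLeastAtMost_iff cong: ball_cong)
    qed
    finally show ?thesis .
  qed
  have "invariant_classes z = invariant_classes z' \<longleftrightarrow> (\<forall>j\<in>{1..s}. \<exists>\<tau>. \<tau> permutes {1..l j} \<and> (\<forall>b\<in>{1..l j}. pw z' j b = pw z j (\<tau> b)))"
    unfolding invariant_classes_def restrict_eq_iff using o by (simp only: cong: ball_cong)
  also have "\<dots> \<longleftrightarrow> cls (mrep z) = cls (mrep z')"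
  proof
    assume "\<forall>j\<in>{1..s}. \<exists>\<tau>. \<tau> permutes {1..l j} \<and> (\<forall>b\<in>{1..l j}. pw z' j b = pw z j (\<tau> b))"
    from bchoice[OF this] obtain \<tau> where
      t: "\<forall>j\<in>{1..s}. \<tau> j permutes {1..l j} \<and> (\<forall>b\<in>{1..l j}. pw z' j b = pw z j (\<tau> j b))" by (rule exE)
    show "cls (mrep z) = cls (mrep z')"
    proof (rule same_invariants_imp_equivalent[OF z z', of \<tau>])
      show "\<tau> j permutes {1..l j}" if "j \<in> {1..s}" for j by (rule conjunct1[OF bspec[OF t that]])
      show "pw z' j b = pw z j (\<tau> j b)" if "j \<in> {1..s}" "b \<in> {1..l j}" for j b
        by (rule bspec[OF conjunct2[OF bspec[OF t that(1)]] that(2)])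
      fix g assume "g \<in> unitary m" "model_x * g = g * model_x"
        "\<And>i. i \<in> {1..n} \<Longrightarrow> model_mat z i * g = g * model_mat z' i"
      then show ?thesis unfolding c by (intro bexI[of _ g]) simp_all
    qed
  next
    assume "cls (mrep z) = cls (mrep z')"
    then obtain g where g: "g \<in> unitary m" "model_x * g = g * model_x \<and> (\<forall>i\<in>{1..n}. model_mat z i * g = g * model_mat z' i)"
      unfolding c by (rule bexE)
    show "\<forall>j\<in>{1..s}. \<exists>\<tau>. \<tau> permutes {1..l j} \<and> (\<forall>b\<in>{1..l j}. pw z' j b = pw z j (\<tau> b))"
    proof
      fix j assume j: "j \<in> {1..s}"
      show "\<exists>\<tau>. \<tau> permutes {1..l j} \<and> (\<forall>b\<in>{1..l j}. pw z' j b = pw z j (\<tau> b))"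
      proof (rule equivalent_imp_same_invariants[OF z z' g(1) conjunct1[OF g(2)] bspec[OF conjunct2[OF g(2)]] j])
        fix \<tau> assume "\<tau> permutes {1..l j}" "\<And>b. b \<in> {1..l j} \<Longrightarrow> pw z' j b = pw z j (\<tau> b)"
        then show ?thesis by (intro exI[of _ \<tau>]) simp
      qed
    qed
  qed
  finally show ?thesis .
qed

theorem orbit_space_homeomorphic:
  "orbit_space (unitary_group m) cj HP homeomorphic_space product_topology (\<lambda>j. symmetric_product (l j) (torus n)) {1..s}"
proof -
  obtain F where "homeomorphic_map (orbit_space (unitary_group m) cj HP) (product_topology (\<lambda>j. symmetric_product (l j) (torus n)) {1..s}) F"
    by (rule quotient_maps_same_fibres[OF quotient_map_mrep quotient_map_invariant_classes])
      (simp only: topspace_TZ invariant_classes_eq_iff)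
  then show ?thesis by (rule homeomorphic_map_imp_homeomorphic_space)
qed

end

section \<open>The induced space\<close>

text \<open>Replacing u by u d^-1 and X by d X d^-1 leaves u X u^-1 unchanged; this is phrased as an
  intertwining relation to fit \<open>eq_conj_rep_iff\<close>.\<close>

lemma conj_transport:
  assumes u: "u \<in> unitary m" and d: "d \<in> unitary m" and X: "X \<in> carrier_mat m m"
  shows "(u * X * mat_adjoint u) * (u * mat_adjoint d) = (u * mat_adjoint d) * (d * X * mat_adjoint d)"
proof -
  note U = unitaryD[OF u] and D = unitaryD[OF d]
  have "(u * X * mat_adjoint u) * (u * mat_adjoint d) = u * X * (mat_adjoint u * u) * mat_adjoint d"
    using U(1,5) D(1,5) X by (simp add: assoc_mult_mat[of _ m m _ m _ m])
  also have "\<dots> = u * (mat_adjoint d * d) * X * mat_adjoint d"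
    unfolding U(3) D(3) using U(1,5) D(1,5) X by simp
  also have "\<dots> = (u * mat_adjoint d) * (d * X * mat_adjoint d)"
    using U(1,5) D(1,5) X by (simp add: assoc_mult_mat[of _ m m _ m _ m])
  finally show ?thesis .
qed

text \<open>Cancelling v on the left shows that w = v^-1 u conjugates X to Y. Applied with X and Y
  both equal to \<open>model_x\<close>, it says that w commutes with \<open>model_x\<close>.\<close>

lemma conj_quotient:
  assumes u: "u \<in> unitary m" and v: "v \<in> unitary m" and X: "X \<in> carrier_mat m m" and Y: "Y \<in> carrier_mat m m"
    and eq: "(u * X * mat_adjoint u) * v = v * Y"
  shows "(mat_adjoint v * u) * X = Y * (mat_adjoint v * u)" "Y = (mat_adjoint v * u) * X * mat_adjoint (mat_adjoint v * u)"
proof -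
  note U = unitaryD[OF u] and V = unitaryD[OF v]
  have w: "mat_adjoint v * u \<in> unitary m" by (rule unitary_mult[OF V(4) u])
  have "Y = (mat_adjoint v * v) * Y" unfolding V(3) by (rule left_mult_one_mat[OF Y, symmetric])
  also have "\<dots> = mat_adjoint v * (v * Y)" by (rule assoc_mult_mat[OF V(5) V(1) Y])
  also have "\<dots> = (mat_adjoint v * u) * X * (mat_adjoint u * v)"
    unfolding eq[symmetric] using U(1,5) V(1,5) X by (simp add: assoc_mult_mat[of _ m m _ m _ m])
  also have "mat_adjoint u * v = mat_adjoint (mat_adjoint v * u)"
    by (simp only: mat_adjoint_mult[OF V(5) U(1)] mat_adjoint_adjoint)
  finally show 2: "Y = (mat_adjoint v * u) * X * mat_adjoint (mat_adjoint v * u)" .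
  show "(mat_adjoint v * u) * X = Y * (mat_adjoint v * u)"
    by (rule unitary_conj_eq_iff[OF w X Y, THEN iffD1, OF 2, symmetric])
qed

lemma smult_one_mult:
  fixes M :: "complex mat"
  assumes "M \<in> carrier_mat d d"
  shows "(z \<cdot>\<^sub>m 1\<^sub>m d) * M = z \<cdot>\<^sub>m M" "M * (z \<cdot>\<^sub>m 1\<^sub>m d) = z \<cdot>\<^sub>m M"
proof -
  show "(z \<cdot>\<^sub>m 1\<^sub>m d) * M = z \<cdot>\<^sub>m M"
    unfolding mult_smult_assoc_mat[OF one_carrier_mat assms] left_mult_one_mat[OF assms] by (rule refl)
  show "M * (z \<cdot>\<^sub>m 1\<^sub>m d) = z \<cdot>\<^sub>m M"
    unfolding mult_smult_distrib[OF assms one_carrier_mat] right_mult_one_mat[OF assms] by (rule refl)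
qed

context unitary_representations
begin

section \<open>Block scalar matrices and the twisted relations\<close>

abbreviation sc :: "(nat \<Rightarrow> complex) \<Rightarrow> complex mat" where
  "sc f \<equiv> block_diag s (\<lambda>j. f j \<cdot>\<^sub>m 1\<^sub>m (\<mu> j))"

lemma sc_mult: "sc f * sc g = sc (\<lambda>j. f j * g j)"
proof -
  have "(f j \<cdot>\<^sub>m 1\<^sub>m (\<mu> j)) * (g j \<cdot>\<^sub>m 1\<^sub>m (\<mu> j)) = (f j * g j) \<cdot>\<^sub>m 1\<^sub>m (\<mu> j)" for j
    by (subst smult_one_mult(1)) (auto intro!: eq_matI)
  then show ?thesis by (simp only: block_diag_mult[OF block_diag_scalars(1) block_diag_scalars(1)])
qed

lemma sc_one: "(\<And>j. j \<in> {1..s} \<Longrightarrow> f j = 1) \<Longrightarrow> sc f = 1\<^sub>m m"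
  unfolding block_diag_one[symmetric] by (rule block_diag_cong) (auto intro!: eq_matI)

lemma sc_carrier: "sc f \<in> carrier_mat m m"
  by (rule block_diag_carrier[OF block_diag_scalars(1)])

text \<open>The constraint on the numbering \<open>ix\<close> enters here: labels with eigenvalue
  index j sit in the j-th diagonal block.\<close>

lemma model_x_sc: "model_x = sc lam"
proof (rule block_mat_eqI[OF unitaryD(1)[OF model_x_unitary] sc_carrier m_eq])
  fix j i j' i' assume ji: "j \<in> {1..s}" "i < \<mu> j" "j' \<in> {1..s}" "i' < \<mu> j'"
  let ?p = "block_pos \<mu> (j, i)" and ?q = "block_pos \<mu> (j', i')"
  note lt = pos_less[OF ji(1,2)] pos_less[OF ji(3,4)]
  have e: "ix ?p = ix ?q \<longleftrightarrow> ?p = ?q"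
    by (rule inj_on_eq_iff[OF bij_betw_imp_inj_on[OF ix(1)]]) (simp_all only: lessThan_iff lt)
  have f: "fst (ix ?q) = j'"
    by (simp only: ix(2)[OF lt(2)] block_index_pos[of j' s i' \<mu>, OF ji(3,4)] fst_conv)
  have "model_x $$ (?p, ?q) = (if ix ?p = ix ?q then lam (fst (ix ?q)) else 0)"
    using lt by (simp add: model_x_def monomial_mat_def split_beta)
  also have "\<dots> = (if ?p = ?q then lam j else 0)"
    unfolding e f using block_pos_eq_iff[OF ji] by auto
  also have "\<dots> = sc lam $$ (?p, ?q)" by (rule block_diag_scalars(2)[OF ji, symmetric])
  finally show "model_x $$ (?p, ?q) = sc lam $$ (?p, ?q)" .
qed

lemma model_x_pow: "model_x [^]\<^bsub>unitary_group m\<^esub> (r::nat) = sc (\<lambda>j. lam j ^ r)"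
proof -
  interpret U: group "unitary_group m" by (rule group_unitary_group)
  show ?thesis
  proof (induction r)
    case 0
    show ?case by (simp add: sc_one)
  next
    case (Suc r)
    have "model_x [^]\<^bsub>unitary_group m\<^esub> Suc r = sc (\<lambda>j. lam j ^ r) * sc lam"
      unfolding U.nat_pow_Suc Suc by (simp only: unitary_group_simps model_x_sc)
    also have "\<dots> = sc (\<lambda>j. lam j ^ Suc r)" unfolding sc_mult by (simp add: mult.commute)
    finally show ?case .
  qed
qed

lemma twist_cases:
  "i \<in> {1..t} \<and> i' = t + i \<Longrightarrow> twist j i i' = lam j ^ c i"
  "\<not> (i \<in> {1..t} \<and> i' = t + i) \<Longrightarrow> i' \<in> {1..t} \<and> i = t + i' \<Longrightarrow> twist j i i' = inverse (lam j ^ c i')"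
  "\<not> (i \<in> {1..t} \<and> i' = t + i) \<Longrightarrow> \<not> (i' \<in> {1..t} \<and> i = t + i') \<Longrightarrow> twist j i i' = 1"
  unfolding twist_def by (rule if_P, assumption, rule trans[OF if_not_P if_P], assumption+, rule trans[OF if_not_P if_not_P], assumption+)

text \<open>All relations become one formula, with the scalars of the different eigenspaces
  collected in a block scalar matrix. In this form they split into blocks and compare directly with
  the almost commuting tuples.\<close>

lemma twisted_rel:
  assumes R: "unitary_rels m model_x A" and i: "i \<in> {1..n}" "i' \<in> {1..n}"
  shows "A i * A i' = sc (\<lambda>j. twist j i i') * (A i' * A i)"
proof -
  note RD = unitary_relsD[OF R]
  have c: "A i \<in> carrier_mat m m" "A i' \<in> carrier_mat m m" by (intro unitaryD(1)[OF RD(2)] i)+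
  then have cc: "A i * A i' \<in> carrier_mat m m" "A i' * A i \<in> carrier_mat m m" by simp_all
  show ?thesis
  proof (cases "i \<in> {1..t} \<and> i' = t + i")
    case True
    have "sc (\<lambda>j. twist j i i') = sc (\<lambda>j. lam j ^ c i)" by (simp only: twist_cases(1)[OF True])
    with RD(4)[of i] True show ?thesis by (simp add: model_x_pow)
  next
    case F: False
    show ?thesis
    proof (cases "i' \<in> {1..t} \<and> i = t + i'")
      case True
      have tw: "sc (\<lambda>j. twist j i i') = sc (\<lambda>j. inverse (lam j ^ c i'))"
        by (simp only: twist_cases(2)[OF F True])
      have 1: "sc (\<lambda>j. inverse (lam j ^ c i')) * sc (\<lambda>j. lam j ^ c i') = 1\<^sub>m m"
        unfolding sc_mult by (rule sc_one) (simp add: lam_nonzero)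
      have "A i' * A i = sc (\<lambda>j. lam j ^ c i') * (A i * A i')"
        using RD(4)[of i'] True by (simp add: model_x_pow)
      then have "sc (\<lambda>j. twist j i i') * (A i' * A i) = sc (\<lambda>j. inverse (lam j ^ c i')) * (sc (\<lambda>j. lam j ^ c i') * (A i * A i'))"
        unfolding tw by (rule arg_cong)
      also have "\<dots> = 1\<^sub>m m * (A i * A i')"
        unfolding 1[symmetric] by (rule assoc_mult_mat[OF sc_carrier sc_carrier cc(1), symmetric])
      also have "\<dots> = A i * A i'" by (rule left_mult_one_mat[OF cc(1)])
      finally show ?thesis by (rule sym)
    next
      case False
      have "sc (\<lambda>j. twist j i i') = 1\<^sub>m m" by (rule sc_one) (rule twist_cases(3)[OF F False])
      then show ?thesis by (simp only: RD(5)[OF i F False] left_mult_one_mat[OF cc(2)])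
    qed
  qed
qed

section \<open>Tuples of blocks and their assembly\<close>

definition Dm :: "nat \<Rightarrow> nat \<Rightarrow> nat \<Rightarrow> ratmod" where
  "Dm j = D_matrix t (\<lambda>i. int_scale (- int (c i)) (log_ratmod (lam j)))"

definition BT :: "(nat \<Rightarrow> nat \<Rightarrow> complex mat) topology" where
  "BT = product_topology (\<lambda>j. almost_commuting n (\<mu> j) (Dm j)) {1..s}"

text \<open>Families of blocks of the right sizes, before unitarity and relations are imposed. Here
  \<open>bd\<close> is already injective, so identities of tuples can be checked after assembling
  the blocks.\<close>

definition CB :: "(nat \<Rightarrow> nat \<Rightarrow> complex mat) set" where
  "CB = (\<Pi>\<^sub>E j\<in>{1..s}. \<Pi>\<^sub>E i\<in>{1..n}. carrier_mat (\<mu> j) (\<mu> j))"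

definition bd :: "(nat \<Rightarrow> nat \<Rightarrow> complex mat) \<Rightarrow> nat \<Rightarrow> complex mat" where
  "bd B i = block_diag s (\<lambda>j. B j i)"

lemma CB_carrier: "B \<in> CB \<Longrightarrow> j \<in> {1..s} \<Longrightarrow> i \<in> {1..n} \<Longrightarrow> B j i \<in> carrier_mat (\<mu> j) (\<mu> j)"
proof -
  assume B: "B \<in> CB" and j: "j \<in> {1..s}" and i: "i \<in> {1..n}"
  have "B j \<in> {1..n} \<rightarrow>\<^sub>E carrier_mat (\<mu> j) (\<mu> j)"
    by (rule PiE_mem[OF B[unfolded CB_def] j])
  then show "B j i \<in> carrier_mat (\<mu> j) (\<mu> j)"
    by (rule PiE_mem[where T = "\<lambda>_. carrier_mat (\<mu> j) (\<mu> j)"]) (rule i)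
qed

lemma CB_family: "B \<in> CB \<Longrightarrow> i \<in> {1..n} \<Longrightarrow> block_family (\<lambda>j. B j i)"
  by (rule block_familyI) (rule CB_carrier)

lemma bd_inj:
  assumes B: "B \<in> CB" and B': "B' \<in> CB" and eq: "\<And>i. i \<in> {1..n} \<Longrightarrow> bd B i = bd B' i"
  shows "B = B'"
proof (rule PiE_ext[OF B[unfolded CB_def] B'[unfolded CB_def]])
  fix j assume j: "j \<in> {1..s}"
  show "B j = B' j"
  proof (rule PiE_ext[OF PiE_mem[OF B[unfolded CB_def] j] PiE_mem[OF B'[unfolded CB_def] j]])
    fix i assume i: "i \<in> {1..n}"
    show "B j i = B' j i"
      using block_diag_inj[OF CB_family[OF B i] CB_family[OF B' i] eq[OF i, unfolded bd_def] j] .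
  qed
qed

lemma bd_twisted_iff:
  assumes B: "B \<in> CB" and i: "i \<in> {1..n}" "i' \<in> {1..n}"
  shows "bd B i * bd B i' = sc (\<lambda>j. twist j i i') * (bd B i' * bd B i) \<longleftrightarrow>
    (\<forall>j\<in>{1..s}. B j i * B j i' = twist j i i' \<cdot>\<^sub>m (B j i' * B j i))"
proof -
  note f = CB_family[OF B i(1)] CB_family[OF B i(2)]
  have f1: "block_family (\<lambda>j. B j i * B j i')" and f2: "block_family (\<lambda>j. B j i' * B j i)"
    by (rule block_familyI, rule mult_carrier_mat[OF CB_carrier[OF B _ i(1)] CB_carrier[OF B _ i(2)]], assumption+)
      (rule block_familyI, rule mult_carrier_mat[OF CB_carrier[OF B _ i(2)] CB_carrier[OF B _ i(1)]], assumption+)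
  have f3: "block_family (\<lambda>j. twist j i i' \<cdot>\<^sub>m (B j i' * B j i))"
    by (rule block_familyI, rule smult_carrier_mat, rule block_familyD[OF f2])
  have L: "bd B i * bd B i' = block_diag s (\<lambda>j. B j i * B j i')"
    unfolding bd_def by (rule block_diag_mult[OF f])
  have R: "sc (\<lambda>j. twist j i i') * (bd B i' * bd B i) = block_diag s (\<lambda>j. twist j i i' \<cdot>\<^sub>m (B j i' * B j i))"
    unfolding bd_def block_diag_mult[OF f(2,1)] block_diag_mult[OF block_diag_scalars(1) f2]
    by (rule block_diag_cong) (rule smult_one_mult(1)[OF block_familyD[OF f2]])
  show ?thesis unfolding L R
  proof (rule iffI)
    assume eq: "block_diag s (\<lambda>j. B j i * B j i') = block_diag s (\<lambda>j. twist j i i' \<cdot>\<^sub>m (B j i' * B j i))"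
    show "\<forall>j\<in>{1..s}. B j i * B j i' = twist j i i' \<cdot>\<^sub>m (B j i' * B j i)"
      by (rule ballI) (rule block_diag_inj[OF f1 f3 eq])
  next
    assume eq: "\<forall>j\<in>{1..s}. B j i * B j i' = twist j i i' \<cdot>\<^sub>m (B j i' * B j i)"
    show "block_diag s (\<lambda>j. B j i * B j i') = block_diag s (\<lambda>j. twist j i i' \<cdot>\<^sub>m (B j i' * B j i))"
      by (rule block_diag_cong) (rule bspec[OF eq])
  qed
qed

lemma block_diag_commutes_model_x:
  assumes h: "block_family h"
  shows "block_diag s h * model_x = model_x * block_diag s h"
  unfolding model_x_sc block_diag_mult[OF h block_diag_scalars(1)] block_diag_mult[OF block_diag_scalars(1) h]
  by (rule block_diag_cong) (simp only: smult_one_mult[OF block_familyD[OF h]])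

lemma topspace_BT:
  "B \<in> topspace BT \<longleftrightarrow> B \<in> CB \<and> (\<forall>j\<in>{1..s}. \<forall>i\<in>{1..n}. B j i \<in> unitary (\<mu> j)) \<and>
     (\<forall>j\<in>{1..s}. \<forall>i\<in>{1..n}. \<forall>i'\<in>{1..n}. B j i * B j i' = twist j i i' \<cdot>\<^sub>m (B j i' * B j i))"
proof -
  have d: "exp_ratmod (Dm j i i') = twist j i i'" if "j \<in> {1..s}" for j i i'
    unfolding Dm_def by (rule exp_D_matrix[OF that])
  have sub: "unitary d \<subseteq> carrier_mat d d" for d by (rule subsetI) (rule unitaryD(1))
  have u: "A \<in> {1..n} \<rightarrow>\<^sub>E unitary d \<longleftrightarrow> A \<in> {1..n} \<rightarrow>\<^sub>E carrier_mat d d \<and> (\<forall>i\<in>{1..n}. A i \<in> unitary d)" for A d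
  proof (rule iffI)
    assume A: "A \<in> {1..n} \<rightarrow>\<^sub>E unitary d"
    show "A \<in> {1..n} \<rightarrow>\<^sub>E carrier_mat d d \<and> (\<forall>i\<in>{1..n}. A i \<in> unitary d)"
      by (intro conjI ballI subsetD[OF PiE_mono[OF sub] A] PiE_mem[OF A])
  next
    assume A: "A \<in> {1..n} \<rightarrow>\<^sub>E carrier_mat d d \<and> (\<forall>i\<in>{1..n}. A i \<in> unitary d)"
    show "A \<in> {1..n} \<rightarrow>\<^sub>E unitary d"
      by (rule PiE_I) (erule bspec[OF conjunct2[OF A]], erule PiE_arb[OF conjunct1[OF A]])
  qed
  have 1: "B \<in> topspace BT \<longleftrightarrow> B \<in> extensional {1..s} \<and> (\<forall>j\<in>{1..s}. B j \<in> topspace (almost_commuting n (\<mu> j) (Dm j)))"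
    unfolding BT_def topspace_product_topology PiE_iff[of B] by (rule conj_commute)
  have 2: "B j \<in> topspace (almost_commuting n (\<mu> j) (Dm j)) \<longleftrightarrow> B j \<in> {1..n} \<rightarrow>\<^sub>E carrier_mat (\<mu> j) (\<mu> j) \<and>
     (\<forall>i\<in>{1..n}. B j i \<in> unitary (\<mu> j)) \<and>
     (\<forall>i\<in>{1..n}. \<forall>i'\<in>{1..n}. B j i * B j i' = twist j i i' \<cdot>\<^sub>m (B j i' * B j i))" if "j \<in> {1..s}" for j
    by (simp only: topspace_almost_commuting mem_Collect_eq d[OF that] u conj_assoc)
  have 3: "B \<in> CB \<longleftrightarrow> B \<in> extensional {1..s} \<and> (\<forall>j\<in>{1..s}. B j \<in> {1..n} \<rightarrow>\<^sub>E carrier_mat (\<mu> j) (\<mu> j))"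
    unfolding CB_def PiE_iff[of B] by (rule conj_commute)
  show ?thesis
    by (simp only: 1 2 3 ball_conj_distrib conj_assoc cong: ball_cong)
qed

lemma BT_CB: "B \<in> topspace BT \<Longrightarrow> B \<in> CB"
  by (simp only: topspace_BT)

text \<open>Unitarity and the twisted relations hold for block diagonal matrices exactly when they
  hold in every block, and the twist of the j-th block is the scalar prescribed by
  \<open>Dm j\<close>.\<close>

lemma BT_rels_iff:
  assumes B: "B \<in> CB"
  shows "B \<in> topspace BT \<longleftrightarrow> unitary_rels m model_x (bd B)"
proof (rule iffI)
  assume BT: "B \<in> topspace BT"
  have tw: "bd B i * bd B i' = sc (\<lambda>j. twist j i i') * (bd B i' * bd B i)" if "i \<in> {1..n}" "i' \<in> {1..n}" for i i'
    unfolding bd_twisted_iff[OF B that] using BT that unfolding topspace_BT by blast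
  have u: "bd B i \<in> unitary m" if "i \<in> {1..n}" for i
    unfolding bd_def block_diag_unitary_iff[OF CB_family[OF B that]]
    using BT that unfolding topspace_BT by blast
  show "unitary_rels m model_x (bd B)"
    unfolding heisenberg_rels_def unitary_group_simps
  proof (intro conjI ballI impI)
    show "model_x \<in> unitary m" by (rule model_x_unitary)
    fix i assume i: "i \<in> {1..n}"
    show "bd B i \<in> unitary m" by (rule u[OF i])
    show "model_x * bd B i = bd B i * model_x"
      unfolding bd_def by (rule block_diag_commutes_model_x[OF CB_family[OF B i], symmetric])
  next
    fix i assume i: "i \<in> {1..t}"
    have e: "sc (\<lambda>j. twist j i (t + i)) = sc (\<lambda>j. lam j ^ c i)" using i by (simp only: twist_cases(1)[OF conjI[OF i refl]])
    have "i \<in> {1..n}" "t + i \<in> {1..n}" using i t2n by auto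
    from tw[OF this] show "bd B i * bd B (t + i) = model_x [^]\<^bsub>unitary_group m\<^esub> c i * (bd B (t + i) * bd B i)"
      by (simp only: e model_x_pow)
  next
    fix i i' assume i: "i \<in> {1..n}" "i' \<in> {1..n}" and F: "\<not> (i \<in> {1..t} \<and> i' = t + i)" "\<not> (i' \<in> {1..t} \<and> i = t + i')"
    have "sc (\<lambda>j. twist j i i') = 1\<^sub>m m" by (rule sc_one) (rule twist_cases(3)[OF F])
    then show "bd B i * bd B i' = bd B i' * bd B i"
      using tw[OF i] left_mult_one_mat[OF mult_carrier_mat[OF unitaryD(1)[OF u[OF i(2)]] unitaryD(1)[OF u[OF i(1)]]]] by simp
  qed
next
  assume R: "unitary_rels m model_x (bd B)"
  show "B \<in> topspace BT"
    unfolding topspace_BT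
  proof (intro conjI ballI B)
    fix j i assume j: "j \<in> {1..s}" and i: "i \<in> {1..n}"
    show "B j i \<in> unitary (\<mu> j)"
      by (rule bspec[OF block_diag_unitary_iff[OF CB_family[OF B i], THEN iffD1, OF unitary_relsD(2)[OF R i, unfolded bd_def]] j])
    fix i' assume i': "i' \<in> {1..n}"
    show "B j i * B j i' = twist j i i' \<cdot>\<^sub>m (B j i' * B j i)"
      by (rule bspec[OF bd_twisted_iff[OF B i i', THEN iffD1, OF twisted_rel[OF R i i']] j])
  qed
qed

section \<open>The action of the block unitary group\<close>

definition act :: "(nat \<Rightarrow> complex mat) \<Rightarrow> (nat \<Rightarrow> nat \<Rightarrow> complex mat) \<Rightarrow> nat \<Rightarrow> nat \<Rightarrow> complex mat" where
  "act h B = (\<lambda>j\<in>{1..s}. conj_action (\<mu> j) {1..n} (h j) (B j))"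

abbreviation H :: "(nat \<Rightarrow> complex mat) monoid" where
  "H \<equiv> block_unitary_group s \<mu>"

lemma group_H: "group H"
  unfolding block_unitary_group_def by (rule product_group) (rule group_unitary_group)

lemma H_unitary: "h \<in> carrier H \<Longrightarrow> j \<in> {1..s} \<Longrightarrow> h j \<in> unitary (\<mu> j)"
  unfolding block_unitary_group_def carrier_product_group by (rule PiE_mem)

lemma H_family: "h \<in> carrier H \<Longrightarrow> block_family h"
  by (rule block_familyI) (rule unitaryD(1)[OF H_unitary])

lemma H_block_diag_unitary: "h \<in> carrier H \<Longrightarrow> block_diag s h \<in> unitary m"
  using block_diag_unitary_iff[OF H_family] H_unitary by simp

lemma act_value:
  assumes "h \<in> carrier H" "j \<in> {1..s}" "i \<in> {1..n}"
  shows "act h B j i = h j * B j i * mat_adjoint (h j)"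
  using assms H_unitary[OF assms(1,2)] by (simp add: act_def conj_action_def del: atLeastAtMost_iff One_nat_def)

lemma act_CB:
  assumes h: "h \<in> carrier H" and B: "B \<in> CB"
  shows "act h B \<in> CB"
proof -
  have "act h B j \<in> (\<Pi>\<^sub>E i\<in>{1..n}. carrier_mat (\<mu> j) (\<mu> j))" if j: "j \<in> {1..s}" for j
  proof (rule PiE_I)
    fix i assume i: "i \<in> {1..n}"
    show "act h B j i \<in> carrier_mat (\<mu> j) (\<mu> j)"
      unfolding act_value[OF h j i] using unitaryD(1,5)[OF H_unitary[OF h j]] CB_carrier[OF B j i]
      by (intro mult_carrier_mat)
  next
    fix i assume "i \<notin> {1..n}"
    then show "act h B j i = undefined" using j by (simp add: act_def conj_action_def del: atLeastAtMost_iff One_nat_def)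
  qed
  moreover have "act h B j = undefined" if "j \<notin> {1..s}" for j
    using that by (simp only: act_def restrict_apply if_False)
  ultimately show ?thesis unfolding CB_def by (rule PiE_I)
qed

lemma bd_act:
  assumes h: "h \<in> carrier H" and B: "B \<in> CB" and i: "i \<in> {1..n}"
  shows "bd (act h B) i = block_diag s h * bd B i * mat_adjoint (block_diag s h)"
proof -
  have f: "block_family (\<lambda>j. h j * B j i)"
    by (rule block_familyI) (rule mult_carrier_mat[OF block_familyD[OF H_family[OF h]] CB_carrier[OF B _ i]])
  show ?thesis
    unfolding bd_def block_diag_adjoint[OF H_family[OF h]] block_diag_mult[OF H_family[OF h] CB_family[OF B i]]
      block_diag_mult[OF f adjoint_family[OF H_family[OF h]]]
    by (rule block_diag_cong) (rule act_value[OF h _ i])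
qed

lemma conj_model_x:
  assumes h: "h \<in> carrier H"
  shows "block_diag s h * model_x * mat_adjoint (block_diag s h) = model_x"
  by (rule unitary_conj_eq_iff[OF H_block_diag_unitary[OF h] unitaryD(1)[OF model_x_unitary] unitaryD(1)[OF model_x_unitary],
        THEN iffD2, symmetric]) (rule block_diag_commutes_model_x[OF H_family[OF h], symmetric])

lemma BT_rels: "B \<in> topspace BT \<Longrightarrow> unitary_rels m model_x (bd B)"
  using BT_rels_iff[OF BT_CB] by simp

definition Psi :: "complex mat \<times> (nat \<Rightarrow> nat \<Rightarrow> complex mat) \<Rightarrow> 'g \<Rightarrow> complex mat" where
  "Psi = (\<lambda>(u, B). cj u (rep model_x (bd B)))"

lemma Psi_in_HP: "u \<in> unitary m \<Longrightarrow> B \<in> topspace BT \<Longrightarrow> Psi (u, B) \<in> topspace HP"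
  unfolding Psi_def by (simp add: conj_HP rep_in_HP[OF BT_rels model_x_char_poly])

lemma Psi_values:
  assumes u: "u \<in> unitary m" and B: "B \<in> topspace BT"
  shows "Psi (u, B) x = u * model_x * mat_adjoint u"
    "i \<in> {1..n} \<Longrightarrow> Psi (u, B) (a i) = u * bd B i * mat_adjoint u"
  using conj_value[OF u x_in] conj_value[OF u a_in] rep_values[OF BT_rels[OF B]]
  by (simp_all add: Psi_def del: atLeastAtMost_iff One_nat_def)

lemma bd_carrier: "B \<in> topspace BT \<Longrightarrow> i \<in> {1..n} \<Longrightarrow> bd B i \<in> unitary m"
  by (rule unitary_relsD(2)[OF BT_rels])

text \<open>Conjugation by a block diagonal unitary matrix fixes \<open>model_x\<close> and carries
  representations to representations, so the relations come from \<open>HP_rels\<close> instead of a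
  computation in each block.\<close>

lemma act_BT:
  assumes h: "h \<in> carrier H" and B: "B \<in> topspace BT"
  shows "act h B \<in> topspace BT"
proof -
  note D = H_block_diag_unitary[OF h]
  have "unitary_rels m (Psi (block_diag s h, B) x) (\<lambda>i. Psi (block_diag s h, B) (a i))"
    by (rule HP_rels[OF Psi_in_HP[OF D B]])
  then have "unitary_rels m model_x (\<lambda>i. Psi (block_diag s h, B) (a i))"
    by (simp only: Psi_values(1)[OF D B] conj_model_x[OF h])
  moreover have "Psi (block_diag s h, B) (a i) = bd (act h B) i" if "i \<in> {1..n}" for i
    by (simp only: Psi_values(2)[OF D B that] bd_act[OF h BT_CB[OF B] that])
  ultimately have "unitary_rels m model_x (bd (act h B))"
    by (rule heisenberg_rels_cong[OF t2n, where A = "\<lambda>i. Psi (block_diag s h, B) (a i)" and A' = "bd (act h B)",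
          THEN iffD1, rotated])
  then show ?thesis by (rule BT_rels_iff[OF act_CB[OF h BT_CB[OF B]], THEN iffD2])
qed

text \<open>Spelled out exactly as in \<open>induced_space\<close>, so that unfolding identifies its
  orbit space with the induced space; \<open>phi_value\<close> is the form used for
  computing.\<close>

definition phi :: "(nat \<Rightarrow> complex mat) \<Rightarrow> complex mat \<times> (nat \<Rightarrow> nat \<Rightarrow> complex mat) \<Rightarrow> complex mat \<times> (nat \<Rightarrow> nat \<Rightarrow> complex mat)" where
  "phi = (\<lambda>h (u, B). (u \<otimes>\<^bsub>unitary_group m\<^esub> block_diag s (inv\<^bsub>H\<^esub> h), \<lambda>j\<in>{1..s}. conj_action (\<mu> j) {1..n} (h j) (B j)))"

lemma phi_value:
  assumes h: "h \<in> carrier H"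
  shows "phi h (u, B) = (u * mat_adjoint (block_diag s h), act h B)"
proof -
  have "inv\<^bsub>H\<^esub> h = (\<lambda>j\<in>{1..s}. inv\<^bsub>unitary_group (\<mu> j)\<^esub> h j)"
    using h unfolding block_unitary_group_def
    by (intro inv_product_group) (simp_all only: carrier_product_group group_unitary_group)
  then have "block_diag s (inv\<^bsub>H\<^esub> h) = block_diag s (\<lambda>j. mat_adjoint (h j))"
    by (intro block_diag_cong) (simp add: inv_unitary_group[OF H_unitary[OF h]] del: atLeastAtMost_iff One_nat_def)
  then show ?thesis by (simp add: phi_def act_def block_diag_adjoint[OF H_family[OF h]])
qed

definition XT :: "(complex mat \<times> (nat \<Rightarrow> nat \<Rightarrow> complex mat)) topology" where
  "XT = prod_topology (unitary_topology m) BT"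

lemma topspace_XT: "topspace XT = unitary m \<times> topspace BT"
  by (simp add: XT_def)

text \<open>After assembling the blocks the action on tuples is conjugation by
  \<open>block_diag s h\<close>, so the action laws are matrix identities, transferred back by
  injectivity of \<open>bd\<close>.\<close>

lemma orbit_phi_eq_iff:
  assumes y: "y \<in> topspace XT" and z: "z \<in> topspace XT"
  shows "orbit H phi y = orbit H phi z \<longleftrightarrow> (\<exists>h\<in>carrier H. z = phi h y)"
proof (rule orbit_eq_iff[OF group_H _ _ _ y z])
  interpret H: group H by (rule group_H)
  fix g y assume g: "g \<in> carrier H" and "y \<in> topspace XT"
  then obtain u B where y: "y = (u, B)" "u \<in> unitary m" "B \<in> topspace BT" unfolding topspace_XT by (elim SigmaE)
  note G = H_block_diag_unitary[OF g]
  show "phi g y \<in> topspace XT"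
    unfolding y(1) phi_value[OF g] topspace_XT by (intro SigmaI unitary_mult y(2) unitaryD(4)[OF G] act_BT[OF g y(3)])
  fix h assume h: "h \<in> carrier H"
  note Hh = H_block_diag_unitary[OF h] and gh = H.m_closed[OF g h]
  have D: "block_diag s (g \<otimes>\<^bsub>H\<^esub> h) = block_diag s g * block_diag s h"
    unfolding block_diag_mult[OF H_family[OF g] H_family[OF h]]
    by (rule block_diag_cong) (simp add: block_unitary_group_def del: atLeastAtMost_iff One_nat_def)
  have "act (g \<otimes>\<^bsub>H\<^esub> h) B = act g (act h B)"
  proof (rule bd_inj)
    show "act (g \<otimes>\<^bsub>H\<^esub> h) B \<in> CB" by (rule act_CB[OF gh BT_CB[OF y(3)]])
    show "act g (act h B) \<in> CB" by (rule act_CB[OF g act_CB[OF h BT_CB[OF y(3)]]])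
    fix i assume i: "i \<in> {1..n}"
    show "bd (act (g \<otimes>\<^bsub>H\<^esub> h) B) i = bd (act g (act h B)) i"
      unfolding bd_act[OF gh BT_CB[OF y(3)] i] bd_act[OF g act_CB[OF h BT_CB[OF y(3)]] i] bd_act[OF h BT_CB[OF y(3)] i]
        D mat_adjoint_mult[OF unitaryD(1)[OF G] unitaryD(1)[OF Hh]]
      using unitaryD(1,5)[OF G] unitaryD(1,5)[OF Hh] unitaryD(1)[OF bd_carrier[OF y(3) i]]
      by (simp add: assoc_mult_mat[of _ m m _ m _ m])
  qed
  moreover have "u * mat_adjoint (block_diag s (g \<otimes>\<^bsub>H\<^esub> h)) = u * mat_adjoint (block_diag s h) * mat_adjoint (block_diag s g)"
    unfolding D mat_adjoint_mult[OF unitaryD(1)[OF G] unitaryD(1)[OF Hh]]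
    by (rule assoc_mult_mat[OF unitaryD(1)[OF y(2)] unitaryD(5)[OF Hh] unitaryD(5)[OF G], symmetric])
  ultimately show "phi (g \<otimes>\<^bsub>H\<^esub> h) y = phi g (phi h y)"
    by (simp only: y(1) phi_value[OF gh] phi_value[OF g] phi_value[OF h])
next
  interpret H: group H by (rule group_H)
  fix y assume "y \<in> topspace XT"
  then obtain u B where y: "y = (u, B)" "u \<in> unitary m" "B \<in> topspace BT" unfolding topspace_XT by (elim SigmaE)
  have D: "block_diag s \<one>\<^bsub>H\<^esub> = 1\<^sub>m m"
    unfolding block_diag_one[symmetric] by (rule block_diag_cong) (simp add: block_unitary_group_def del: atLeastAtMost_iff One_nat_def)
  have "act \<one>\<^bsub>H\<^esub> B = B"
  proof (rule bd_inj[OF act_CB[OF H.one_closed BT_CB[OF y(3)]] BT_CB[OF y(3)]])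
    fix i assume i: "i \<in> {1..n}"
    show "bd (act \<one>\<^bsub>H\<^esub> B) i = bd B i"
      unfolding bd_act[OF H.one_closed BT_CB[OF y(3)] i] D mat_adjoint_one
      using unitaryD(1)[OF bd_carrier[OF y(3) i]] by simp
  qed
  then show "phi \<one>\<^bsub>H\<^esub> y = y"
    by (simp only: y(1) phi_value[OF H.one_closed] D mat_adjoint_one right_mult_one_mat[OF unitaryD(1)[OF y(2)]])
qed

text \<open>If two pairs give the same representation, w = u'^-1 u commutes with
  \<open>model_x\<close>. As the lam_j are distinct, w is block diagonal, and its diagonal blocks
  form the required h.\<close>

lemma Psi_eq_iff:
  assumes u: "u \<in> unitary m" and B: "B \<in> topspace BT" and u': "u' \<in> unitary m" and B': "B' \<in> topspace BT"
  shows "Psi (u, B) = Psi (u', B') \<longleftrightarrow> (\<exists>h\<in>carrier H. (u', B') = phi h (u, B))"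
proof -
  note Uc = unitaryD[OF u] and Uc' = unitaryD[OF u']
  note Xc = unitaryD(1)[OF model_x_unitary]
  note bc = unitaryD(1)[OF bd_carrier[OF B]] and bc' = unitaryD(1)[OF bd_carrier[OF B']]
  have iff: "Psi (u, B) = Psi (u', B') \<longleftrightarrow>
    (u * model_x * mat_adjoint u) * u' = u' * model_x \<and>
    (\<forall>i\<in>{1..n}. (u * bd B i * mat_adjoint u) * u' = u' * bd B' i)"
    using eq_conj_rep_iff[OF Psi_in_HP[OF u B] BT_rels[OF B'] model_x_char_poly u'] Psi_values[OF u B]
    by (simp add: Psi_def[THEN fun_cong, of "(u', B')"] del: atLeastAtMost_iff One_nat_def cong: ball_cong)
  show ?thesis
  proof (rule iffI)
    assume "\<exists>h\<in>carrier H. (u', B') = phi h (u, B)"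
    then obtain h where h: "h \<in> carrier H" and "(u', B') = phi h (u, B)" by (rule bexE)
    then have e: "u' = u * mat_adjoint (block_diag s h)" "B' = act h B" by (simp_all add: phi_value)
    show "Psi (u, B) = Psi (u', B')"
      unfolding iff
    proof (intro conjI ballI)
      show "u * model_x * mat_adjoint u * u' = u' * model_x"
        using conj_transport[OF u H_block_diag_unitary[OF h] Xc] by (simp only: e(1) conj_model_x[OF h])
      fix i assume i: "i \<in> {1..n}"
      show "u * bd B i * mat_adjoint u * u' = u' * bd B' i"
        using conj_transport[OF u H_block_diag_unitary[OF h] bc[OF i]] by (simp only: e bd_act[OF h BT_CB[OF B] i])
    qed
  next
    assume "Psi (u, B) = Psi (u', B')"
    note eqs = this[unfolded iff]
    define w where "w = mat_adjoint u' * u"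
    have w: "w \<in> unitary m" unfolding w_def by (rule unitary_mult[OF Uc'(4) u])
    have "w * model_x = model_x * w"
      unfolding w_def by (rule conj_quotient(1)[OF u u' Xc Xc conjunct1[OF eqs]])
    from commutes_with_scalars_imp_block_diag[OF unitaryD(1)[OF w] lam_inj this[unfolded model_x_sc]]
    have wd: "w = block_diag s (diag_part w)" .
    define h where "h = (\<lambda>j\<in>{1..s}. diag_part w j)"
    have "block_diag s h = block_diag s (diag_part w)"
      by (rule block_diag_cong) (simp add: h_def del: atLeastAtMost_iff One_nat_def)
    then have hw: "block_diag s h = w" using wd by simp
    have "\<forall>j\<in>{1..s}. diag_part w j \<in> unitary (\<mu> j)"
      using block_diag_unitary_iff[OF diag_part_family, of w] w wd by simp
    then have h: "h \<in> carrier H"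
      by (simp add: block_unitary_group_def h_def del: atLeastAtMost_iff One_nat_def)
    have "B' = act h B"
    proof (rule bd_inj[OF BT_CB[OF B'] act_CB[OF h BT_CB[OF B]]])
      fix i assume i: "i \<in> {1..n}"
      show "bd B' i = bd (act h B) i"
        unfolding bd_act[OF h BT_CB[OF B] i] hw w_def
        by (rule conj_quotient(2)[OF u u' bc[OF i] bc'[OF i] bspec[OF conjunct2[OF eqs] i]])
    qed
    moreover have "u' = u * mat_adjoint (block_diag s h)"
    proof -
      have "u * mat_adjoint (block_diag s h) = u * (mat_adjoint u * u')"
        unfolding hw w_def mat_adjoint_mult[OF Uc'(5) Uc(1)] mat_adjoint_adjoint by (rule refl)
      also have "\<dots> = (u * mat_adjoint u) * u'" by (rule assoc_mult_mat[OF Uc(1,5) Uc'(1), symmetric])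
      also have "\<dots> = u'" unfolding Uc(2) by (rule left_mult_one_mat[OF Uc'(1)])
      finally show ?thesis by (rule sym)
    qed
    ultimately show "\<exists>h\<in>carrier H. (u', B') = phi h (u, B)"
      using h by (intro bexI[of _ h]) (simp_all add: phi_value)
  qed
qed

lemma continuous_map_bd:
  assumes i: "i \<in> {1..n}"
  shows "continuous_map BT (unitary_topology m) (\<lambda>B. bd B i)"
  unfolding continuous_map_into_unitary
proof (intro conjI allI impI)
  show "(\<lambda>B. bd B i) \<in> topspace BT \<rightarrow> unitary m" by (intro Pi_I bd_carrier i)
  fix p q assume pq: "p < m" "q < m"
  obtain j r where p: "p = block_pos \<mu> (j, r)" "j \<in> {1..s}" "r < \<mu> j" by (rule block_cases[OF pq(1)[unfolded m_eq]])
  obtain j' r' where q: "q = block_pos \<mu> (j', r')" "j' \<in> {1..s}" "r' < \<mu> j'" by (rule block_cases[OF pq(2)[unfolded m_eq]])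
  have e: "bd B i $$ (p, q) = (if j = j' then B j i $$ (r, r') else 0)" if "B \<in> topspace BT" for B
    unfolding bd_def p(1) q(1) by (rule block_diag_entry[OF CB_family[OF BT_CB[OF that] i] p(2,3) q(2,3)])
  have "continuous_map BT euclidean (\<lambda>B. if j = j' then B j i $$ (r, r') else 0)"
  proof (cases "j = j'")
    case True
    have 1: "continuous_map BT (almost_commuting n (\<mu> j) (Dm j)) (\<lambda>B. B j)"
      unfolding BT_def by (rule continuous_map_product_projection[OF p(2)])
    have 2: "continuous_map (almost_commuting n (\<mu> j) (Dm j)) (unitary_topology (\<mu> j)) (\<lambda>A. A i)"
      unfolding almost_commuting_def by (rule continuous_map_from_subtopology[OF continuous_map_product_projection[OF i]])
    have "r' < \<mu> j" using q(3) True by simp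
    from continuous_map_unitary_entry[OF continuous_map_compose[OF 1 2] p(3) this] True show ?thesis by (simp add: o_def)
  qed simp
  then show "continuous_map BT euclidean (\<lambda>B. bd B i $$ (p, q))"
    by (rule continuous_map_eq) (rule e[symmetric])
qed

lemma continuous_map_Psi: "continuous_map XT HP Psi"
proof (rule continuous_map_HP)
  have T: "fst y \<in> unitary m" "snd y \<in> topspace BT" if "y \<in> topspace XT" for y
    using that by (simp_all add: topspace_XT mem_Times_iff)
  have 1: "continuous_map XT (unitary_topology m) fst" unfolding XT_def by (rule continuous_map_fst)
  show "Psi \<in> topspace XT \<rightarrow> topspace HP"
  proof (rule Pi_I)
    fix y assume "y \<in> topspace XT"
    from Psi_in_HP[OF T[OF this]] show "Psi y \<in> topspace HP" by simp
  qed
  have "continuous_map XT (unitary_topology m) (\<lambda>y. fst y * model_x * mat_adjoint (fst y))"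
    by (intro continuous_map_unitary_mult continuous_map_unitary_adjoint 1) (simp add: model_x_unitary)
  then show "continuous_map XT (unitary_topology m) (\<lambda>y. Psi y x)"
  proof (rule continuous_map_eq)
    fix y assume "y \<in> topspace XT"
    from Psi_values(1)[OF T[OF this]] show "fst y * model_x * mat_adjoint (fst y) = Psi y x" by simp
  qed
  fix i assume i: "i \<in> {1..n}"
  have 2: "continuous_map XT (unitary_topology m) (\<lambda>y. bd (snd y) i)"
    using continuous_map_compose[OF continuous_map_snd continuous_map_bd[OF i]] unfolding XT_def by (simp only: o_def)
  have "continuous_map XT (unitary_topology m) (\<lambda>y. fst y * bd (snd y) i * mat_adjoint (fst y))"
    by (intro continuous_map_unitary_mult continuous_map_unitary_adjoint 1 2)
  then show "continuous_map XT (unitary_topology m) (\<lambda>y. Psi y (a i))"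
  proof (rule continuous_map_eq)
    fix y assume "y \<in> topspace XT"
    from Psi_values(2)[OF T[OF this] i] show "fst y * bd (snd y) i * mat_adjoint (fst y) = Psi y (a i)" by simp
  qed
qed

text \<open>The model matrices commute with \<open>model_x\<close>, hence are block diagonal, so
  every conjugate of a model comes from a tuple of blocks.\<close>

lemma Psi_surj: "Psi ` topspace XT = topspace HP"
proof (rule equalityI; rule subsetI)
  fix f assume "f \<in> Psi ` topspace XT"
  then show "f \<in> topspace HP" using continuous_map_funspace[OF continuous_map_Psi] by blast
next
  fix f assume f: "f \<in> topspace HP"
  obtain g z where g: "g \<in> unitary m" and z: "z \<in> Zset" and fz: "f = cj g (mrep z)" by (rule HP_conj_mrep[OF f])
  note R = model_rels[OF z]
  define B where "B = (\<lambda>j\<in>{1..s}. \<lambda>i\<in>{1..n}. diag_part (model_mat z i) j)"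
  have CB: "B \<in> CB"
    unfolding B_def CB_def restrict_PiE_iff by (intro ballI block_familyD[OF diag_part_family])
  have bd: "bd B i = model_mat z i" if i: "i \<in> {1..n}" for i
  proof -
    have "bd B i = block_diag s (diag_part (model_mat z i))"
      unfolding bd_def by (rule block_diag_cong) (simp add: B_def i del: atLeastAtMost_iff One_nat_def)
    also have "\<dots> = model_mat z i"
      by (rule commutes_with_scalars_imp_block_diag[OF unitaryD(1)[OF unitary_relsD(2)[OF R i]] lam_inj, symmetric])
        (use unitary_relsD(3)[OF R i] in \<open>simp only: model_x_sc\<close>)
    finally show ?thesis .
  qed
  have "unitary_rels m model_x (bd B)"
    by (rule heisenberg_rels_cong[OF t2n, where A = "bd B" and A' = "model_mat z", THEN iffD2, OF bd R])
  then have B: "B \<in> topspace BT" by (rule BT_rels_iff[OF CB, THEN iffD2])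
  have "rep model_x (bd B) = mrep z"
    by (rule HP_eqI[OF rep_in_HP[OF BT_rels[OF B] model_x_char_poly] mrep_in_HP[OF z]])
      (simp_all add: mrep_def rep_values[OF R] rep_values[OF BT_rels[OF B]] bd del: atLeastAtMost_iff One_nat_def)
  then have "f = Psi (g, B)" by (simp add: Psi_def fz)
  with g B show "f \<in> Psi ` topspace XT" unfolding topspace_XT by (intro image_eqI[of _ _ "(g, B)"]) simp_all
qed

lemma quotient_map_Psi: "quotient_map XT HP Psi"
proof (rule continuous_imp_quotient_map[OF continuous_map_Psi _ Hausdorff_HP Psi_surj])
  have "compact_space BT"
    unfolding BT_def compact_space_product_topology by (intro disjI2 ballI compact_space_almost_commuting)
  then show "compact_space XT"
    unfolding XT_def compact_space_prod_topology by (intro disjI2 conjI compact_space_unitary_topology)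
qed

text \<open>Left multiplication by g commutes with the right multiplication through which
  \<open>phi\<close> acts on the first factor.\<close>

lemma left_mult_orbit:
  assumes g: "g \<in> unitary m" and u: "u \<in> unitary m"
  shows "left_mult_action m g (orbit H phi (u, B)) = orbit H phi (g * u, B)"
proof -
  have e: "(\<lambda>(u, y). (g \<otimes>\<^bsub>unitary_group m\<^esub> u, y)) (phi h (u, B)) = phi h (g * u, B)" if h: "h \<in> carrier H" for h
    unfolding phi_value[OF h]
    using assoc_mult_mat[OF unitaryD(1)[OF g] unitaryD(1)[OF u] unitaryD(5)[OF H_block_diag_unitary[OF h]]] by simp
  have o: "orbit H phi y = (\<lambda>h. phi h y) ` carrier H" for y unfolding orbit_def by (rule Setcompr_eq_image)
  show ?thesis unfolding o left_mult_action_def image_image by (rule image_cong[OF refl e])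
qed

text \<open>Equivariance is inherited from \<open>conj_mult\<close>: F is known on the
  representatives (u, B), and conjugating the representation of (u, B) by g gives the one of (g u,
  B).\<close>

theorem induced_space_homeomorphic:
  "\<exists>F. homeomorphic_map HP (induced_space n m s \<mu> Dm) F \<and>
     (\<forall>g\<in>unitary m. \<forall>f\<in>topspace HP. F (cj g f) = left_mult_action m g (F f))"
proof -
  have I: "induced_space n m s \<mu> Dm = orbit_space H phi XT"
    unfolding induced_space_def balanced_product_def XT_def BT_def phi_def by (rule refl)
  show ?thesis
    unfolding I
  proof (rule quotient_maps_same_fibres[OF quotient_map_Psi quotient_map_orbit[of XT H phi]])
    fix y z assume y: "y \<in> topspace XT" and z: "z \<in> topspace XT"
    obtain u B where yy: "y = (u, B)" "u \<in> unitary m" "B \<in> topspace BT" using y unfolding topspace_XT by (elim SigmaE)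
    obtain u' B' where zz: "z = (u', B')" "u' \<in> unitary m" "B' \<in> topspace BT" using z unfolding topspace_XT by (elim SigmaE)
    show "Psi y = Psi z \<longleftrightarrow> orbit H phi y = orbit H phi z"
      unfolding orbit_phi_eq_iff[OF y z] unfolding yy(1) zz(1) by (rule Psi_eq_iff[OF yy(2,3) zz(2,3)])
  next
    fix F assume F: "homeomorphic_map HP (orbit_space H phi XT) F"
      and v: "\<And>y. y \<in> topspace XT \<Longrightarrow> F (Psi y) = orbit H phi y"
    have "F (cj g f) = left_mult_action m g (F f)" if g: "g \<in> unitary m" and f: "f \<in> topspace HP" for g f
    proof -
      obtain y where y: "f = Psi y" "y \<in> topspace XT" using f unfolding Psi_surj[symmetric] by (rule imageE)
      obtain u B where yy: "y = (u, B)" and u: "u \<in> unitary m" and B: "B \<in> topspace BT"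
        using y(2) unfolding topspace_XT by (elim SigmaE)
      have fe: "f = Psi (u, B)" by (simp only: y(1) yy)
      have gu: "(g * u, B) \<in> topspace XT" "(u, B) \<in> topspace XT"
        unfolding topspace_XT by (intro SigmaI unitary_mult g u B)+
      have "cj g f = Psi (g * u, B)"
        unfolding fe Psi_def prod.case
        by (rule conj_mult[OF g u rep_in_HP[OF BT_rels[OF B] model_x_char_poly], symmetric])
      then have "F (cj g f) = orbit H phi (g * u, B)" by (simp only: v[OF gu(1)])
      also have "\<dots> = left_mult_action m g (orbit H phi (u, B))" by (rule left_mult_orbit[OF g u, symmetric])
      also have "orbit H phi (u, B) = F f" by (simp only: fe v[OF gu(2)])
      finally show ?thesis .
    qed
    with F show "\<exists>F. homeomorphic_map HP (orbit_space H phi XT) F \<and>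
        (\<forall>g\<in>unitary m. \<forall>f\<in>topspace HP. F (cj g f) = left_mult_action m g (F f))"
      by (intro exI[of _ F] conjI ballI)
  qed
qed

end

section \<open>Assembly of both statements\<close>

lemma of_nat_div_gcd:
  assumes "(k :: nat) > 0"
  shows "of_nat (k div gcd k c) = (of_nat k / of_nat (gcd k c) :: rat)"
proof -
  have "k = gcd k c * (k div gcd k c)" by simp
  then have "(of_nat k :: rat) = of_nat (gcd k c) * of_nat (k div gcd k c)" by (metis of_nat_mult)
  moreover have "(of_nat (gcd k c) :: rat) \<noteq> 0" using assms by simp
  ultimately show ?thesis by (simp add: field_simps)
qed

theorem theoremB:
  fixes \<Gamma> :: "('g, 'r) monoid_scheme"
    and \<iota> :: "int \<Rightarrow> 'g" and \<pi> :: "'g \<Rightarrow> nat \<Rightarrow> int"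
    and x :: 'g and a :: "nat \<Rightarrow> 'g"
    and n t s m :: nat and c \<mu> k :: "nat \<Rightarrow> nat"
    and lam :: "nat \<Rightarrow> complex" and p :: "complex poly" and q :: "nat \<Rightarrow> ratmod"
  assumes "2 * t \<le> n"
    and "\<And>i. i \<in> {1..t} \<Longrightarrow> c i > 0"
    and "\<And>i. i \<in> {1..<t} \<Longrightarrow> c i dvd c (i + 1)"
    and "central_extension \<Gamma> (Zn n) \<iota> \<pi>"
    and "has_k_invariant \<Gamma> (Zn n) \<iota> \<pi> (omega t c)"
    and "x = \<iota> 1"
    and "\<And>i. i \<in> {1..n} \<Longrightarrow> a i \<in> carrier \<Gamma> \<and> \<pi> (a i) = Zn_basis n i"
    and "inj_on lam {1..s}"
    and "\<And>j. j \<in> {1..s} \<Longrightarrow> primitive_root_of_unity (k j) (lam j)"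
    and "\<And>j. j \<in> {1..s} \<Longrightarrow> \<mu> j \<ge> 1"
    and "m = (\<Sum>j = 1..s. \<mu> j)"
    and "p = (\<Prod>j = 1..s. [:- lam j, 1:] ^ \<mu> j)"
    and "\<And>j. j \<in> {1..s} \<Longrightarrow> q j = log_ratmod (lam j)"
    and "topspace (hom_space_char_poly \<Gamma> n x a m p) \<noteq> {}"
  shows "(\<exists>F. homeomorphic_map
               (hom_space_char_poly \<Gamma> n x a m p)
               (induced_space n m s \<mu> (\<lambda>j. D_matrix t (\<lambda>i. int_scale (- int (c i)) (q j)))) F \<and>
             (\<forall>g \<in> carrier (unitary_group m). \<forall>f \<in> topspace (hom_space_char_poly \<Gamma> n x a m p).
                F (conj_action m (carrier \<Gamma>) g f) = left_mult_action m g (F f))) \<and>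
         (\<exists>l :: nat \<Rightarrow> nat.
             (\<forall>j \<in> {1..s}. of_nat (l j) =
                (of_nat (\<mu> j) / (\<Prod>i = 1..t. of_nat (k j) / of_nat (gcd (k j) (c i))) :: rat)) \<and>
             orbit_space (unitary_group m) (conj_action m (carrier \<Gamma>)) (hom_space_char_poly \<Gamma> n x a m p)
               homeomorphic_space
             product_topology (\<lambda>j. symmetric_product (l j) (torus n)) {1..s})"
proof -
  interpret T: heisenberg_type n t s c k lam
    by (rule heisenberg_type.intro) (rule assms(1), erule assms(2), rule assms(8), erule assms(9))
  interpret X: heisenberg_extension \<Gamma> \<iota> \<pi> x a n t c
    by (rule heisenberg_extension.intro) (rule assms(1), rule assms(4), rule assms(5), rule assms(6), erule assms(7))
  obtain f where "f \<in> topspace (hom_space_char_poly \<Gamma> n x a m p)"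
    using assms(14) unfolding ex_in_conv[symmetric] by (rule exE)
  then have f: "f \<in> hom \<Gamma> (unitary_group m)" and cp: "char_poly (f x) = (\<Prod>j = 1..s. [:- lam j, 1:] ^ \<mu> j)"
    unfolding hom_space_char_poly_def hom_space_def topspace_subtopology topspace_pullback_topology assms(12)
    by simp_all
  \<comment> \<open>Any one representation, decomposed into blocks, shows that
    \<open>card (T.Box j)\<close> divides \<mu> j; the quotients are fixed here because the models
    can be built only once they are known.\<close>
  have "\<exists>l. \<forall>j\<in>{1..s}. \<mu> j = l j * card (T.Box j)"
  proof (rule T.decomposition_count[OF X.rels_hom[OF group_unitary_group f] cp])
    fix r J Z u
    assume "\<And>j. j \<in> {1..s} \<Longrightarrow> \<mu> j = card {b \<in> {..<r}. J b = j} * card (T.Box j)"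
    then show ?thesis by (intro exI[of _ "\<lambda>j. card {b \<in> {..<r}. J b = j}"] ballI)
  qed
  then obtain l where l: "\<forall>j\<in>{1..s}. \<mu> j = l j * card (T.Box j)" by (rule exE)
  interpret M: unitary_representations \<Gamma> \<iota> \<pi> x a n t s c k lam m \<mu> l
    by (intro unitary_representations.intro heisenberg_model.intro heisenberg_model_axioms.intro
        X.heisenberg_extension_axioms T.heisenberg_type_axioms) (rule assms(11), erule bspec[OF l])
  have HP: "M.HP = hom_space_char_poly \<Gamma> n x a m p"
    unfolding M.HP_def assms(12) by (rule refl)
  have "product_topology (\<lambda>j. almost_commuting n (\<mu> j) (D_matrix t (\<lambda>i. int_scale (- int (c i)) (q j)))) {1..s} =
      product_topology (\<lambda>j. almost_commuting n (\<mu> j) (M.Dm j)) {1..s}"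
    by (rule product_topology_cong) (simp only: M.Dm_def assms(13))
  then have D: "induced_space n m s \<mu> (\<lambda>j. D_matrix t (\<lambda>i. int_scale (- int (c i)) (q j))) = induced_space n m s \<mu> M.Dm"
    unfolding induced_space_def by (rule arg_cong)
  have "(of_nat (l j) :: rat) = of_nat (\<mu> j) / (\<Prod>i = 1..t. of_nat (k j) / of_nat (gcd (k j) (c i)))"
    if j: "j \<in> {1..s}" for j
  proof -
    have "(of_nat (card (T.Box j)) :: rat) = (\<Prod>i = 1..t. of_nat (T.N j i))"
      by (simp add: T.card_Box)
    also have "\<dots> = (\<Prod>i = 1..t. of_nat (k j) / of_nat (gcd (k j) (c i)))"
      by (rule prod.cong) (simp_all add: T.N_def of_nat_div_gcd[OF T.k_pos[OF j]] del: atLeastAtMost_iff One_nat_def)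
    finally have "(\<Prod>i = 1..t. of_nat (k j) / of_nat (gcd (k j) (c i))) = (of_nat (card (T.Box j)) :: rat)" by (rule sym)
    then show ?thesis using bspec[OF l j] T.card_Box_pos[OF j] by simp
  qed
  then show ?thesis
    unfolding D
    using M.induced_space_homeomorphic[unfolded HP] M.orbit_space_homeomorphic[unfolded HP]
    by (intro conjI exI[of _ l] ballI)
qed

end
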